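(* Let $\mathcal{D}\subset\mathbb{R}^2$ be a nontrivial (balanced) quadriculated disk. Let $G^{+}_{\mathcal{D}}$ be the even domino group, let $\operatorname{Tw}: G^{+}_{\mathcal{D}} \to \mathbb{Z}$ be the twist map and let $\ker(\operatorname{Tw})<G^{+}_{\mathcal{D}}$ be its kernel. Let $\mathbf{T}_0, \mathbf{T}_1$ be independent random tilings of $\mathcal{R}_N = \mathcal{D} \times [0,N]$. Then $$\lim_{N \to \infty} \operatorname{Prob}[\mathbf{T}_0 \approx \mathbf{T}_1 \,|\, \operatorname{Tw}(\mathbf{T}_0) = \operatorname{Tw}(\mathbf{T}_1)] = \frac{1}{|\ker(\operatorname{Tw})|},$$ where $1/|\ker(\operatorname{Tw})|=0$ if $\ker(\operatorname{Tw})$ is infinite.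
   Context: Quadriculated disk: a set $\mathcal{D}\subset\mathbb{R}^2$ which is the union of finitely many closed unit squares with vertices in $\mathbb{Z}^2$ and is homeomorphic to the closed unit disk. Unit squares carry a checkerboard coloring and $\mathcal{D}$ is always assumed balanced (equal numbers of white and black squares). $\mathcal{D}$ is nontrivial if it has at least $6$ unit squares and at least one of its squares has at least three neighbours. Tilings: $\mathcal{R}_N=\mathcal{D}\times[0,N]\subset\mathbb{R}^3$ is a union of closed unit cubes with vertices in $\mathbb{Z}^3$. A domino is the union of two unit cubes sharing a face; a tiling is a set of dominoes with disjoint interiors whose union is $\mathcal{R}_N$. $\mathcal{T}(\mathcal{R}_N)$ is the set of tilings; a random tiling is uniformly distributed in $\mathcal{T}(\mathcal{R}_N)$ (nonempty for all sufficiently large $N$). For $N$ even, $\mathbf{t}_{\mathrm{vert},N}$ is the tiling of $\mathcal{R}_N$ with all dominoes vertical (in the third direction). Concatenation (stacking) of $\mathbf{t}_0\in\mathcal{T}(\mathcal{R}_{N_0})$ and $\mathbf{t}_1\in\mathcal{T}(\mathcal{R}_{N_1})$ is $\mathbf{t}_0\ast\mathbf{t}_1\in\mathcal{T}(\mathcal{R}_{N_0+N_1})$. Flips and domino group: a flip removes two adjacent parallel dominoes (whose union is a $2\times2\times1$ block) and places them back in the other position. $\mathbf{t}_0\approx\mathbf{t}_1$ means the two tilings of $\mathcal{R}_N$ are joined by a finite sequence of flips. For $\mathbf{t}_i\in\mathcal{T}(\mathcal{R}_{N_i})$ with $N_0\equiv N_1\pmod 2$, write $\mathbf{t}_0\sim\mathbf{t}_1$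 if there exists $N\equiv N_0\pmod 2$, $N\ge\max\{N_0,N_1\}$, with $\mathbf{t}_0\ast\mathbf{t}_{\mathrm{vert},N-N_0}\approx\mathbf{t}_1\ast\mathbf{t}_{\mathrm{vert},N-N_1}$. The domino group $G_{\mathcal{D}}$ is the set of $\sim$-classes of tilings of $\mathcal{R}_N$ (all $N$) with operation induced by $\ast$; it is a group with identity the class of vertical tilings. The even domino group $G^+_{\mathcal{D}}<G_{\mathcal{D}}$ is the kernel of the homomorphism $G_{\mathcal{D}}\to\mathbb{Z}/(2)$ taking the class of $\mathbf{t}\in\mathcal{T}(\mathcal{R}_N)$ to $N\bmod 2$. Twist: color unit cubes black and white in a checkerboard pattern. For a domino $d$, let $v(d)\in\{\pm e_1,\pm e_2,\pm e_3\}$ be the center of its black cube minus the center of its white cube. Fix $u\in\{\pm e_1,\pm e_2\}$. The (open) $u$-shade of $d$ is $S^u(d)=\operatorname{int}\big((\bigcup_{s\ge 0}(d+su))\smallsetminus d\big)$. Set $\tau^u(d_0,d_1)=\frac14\det(v(d_1),v(d_0),u)$ if $d_1\cap S^u(d_0)\neq\emptyset$ and $0$ otherwise. Then $\operatorname{Tw}(\mathbf{t})=\sum_{d_0,d_1\in\mathbf{t}}\tau^u(d_0,d_1)$; this is an integer, independent of $u$, invariant under flips, additive under concatenation and zero on vertical tilings, so it defines a homomorphism $\operatorname{Tw}:G_{\mathcal{D}}\to\mathbb{Z}$, which is restricted to $G^+_{\mathcal{D}}$. *)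

theory Defs
  imports
    "HOL-Probability.Probability"
    "HOL-Algebra.Elementary_Groups"
begin

section \<open>Unit squares and unit cubes\<close>

text \<open>A unit square (\<open>'n = 2\<close>) or unit cube (\<open>'n = 3\<close>) with integral vertices
  is addressed by its least vertex.\<close>

definition cell :: "int ^ 'n \<Rightarrow> (real ^ 'n) set" where
  "cell p = cbox (\<chi> i. of_int (p $ i)) (\<chi> i. of_int (p $ i) + 1)"

definition center :: "int ^ 'n \<Rightarrow> real ^ 'n" where
  "center p = (\<chi> i. of_int (p $ i) + 1 / 2)"

text \<open>Sharing an edge (squares) or a face (cubes).\<close>

definition adjacent :: "int ^ 'n \<Rightarrow> int ^ 'n \<Rightarrow> bool" where
  "adjacent p q \<longleftrightarrow> (\<exists>i. q = p + axis i 1 \<or> p = q + axis i 1)"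

text \<open>The choice of which colour class is called black is immaterial.\<close>

definition black :: "int ^ 'n \<Rightarrow> bool" where
  "black p \<longleftrightarrow> even (\<Sum>i\<in>UNIV. p $ i)"

section \<open>Quadriculated disks\<close>

definition squares :: "(real ^ 2) set \<Rightarrow> (int ^ 2) set" where
  "squares D = {p. cell p \<subseteq> D}"

definition quadriculated_disk :: "(real ^ 2) set \<Rightarrow> bool" where
  "quadriculated_disk D \<longleftrightarrow>
     (\<exists>S. finite S \<and> D = \<Union> (cell ` S)) \<and> D homeomorphic cball (0 :: real ^ 2) 1"

definition balanced :: "(real ^ 2) set \<Rightarrow> bool" where
  "balanced D \<longleftrightarrow> card {p \<in> squares D. black p} = card {p \<in> squares D. \<not> black p}"

definition nontrivial :: "(real ^ 2) set \<Rightarrow> bool" where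
  "nontrivial D \<longleftrightarrow>
     card (squares D) \<ge> 6 \<and> (\<exists>p\<in>squares D. card {q \<in> squares D. adjacent p q} \<ge> 3)"

section \<open>Dominoes and tilings\<close>

type_synonym domino = "(real ^ 3) set"
type_synonym tiling = "domino set"

definition is_domino :: "domino \<Rightarrow> bool" where
  "is_domino d \<longleftrightarrow> (\<exists>p q. adjacent p q \<and> d = cell p \<union> cell q)"

definition region :: "(real ^ 2) set \<Rightarrow> nat \<Rightarrow> (real ^ 3) set" where
  "region D N = {x. vector [x $ 1, x $ 2] \<in> D \<and> 0 \<le> x $ 3 \<and> x $ 3 \<le> real N}"

definition tilings :: "(real ^ 2) set \<Rightarrow> nat \<Rightarrow> tiling set" where
  "tilings D N =
     {t. (\<forall>d\<in>t. is_domino d) \<and>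
         pairwise (\<lambda>d d'. interior d \<inter> interior d' = {}) t \<and>
         \<Union> t = region D N}"

text \<open>For even \<open>N\<close> this is the tiling by vertical dominoes. It is empty for \<open>N = 0\<close>,
  so that stacking it on top of a tiling has no effect.\<close>

definition vert_tiling :: "(real ^ 2) set \<Rightarrow> nat \<Rightarrow> tiling" where
  "vert_tiling D N =
     {d. \<exists>p. d = cell p \<union> cell (p + axis 3 1) \<and> even (p $ 3) \<and> d \<subseteq> region D N}"

text \<open>\<open>stack N0 t0 t1\<close> puts \<open>t1\<close> on top of a tiling \<open>t0\<close> of height \<open>N0\<close>.\<close>

definition stack :: "nat \<Rightarrow> tiling \<Rightarrow> tiling \<Rightarrow> tiling" where
  "stack N0 t0 t1 = t0 \<union> (\<lambda>d. (+) (axis 3 (real N0)) ` d) ` t1"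

section \<open>Flips\<close>

text \<open>The two dominoes in direction \<open>i\<close> whose union is the \<open>2 \<times> 2 \<times> 1\<close> block
  spanned by the directions \<open>i \<noteq> j\<close> at \<open>p\<close>. Swapping \<open>i\<close> and \<open>j\<close> gives
  the other tiling of the same block.\<close>

definition domino_pair :: "int ^ 3 \<Rightarrow> 3 \<Rightarrow> 3 \<Rightarrow> domino set" where
  "domino_pair p i j =
     {cell p \<union> cell (p + axis i 1),
      cell (p + axis j 1) \<union> cell (p + axis j 1 + axis i 1)}"

definition flip :: "tiling \<Rightarrow> tiling \<Rightarrow> bool" where
  "flip t t' \<longleftrightarrow>
     (\<exists>p i j. i \<noteq> j \<and> domino_pair p i j \<subseteq> t \<and>
              t' = (t - domino_pair p i j) \<union> domino_pair p j i)"

definition flip_equiv :: "tiling \<Rightarrow> tiling \<Rightarrow> bool" where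
  "flip_equiv t t' \<longleftrightarrow> flip\<^sup>*\<^sup>* t t'"

section \<open>The domino group\<close>

text \<open>Tilings of all heights are collected as pairs of a height and a tiling.\<close>

definition all_tilings :: "(real ^ 2) set \<Rightarrow> (nat \<times> tiling) set" where
  "all_tilings D = {(N, t). t \<in> tilings D N}"

definition domino_rel :: "(real ^ 2) set \<Rightarrow> ((nat \<times> tiling) \<times> (nat \<times> tiling)) set" where
  "domino_rel D =
     {((N0, t0), (N1, t1)).
        t0 \<in> tilings D N0 \<and> t1 \<in> tilings D N1 \<and> N0 mod 2 = N1 mod 2 \<and>
        (\<exists>N. N mod 2 = N0 mod 2 \<and> N \<ge> max N0 N1 \<and>
             flip_equiv (stack N0 t0 (vert_tiling D (N - N0))) (stack N1 t1 (vert_tiling D (N - N1))))}"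

definition domino_group :: "(real ^ 2) set \<Rightarrow> (nat \<times> tiling) set monoid" where
  "domino_group D =
     \<lparr>carrier = all_tilings D // domino_rel D,
      mult = (\<lambda>A B. \<Union>(N0, t0)\<in>A. \<Union>(N1, t1)\<in>B. domino_rel D `` {(N0 + N1, stack N0 t0 t1)}),
      one = domino_rel D `` {(2, vert_tiling D 2)}\<rparr>"

definition height_parity :: "(nat \<times> tiling) set \<Rightarrow> int" where
  "height_parity A = the_elem ((\<lambda>(N, t). int N mod 2) ` A)"

definition even_domino_group :: "(real ^ 2) set \<Rightarrow> (nat \<times> tiling) set monoid" where
  "even_domino_group D =
     (domino_group D)\<lparr>carrier := kernel (domino_group D) (integer_mod_group 2) height_parity\<rparr>"

section \<open>Twist\<close>

text \<open>Center of the black cube minus center of the white cube.\<close>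

definition domino_vec :: "domino \<Rightarrow> real ^ 3" where
  "domino_vec d =
     (THE w. \<exists>p q. adjacent p q \<and> d = cell p \<union> cell q \<and> black p \<and> \<not> black q \<and>
                   w = center p - center q)"

definition shade :: "real ^ 3 \<Rightarrow> domino \<Rightarrow> (real ^ 3) set" where
  "shade u d = interior ((\<Union>s\<in>{0..}. (\<lambda>x. x + s *\<^sub>R u) ` d) - d)"

definition effect :: "real ^ 3 \<Rightarrow> domino \<Rightarrow> domino \<Rightarrow> real" where
  "effect u d0 d1 =
     (if d1 \<inter> shade u d0 \<noteq> {}
      then 1 / 4 * det (vector [domino_vec d1, domino_vec d0, u]) else 0)"

text \<open>The sum of effects over a tiling of a cylinder is an integer, and \<open>twist\<close> is that integer.\<close>

definition twist :: "real ^ 3 \<Rightarrow> tiling \<Rightarrow> int" where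
  "twist u t = (THE k. of_int k = (\<Sum>d0\<in>t. \<Sum>d1\<in>t. effect u d0 d1))"

definition twist_hom :: "real ^ 3 \<Rightarrow> (nat \<times> tiling) set \<Rightarrow> int" where
  "twist_hom u A = the_elem ((\<lambda>(N, t). twist u t) ` A)"

definition twist_kernel :: "real ^ 3 \<Rightarrow> (real ^ 2) set \<Rightarrow> (nat \<times> tiling) set set" where
  "twist_kernel u D = kernel (even_domino_group D) integer_group (twist_hom u)"

section \<open>Random tilings\<close>

definition random_tiling :: "(real ^ 2) set \<Rightarrow> nat \<Rightarrow> tiling pmf" where
  "random_tiling D N = pmf_of_set (tilings D N)"

end

theory Submission
  imports Defs
begin

text \<open>Cut at integral heights, a tiling of \<open>R\<^sub>N\<close> becomes a closed walk of length \<open>N\<close> at the empty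
  plug, in a finite graph whose vertices are the plugs (the squares crossed by vertical dominoes) and
  whose edges are the tilings of a single floor; turning a floor upside down reverses its edge. A floor
  followed by its reflection can be flipped into vertical dominoes, so walks up to flips and added
  vertical space form a groupoid, and the domino group is its vertex group.

  The number \<open>r(n)\<close> of pairs of equivalent walks of length \<open>n\<close> from the empty plug is
  log-convex, because reversal makes it a squared norm of a self-adjoint power; hence \<open>r(n + 1) / r(n)\<close>
  converges. The number of pairs of closed walks of equal twist is at least a multiple of \<open>1 / n\<close> times
  the number of all pairs, as the twist grows linearly. If \<open>r\<close> grows exponentially slower than the
  number of all pairs, then the limit is \<open>0\<close> and the kernel is infinite. If it grows at the same rate,
  a ground state representation bounds the energy of the class counts, so that a translation by any
  fixed class of even length and zero twist asymptotically preserves them: all classes of the kernel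
  are equally likely as the difference of two tilings of equal twist.

  Equivalence has to be replaced by flips without additional space. For infinite kernel this only
  lowers the probability. For finite kernel the walks have normal forms built from the powers of one
  cycle, so a bounded amount of vertical space always suffices, and all but an exponentially small
  part of the tilings already contains that much.\<close>

section \<open>Walks in a finite graph with reversal\<close>

text \<open>No operator on the possibly infinite set of classes is ever formed: all estimates
  concern finite counts. Parity is an obstacle, since walks of lengths \<open>n\<close> and
  \<open>n + 1\<close> cannot be compared edge by edge; so the energy lives on paths of two edges,
  and the odd closed walk obtained from balancedness and connectedness makes every reachable vertex
  reachable by an even walk.

  The ground state is never constructed. Resolvents at a parameter \<mu> above
  \<open>max_rate\<close>, normalized at the base, are supersolutions with bounds uniform in \<mu>;
  the resulting estimates are affine in \<mu> and pass to the limit. They bound the energy by the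
  deficit \<open>max_rate * ret n - ret (Suc n)\<close>, which is small against \<open>ret n\<close>
  exactly when the two growth rates agree.

  The cycle in the normal forms has maximal twist per height. Only then does a normal form exceed
  its walk by a bounded length, so that space spent on normalizing becomes available again for the
  next floor.

  The geometric twist is a quarter of a sum over floors. It is an integer on closed walks because
  modulo 4 the summand is the difference of a potential of the two plugs.\<close>

locale multigraph =
  fixes E :: "'e set" and src tgt :: "'e \<Rightarrow> 'v" and opp :: "'e \<Rightarrow> 'e" and base :: 'v
  assumes finite_edges: "finite E"
    and opp_edge: "e \<in> E \<Longrightarrow> opp e \<in> E"
    and src_opp: "e \<in> E \<Longrightarrow> src (opp e) = tgt e"
    and tgt_opp: "e \<in> E \<Longrightarrow> tgt (opp e) = src e"
    and opp_opp: "e \<in> E \<Longrightarrow> opp (opp e) = e"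
begin

fun walk :: "'v \<Rightarrow> 'e list \<Rightarrow> 'v \<Rightarrow> bool" where
  "walk p [] q \<longleftrightarrow> p = q"
| "walk p (e # w) q \<longleftrightarrow> e \<in> E \<and> src e = p \<and> walk (tgt e) w q"

definition inv_walk :: "'e list \<Rightarrow> 'e list" where
  "inv_walk w = rev (map opp w)"

definition walks :: "nat \<Rightarrow> 'v \<Rightarrow> 'v \<Rightarrow> 'e list set" where
  "walks n p q = {w. walk p w q \<and> length w = n}"

definition walks_from :: "nat \<Rightarrow> 'e list set" where
  "walks_from n = {w. (\<exists>p. walk base w p) \<and> length w = n}"

definition verts :: "'v set" where
  "verts = {p. \<exists>w. walk base w p}"

lemma walk_append: "walk p (u @ w) q \<longleftrightarrow> (\<exists>r. walk p u r \<and> walk r w q)"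
  by (induction u arbitrary: p) auto

lemma walk_appendI: "walk p u r \<Longrightarrow> walk r w q \<Longrightarrow> walk p (u @ w) q"
  using walk_append by blast

lemma walk_edges: "walk p w q \<Longrightarrow> set w \<subseteq> E"
  by (induction w arbitrary: p) auto

lemma walk_unique: "walk p w q \<Longrightarrow> walk p w q' \<Longrightarrow> q = q'"
  by (induction w arbitrary: p) auto

lemma length_inv_walk [simp]: "length (inv_walk w) = length w"
  by (simp add: inv_walk_def)

lemma inv_walk_Nil [simp]: "inv_walk [] = []"
  by (simp add: inv_walk_def)

lemma inv_walk_Cons: "inv_walk (e # w) = inv_walk w @ [opp e]"
  by (simp add: inv_walk_def)

lemma inv_walk_append: "inv_walk (u @ w) = inv_walk w @ inv_walk u"
  by (simp add: inv_walk_def)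

lemma walk_inv: "walk p w q \<Longrightarrow> walk q (inv_walk w) p"
  by (induction w arbitrary: p)
     (auto simp: inv_walk_Cons walk_append opp_edge src_opp tgt_opp)

lemma inv_inv_walk: "walk p w q \<Longrightarrow> inv_walk (inv_walk w) = w"
  by (induction w arbitrary: p) (auto simp: inv_walk_Cons inv_walk_append opp_opp inv_walk_def)

lemma finite_walks: "finite (walks n p q)"
proof (rule finite_subset)
  show "walks n p q \<subseteq> {w. set w \<subseteq> E \<and> length w = n}"
    using walk_edges by (auto simp: walks_def)
  show "finite {w. set w \<subseteq> E \<and> length w = n}"
    using finite_edges by (rule finite_lists_length_eq)
qed

lemma finite_walks_from: "finite (walks_from n)"
proof (rule finite_subset)
  show "walks_from n \<subseteq> {w. set w \<subseteq> E \<and> length w = n}"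
    using walk_edges by (auto simp: walks_from_def)
  show "finite {w. set w \<subseteq> E \<and> length w = n}"
    using finite_edges by (rule finite_lists_length_eq)
qed

lemma base_verts: "base \<in> verts"
  unfolding verts_def by (auto intro: exI[of _ "[]"])

lemma verts_walk: "p \<in> verts \<Longrightarrow> walk p w q \<Longrightarrow> q \<in> verts"
  unfolding verts_def using walk_append by blast

lemma verts_tgt: "e \<in> E \<Longrightarrow> src e \<in> verts \<Longrightarrow> tgt e \<in> verts"
  using verts_walk[of "src e" "[e]" "tgt e"] by simp

lemma finite_verts: "finite verts"
proof (rule finite_subset)
  show "verts \<subseteq> insert base (tgt ` E)"
  proof
    fix p assume "p \<in> verts"
    then obtain w where w: "walk base w p" unfolding verts_def by blast
    show "p \<in> insert base (tgt ` E)"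
    proof (cases w rule: rev_cases)
      case Nil
      then show ?thesis using w by simp
    next
      case (snoc u e)
      then show ?thesis using w by (auto simp: walk_append)
    qed
  qed
qed (use finite_edges in simp)

lemma walks_from_eq: "walks_from n = (\<Union>p\<in>verts. walks n base p)"
  by (auto simp: walks_from_def walks_def verts_def)

text \<open>Two-step paths issuing from reachable vertices: working with them avoids the
  bipartite obstruction to comparing walks of different parity.\<close>

definition two_steps :: "('e \<times> 'e) set" where
  "two_steps = {(e, e'). e \<in> E \<and> e' \<in> E \<and> src e' = tgt e \<and> src e \<in> verts}"

lemma finite_two_steps: "finite two_steps"
  by (rule finite_subset[of _ "E \<times> E"]) (auto simp: two_steps_def finite_edges)

lemma two_steps_verts: "(e, e') \<in> two_steps \<Longrightarrow> src e \<in> verts \<and> tgt e' \<in> verts"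
  unfolding two_steps_def using verts_tgt by (metis (mono_tags, lifting) case_prodD mem_Collect_eq)

text \<open>Reversing two-step paths permutes them; this symmetry of the squared adjacency operator
  identifies the two diagonal sums of the energy.\<close>

lemma bij_two_steps: "bij_betw (\<lambda>(e, e'). (opp e', opp e)) two_steps two_steps"
  by (rule bij_betw_byWitness[of _ "\<lambda>(e, e'). (opp e', opp e)"])
     (auto simp: two_steps_def opp_edge src_opp tgt_opp opp_opp verts_tgt)

end

section \<open>Counting coincidences as inner products\<close>

lemma sum_card_fibres:
  assumes "finite A" "finite B" "finite Q" "f ` A \<subseteq> Q"
  shows "(\<Sum>c\<in>Q. real (card {a\<in>A. f a = c}) * real (card {b\<in>B. g b = c}))
       = real (card {(a, b). a \<in> A \<and> b \<in> B \<and> f a = g b})"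
proof -
  have "{(a, b). a \<in> A \<and> b \<in> B \<and> f a = g b}
      = (\<Union>c\<in>Q. {a\<in>A. f a = c} \<times> {b\<in>B. g b = c})"
    using assms(4) by auto
  also have "card \<dots> = (\<Sum>c\<in>Q. card ({a\<in>A. f a = c} \<times> {b\<in>B. g b = c}))"
    using assms by (subst card_UN_disjoint) auto
  finally show ?thesis
    by (simp add: card_cartesian_product)
qed

text \<open>The number of coincidences \<open>f a = g b\<close> is the inner product of the vectors
  of fibre sizes, so Cauchy-Schwarz compares it with the coincidences inside \<open>A\<close> and
  inside \<open>B\<close>.\<close>

lemma card_fibre_pairs_Cauchy_Schwarz:
  assumes "finite A" "finite B"
  shows "(real (card {(a, b). a \<in> A \<and> b \<in> B \<and> f a = g b}))\<^sup>2
       \<le> real (card {(a, a'). a \<in> A \<and> a' \<in> A \<and> f a = f a'})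
         * real (card {(b, b'). b \<in> B \<and> b' \<in> B \<and> g b = g b'})"
proof -
  let ?Q = "f ` A \<union> g ` B"
  let ?x = "\<lambda>c. real (card {a\<in>A. f a = c})" and ?y = "\<lambda>c. real (card {b\<in>B. g b = c})"
  have "(\<Sum>c\<in>?Q. ?x c * ?y c)\<^sup>2 \<le> (\<Sum>c\<in>?Q. (?x c)\<^sup>2) * (\<Sum>c\<in>?Q. (?y c)\<^sup>2)"
    by (rule Cauchy_Schwarz_ineq_sum)
  then show ?thesis
    using assms by (simp add: sum_card_fibres power2_eq_square)
qed

section \<open>Walks modulo an equivalence in which backtracking cancels\<close>

locale walk_groupoid = multigraph E src tgt opp base
  for E :: "'e set" and src tgt :: "'e \<Rightarrow> 'v" and opp :: "'e \<Rightarrow> 'e" and base :: 'v +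
  fixes sim :: "'v \<Rightarrow> 'v \<Rightarrow> 'e list \<Rightarrow> 'e list \<Rightarrow> bool"
  assumes odd_closed: "\<exists>w. walk base w base \<and> odd (length w)"
    and sim_walk: "sim p q w w' \<Longrightarrow> walk p w q \<and> walk p w' q"
    and sim_refl: "walk p w q \<Longrightarrow> sim p q w w"
    and sim_sym: "sim p q w w' \<Longrightarrow> sim p q w' w"
    and sim_trans: "sim p q w w' \<Longrightarrow> sim p q w' w'' \<Longrightarrow> sim p q w w''"
    and sim_append: "sim p q w w' \<Longrightarrow> sim q r v v' \<Longrightarrow> sim p r (w @ v) (w' @ v')"
    and sim_cancel: "e \<in> E \<Longrightarrow> sim (src e) (src e) [e, opp e] []"
begin

lemma sim_walk_inv: "walk p w q \<Longrightarrow> sim p p (w @ inv_walk w) []"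
proof (induction w arbitrary: p)
  case Nil
  then show ?case by (simp add: sim_refl)
next
  case (Cons e w)
  then have e: "e \<in> E" "src e = p" and w: "walk (tgt e) w q" by auto
  have "sim p (tgt e) [e] [e]" using e by (simp add: sim_refl)
  moreover have "sim (tgt e) p (w @ inv_walk w @ [opp e]) ([] @ [opp e])"
    using sim_append[OF Cons.IH[OF w], of p "[opp e]" "[opp e]"] e
    by (simp add: sim_refl opp_edge src_opp tgt_opp)
  ultimately have "sim p p ([e] @ w @ inv_walk w @ [opp e]) ([e] @ [] @ [opp e])"
    by (rule sim_append)
  then show ?case using sim_trans[OF _ sim_cancel[OF e(1)]] e by (simp add: inv_walk_Cons)
qed

lemma sim_inv_walk: "walk p w q \<Longrightarrow> sim q q (inv_walk w @ w) []"
  using sim_walk_inv[OF walk_inv, of p w q] by (simp add: inv_inv_walk)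

lemma sim_cancel_left:
  assumes "walk p u q" "walk q w r"
  shows "sim q r (inv_walk u @ u @ w) w"
  using sim_append[OF sim_inv_walk[OF assms(1)] sim_refl[OF assms(2)]] by simp

lemma sim_cancel_right:
  assumes "walk p w q" "walk q u r"
  shows "sim p q (w @ u @ inv_walk u) w"
  using sim_append[OF sim_refl[OF assms(1)] sim_walk_inv[OF assms(2)]] by simp

lemma sim_left_iff:
  assumes "walk p u q" "walk q w r" "walk q w' r"
  shows "sim p r (u @ w) (u @ w') \<longleftrightarrow> sim q r w w'"
proof
  assume "sim p r (u @ w) (u @ w')"
  then have "sim q r (inv_walk u @ u @ w) (inv_walk u @ u @ w')"
    using assms by (intro sim_append[of q p "inv_walk u"]) (auto intro: sim_refl walk_inv)
  then show "sim q r w w'"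
    using sim_cancel_left[OF assms(1,2)] sim_cancel_left[OF assms(1,3)] sim_sym sim_trans by blast
qed (use assms in \<open>auto intro: sim_append sim_refl\<close>)

lemma sim_move:
  assumes "walk p w q" "walk q s r" "walk p w' r"
  shows "sim p r (w @ s) w' \<longleftrightarrow> sim p q w (w' @ inv_walk s)"
proof
  assume "sim p r (w @ s) w'"
  then have "sim p q ((w @ s) @ inv_walk s) (w' @ inv_walk s)"
    by (rule sim_append) (use assms in \<open>auto intro: sim_refl walk_inv\<close>)
  then show "sim p q w (w' @ inv_walk s)"
    using sim_trans[OF sim_sym[OF sim_cancel_right[OF assms(1,2)]]] by simp
next
  assume "sim p q w (w' @ inv_walk s)"
  then have "sim p r (w @ s) ((w' @ inv_walk s) @ s)"
    by (rule sim_append) (use assms in \<open>auto intro: sim_refl\<close>)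
  moreover have "sim p r (w' @ inv_walk s @ s) w'"
    using sim_append[OF sim_refl[OF assms(3)] sim_inv_walk[OF assms(2)]] by simp
  ultimately show "sim p r (w @ s) w'" by (simp add: sim_trans[of p r _ "w' @ inv_walk s @ s"])
qed

text \<open>The endpoint is quantified away so that a class is a plain set of walks. Nothing is
  lost: walks from the base with equal keys end at the same vertex.\<close>

definition key :: "'e list \<Rightarrow> 'e list set" where
  "key w = {w'. \<exists>p. sim base p w w'}"

lemma key_eq_iff:
  assumes "walk base w p"
  shows "key w = key w' \<longleftrightarrow> sim base p w w'"
proof
  assume "key w = key w'"
  moreover have "w \<in> key w" using assms sim_refl by (auto simp: key_def)
  ultimately have "w \<in> key w'" by simp
  then obtain q where q: "sim base q w' w" by (auto simp: key_def)
  then have "q = p" using sim_walk assms walk_unique by blast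
  then show "sim base p w w'" using q sim_sym by simp
next
  assume s: "sim base p w w'"
  then have w': "walk base w' p" using sim_walk by blast
  have "sim base q w z \<longleftrightarrow> sim base q w' z" for q z
  proof
    assume z: "sim base q w z"
    then have "q = p" using sim_walk assms walk_unique by blast
    then show "sim base q w' z" using z s sim_sym sim_trans by blast
  next
    assume z: "sim base q w' z"
    then have "q = p" using sim_walk w' walk_unique by blast
    then show "sim base q w z" using z s sim_trans by blast
  qed
  then show "key w = key w'" by (simp add: key_def)
qed

definition pairs :: "nat \<Rightarrow> nat \<Rightarrow> ('e list \<times> 'e list) set" where
  "pairs n m = {(w, w'). w \<in> walks_from n \<and> w' \<in> walks_from m \<and> key w = key w'}"

lemma pairs_iff: "(w, w') \<in> pairs n m \<longleftrightarrow> length w = n \<and> length w' = m \<and> (\<exists>p. sim base p w w')"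
proof -
  have "w \<in> walks_from n \<and> w' \<in> walks_from m \<and> key w = key w'"
    if "length w = n" "length w' = m" "sim base p w w'" for p
    using that sim_walk[OF that(3)] key_eq_iff[of w p w'] by (auto simp: walks_from_def)
  then show ?thesis
    using key_eq_iff by (auto simp: pairs_def walks_from_def)
qed

lemma finite_pairs: "finite (pairs n m)"
  by (rule finite_subset[of _ "walks_from n \<times> walks_from m"])
     (auto simp: pairs_def finite_walks_from)

lemma pairs_swap: "(x, y) \<in> pairs n m \<longleftrightarrow> (y, x) \<in> pairs m n"
  by (auto simp: pairs_iff intro: sim_sym)

text \<open>Moving the last edge of \<open>x\<close> to the end of \<open>y\<close>, reversed, keeps
  the pair equivalent. The second claim, that reversing twice restores \<open>x\<close>, makes the
  move a bijection.\<close>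

lemma pairs_rotate:
  assumes "(x, y) \<in> pairs (Suc n) m"
  shows "(butlast x, y @ [opp (last x)]) \<in> pairs n (Suc m)"
    and "butlast x @ [opp (opp (last x))] = x"
proof -
  from assms obtain p where l: "length x = Suc n" "length y = m" and s: "sim base p x y"
    by (auto simp: pairs_iff)
  obtain w e where x: "x = w @ [e]" using l by (cases x rule: rev_cases) auto
  from s have wx: "walk base x p" and wy: "walk base y p" using sim_walk by blast+
  then have e: "e \<in> E" "tgt e = p" "walk base w (src e)" by (auto simp: x walk_append)
  have "sim base (src e) w (y @ [opp e])"
    using sim_move[of base w "src e" "[e]" p y] e s wy by (simp add: x inv_walk_def)
  then show "(butlast x, y @ [opp (last x)]) \<in> pairs n (Suc m)"
    using l by (auto simp: pairs_iff x)
  show "butlast x @ [opp (opp (last x))] = x"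
    using e by (simp add: x opp_opp)
qed

text \<open>This is self-adjointness: with the adjacency operator A on classes and the unit vector x
  at the empty walk, \<open>pairs n m\<close> counts the inner product of A^n x and A^m x, and one
  factor A moves across.\<close>

lemma card_pairs_Suc: "card (pairs (Suc n) m) = card (pairs n (Suc m))"
proof (rule bij_betw_same_card)
  let ?f = "\<lambda>z. (butlast (fst z), snd z @ [opp (last (fst z))])"
  let ?g = "\<lambda>z. (fst z @ [opp (last (snd z))], butlast (snd z))"
  show "bij_betw ?f (pairs (Suc n) m) (pairs n (Suc m))"
  proof (rule bij_betw_byWitness[where f' = ?g])
    show "\<forall>z\<in>pairs (Suc n) m. ?g (?f z) = z"
    proof
      fix z assume "z \<in> pairs (Suc n) m"
      then have "butlast (fst z) @ [opp (opp (last (fst z)))] = fst z"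
        by (intro pairs_rotate(2)[of "fst z" "snd z" n m]) (simp only: prod.collapse)
      then show "?g (?f z) = z" by (intro prod_eqI) auto
    qed
    show "\<forall>z\<in>pairs n (Suc m). ?f (?g z) = z"
    proof
      fix z assume "z \<in> pairs n (Suc m)"
      then have "butlast (snd z) @ [opp (opp (last (snd z)))] = snd z"
        by (intro pairs_rotate(2)[of "snd z" "fst z" m n]) (subst pairs_swap, simp only: prod.collapse)
      then show "?f (?g z) = z" by (intro prod_eqI) auto
    qed
    show "?f ` pairs (Suc n) m \<subseteq> pairs n (Suc m)"
    proof (rule image_subsetI)
      fix z assume "z \<in> pairs (Suc n) m"
      then show "?f z \<in> pairs n (Suc m)"
        by (intro pairs_rotate(1)) (simp only: prod.collapse)
    qed
    show "?g ` pairs n (Suc m) \<subseteq> pairs (Suc n) m"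
    proof (rule image_subsetI)
      fix z assume "z \<in> pairs n (Suc m)"
      then show "?g z \<in> pairs (Suc n) m"
        by (subst pairs_swap, intro pairs_rotate(1)) (subst pairs_swap, simp only: prod.collapse)
    qed
  qed
qed

definition ret :: "nat \<Rightarrow> real" where
  "ret n = real (card (pairs n n))"

lemma card_pairs_shift: "card (pairs (n + k) m) = card (pairs n (k + m))"
  by (induction k arbitrary: m) (auto simp: card_pairs_Suc)

lemma card_pairs_Suc_Suc: "real (card (pairs (Suc (Suc n)) n)) = ret (Suc n)"
  by (simp add: ret_def card_pairs_Suc)

text \<open>Self-adjointness rewrites \<open>ret (Suc n)\<close> as the inner product of the counts
  for lengths \<open>n + 2\<close> and \<open>n\<close>; Cauchy-Schwarz then bounds its square by
  the two squared norms.\<close>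

lemma ret_log_convex: "(ret (Suc n))\<^sup>2 \<le> ret n * ret (Suc (Suc n))"
proof -
  have "(real (card (pairs (Suc (Suc n)) n)))\<^sup>2
      \<le> real (card (pairs (Suc (Suc n)) (Suc (Suc n)))) * real (card (pairs n n))"
    using card_fibre_pairs_Cauchy_Schwarz[of "walks_from (Suc (Suc n))" "walks_from n" key key]
    by (simp only: pairs_def finite_walks_from simp_thms True_implies_equals)
  then have "(ret (Suc n))\<^sup>2 \<le> ret (Suc (Suc n)) * ret n"
    unfolding card_pairs_Suc_Suc by (simp only: ret_def)
  then show ?thesis by (simp only: mult.commute)
qed

lemma edge_base: "\<exists>e\<in>E. src e = base"
proof -
  obtain w where "walk base w base" "odd (length w)" using odd_closed by blast
  then show ?thesis by (cases w) auto
qed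

lemma ex_edge: assumes "p \<in> verts" shows "\<exists>e\<in>E. src e = p"
proof -
  obtain w where w: "walk base w p" using assms unfolding verts_def by blast
  show ?thesis
  proof (cases w rule: rev_cases)
    case Nil then show ?thesis using w edge_base by simp
  next
    case (snoc u e)
    then show ?thesis using w by (auto simp: walk_append intro!: bexI[of _ "opp e"] opp_edge src_opp)
  qed
qed

lemma ex_walk_length: "\<exists>w. (\<exists>p. walk base w p) \<and> length w = n"
proof (induction n)
  case 0 then show ?case by (auto intro: exI[of _ "[]"])
next
  case (Suc n)
  then obtain w p where w: "walk base w p" "length w = n" by blast
  then have "p \<in> verts" unfolding verts_def by blast
  then obtain e where "e \<in> E" "src e = p" using ex_edge by blast
  then show ?case using w by (intro exI[of _ "w @ [e]"]) (auto simp: walk_append)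
qed

lemma ret_ge_1: "ret n \<ge> 1"
proof -
  obtain w p where "walk base w p" "length w = n" using ex_walk_length by blast
  then have "(w, w) \<in> pairs n n" using sim_refl by (auto simp: pairs_iff)
  then have "card (pairs n n) > 0" using finite_pairs card_gt_0_iff by blast
  then show ?thesis unfolding ret_def by simp
qed

lemma ret_pos: "ret n > 0"
  using ret_ge_1[of n] by linarith

end

section \<open>Class counts transported to the base and their energy\<close>

context walk_groupoid
begin

lemma sim_right_iff:
  assumes "walk p w q" "walk p w' q" "walk q s r"
  shows "sim p r (w @ s) (w' @ s) \<longleftrightarrow> sim p q w w'"
  using sim_move[of p w q s r "w' @ s"] assms sim_cancel_right[OF assms(2,3)]
  by (auto intro: walk_appendI dest: sim_trans sim_sym)

text \<open>An odd closed walk put in front corrects the parity, so steps of two edges still reach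
  every vertex.\<close>

lemma even_walk: assumes "p \<in> verts" shows "\<exists>w. walk base w p \<and> even (length w)"
proof -
  obtain w where w: "walk base w p" using assms unfolding verts_def by blast
  obtain v where v: "walk base v base" "odd (length v)" using odd_closed by blast
  show ?thesis
  proof (cases "even (length w)")
    case False
    then show ?thesis using v w by (intro exI[of _ "v @ w"]) (auto intro: walk_appendI)
  qed (use w in blast)
qed

definition ret_at :: "nat \<Rightarrow> 'v \<Rightarrow> real" where
  "ret_at n p = real (card {(w, w'). w \<in> walks n base p \<and> w' \<in> walks n base p \<and> key w = key w'})"

definition cross :: "nat \<Rightarrow> 'e \<Rightarrow> 'e \<Rightarrow> real" where
  "cross n e e' = real (card {(w, w'). w \<in> walks n base (src e) \<and> w' \<in> walks n base (tgt e')
     \<and> key (w @ [e, e']) = key w'})"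

text \<open>Here \<open>q\<close> is meant to be the endpoint of \<open>s\<close>.\<close>

definition shifted_count :: "nat \<Rightarrow> 'e list \<Rightarrow> 'v \<Rightarrow> 'e list set \<Rightarrow> real" where
  "shifted_count n s q c = real (card {w \<in> walks n base q. key (w @ inv_walk s) = c})"

text \<open>Appending the reverse of \<open>s\<close> turns counts at an arbitrary vertex into
  functions on classes of closed walks, so that counts at different vertices can be subtracted and
  paired.\<close>

definition shifted_inner :: "nat \<Rightarrow> 'e list \<Rightarrow> 'v \<Rightarrow> 'e list \<Rightarrow> 'v \<Rightarrow> real" where
  "shifted_inner n s q s' q' = real (card {(w, w'). w \<in> walks n base q \<and> w' \<in> walks n base q'
     \<and> key (w @ inv_walk s) = key (w' @ inv_walk s')})"

text \<open>A finite carrier for sums over classes; \<open>B\<close> only has to bound the lengths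
  of the walks involved.\<close>

definition keys_upto :: "nat \<Rightarrow> 'e list set set" where
  "keys_upto B = key ` (\<Union>m\<le>B. walks_from m)"

lemma finite_keys_upto: "finite (keys_upto B)"
  by (simp add: keys_upto_def finite_walks_from)

lemma shifted_keys:
  assumes "walk base s q" "n + length s \<le> B"
  shows "(\<lambda>w. key (w @ inv_walk s)) ` walks n base q \<subseteq> keys_upto B"
proof (rule image_subsetI)
  fix w assume "w \<in> walks n base q"
  then have "walk base (w @ inv_walk s) base" "length (w @ inv_walk s) \<le> B"
    using assms by (auto simp: walks_def intro: walk_appendI walk_inv)
  then show "key (w @ inv_walk s) \<in> keys_upto B"
    unfolding keys_upto_def walks_from_def by (intro imageI) auto
qed

lemma sum_shifted_count:
  assumes "walk base s q" "n + length s \<le> B"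
  shows "(\<Sum>c\<in>keys_upto B. shifted_count n s q c * shifted_count n s' q' c) = shifted_inner n s q s' q'"
  unfolding shifted_count_def shifted_inner_def
  by (rule sum_card_fibres[OF finite_walks finite_walks finite_keys_upto shifted_keys[OF assms]])

lemma shifted_inner_same:
  assumes "walk base s q"
  shows "shifted_inner n s q s q = ret_at n q"
proof -
  have "key (w @ inv_walk s) = key (w' @ inv_walk s) \<longleftrightarrow> key w = key w'"
    if "walk base w q" "walk base w' q" for w w'
    using that assms sim_right_iff[OF that walk_inv[OF assms]]
    by (simp add: key_eq_iff[of w q] key_eq_iff[of "w @ inv_walk s" base] walk_appendI walk_inv)
  then have "{(w, w'). w \<in> walks n base q \<and> w' \<in> walks n base q \<and> key (w @ inv_walk s) = key (w' @ inv_walk s)}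
    = {(w, w'). w \<in> walks n base q \<and> w' \<in> walks n base q \<and> key w = key w'}"
    by (auto simp: walks_def)
  then show ?thesis by (simp add: shifted_inner_def ret_at_def)
qed

text \<open>The common factor \<open>inv_walk s\<close> cancels on the right, so the pairing of
  neighbouring transported counts does not depend on the path \<open>s\<close>.\<close>

lemma shifted_inner_step:
  assumes s: "walk base s (src e)" and e: "e \<in> E" "e' \<in> E" "src e' = tgt e"
  shows "shifted_inner n s (src e) (s @ [e, e']) (tgt e') = cross n e e'"
proof -
  have w2: "walk (src e) [e, e'] (tgt e')" using e by simp
  have "key (w @ inv_walk s) = key (w' @ inv_walk (s @ [e, e'])) \<longleftrightarrow> key (w @ [e, e']) = key w'"
    if w: "walk base w (src e)" and w': "walk base w' (tgt e')" for w w'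
  proof -
    have "key (w @ inv_walk s) = key (w' @ inv_walk (s @ [e, e']))
      \<longleftrightarrow> sim base base (w @ inv_walk s) ((w' @ inv_walk [e, e']) @ inv_walk s)"
      using w s by (subst key_eq_iff[of _ base]) (auto intro: walk_appendI walk_inv simp: inv_walk_append)
    also have "\<dots> \<longleftrightarrow> sim base (src e) w (w' @ inv_walk [e, e'])"
      using w w' s w2 by (intro sim_right_iff) (auto intro: walk_appendI walk_inv simp del: walk.simps)
    also have "\<dots> \<longleftrightarrow> sim base (tgt e') (w @ [e, e']) w'"
      using sim_move[OF w w2 w'] by simp
    also have "\<dots> \<longleftrightarrow> key (w @ [e, e']) = key w'"
      using key_eq_iff[of "w @ [e, e']" "tgt e'" w'] walk_appendI[OF w w2] by simp
    finally show ?thesis .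
  qed
  then have "{(w, w'). w \<in> walks n base (src e) \<and> w' \<in> walks n base (tgt e')
      \<and> key (w @ inv_walk s) = key (w' @ inv_walk (s @ [e, e']))}
    = {(w, w'). w \<in> walks n base (src e) \<and> w' \<in> walks n base (tgt e') \<and> key (w @ [e, e']) = key w'}"
    by (auto simp: walks_def)
  then show ?thesis by (simp add: shifted_inner_def cross_def)
qed

lemma sum_shifted_diff:
  assumes s: "walk base s q" "n + length s \<le> B" and s': "walk base s' q'" "n + length s' \<le> B"
  shows "(\<Sum>c\<in>keys_upto B. (shifted_count n s q c / x - shifted_count n s' q' c / y)\<^sup>2)
       = ret_at n q / x\<^sup>2 + ret_at n q' / y\<^sup>2 - 2 * shifted_inner n s q s' q' / (x * y)"
proof -
  let ?f = "shifted_count n s q" and ?g = "shifted_count n s' q'"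
  have "(\<Sum>c\<in>keys_upto B. (?f c / x - ?g c / y)\<^sup>2)
      = (\<Sum>c\<in>keys_upto B. (?f c * ?f c) / x\<^sup>2 + (?g c * ?g c) / y\<^sup>2 - 2 * (?f c * ?g c) / (x * y))"
    by (rule sum.cong) (simp_all add: power2_eq_square left_diff_distrib right_diff_distrib mult.commute)
  also have "\<dots> = (\<Sum>c\<in>keys_upto B. ?f c * ?f c) / x\<^sup>2 + (\<Sum>c\<in>keys_upto B. ?g c * ?g c) / y\<^sup>2
      - 2 * (\<Sum>c\<in>keys_upto B. ?f c * ?g c) / (x * y)"
    by (simp add: sum.distrib sum_subtractf sum_divide_distrib sum_distrib_left)
  finally show ?thesis
    by (simp add: sum_shifted_count[OF s] sum_shifted_count[OF s'] shifted_inner_same[OF s(1)]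
        shifted_inner_same[OF s'(1)])
qed

lemma ret_eq_sum: "ret n = (\<Sum>p\<in>verts. ret_at n p)"
proof -
  have pairs_eq: "pairs n n = (\<Union>p\<in>verts. {(w, w'). w \<in> walks n base p \<and> w' \<in> walks n base p \<and> key w = key w'})"
    (is "_ = \<Union>(?P ` verts)")
  proof (intro equalityI subsetI)
    fix z assume z: "z \<in> pairs n n"
    obtain x y where xy: "z = (x, y)" by (cases z)
    with z obtain p where "length x = n" "length y = n" and s: "sim base p x y"
      by (auto simp: pairs_iff)
    then have "(x, y) \<in> ?P p"
      using sim_walk[OF s] key_eq_iff[of x p y] by (auto simp: walks_def)
    moreover have "p \<in> verts" using sim_walk[OF s] by (auto simp: verts_def)
    ultimately show "z \<in> \<Union>(?P ` verts)" unfolding xy by (rule UN_I[rotated])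
  next
    fix z assume "z \<in> \<Union>(?P ` verts)"
    then obtain p x y where p: "p \<in> verts" and z: "z = (x, y)" "x \<in> walks n base p"
      "y \<in> walks n base p" "key x = key y" by auto
    then have "x \<in> walks_from n" "y \<in> walks_from n" unfolding walks_from_eq by blast+
    then show "z \<in> pairs n n" using z by (simp add: pairs_def)
  qed
  have "card (\<Union>(?P ` verts)) = (\<Sum>p\<in>verts. card (?P p))"
  proof (rule card_UN_disjoint)
    have "finite (?P p)" for p
      by (rule finite_subset[of _ "walks n base p \<times> walks n base p"]) (auto simp: finite_walks)
    then show "\<forall>p\<in>verts. finite (?P p)" by blast
    have "?P p \<inter> ?P q = {}" if "p \<noteq> q" for p q
      using that walk_unique by (fastforce simp: walks_def)
    then show "\<forall>p\<in>verts. \<forall>q\<in>verts. p \<noteq> q \<longrightarrow> ?P p \<inter> ?P q = {}" by blast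
  qed (rule finite_verts)
  then show ?thesis unfolding ret_def ret_at_def pairs_eq by (simp only: of_nat_sum)
qed

text \<open>The last two edges of a walk of length \<open>n + 2\<close> run over
  \<open>two_steps\<close>, and pairs of lengths \<open>n + 2\<close> and \<open>n\<close> are
  counted by \<open>ret (Suc n)\<close> by self-adjointness.\<close>

lemma sum_cross: "(\<Sum>(e, e')\<in>two_steps. cross n e e') = ret (Suc n)"
proof -
  let ?P = "\<lambda>(e, e'). {(w, w'). w \<in> walks n base (src e) \<and> w' \<in> walks n base (tgt e')
     \<and> key (w @ [e, e']) = key w'}"
  let ?Q = "\<lambda>z. (\<lambda>(w, w'). (w @ [fst z, snd z], w')) ` ?P z"
  have fin: "finite (?P z)" for z
    by (rule finite_subset[of _ "walks n base (src (fst z)) \<times> walks n base (tgt (snd z))"])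
       (auto simp: finite_walks)
  have pairs_eq: "pairs (Suc (Suc n)) n = (\<Union>z\<in>two_steps. ?Q z)"
  proof (intro equalityI subsetI)
    fix z assume z: "z \<in> pairs (Suc (Suc n)) n"
    obtain x y where xy: "z = (x, y)" by (cases z)
    with z obtain p where l: "length x = Suc (Suc n)" "length y = n" and s: "sim base p x y"
      by (auto simp: pairs_iff)
    obtain x1 e' where x1: "x = x1 @ [e']" using l by (cases x rule: rev_cases) auto
    obtain w e where w: "x1 = w @ [e]" using l x1 by (cases x1 rule: rev_cases) auto
    have wx: "walk base x p" and wy: "walk base y p" using s sim_walk by blast+
    then have e: "e \<in> E" "e' \<in> E" "src e' = tgt e" "tgt e' = p" "walk base w (src e)"
      by (auto simp: x1 w walk_append)
    then have "(e, e') \<in> two_steps" by (auto simp: two_steps_def verts_def)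
    moreover have "(w, y) \<in> ?P (e, e')"
      using e wy l s wx key_eq_iff[OF wx, of y] by (auto simp: x1 w walks_def)
    moreover from this have "z \<in> ?Q (e, e')"
      unfolding xy x1 w by (intro image_eqI[of _ _ "(w, y)"]) auto
    ultimately show "z \<in> (\<Union>z\<in>two_steps. ?Q z)" by blast
  next
    fix z assume "z \<in> (\<Union>z\<in>two_steps. ?Q z)"
    then obtain e e' w w' where e: "(e, e') \<in> two_steps" and z: "z = (w @ [e, e'], w')"
      and w: "w \<in> walks n base (src e)" "w' \<in> walks n base (tgt e')" "key (w @ [e, e']) = key w'"
      by auto
    have "walk base (w @ [e, e']) (tgt e')"
      using e w by (auto simp: two_steps_def walks_def intro!: walk_appendI)
    then show "z \<in> pairs (Suc (Suc n)) n"
      using w z by (auto simp: pairs_def walks_from_def walks_def)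
  qed
  have "card (\<Union>z\<in>two_steps. ?Q z) = (\<Sum>z\<in>two_steps. card (?Q z))"
  proof (rule card_UN_disjoint)
    show "\<forall>z\<in>two_steps. finite (?Q z)" using fin by blast
    show "\<forall>z\<in>two_steps. \<forall>z'\<in>two_steps. z \<noteq> z' \<longrightarrow> ?Q z \<inter> ?Q z' = {}" by auto
  qed (rule finite_two_steps)
  also have "\<dots> = (\<Sum>z\<in>two_steps. card (?P z))"
    by (intro sum.cong refl card_image) (auto simp: inj_on_def)
  finally show ?thesis
    unfolding card_pairs_Suc_Suc[symmetric] cross_def pairs_eq
    by (simp only: of_nat_sum split_def)
qed

text \<open>A positive supersolution \<open>v\<close> of the squared adjacency operator turns the quadratic form into
  a sum of squares.\<close>

definition supersolution :: "('v \<Rightarrow> real) \<Rightarrow> real \<Rightarrow> bool" where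
  "supersolution v \<mu> \<longleftrightarrow> (\<forall>p\<in>verts. v p > 0) \<and>
     (\<forall>p\<in>verts. (\<Sum>z\<in>{z\<in>two_steps. src (fst z) = p}. v (tgt (snd z))) \<le> \<mu> * v p)"

text \<open>With f and g the counts transported from p = \<open>src e\<close> and q =
  \<open>tgt e'\<close>, this is v(p) v(q) |f / v(p) - g / v(q)|^2 expanded: the ground state term
  of one two-step path.\<close>

definition energy :: "('v \<Rightarrow> real) \<Rightarrow> nat \<Rightarrow> 'e \<Rightarrow> 'e \<Rightarrow> real" where
  "energy v n e e' = v (tgt e') / v (src e) * ret_at n (src e)
     + v (src e) / v (tgt e') * ret_at n (tgt e') - 2 * cross n e e'"

lemma energy_eq:
  assumes "supersolution v \<mu>" and s: "walk base s (src e)" and z: "(e, e') \<in> two_steps"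
    and B: "n + length s + 2 \<le> B"
  shows "energy v n e e' = v (src e) * v (tgt e') *
    (\<Sum>c\<in>keys_upto B. (shifted_count n s (src e) c / v (src e)
        - shifted_count n (s @ [e, e']) (tgt e') c / v (tgt e'))\<^sup>2)"
proof -
  have e: "e \<in> E" "e' \<in> E" "src e' = tgt e" using z by (auto simp: two_steps_def)
  have p: "v (src e) > 0" "v (tgt e') > 0"
    using assms(1) two_steps_verts[OF z] by (auto simp: supersolution_def)
  have s': "walk base (s @ [e, e']) (tgt e')" using s e by (auto intro: walk_appendI)
  have B': "n + length s \<le> B" "n + length (s @ [e, e']) \<le> B" using B by auto
  show ?thesis
    unfolding sum_shifted_diff[OF s B'(1) s' B'(2)] shifted_inner_step[OF s e] energy_def
    using p by (simp add: field_simps power2_eq_square)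
qed

lemma energy_nonneg:
  assumes "supersolution v \<mu>" and z: "(e, e') \<in> two_steps"
  shows "energy v n e e' \<ge> 0"
proof -
  have v: "src e \<in> verts" "tgt e' \<in> verts" using two_steps_verts[OF z] by auto
  then obtain s where s: "walk base s (src e)" unfolding verts_def by blast
  show ?thesis
    unfolding energy_eq[OF assms(1) s z order_refl, of n]
    using assms(1) v by (intro mult_nonneg_nonneg sum_nonneg) (auto simp: supersolution_def less_imp_le)
qed

lemma ret_at_nonneg: "ret_at n p \<ge> 0" by (simp add: ret_at_def)

text \<open>Reversal identifies the two diagonal sums, each of which the supersolution inequality
  bounds by \<open>\<mu> * ret n\<close>, while the cross terms add up to
  \<open>ret (Suc n)\<close>.\<close>

lemma sum_energy:
  assumes "supersolution v \<mu>"
  shows "(\<Sum>(e, e')\<in>two_steps. energy v n e e') \<le> 2 * (\<mu> * ret n - ret (Suc n))"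
proof -
  let ?h = "\<lambda>z. v (tgt (snd z)) / v (src (fst z)) * ret_at n (src (fst z))"
  have le: "(\<Sum>z\<in>two_steps. ?h z) \<le> \<mu> * ret n"
  proof -
    have "(\<Sum>z\<in>two_steps. ?h z) = (\<Sum>p\<in>verts. \<Sum>z\<in>{z\<in>two_steps. src (fst z) = p}. ?h z)"
      by (rule sum.group[symmetric, OF finite_two_steps finite_verts]) (use two_steps_verts in auto)
    also have "\<dots> = (\<Sum>p\<in>verts. (\<Sum>z\<in>{z\<in>two_steps. src (fst z) = p}. v (tgt (snd z))) * (ret_at n p / v p))"
      by (intro sum.cong refl) (simp add: sum_distrib_right sum_divide_distrib)
    also have "\<dots> \<le> (\<Sum>p\<in>verts. (\<mu> * v p) * (ret_at n p / v p))"
      using assms by (intro sum_mono mult_right_mono) (auto simp: supersolution_def ret_at_nonneg less_imp_le)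
    also have "\<dots> = (\<Sum>p\<in>verts. \<mu> * ret_at n p)"
      using assms by (intro sum.cong refl) (auto simp: supersolution_def)
    finally show ?thesis by (simp add: ret_eq_sum sum_distrib_left)
  qed
  have "(\<Sum>z\<in>two_steps. v (src (fst z)) / v (tgt (snd z)) * ret_at n (tgt (snd z))) = (\<Sum>z\<in>two_steps. ?h z)"
    unfolding sum.reindex_bij_betw[OF bij_two_steps, of ?h, symmetric]
    by (intro sum.cong refl) (auto simp: two_steps_def src_opp tgt_opp)
  then have "(\<Sum>(e, e')\<in>two_steps. energy v n e e') = 2 * (\<Sum>z\<in>two_steps. ?h z) - 2 * ret (Suc n)"
    unfolding sum_cross[symmetric]
    by (simp add: energy_def case_prod_unfold sum.distrib sum_subtractf sum_distrib_left)
  then show ?thesis using le by simp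
qed

lemma energy_le:
  assumes "supersolution v \<mu>" "(e, e') \<in> two_steps"
  shows "energy v n e e' \<le> 2 * (\<mu> * ret n - ret (Suc n))"
proof -
  have "energy v n e e' \<le> (\<Sum>z\<in>two_steps. energy v n (fst z) (snd z))"
    using assms energy_nonneg[OF assms(1)]
    by (intro member_le_sum[of "(e, e')" two_steps "\<lambda>z. energy v n (fst z) (snd z)", simplified])
       (auto simp: finite_two_steps)
  then show ?thesis using sum_energy[OF assms(1), of n] by (simp add: case_prod_unfold)
qed

lemma ret_Suc_le:
  assumes "supersolution v \<mu>"
  shows "ret (Suc n) \<le> \<mu> * ret n"
proof -
  have "0 \<le> (\<Sum>(e, e')\<in>two_steps. energy v n e e')"
    using energy_nonneg[OF assms] by (intro sum_nonneg) auto
  then show ?thesis using sum_energy[OF assms, of n] by simp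
qed

text \<open>A crude supersolution, good enough to bound the ratios
  \<open>ret (Suc n) / ret n\<close> so that the supremum \<open>rate\<close> makes sense.\<close>

lemma supersolution_one: "supersolution (\<lambda>_. 1) (real (card two_steps))"
  by (auto simp: supersolution_def finite_two_steps intro!: card_mono)

definition rate :: real where
  "rate = (SUP n. ret (Suc n) / ret n)"

lemma ratio_bounded: "bdd_above (range (\<lambda>n. ret (Suc n) / ret n))"
  using ret_Suc_le[OF supersolution_one] ret_pos
  by (intro bdd_aboveI2[of _ _ "real (card two_steps)"]) (simp add: field_simps)

lemma ratio_le_rate: "ret (Suc n) \<le> rate * ret n"
  using cSUP_upper[OF UNIV_I ratio_bounded, of n] ret_pos[of n]
  by (simp add: rate_def field_simps)

lemma ratio_tendsto_rate: "(\<lambda>n. ret (Suc n) / ret n) \<longlonglongrightarrow> rate"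
  unfolding rate_def
proof (rule LIMSEQ_incseq_SUP[OF ratio_bounded], rule incseq_SucI)
  fix n
  show "ret (Suc n) / ret n \<le> ret (Suc (Suc n)) / ret (Suc n)"
    using ret_log_convex[of n] ret_pos[of n] ret_pos[of "Suc n"]
    by (simp add: field_simps power2_eq_square)
qed

lemma rate_pos: "rate > 0"
  using ratio_le_rate[of 0] ret_pos[of 0] ret_pos[of "Suc 0"]
  by (metis less_le_trans zero_less_mult_pos2)

end

section \<open>Growth of all walks and the ground state estimates\<close>

context walk_groupoid
begin

text \<open>The coarsest admissible equivalence identifies all walks with common endpoints. Applied
  to it, the preceding results describe the growth of all walks.\<close>

lemma triv_groupoid: "walk_groupoid E src tgt opp base (\<lambda>p q w w'. walk p w q \<and> walk p w' q)"
  by unfold_locales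
     (use odd_closed in \<open>auto intro: walk_appendI simp: opp_edge src_opp tgt_opp\<close>)

interpretation triv: walk_groupoid E src tgt opp base "\<lambda>p q w w'. walk p w q \<and> walk p w' q"
  by (rule triv_groupoid)

definition walk_count :: "nat \<Rightarrow> 'v \<Rightarrow> real" where
  "walk_count n p = real (card (walks n base p))"

text \<open>A growth factor per two edges, since \<open>triv.ret n\<close> counts closed walks of
  length \<open>2 * n\<close>. On this scale it is comparable with \<open>rate\<close>.\<close>

definition max_rate :: real where
  "max_rate = triv.rate"

text \<open>Rotating all edges of the first walk onto the second leaves the empty walk paired with a
  closed walk of length \<open>2 * n\<close>.\<close>

lemma triv_ret: "triv.ret n = walk_count (2 * n) base"
proof -
  have "card (triv.pairs n n) = card (triv.pairs 0 (n + n))"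
    using triv.card_pairs_shift[of 0 n n] by simp
  also have "triv.pairs 0 (n + n) = Pair [] ` walks (2 * n) base base"
    by (auto simp: triv.pairs_iff walks_def)
  also have "card \<dots> = card (walks (2 * n) base base)"
    by (rule card_image) (simp add: inj_on_def)
  finally show ?thesis by (simp add: triv.ret_def walk_count_def)
qed

lemma closed_ratio_le: "walk_count (2 * Suc n) base \<le> max_rate * walk_count (2 * n) base"
  using triv.ratio_le_rate[of n] by (simp add: triv_ret max_rate_def)

lemma closed_ratio_tendsto:
  "(\<lambda>n. walk_count (2 * Suc n) base / walk_count (2 * n) base) \<longlonglongrightarrow> max_rate"
  using triv.ratio_tendsto_rate by (simp add: triv_ret max_rate_def)

lemma max_rate_pos: "max_rate > 0"
  using triv.rate_pos by (simp add: max_rate_def)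

lemma walk_count_base_pos: "walk_count (2 * n) base > 0"
  using triv.ret_pos[of n] by (simp add: triv_ret)

lemma walk_count_nonneg: "walk_count n p \<ge> 0"
  by (simp add: walk_count_def)

text \<open>Splitting off the last two edges gives a sum over two-step paths into \<open>p\<close>;
  reversal turns it into one over paths out of \<open>p\<close>, the form in which supersolutions
  are stated.\<close>

lemma walk_count_two_steps:
  assumes "p \<in> verts"
  shows "walk_count (Suc (Suc n)) p = (\<Sum>z\<in>{z\<in>two_steps. src (fst z) = p}. walk_count n (tgt (snd z)))"
proof -
  let ?S = "{z\<in>two_steps. tgt (snd z) = p}"
  let ?Q = "\<lambda>z. (\<lambda>w. w @ [fst z, snd z]) ` walks n base (src (fst z))"
  have eq: "walks (Suc (Suc n)) base p = (\<Union>z\<in>?S. ?Q z)"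
  proof (intro equalityI subsetI)
    fix x assume x: "x \<in> walks (Suc (Suc n)) base p"
    obtain x1 e' where x1: "x = x1 @ [e']" using x by (cases x rule: rev_cases) (auto simp: walks_def)
    obtain w e where w: "x1 = w @ [e]" using x x1 by (cases x1 rule: rev_cases) (auto simp: walks_def)
    have e: "e \<in> E" "e' \<in> E" "src e' = tgt e" "tgt e' = p" "w \<in> walks n base (src e)"
      using x by (auto simp: x1 w walk_append walks_def)
    then have "(e, e') \<in> ?S" by (auto simp: two_steps_def verts_def walks_def)
    moreover have "x \<in> ?Q (e, e')" using e by (auto simp: x1 w)
    ultimately show "x \<in> (\<Union>z\<in>?S. ?Q z)" by (rule UN_I)
  qed (auto simp: walks_def walk_append two_steps_def)
  have "card (\<Union>z\<in>?S. ?Q z) = (\<Sum>z\<in>?S. card (?Q z))"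
    by (rule card_UN_disjoint) (auto simp: finite_two_steps finite_walks)
  also have "\<dots> = (\<Sum>z\<in>?S. card (walks n base (src (fst z))))"
    by (intro sum.cong refl card_image) (auto simp: inj_on_def)
  finally have "walk_count (Suc (Suc n)) p = (\<Sum>z\<in>?S. walk_count n (src (fst z)))"
    by (simp add: walk_count_def eq)
  also have "\<dots> = (\<Sum>z\<in>{z\<in>two_steps. src (fst z) = p}. walk_count n (tgt (snd z)))"
  proof (rule sum.reindex_bij_witness[where i = "\<lambda>(e, e'). (opp e', opp e)" and j = "\<lambda>(e, e'). (opp e', opp e)"])
  qed (auto simp: two_steps_def opp_edge src_opp tgt_opp opp_opp verts_tgt)
  finally show ?thesis .
qed

text \<open>Appending the fixed walk \<open>s\<close> embeds the walks to \<open>p\<close> into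
  closed walks, whose growth per two edges is at most \<open>max_rate\<close>.\<close>

lemma walk_count_le_closed:
  assumes "walk p s base" "length s = 2 * k"
  shows "walk_count (2 * n) p \<le> max_rate ^ n * walk_count (2 * k) base"
proof -
  have "card (walks (2 * n) base p) \<le> card (walks (2 * (n + k)) base base)"
    by (rule card_inj_on_le[of "\<lambda>w. w @ s", OF _ _ finite_walks])
       (use assms in \<open>auto simp: inj_on_def walks_def intro: walk_appendI\<close>)
  moreover have "walk_count (2 * (n + k)) base \<le> max_rate ^ n * walk_count (2 * k) base"
  proof (induction n)
    case (Suc n)
    have "walk_count (2 * (Suc n + k)) base \<le> max_rate * walk_count (2 * (n + k)) base"
      using closed_ratio_le[of "n + k"] by simp
    also have "\<dots> \<le> max_rate * (max_rate ^ n * walk_count (2 * k) base)"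
      using Suc max_rate_pos by (intro mult_left_mono) auto
    finally show ?case by simp
  qed simp
  ultimately show ?thesis by (simp add: walk_count_def)
qed

lemma even_walk_to_base:
  assumes "p \<in> verts"
  shows "\<exists>s k. walk base s p \<and> length s = 2 * k"
  using even_walk[OF assms] unfolding dvd_def by blast

text \<open>Up to a factor \<mu>, the Green's function of the squared adjacency operator between the
  base and \<open>p\<close>. It is an eigenfunction for \<mu> except at the base, where the term for
  \<open>n = 0\<close> leaves an inequality.\<close>

definition resolvent :: "real \<Rightarrow> 'v \<Rightarrow> real" where
  "resolvent \<mu> p = (\<Sum>n. walk_count (2 * n) p / \<mu> ^ n)"

lemma summable_resolvent:
  assumes "p \<in> verts" "\<mu> > max_rate"
  shows "summable (\<lambda>n. walk_count (2 * n) p / \<mu> ^ n)"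
proof -
  obtain s k where s: "walk base s p" "length s = 2 * k" using even_walk_to_base[OF assms(1)] by blast
  have \<mu>: "\<mu> > 0" using assms max_rate_pos by linarith
  show ?thesis
  proof (rule summable_comparison_test'[of "\<lambda>n. walk_count (2 * k) base * (max_rate / \<mu>) ^ n" 0])
    show "summable (\<lambda>n. walk_count (2 * k) base * (max_rate / \<mu>) ^ n)"
      using assms max_rate_pos \<mu> by (intro summable_mult summable_geometric) auto
    fix n
    have "walk_count (2 * n) p \<le> max_rate ^ n * walk_count (2 * k) base"
      using walk_count_le_closed[of p "inv_walk s" k n] s walk_inv by simp
    then show "norm (walk_count (2 * n) p / \<mu> ^ n) \<le> walk_count (2 * k) base * (max_rate / \<mu>) ^ n"
      using \<mu> by (simp add: walk_count_nonneg field_simps)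
  qed
qed

lemma resolvent_sum_le:
  assumes "p \<in> verts" "\<mu> > max_rate"
  shows "(\<Sum>z\<in>{z\<in>two_steps. src (fst z) = p}. resolvent \<mu> (tgt (snd z))) \<le> \<mu> * resolvent \<mu> p"
proof -
  let ?S = "{z\<in>two_steps. src (fst z) = p}"
  let ?f = "\<lambda>n. walk_count (2 * n) p / \<mu> ^ n"
  have \<mu>: "\<mu> > 0" using assms max_rate_pos by linarith
  have "(\<Sum>z\<in>?S. resolvent \<mu> (tgt (snd z))) = (\<Sum>n. \<Sum>z\<in>?S. walk_count (2 * n) (tgt (snd z)) / \<mu> ^ n)"
    unfolding resolvent_def
    by (rule suminf_sum[symmetric]) (use assms two_steps_verts in \<open>auto intro!: summable_resolvent\<close>)
  also have "\<dots> = (\<Sum>n. walk_count (Suc (Suc (2 * n))) p / \<mu> ^ n)"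
    unfolding walk_count_two_steps[OF assms(1)] sum_divide_distrib ..
  also have "\<dots> = (\<Sum>n. \<mu> * ?f (Suc n))"
    using \<mu> by (intro suminf_cong) simp
  also have "\<dots> = \<mu> * (\<Sum>n. ?f (Suc n))"
    by (rule suminf_mult) (use summable_resolvent[OF assms] in \<open>simp only: summable_Suc_iff[of ?f]\<close>)
  also have "(\<Sum>n. ?f (Suc n)) \<le> resolvent \<mu> p"
    unfolding resolvent_def using suminf_split_head[OF summable_resolvent[OF assms]] walk_count_nonneg[of 0 p]
    by simp
  finally show ?thesis using \<mu> by simp
qed

lemma resolvent_nonneg:
  assumes "p \<in> verts" "\<mu> > max_rate"
  shows "resolvent \<mu> p \<ge> 0"
  unfolding resolvent_def using max_rate_pos assms
  by (intro suminf_nonneg summable_resolvent) (auto simp: walk_count_nonneg)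

text \<open>Each term of the nonnegative sum over two-step paths is at most the whole sum, so two
  edges cost a factor \<mu>.\<close>

lemma resolvent_Harnack:
  assumes "p \<in> verts" "\<mu> > max_rate" "walk p s q" "length s = 2 * k"
  shows "resolvent \<mu> q \<le> \<mu> ^ k * resolvent \<mu> p"
  using assms(1,3,4)
proof (induction k arbitrary: p s)
  case 0
  then show ?case by simp
next
  case (Suc k)
  then obtain e e' s' where s: "s = e # e' # s'" by (auto simp: length_Suc_conv)
  have z: "(e, e') \<in> two_steps" "src e = p" "walk (tgt e') s' q" "length s' = 2 * k"
    using Suc.prems by (auto simp: s two_steps_def)
  have \<mu>: "\<mu> > 0" using assms max_rate_pos by linarith
  have v: "tgt e' \<in> verts" using two_steps_verts[OF z(1)] by simp
  have "resolvent \<mu> (tgt e') \<le> (\<Sum>z\<in>{z\<in>two_steps. src (fst z) = p}. resolvent \<mu> (tgt (snd z)))"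
    using z assms(2) two_steps_verts finite_two_steps
    by (intro member_le_sum[of "(e, e')" _ "\<lambda>z. resolvent \<mu> (tgt (snd z))", simplified])
       (auto intro!: resolvent_nonneg)
  also have "\<dots> \<le> \<mu> * resolvent \<mu> p" using Suc.prems(1) assms(2) by (rule resolvent_sum_le)
  finally have "\<mu> ^ k * resolvent \<mu> (tgt e') \<le> \<mu> ^ k * (\<mu> * resolvent \<mu> p)"
    using \<mu> by (intro mult_left_mono) auto
  then show ?case using Suc.IH[OF v z(3,4)] by (simp add: algebra_simps)
qed

text \<open>The resolvent normalized at the base. The Harnack bound pinches its values by powers of
  \<mu>, and \<mu> is at most \<open>max_rate + 1\<close>, so \<open>K\<close> does not depend on
  \<mu>; this uniformity allows \<mu> to tend to \<open>max_rate\<close> later.\<close>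

lemma ex_supersolution:
  "\<exists>K\<ge>1. \<forall>\<mu>. max_rate < \<mu> \<and> \<mu> \<le> max_rate + 1 \<longrightarrow>
     (\<exists>v. supersolution v \<mu> \<and> v base = 1 \<and> (\<forall>p\<in>verts. 1 / K \<le> v p \<and> v p \<le> K))"
proof -
  define k where "k p = (SOME k. \<exists>s. walk base s p \<and> length s = 2 * k)" for p
  have k: "\<exists>s. walk base s p \<and> length s = 2 * k p" if "p \<in> verts" for p
    unfolding k_def by (rule someI_ex) (use even_walk_to_base[OF that] in blast)
  define m where "m = max_rate + 1"
  define K where "K = (\<Sum>p\<in>verts. m ^ k p)"
  have m: "m \<ge> 1" using max_rate_pos by (simp add: m_def)
  have K: "m ^ k p \<le> K" if "p \<in> verts" for p
    unfolding K_def using that m finite_verts by (intro member_le_sum) auto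
  have "1 \<le> m ^ k base" using m by simp
  then have "K \<ge> 1" using K[OF base_verts] by linarith
  moreover have "\<exists>v. supersolution v \<mu> \<and> v base = 1 \<and> (\<forall>p\<in>verts. 1 / K \<le> v p \<and> v p \<le> K)"
    if \<mu>: "max_rate < \<mu>" "\<mu> \<le> max_rate + 1" for \<mu>
  proof -
    let ?r = "resolvent \<mu>"
    have \<mu>0: "\<mu> > 0" using \<mu> max_rate_pos by linarith
    have "?r base \<ge> (\<Sum>n<1. walk_count (2 * n) base / \<mu> ^ n)"
      unfolding resolvent_def
      by (rule sum_le_suminf[OF summable_resolvent[OF base_verts \<mu>(1)]]) (use \<mu>0 in \<open>auto simp: walk_count_nonneg\<close>)
    then have b: "?r base > 0" using walk_count_base_pos[of 0] by simp
    have bounds: "?r base \<le> K * ?r p" "?r p \<le> K * ?r base" if p: "p \<in> verts" for p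
    proof -
      obtain s where s: "walk base s p" "length s = 2 * k p" using k[OF p] by blast
      have le: "\<mu> ^ k p \<le> K" using power_mono[of \<mu> m "k p"] \<mu> \<mu>0 K[OF p] by (simp add: m_def)
      have "?r p \<le> \<mu> ^ k p * ?r base" by (rule resolvent_Harnack[OF base_verts \<mu>(1) s])
      also have "\<dots> \<le> K * ?r base" using le b by (intro mult_right_mono) auto
      finally show "?r p \<le> K * ?r base" .
      have "?r base \<le> \<mu> ^ k p * ?r p"
        by (rule resolvent_Harnack[OF p \<mu>(1) walk_inv[OF s(1)]]) (simp add: s)
      also have "\<dots> \<le> K * ?r p" using le p \<mu> by (intro mult_right_mono resolvent_nonneg) auto
      finally show "?r base \<le> K * ?r p" .
    qed
    have pos: "?r p > 0" if "p \<in> verts" for p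
      using bounds(1)[OF that] b \<open>K \<ge> 1\<close> by (metis less_le_trans zero_less_mult_pos le_less_trans zero_less_one)
    show ?thesis
    proof (intro exI[of _ "\<lambda>p. ?r p / ?r base"] conjI ballI)
      show "supersolution (\<lambda>p. ?r p / ?r base) \<mu>"
        using pos b resolvent_sum_le[OF _ \<mu>(1)]
        by (auto simp: supersolution_def sum_divide_distrib[symmetric] divide_right_mono)
      show "?r base / ?r base = 1" using b by simp
      fix p assume "p \<in> verts"
      then show "1 / K \<le> ?r p / ?r base" "?r p / ?r base \<le> K"
        using bounds[of p] b \<open>K \<ge> 1\<close> by (auto simp: field_simps)
    qed
  qed
  ultimately show ?thesis by blast
qed

text \<open>The inner product of the closed class counts with their translate by the class of
  \<open>s\<close>.\<close>

definition closed_corr :: "nat \<Rightarrow> 'e list \<Rightarrow> real" where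
  "closed_corr n s = real (card {(w, w'). w \<in> walks n base base \<and> w' \<in> walks n base base
     \<and> sim base base w (w' @ inv_walk s)})"

lemma closed_corr_inner:
  "closed_corr n s = shifted_inner n [] base s base"
proof -
  have "key w = key (w' @ inv_walk s) \<longleftrightarrow> sim base base w (w' @ inv_walk s)" if "walk base w base" for w w'
    using key_eq_iff[OF that] .
  then have "{(w, w'). w \<in> walks n base base \<and> w' \<in> walks n base base \<and> key w = key (w' @ inv_walk s)}
    = {(w, w'). w \<in> walks n base base \<and> w' \<in> walks n base base \<and> sim base base w (w' @ inv_walk s)}"
    by (auto simp: walks_def)
  then show ?thesis by (simp add: closed_corr_def shifted_inner_def)
qed

text \<open>Telescoping along \<open>s\<close>, two edges at a time: each step changes the
  normalized transported count by an amount whose L2 norm is controlled by the energy of one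
  two-step path.\<close>

lemma L2_shifted_chain:
  assumes v: "supersolution v \<mu>" "v base = 1" "\<forall>p\<in>verts. 1 / K \<le> v p" and K: "K \<ge> 1"
    and s: "walk base s q" "length s = 2 * k" "n + 2 * k \<le> B"
  shows "L2_set (\<lambda>c. shifted_count n [] base c - shifted_count n s q c / v q) (keys_upto B)
     \<le> k * (K * sqrt (2 * (\<mu> * ret n - ret (Suc n))))"
  using s
proof (induction k arbitrary: s q)
  case 0
  then show ?case using v(2) by (simp add: L2_set_def)
next
  case (Suc k)
  obtain s1 e' where s1: "s = s1 @ [e']" using Suc.prems by (cases s rule: rev_cases) auto
  obtain t e where t: "s1 = t @ [e]" using Suc.prems s1 by (cases s1 rule: rev_cases) auto
  have tw: "walk base t (src e)" and lt: "length t = 2 * k"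
    and e: "e \<in> E" "e' \<in> E" "src e' = tgt e" "tgt e' = q"
    using Suc.prems by (auto simp: s1 t walk_append)
  have z: "(e, e') \<in> two_steps" using e tw by (auto simp: two_steps_def verts_def)
  let ?f = "\<lambda>c. shifted_count n [] base c"
  let ?g = "\<lambda>c. shifted_count n t (src e) c / v (src e)"
  let ?h = "\<lambda>c. shifted_count n s q c / v q"
  have vv: "src e \<in> verts" "q \<in> verts" using two_steps_verts[OF z] e by auto
  let ?\<delta> = "2 * (\<mu> * ret n - ret (Suc n))"
  have "L2_set (\<lambda>c. ?g c - ?h c) (keys_upto B) \<le> K * sqrt ?\<delta>"
  proof -
    let ?X = "\<Sum>c\<in>keys_upto B. (?g c - ?h c)\<^sup>2"
    have "v (src e) * v q * ?X = energy v n e e'"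
      using energy_eq[OF v(1) tw z, of n B] Suc.prems lt e by (simp add: s1 t)
    also have "\<dots> \<le> ?\<delta>" by (rule energy_le[OF v(1) z])
    finally have 1: "v (src e) * v q * ?X \<le> ?\<delta>" .
    \<comment> \<open>The weight of the energy term is bounded below, since both values of
      \<open>v\<close> are at least \<open>1 / K\<close>.\<close>
    have "(1 / K) * (1 / K) \<le> v (src e) * v q"
      using v(1,3) vv K by (intro mult_mono) (auto simp: supersolution_def less_imp_le)
    then have "(1 / K) * (1 / K) * ?X \<le> v (src e) * v q * ?X"
      by (intro mult_right_mono sum_nonneg) auto
    with 1 have "(1 / K) * (1 / K) * ?X \<le> ?\<delta>" by (rule order_trans[rotated])
    then have "K\<^sup>2 * ((1 / K) * (1 / K) * ?X) \<le> K\<^sup>2 * ?\<delta>" by (intro mult_left_mono) auto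
    moreover have "K\<^sup>2 * ((1 / K) * (1 / K) * ?X) = ?X" using K by (simp add: power2_eq_square)
    ultimately have "?X \<le> K\<^sup>2 * ?\<delta>" by (simp only:)
    then have "sqrt ?X \<le> sqrt (K\<^sup>2 * ?\<delta>)" by simp
    then show ?thesis using K by (simp add: L2_set_def real_sqrt_mult)
  qed
  moreover have "L2_set (\<lambda>c. ?f c - ?g c) (keys_upto B) \<le> k * (K * sqrt ?\<delta>)"
    using Suc.IH[OF tw lt] Suc.prems by simp
  moreover have "L2_set (\<lambda>c. (?f c - ?g c) + (?g c - ?h c)) (keys_upto B)
     \<le> L2_set (\<lambda>c. ?f c - ?g c) (keys_upto B) + L2_set (\<lambda>c. ?g c - ?h c) (keys_upto B)"
    by (rule L2_set_triangle_ineq)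
  ultimately show ?case by (simp add: algebra_simps)
qed

text \<open>Supersolutions depend on \<mu> but disappear from the final estimates, so the limit is
  taken in the estimate and not in the supersolutions.\<close>

lemma le_of_all_above:
  assumes "\<And>\<mu>. m < \<mu> \<Longrightarrow> \<mu> \<le> m + 1 \<Longrightarrow> X \<le> a + b * (\<mu>::real)"
  shows "X \<le> a + b * m"
proof (rule tendsto_lowerbound)
  show "((\<lambda>\<mu>. a + b * \<mu>) \<longlongrightarrow> a + b * m) (at_right m)"
    by (intro tendsto_intros)
  show "\<forall>\<^sub>F \<mu> in at_right m. X \<le> a + b * \<mu>"
    unfolding eventually_at_right_field using assms by (intro exI[of _ "m + 1"]) auto
qed simp

text \<open>Transport along a closed walk ends at the base again, where \<open>v\<close> is 1, so
  the chain estimate bounds the distance between the class counts and their translate. The square of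
  this distance is twice the left-hand side.\<close>

lemma closed_corr_deficit:
  assumes "walk base s base" "even (length s)"
  shows "\<exists>C. \<forall>n. ret_at n base - closed_corr n s \<le> C * (max_rate * ret n - ret (Suc n))"
proof -
  obtain k where k: "length s = 2 * k" using assms by (auto elim: evenE)
  obtain K where K: "K \<ge> 1" and sup: "\<And>\<mu>. max_rate < \<mu> \<Longrightarrow> \<mu> \<le> max_rate + 1 \<Longrightarrow>
     (\<exists>v. supersolution v \<mu> \<and> v base = 1 \<and> (\<forall>p\<in>verts. 1 / K \<le> v p \<and> v p \<le> K))"
    using ex_supersolution by blast
  let ?C = "(real k * K)\<^sup>2"
  have "ret_at n base - closed_corr n s \<le> - ?C * ret (Suc n) + (?C * ret n) * max_rate" for n
  proof (rule le_of_all_above)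
    fix \<mu> assume \<mu>: "max_rate < \<mu>" "\<mu> \<le> max_rate + 1"
    then obtain v where v: "supersolution v \<mu>" "v base = 1" "\<forall>p\<in>verts. 1 / K \<le> v p" using sup by blast
    let ?\<delta> = "\<mu> * ret n - ret (Suc n)"
    let ?B = "n + 2 * k"
    have \<delta>: "?\<delta> \<ge> 0" using ret_Suc_le[OF v(1)] by simp
    have "L2_set (\<lambda>c. shifted_count n [] base c - shifted_count n s base c / v base) (keys_upto ?B)
       \<le> k * (K * sqrt (2 * ?\<delta>))"
      by (rule L2_shifted_chain[OF v K assms(1) k]) simp
    then have "(L2_set (\<lambda>c. shifted_count n [] base c / 1 - shifted_count n s base c / 1) (keys_upto ?B))\<^sup>2
       \<le> (k * (K * sqrt (2 * ?\<delta>)))\<^sup>2"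
      using v(2) by (intro power_mono) (auto simp: L2_set_nonneg)
    also have "\<dots> = ?C * (2 * ?\<delta>)" using \<delta> by (simp add: power_mult_distrib)
    finally have "2 * ret_at n base - 2 * closed_corr n s \<le> ?C * (2 * ?\<delta>)"
      using sum_shifted_diff[of "[]" base n ?B s base 1 1] assms k
      by (simp add: L2_set_def sum_nonneg closed_corr_inner)
    then show "ret_at n base - closed_corr n s \<le> - ?C * ret (Suc n) + (?C * ret n) * \<mu>"
      by (simp add: algebra_simps)
  qed
  then show ?thesis by (intro exI[of _ ?C]) (simp add: algebra_simps)
qed

text \<open>After division by \<open>v q\<close>, the counts transported from \<open>q\<close>
  differ from those at the base by an error that the energy controls; the triangle inequality
  compares the norms.\<close>

lemma ret_at_le:
  assumes "q \<in> verts"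
  shows "\<exists>C>0. \<forall>n. ret_at n q \<le> C * (ret_at n base + (max_rate * ret n - ret (Suc n)))"
proof -
  obtain s k where s: "walk base s q" and k: "length s = 2 * k" using even_walk_to_base[OF assms] by blast
  obtain K where K: "K \<ge> 1" and sup: "\<And>\<mu>. max_rate < \<mu> \<Longrightarrow> \<mu> \<le> max_rate + 1 \<Longrightarrow>
     (\<exists>v. supersolution v \<mu> \<and> v base = 1 \<and> (\<forall>p\<in>verts. 1 / K \<le> v p \<and> v p \<le> K))"
    using ex_supersolution by blast
  \<comment> \<open>Absorbs both coefficients that arise from squaring the triangle
    inequality.\<close>
  let ?D = "2 * (real k * K)\<^sup>2 + 1"
  let ?C = "2 * K\<^sup>2 * ?D"
  have "ret_at n q \<le> (?C * ret_at n base - ?C * ret (Suc n)) + (?C * ret n) * max_rate" for n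
  proof (rule le_of_all_above)
    fix \<mu> assume \<mu>: "max_rate < \<mu>" "\<mu> \<le> max_rate + 1"
    then obtain v where v: "supersolution v \<mu>" "v base = 1" "\<forall>p\<in>verts. 1 / K \<le> v p" "\<forall>p\<in>verts. v p \<le> K"
      using sup by blast
    have vq: "0 < v q" "v q \<le> K" using v assms by (auto simp: supersolution_def)
    let ?\<delta> = "\<mu> * ret n - ret (Suc n)"
    let ?B = "n + 2 * k"
    let ?f = "\<lambda>c. shifted_count n [] base c" and ?g = "\<lambda>c. shifted_count n s q c / v q"
    have \<delta>: "?\<delta> \<ge> 0" using ret_Suc_le[OF v(1)] by simp
    have 1: "L2_set (\<lambda>c. ?f c - ?g c) (keys_upto ?B) \<le> k * (K * sqrt (2 * ?\<delta>))"
      by (rule L2_shifted_chain[OF v(1-3) K s k]) simp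
    have "(\<Sum>c\<in>keys_upto ?B. (?g c)\<^sup>2) = (\<Sum>c\<in>keys_upto ?B. shifted_count n s q c * shifted_count n s q c) / (v q)\<^sup>2"
      by (simp add: sum_divide_distrib power2_eq_square)
    then have g: "(L2_set ?g (keys_upto ?B))\<^sup>2 = ret_at n q / (v q)\<^sup>2"
      using sum_shifted_count[OF s, of n ?B s q] k shifted_inner_same[OF s, of n] ret_at_nonneg[of n q]
      by (simp add: L2_set_def sum_nonneg)
    have f: "(L2_set ?f (keys_upto ?B))\<^sup>2 = ret_at n base"
      using sum_shifted_count[of "[]" base n ?B "[]" base] shifted_inner_same[of "[]" base] ret_at_nonneg[of n base]
      by (simp add: L2_set_def sum_nonneg power2_eq_square)
    have "L2_set ?g (keys_upto ?B) = L2_set (\<lambda>c. ?f c + - (?f c - ?g c)) (keys_upto ?B)" by simp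
    also have "\<dots> \<le> L2_set ?f (keys_upto ?B) + L2_set (\<lambda>c. - (?f c - ?g c)) (keys_upto ?B)"
      by (rule L2_set_triangle_ineq)
    also have "L2_set (\<lambda>c. - (?f c - ?g c)) (keys_upto ?B) = L2_set (\<lambda>c. ?f c - ?g c) (keys_upto ?B)"
      by (simp add: L2_set_def power2_commute)
    finally have "L2_set ?g (keys_upto ?B) \<le> L2_set ?f (keys_upto ?B) + k * (K * sqrt (2 * ?\<delta>))"
      using 1 by linarith
    then have "(L2_set ?g (keys_upto ?B))\<^sup>2 \<le> (L2_set ?f (keys_upto ?B) + k * (K * sqrt (2 * ?\<delta>)))\<^sup>2"
      by (intro power_mono) (auto simp: L2_set_nonneg)
    also have "\<dots> \<le> 2 * (L2_set ?f (keys_upto ?B))\<^sup>2 + 2 * (k * (K * sqrt (2 * ?\<delta>)))\<^sup>2"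
      using sum_squares_bound[of "L2_set ?f (keys_upto ?B)" "k * (K * sqrt (2 * ?\<delta>))"]
      by (simp only: power2_sum)
    also have "(k * (K * sqrt (2 * ?\<delta>)))\<^sup>2 = (real k * K)\<^sup>2 * (2 * ?\<delta>)"
      using \<delta> by (simp add: power_mult_distrib)
    finally have "ret_at n q / (v q)\<^sup>2 \<le> 2 * ret_at n base + 2 * ((real k * K)\<^sup>2 * (2 * ?\<delta>))"
      unfolding f g .
    also have "2 * ret_at n base + 2 * ((real k * K)\<^sup>2 * (2 * ?\<delta>)) \<le> 2 * ?D * (ret_at n base + ?\<delta>)"
    proof -
      have "2 * ret_at n base + 2 * ((real k * K)\<^sup>2 * (2 * ?\<delta>)) + (4 * (real k * K)\<^sup>2 * ret_at n base + 2 * ?\<delta>) = 2 * ?D * (ret_at n base + ?\<delta>)"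
      by (simp add: algebra_simps)
      moreover have "0 \<le> 4 * (real k * K)\<^sup>2 * ret_at n base + 2 * ?\<delta>"
        using \<delta> ret_at_nonneg[of n base] by (intro add_nonneg_nonneg mult_nonneg_nonneg) auto
      ultimately show ?thesis by linarith
    qed
    finally have "ret_at n q \<le> (v q)\<^sup>2 * (2 * ?D * (ret_at n base + ?\<delta>))"
      using vq by (simp add: field_simps)
    also have "\<dots> \<le> K\<^sup>2 * (2 * ?D * (ret_at n base + ?\<delta>))"
      using vq \<delta> ret_at_nonneg[of n base] by (intro mult_right_mono power_mono) auto
    finally show "ret_at n q \<le> (?C * ret_at n base - ?C * ret (Suc n)) + (?C * ret n) * \<mu>"
      by (simp add: algebra_simps)
  qed
  moreover have "?C > 0" using K by (intro mult_pos_pos add_nonneg_pos) auto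
  ultimately show ?thesis by (intro exI[of _ ?C]) (simp add: algebra_simps)
qed

lemma ret_Suc_le_max_rate: "ret (Suc n) \<le> max_rate * ret n"
proof -
  obtain K where sup: "\<And>\<mu>. max_rate < \<mu> \<Longrightarrow> \<mu> \<le> max_rate + 1 \<Longrightarrow>
     (\<exists>v. supersolution v \<mu> \<and> v base = 1 \<and> (\<forall>p\<in>verts. 1 / K \<le> v p \<and> v p \<le> K))"
    using ex_supersolution by blast
  have "ret (Suc n) \<le> 0 + ret n * max_rate"
    by (rule le_of_all_above) (use sup ret_Suc_le in \<open>fastforce simp: mult.commute\<close>)
  then show ?thesis by (simp add: mult.commute)
qed

text \<open>Summed over all endpoints: once the deficit is small against \<open>ret n\<close>, pairs
  ending at the base make up a positive fraction of all equivalent pairs.\<close>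

lemma ret_le_ret_at:
  "\<exists>C>0. \<forall>n. ret n \<le> C * (ret_at n base + (max_rate * ret n - ret (Suc n)))"
proof -
  obtain C where C: "\<And>q. q \<in> verts \<Longrightarrow> C q > 0 \<and>
      (\<forall>n. ret_at n q \<le> C q * (ret_at n base + (max_rate * ret n - ret (Suc n))))"
    using ret_at_le by metis
  have "ret n \<le> (\<Sum>q\<in>verts. C q) * (ret_at n base + (max_rate * ret n - ret (Suc n)))" for n
    unfolding ret_eq_sum[of n] sum_distrib_right
    using C by (intro sum_mono) (simp add: ret_eq_sum[symmetric])
  moreover have "(\<Sum>q\<in>verts. C q) > 0"
    using C base_verts finite_verts by (intro sum_pos) auto
  ultimately show ?thesis by blast
qed

end

section \<open>Twisted groupoids\<close>
locale twisted_groupoid = walk_groupoid E src tgt opp base sim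
  for E :: "'e set" and src tgt :: "'e \<Rightarrow> 'v" and opp :: "'e \<Rightarrow> 'e" and base :: 'v
    and sim :: "'v \<Rightarrow> 'v \<Rightarrow> 'e list \<Rightarrow> 'e list \<Rightarrow> bool" +
  fixes tw :: "'e list \<Rightarrow> int"
  assumes tw_sim: "sim base base w w' \<Longrightarrow> tw w = tw w'"
    and tw_append: "walk base w base \<Longrightarrow> walk base w' base \<Longrightarrow> tw (w @ w') = tw w + tw w'"
begin

lemma tw_Nil [simp]: "tw [] = 0"
  using tw_append[of "[]" "[]"] by simp

lemma tw_inv: "walk base w base \<Longrightarrow> tw (inv_walk w) = - tw w"
  using tw_append[of w "inv_walk w"] tw_sim[OF sim_walk_inv, of w base] walk_inv[of base w base] by simp

text \<open>The path to the base is fixed to be empty, so that on closed walks the sum of edge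
  twists is \<open>tw\<close> itself.\<close>

definition rho :: "'v \<Rightarrow> 'e list" where
  "rho p = (if p = base then [] else SOME w. walk base w p)"

lemma walk_rho: "p \<in> verts \<Longrightarrow> walk base (rho p) p"
  unfolding rho_def verts_def by (auto intro: someI_ex)

lemma rho_base [simp]: "rho base = []"
  by (simp add: rho_def)

text \<open>The reference paths \<open>rho\<close> spread the twist over the single edges of a walk.\<close>

definition tw_edge :: "'e \<Rightarrow> int" where
  "tw_edge e = tw (rho (src e) @ [e] @ inv_walk (rho (tgt e)))"

definition twl :: "'e list \<Rightarrow> int" where
  "twl w = sum_list (map tw_edge w)"

lemma twl_append [simp]: "twl (u @ w) = twl u + twl w"
  by (simp add: twl_def)

text \<open>Inserting the reverse of \<open>rho\<close> and \<open>rho\<close> at each intermediate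
  vertex factors the closed-up walk into closed walks, one for each edge, and \<open>tw\<close> is
  additive on these.\<close>

lemma tw_eq_twl:
  assumes "p \<in> verts" "walk p w q"
  shows "tw (rho p @ w @ inv_walk (rho q)) = twl w"
  using assms
proof (induction w arbitrary: p)
  case Nil
  then show ?case using tw_sim[OF sim_walk_inv[OF walk_rho]] by (simp add: twl_def)
next
  case (Cons e w)
  let ?r = "tgt e"
  have e: "e \<in> E" "src e = p" "walk ?r w q" using Cons.prems by auto
  have v: "?r \<in> verts" "q \<in> verts" using verts_tgt[of e] verts_walk[OF Cons.prems] e Cons.prems by auto
  let ?a = "rho p @ [e]" and ?b = "w @ inv_walk (rho q)"
  have a: "walk base ?a ?r" using walk_rho[OF Cons.prems(1)] e by (auto intro: walk_appendI)
  have b: "walk ?r ?b base" using e walk_inv[OF walk_rho[OF v(2)]] by (auto intro: walk_appendI)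
  have r: "walk base (rho ?r) ?r" by (rule walk_rho[OF v(1)])
  have "sim base base ((?a @ inv_walk (rho ?r) @ rho ?r) @ ?b) (?a @ ?b)"
  proof (rule sim_append[OF _ sim_refl[OF b]])
    show "sim base ?r (?a @ inv_walk (rho ?r) @ rho ?r) ?a"
      using sim_append[OF sim_refl[OF a] sim_inv_walk[OF r]] by simp
  qed
  then have "tw (?a @ ?b) = tw ((?a @ inv_walk (rho ?r)) @ (rho ?r @ ?b))"
    using tw_sim by fastforce
  also have "\<dots> = tw (?a @ inv_walk (rho ?r)) + tw (rho ?r @ ?b)"
    using walk_appendI[OF a walk_inv[OF r]] walk_appendI[OF r b] by (rule tw_append)
  also have "tw (rho ?r @ ?b) = twl w" using Cons.IH[OF v(1) e(3)] by simp
  finally show ?case using e by (simp add: tw_edge_def twl_def)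
qed

lemma tw_closed_eq: "walk base w base \<Longrightarrow> tw w = twl w"
  using tw_eq_twl[OF base_verts, of w base] by simp

lemma twl_bound: "\<exists>C\<ge>0. \<forall>p w q. walk p w q \<longrightarrow> \<bar>twl w\<bar> \<le> C * int (length w)"
proof -
  define C where "C = (\<Sum>e\<in>E. \<bar>tw_edge e\<bar>)"
  have "\<bar>tw_edge e\<bar> \<le> C" if "e \<in> E" for e
    unfolding C_def using that finite_edges by (intro member_le_sum) auto
  then have "\<bar>twl w\<bar> \<le> C * int (length w)" if "set w \<subseteq> E" for w
    using that
  proof (induction w)
    case (Cons a w)
    then have "\<bar>twl w\<bar> \<le> C * int (length w)" "\<bar>tw_edge a\<bar> \<le> C" using \<open>\<And>e. e \<in> E \<Longrightarrow> \<bar>tw_edge e\<bar> \<le> C\<close> by auto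
    then show ?case by (simp add: twl_def algebra_simps)
  qed (simp add: twl_def)
  moreover have "C \<ge> 0" unfolding C_def by (intro sum_nonneg) auto
  ultimately show ?thesis using walk_edges by blast
qed

definition equal_twist :: "nat \<Rightarrow> real" where
  "equal_twist n = real (card {(w, w'). w \<in> walks n base base \<and> w' \<in> walks n base base \<and> tw w = tw w'})"

text \<open>Evenness of the length encodes membership in the even domino group.\<close>

definition twist_free :: "'e list set" where
  "twist_free = {s. walk base s base \<and> even (length s) \<and> tw s = 0}"

definition twist_free_classes :: "'e list set set" where
  "twist_free_classes = key ` twist_free"

text \<open>The twist takes only linearly many values on closed walks of length \<open>n\<close>,
  and by Cauchy-Schwarz the coincidences number at least all pairs divided by the number of
  values.\<close>

lemma equal_twist_lower:
  "\<exists>C\<ge>0. \<forall>n. (walk_count n base)\<^sup>2 \<le> (C * real n + 1) * equal_twist n"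
proof -
  obtain C where C: "C \<ge> 0" "\<And>p w q. walk p w q \<Longrightarrow> \<bar>twl w\<bar> \<le> C * int (length w)"
    using twl_bound by blast
  have "(walk_count n base)\<^sup>2 \<le> (real_of_int (2 * C) * real n + 1) * equal_twist n" for n
  proof -
    let ?A = "walks n base base" and ?B = "{- C * int n..C * int n}"
    have A: "tw w \<in> ?B" if "w \<in> ?A" for w
      using C(2)[of base w base] that tw_closed_eq[of w] by (auto simp: walks_def)
    have "{(a, b). a \<in> ?A \<and> b \<in> ?B \<and> tw a = id b} = (\<lambda>a. (a, tw a)) ` ?A" using A by auto
    moreover have "card ((\<lambda>a. (a, tw a)) ` ?A) = card ?A" by (rule card_image) (simp add: inj_on_def)
    moreover have "{(b, b'). b \<in> ?B \<and> b' \<in> ?B \<and> id b = id b'} = (\<lambda>b. (b, b)) ` ?B" by auto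
    moreover have "card ((\<lambda>b. (b, b)) ` ?B) = card ?B" by (rule card_image) (simp add: inj_on_def)
    moreover have "real (card ?B) = real_of_int (2 * C) * real n + 1"
      using C(1) by (simp add: algebra_simps)
    ultimately show ?thesis
      using card_fibre_pairs_Cauchy_Schwarz[of ?A ?B tw id]
      by (simp only: finite_walks finite_atLeastAtMost_int walk_count_def equal_twist_def mult.commute
          simp_thms True_implies_equals)
  qed
  then show ?thesis using C(1) by (intro exI[of _ "real_of_int (2 * C)"]) auto
qed

lemma closed_corr_le: 
  assumes "walk base s base"
  shows "closed_corr n s \<le> ret_at n base"
proof -
  let ?A = "walks n base base"
  have "(closed_corr n s)\<^sup>2 \<le> ret_at n base * shifted_inner n s base s base"
    using card_fibre_pairs_Cauchy_Schwarz[of ?A ?A key "\<lambda>w. key (w @ inv_walk s)"]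
    unfolding closed_corr_inner shifted_inner_def ret_at_def by (simp add: finite_walks)
  then have "(closed_corr n s)\<^sup>2 \<le> (ret_at n base)\<^sup>2"
    by (simp add: shifted_inner_same[OF assms] power2_eq_square)
  then show ?thesis using ret_at_nonneg power2_le_imp_le by blast
qed

text \<open>The defining condition says that the difference \<open>inv_walk w @ w'\<close> lies in
  the class of \<open>s\<close>, so the correlation depends on \<open>s\<close> only through its
  class.\<close>

lemma closed_corr_class:
  assumes "walk base s base"
  shows "closed_corr n s = real (card {(w, w'). w \<in> walks n base base \<and> w' \<in> walks n base base
     \<and> key (inv_walk w @ w') = key s})"
proof -
  have "sim base base w (w' @ inv_walk s) \<longleftrightarrow> key (inv_walk w @ w') = key s"
    if w: "walk base w base" "walk base w' base" for w w'
  proof -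
    have "sim base base w (w' @ inv_walk s) \<longleftrightarrow> sim base base (w @ s) w'"
      using sim_move[OF w(1) assms w(2)] by simp
    also have "\<dots> \<longleftrightarrow> sim base base (inv_walk w @ w @ s) (inv_walk w @ w')"
      using w assms by (intro sim_left_iff[symmetric]) (auto intro: walk_appendI walk_inv)
    also have "\<dots> \<longleftrightarrow> sim base base s (inv_walk w @ w')"
      using sim_cancel_left[OF w(1) assms] sim_sym sim_trans by meson
    also have "\<dots> \<longleftrightarrow> key s = key (inv_walk w @ w')" using key_eq_iff[OF assms] by simp
    finally show ?thesis by auto
  qed
  then have "{(w, w'). w \<in> walks n base base \<and> w' \<in> walks n base base \<and> sim base base w (w' @ inv_walk s)}
    = {(w, w'). w \<in> walks n base base \<and> w' \<in> walks n base base \<and> key (inv_walk w @ w') = key s}"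
    by (auto simp: walks_def)
  then show ?thesis by (simp add: closed_corr_def)
qed

definition class_corr :: "nat \<Rightarrow> 'e list set \<Rightarrow> real" where
  "class_corr n h = real (card {(w, w'). w \<in> walks n base base \<and> w' \<in> walks n base base
     \<and> key (inv_walk w @ w') = h})"

lemma diff_twist_free:
  assumes "w \<in> walks n base base" "w' \<in> walks n base base"
  shows "inv_walk w @ w' \<in> twist_free \<longleftrightarrow> tw w = tw w'"
  using assms tw_append[of "inv_walk w" w'] tw_inv[of w] walk_inv[of base w base]
  by (auto simp: twist_free_def walks_def intro: walk_appendI)

text \<open>Two closed walks of the same length have a difference of even length, which has zero
  twist exactly when their twists agree. The class of the difference therefore partitions the pairs
  of equal twist.\<close>

lemma sum_class_corr_le:
  assumes "F \<subseteq> twist_free_classes" "finite F"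
  shows "(\<Sum>h\<in>F. class_corr n h) \<le> equal_twist n"
    and "F = twist_free_classes \<Longrightarrow> (\<Sum>h\<in>F. class_corr n h) = equal_twist n"
proof -
  let ?A = "walks n base base"
  let ?P = "\<lambda>h. {(w, w'). w \<in> ?A \<and> w' \<in> ?A \<and> key (inv_walk w @ w') = h}"
  let ?T = "{(w, w'). w \<in> ?A \<and> w' \<in> ?A \<and> tw w = tw w'}"
  have finT: "finite ?T" by (rule finite_subset[of _ "?A \<times> ?A"]) (auto simp: finite_walks)
  have fin: "finite (?P h)" for h by (rule finite_subset[of _ "?A \<times> ?A"]) (auto simp: finite_walks)
  have U: "(\<Sum>h\<in>F. class_corr n h) = real (card (\<Union>h\<in>F. ?P h))"
    unfolding class_corr_def
    by (subst card_UN_disjoint) (use assms(2) fin in auto)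
  have sub: "(\<Union>h\<in>F. ?P h) \<subseteq> ?T"
  proof clarify
    fix w w' assume w: "w \<in> ?A" "w' \<in> ?A" and k: "key (inv_walk w @ w') \<in> F"
    then obtain s where s: "s \<in> twist_free" "key (inv_walk w @ w') = key s"
      using assms(1) by (auto simp: twist_free_classes_def)
    have "walk base (inv_walk w @ w') base" using w by (auto simp: walks_def intro: walk_appendI walk_inv)
    then have "tw (inv_walk w @ w') = tw s" using s key_eq_iff tw_sim by blast
    then show "tw w = tw w'" using s w tw_append[of "inv_walk w" w'] tw_inv[of w]
      by (auto simp: twist_free_def walks_def walk_inv)
  qed
  show "(\<Sum>h\<in>F. class_corr n h) \<le> equal_twist n"
    unfolding U equal_twist_def using card_mono[OF finT sub] by simp
  assume F: "F = twist_free_classes"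
  have "?T \<subseteq> (\<Union>h\<in>F. ?P h)"
    using diff_twist_free by (auto simp: F twist_free_classes_def)
  then have "(\<Union>h\<in>F. ?P h) = ?T" using sub by (rule equalityI[rotated])
  then show "(\<Sum>h\<in>F. class_corr n h) = equal_twist n"
    unfolding U equal_twist_def by simp
qed

lemma class_corr_le:
  assumes "h \<in> twist_free_classes"
  shows "class_corr n h \<le> ret_at n base"
  using assms closed_corr_le closed_corr_class
  by (auto simp: twist_free_classes_def twist_free_def class_corr_def)

section \<open>Comparison of the two growth rates\<close>

lemma rate_le_max_rate: "rate \<le> max_rate"
  by (rule LIMSEQ_le_const2[OF ratio_tendsto_rate])
     (use ret_Suc_le_max_rate ret_pos in \<open>auto simp: field_simps\<close>)

lemma equal_twist_pos:
  assumes "walk_count n base > 0"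
  shows "equal_twist n > 0"
proof -
  obtain C where "C \<ge> 0" "(walk_count n base)\<^sup>2 \<le> (C * real n + 1) * equal_twist n"
    using equal_twist_lower by blast
  moreover have "(walk_count n base)\<^sup>2 > 0" using assms by simp
  ultimately have "(C * real n + 1) * equal_twist n > 0" "C * real n + 1 > 0" by (linarith, simp add: add_nonneg_pos)
  then show ?thesis by (simp add: zero_less_mult_iff)
qed

text \<open>An exponential gap beats a linear loss: equivalent pairs number at most a constant times
  \<open>rate ^ n\<close>, while for large \<open>n\<close> pairs of equal twist number at least a
  constant times \<open>\<sigma> ^ n / n\<close>, with \<sigma> strictly between the rates.\<close>

lemma ret_at_over_equal_twist_slow:
  assumes "rate < max_rate"
  shows "(\<lambda>n. ret_at n base / equal_twist n) \<longlonglongrightarrow> 0"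
proof -
  define \<sigma> where "\<sigma> = (rate + max_rate) / 2"
  have \<sigma>: "rate < \<sigma>" "\<sigma> < max_rate" "\<sigma> > 0" using assms rate_pos by (auto simp: \<sigma>_def)
  let ?W = "\<lambda>m. walk_count (2 * m) base"
  obtain m0 where m0: "\<And>m. m \<ge> m0 \<Longrightarrow> ?W (Suc m) / ?W m > \<sigma>"
    using order_tendstoD(1)[OF closed_ratio_tendsto \<sigma>(2)] by (auto simp: eventually_sequentially)
  define c where "c = ?W m0 / \<sigma> ^ m0"
  have c: "c > 0" using walk_count_base_pos[of m0] \<sigma> by (simp add: c_def)
  have W: "?W m \<ge> c * \<sigma> ^ m" if "m \<ge> m0" for m
    using that
  proof (induction m rule: dec_induct)
    case base
    then show ?case using \<sigma> by (simp add: c_def)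
  next
    case (step m)
    have "?W (Suc m) \<ge> \<sigma> * ?W m" using m0[OF step(1)] walk_count_base_pos[of m] by (simp add: field_simps)
    moreover have "\<sigma> * ?W m \<ge> \<sigma> * (c * \<sigma> ^ m)" using step \<sigma> by (intro mult_left_mono) auto
    ultimately show ?case by (simp add: algebra_simps)
  qed
  obtain v where v: "walk base v base" "odd (length v)" using odd_closed by blast
  obtain k where k: "length v = 2 * k + 1" using v(2) by (auto elim: oddE)
  \<comment> \<open>The growth estimate concerns even lengths; a fixed odd closed walk transfers it
    to odd ones.\<close>
  have W_odd: "walk_count (2 * m + 1 + 2 * k) base \<ge> ?W m" for m
    unfolding walk_count_def of_nat_le_iff
    by (rule card_inj_on_le[of "\<lambda>w. w @ v", OF _ _ finite_walks])
       (use v k in \<open>auto simp: inj_on_def walks_def intro: walk_appendI\<close>)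
  \<comment> \<open>The minimum covers both parities: for odd \<open>n\<close> the appended walk
    costs a factor \<open>\<sigma> ^ (2 * k + 1)\<close>.\<close>
  define d where "d = c\<^sup>2 * min 1 (1 / \<sigma> ^ (2 * k + 1))"
  have d: "d > 0" using c \<sigma> by (auto simp: d_def)
  have Wn: "(walk_count n base)\<^sup>2 \<ge> d * \<sigma> ^ n" if n: "n \<ge> 2 * m0 + 2 * k + 1" for n
  proof (cases "even n")
    case True
    then obtain m where m: "n = 2 * m" by (auto elim: evenE)
    then have "(c * \<sigma> ^ m)\<^sup>2 \<le> (?W m)\<^sup>2" using W[of m] n c \<sigma> by (intro power_mono) auto
    moreover have "(c * \<sigma> ^ m)\<^sup>2 = c\<^sup>2 * \<sigma> ^ n" by (simp add: m power_mult_distrib power_mult[symmetric] mult.commute)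
    moreover have "d * \<sigma> ^ n \<le> c\<^sup>2 * \<sigma> ^ n"
      unfolding d_def using \<sigma> by (intro mult_right_mono mult_left_le) auto
    ultimately show ?thesis by (simp add: m)
  next
    case False
    then have "even (n - (2 * k + 1))" using n by auto
    then obtain m where m': "n - (2 * k + 1) = 2 * m" unfolding dvd_def by blast
    then have m: "n = 2 * m + 1 + 2 * k" "m \<ge> m0" using n by auto
    have "c * \<sigma> ^ m \<le> walk_count n base" using W[OF m(2)] W_odd[of m] m(1) by simp
    then have "(c * \<sigma> ^ m)\<^sup>2 \<le> (walk_count n base)\<^sup>2" using c \<sigma> by (intro power_mono) auto
    moreover have "(c * \<sigma> ^ m)\<^sup>2 = c\<^sup>2 * (1 / \<sigma> ^ (2 * k + 1)) * \<sigma> ^ n"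
      using \<sigma> unfolding m(1) by (simp add: power_mult_distrib power_mult[symmetric] power_add mult.commute)
    moreover have "d * \<sigma> ^ n \<le> c\<^sup>2 * (1 / \<sigma> ^ (2 * k + 1)) * \<sigma> ^ n"
      unfolding d_def using \<sigma> by (intro mult_right_mono mult_left_mono) auto
    ultimately show ?thesis by simp
  qed
  have ret: "ret n \<le> rate ^ n * ret 0" for n
  proof (induction n)
    case (Suc n)
    have "ret (Suc n) \<le> rate * ret n" by (rule ratio_le_rate)
    also have "\<dots> \<le> rate * (rate ^ n * ret 0)" using Suc rate_pos by (intro mult_left_mono) auto
    finally show ?case by simp
  qed simp
  have a: "ret_at n base \<le> rate ^ n * ret 0" for n
  proof -
    have "ret_at n base \<le> ret n" unfolding ret_eq_sum
      using base_verts finite_verts ret_at_nonneg by (intro member_le_sum) auto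
    then show ?thesis using ret[of n] by linarith
  qed
  obtain C where C: "C \<ge> 0" "\<And>n. (walk_count n base)\<^sup>2 \<le> (C * real n + 1) * equal_twist n"
    using equal_twist_lower by blast
  let ?x = "rate / \<sigma>"
  have x: "norm ?x < 1" using \<sigma> rate_pos by simp
  have lim: "(\<lambda>n. ret 0 / d * (C * (real n * ?x ^ n) + ?x ^ n)) \<longlonglongrightarrow> ret 0 / d * (C * 0 + 0)"
    by (intro tendsto_intros powser_times_n_limit_0 LIMSEQ_power_zero x)
  have bound: "ret_at n base / equal_twist n \<le> ret 0 / d * (C * (real n * ?x ^ n) + ?x ^ n)"
    if n: "n \<ge> 2 * m0 + 2 * k + 1" for n
  proof -
    have dn: "d * \<sigma> ^ n > 0" using d \<sigma> by simp
    have 1: "d * \<sigma> ^ n \<le> (C * real n + 1) * equal_twist n" using Wn[OF n] C(2)[of n] by linarith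
    have "walk_count n base \<noteq> 0" using Wn[OF n] dn by (metis less_le_not_le zero_power2)
    then have e: "equal_twist n > 0" using equal_twist_pos walk_count_nonneg[of n base] by simp
    have "ret_at n base * (d * \<sigma> ^ n) \<le> (rate ^ n * ret 0) * ((C * real n + 1) * equal_twist n)"
      using a[of n] 1 dn ret_at_nonneg[of n base] ret_pos[of 0] rate_pos by (intro mult_mono[OF a 1]) auto
    then have "ret_at n base / equal_twist n \<le> (rate ^ n * ret 0) * (C * real n + 1) / (d * \<sigma> ^ n)"
      using e dn by (simp add: field_simps)
    also have "\<dots> = ret 0 / d * (C * (real n * ?x ^ n) + ?x ^ n)"
      using d \<sigma> by (simp add: field_simps power_divide)
    finally show ?thesis .
  qed
  show ?thesis
  proof (rule tendsto_sandwich[of "\<lambda>_. 0" _ _ "\<lambda>n. ret 0 / d * (C * (real n * ?x ^ n) + ?x ^ n)"])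
    show "\<forall>\<^sub>F n in sequentially. 0 \<le> ret_at n base / equal_twist n"
      by (simp add: ret_at_nonneg equal_twist_def)
    show "\<forall>\<^sub>F n in sequentially. ret_at n base / equal_twist n \<le> ret 0 / d * (C * (real n * ?x ^ n) + ?x ^ n)"
      unfolding eventually_sequentially using bound by blast
  qed (use lim in simp_all)
qed

text \<open>Equality of the rates makes the deficit negligible against \<open>ret n\<close>, hence
  against \<open>ret_at n base\<close>; so translation by an even class of zero twist changes the
  closed class counts by a relatively small amount.\<close>

lemma class_corr_tendsto:
  assumes "rate = max_rate"
  shows "\<exists>N. \<forall>n\<ge>N. ret_at n base > 0"
    and "h \<in> twist_free_classes \<Longrightarrow> (\<lambda>n. class_corr n h / ret_at n base) \<longlonglongrightarrow> 1"
proof -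
  obtain C where C: "C > 0" "\<And>n. ret n \<le> C * (ret_at n base + (max_rate * ret n - ret (Suc n)))"
    using ret_le_ret_at by blast
  let ?\<delta> = "\<lambda>n. max_rate - ret (Suc n) / ret n"
  have \<delta>: "?\<delta> \<longlonglongrightarrow> 0"
    using tendsto_diff[OF tendsto_const[of max_rate] ratio_tendsto_rate] assms by simp
  have \<delta>r: "max_rate * ret n - ret (Suc n) = ?\<delta> n * ret n" for n
    using ret_pos[of n] by (simp add: field_simps)
  have "\<forall>\<^sub>F n in sequentially. ?\<delta> n < 1 / (2 * C)"
    using order_tendstoD(2)[OF \<delta>, of "1 / (2 * C)"] C(1) by simp
  then obtain N where N: "\<And>n. n \<ge> N \<Longrightarrow> ?\<delta> n < 1 / (2 * C)" by (auto simp: eventually_sequentially)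
  \<comment> \<open>Beyond \<open>N\<close> the deficit term accounts for at most half of
    \<open>ret n\<close> and is moved to the left.\<close>
  have half: "ret n \<le> 2 * C * ret_at n base" if "n \<ge> N" for n
  proof -
    have "ret n \<le> C * ret_at n base + C * (?\<delta> n * ret n)" using C(2)[of n] by (simp add: \<delta>r algebra_simps)
    moreover have "C * (?\<delta> n * ret n) \<le> C * (1 / (2 * C) * ret n)"
      using N[OF that] C(1) ret_pos[of n] by (intro mult_left_mono mult_right_mono) auto
    moreover have "C * (1 / (2 * C) * ret n) = ret n / 2" using C(1) by simp
    ultimately show ?thesis by linarith
  qed
  have pos: "ret_at n base > 0" if "n \<ge> N" for n
    using half[OF that] ret_pos[of n] C(1) by (metis less_le_trans zero_less_mult_pos mult_pos_pos zero_less_numeral)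
  then show "\<exists>N. \<forall>n\<ge>N. ret_at n base > 0" by blast
  assume h: "h \<in> twist_free_classes"
  then obtain s where s: "walk base s base" "even (length s)" "h = key s"
    by (auto simp: twist_free_classes_def twist_free_def)
  have hc: "class_corr n h = closed_corr n s" for n
    using closed_corr_class[OF s(1)] s(3) by (simp add: class_corr_def)
  obtain Cs where Cs: "\<And>n. ret_at n base - closed_corr n s \<le> Cs * (max_rate * ret n - ret (Suc n))"
    using closed_corr_deficit[OF s(1,2)] by blast
  define K where "K = max Cs 0"
  have "1 - K * (2 * C) * ?\<delta> n \<le> class_corr n h / ret_at n base" if n: "n \<ge> N" for n
  proof -
    have d0: "?\<delta> n \<ge> 0" using ret_Suc_le_max_rate[of n] ret_pos[of n] by (simp add: field_simps)
    have "ret_at n base - closed_corr n s \<le> Cs * (?\<delta> n * ret n)" using Cs[of n] by (simp add: \<delta>r)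
    also have "\<dots> \<le> K * (?\<delta> n * ret n)"
      using d0 ret_pos[of n] by (intro mult_right_mono) (auto simp: K_def)
    also have "\<dots> \<le> K * (?\<delta> n * (2 * C * ret_at n base))"
      using half[OF n] d0 by (intro mult_left_mono) (auto simp: K_def)
    finally show ?thesis using pos[OF n] by (simp add: hc field_simps)
  qed
  moreover have "class_corr n h / ret_at n base \<le> 1" if "n \<ge> N" for n
    using class_corr_le[OF h, of n] pos[OF that] by simp
  moreover have "(\<lambda>n. 1 - K * (2 * C) * ?\<delta> n) \<longlonglongrightarrow> 1"
    using tendsto_diff[OF tendsto_const[of 1] tendsto_mult[OF tendsto_const[of "K * (2 * C)"] \<delta>]] by simp
  ultimately show "(\<lambda>n. class_corr n h / ret_at n base) \<longlonglongrightarrow> 1"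
    by (intro tendsto_sandwich[of "\<lambda>n. 1 - K * (2 * C) * ?\<delta> n" "\<lambda>n. class_corr n h / ret_at n base"
          sequentially "\<lambda>_. 1" 1] tendsto_const)
       (auto simp: eventually_sequentially)
qed

lemma equal_twist_le:
  assumes "finite twist_free_classes"
  shows "equal_twist n \<le> card twist_free_classes * ret_at n base"
proof -
  have "equal_twist n = (\<Sum>h\<in>twist_free_classes. class_corr n h)"
    using sum_class_corr_le(2)[OF subset_refl assms] by simp
  also have "\<dots> \<le> (\<Sum>h\<in>twist_free_classes. ret_at n base)"
    by (intro sum_mono class_corr_le)
  finally show ?thesis by simp
qed

lemma Nil_twist_free: "[] \<in> twist_free"
  by (simp add: twist_free_def)

text \<open>Even lengths are realized by going out and back, odd ones by adding a fixed odd closed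
  walk.\<close>

lemma walk_count_eventually_pos: "\<exists>N. \<forall>n\<ge>N. walk_count n base > 0"
proof -
  obtain v where v: "walk base v base" "odd (length v)" using odd_closed by blast
  have "walk_count n base > 0" if n: "n \<ge> length v" for n
  proof -
    have "\<exists>w. walk base w base \<and> length w = n"
    proof (cases "even n")
      case True
      obtain u p where u: "walk base u p" "length u = n div 2" using ex_walk_length by blast
      then show ?thesis using True
        by (intro exI[of _ "u @ inv_walk u"]) (auto intro: walk_appendI walk_inv)
    next
      case False
      obtain u p where u: "walk base u p" "length u = (n - length v) div 2" using ex_walk_length by blast
      have "even (n - length v)" using False v(2) n by auto
      then have "length (v @ u @ inv_walk u) = n" using u(2) n by (simp add: mult_2[symmetric])
      moreover have "walk base (v @ u @ inv_walk u) base"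
        using v(1) u(1) walk_inv[OF u(1)] by (auto intro: walk_appendI)
      ultimately show ?thesis by blast
    qed
    then have "walks n base base \<noteq> {}" by (auto simp: walks_def)
    then show ?thesis by (simp add: walk_count_def card_gt_0_iff finite_walks)
  qed
  then show ?thesis by blast
qed

text \<open>If the kernel is finite, pairs of equal twist number at most its size times the
  equivalent pairs, which keeps the ratio away from 0 and excludes a gap between the rates.\<close>

theorem ret_at_over_equal_twist:
  "(\<lambda>n. ret_at n base / equal_twist n) \<longlonglongrightarrow>
     (if finite twist_free_classes then 1 / real (card twist_free_classes) else 0)"
proof (cases "rate = max_rate")
  case False
  then have lim: "(\<lambda>n. ret_at n base / equal_twist n) \<longlonglongrightarrow> 0"
    using ret_at_over_equal_twist_slow rate_le_max_rate by simp
  have "infinite twist_free_classes"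
  proof
    assume fin: "finite twist_free_classes"
    let ?k = "real (card twist_free_classes)"
    have k: "?k > 0" using fin Nil_twist_free by (auto simp: card_gt_0_iff twist_free_classes_def)
    obtain N where N: "\<And>n. n \<ge> N \<Longrightarrow> walk_count n base > 0" using walk_count_eventually_pos by blast
    have "1 / ?k \<le> ret_at n base / equal_twist n" if "n \<ge> N" for n
      using equal_twist_le[OF fin, of n] equal_twist_pos[OF N[OF that]] k by (simp add: field_simps)
    then have "1 / ?k \<le> 0"
      by (intro LIMSEQ_le_const[OF lim]) blast
    then show False using k by simp
  qed
  then show ?thesis using lim by simp
next
  case True
  obtain N where pos: "\<And>n. n \<ge> N \<Longrightarrow> ret_at n base > 0" using class_corr_tendsto(1)[OF True] by blast
  have corr: "(\<lambda>n. class_corr n h / ret_at n base) \<longlonglongrightarrow> 1" if "h \<in> twist_free_classes" for h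
    using class_corr_tendsto(2)[OF True that] .
  have F: "(\<lambda>n. (\<Sum>h\<in>F. class_corr n h) / ret_at n base) \<longlonglongrightarrow> card F" if "F \<subseteq> twist_free_classes" for F
  proof -
    have "(\<lambda>n. \<Sum>h\<in>F. class_corr n h / ret_at n base) \<longlonglongrightarrow> (\<Sum>h\<in>F. 1)"
      using that by (intro tendsto_sum corr) auto
    then show ?thesis by (simp add: sum_divide_distrib)
  qed
  show ?thesis
  proof (cases "finite twist_free_classes")
    case fin: True
    let ?k = "real (card twist_free_classes)"
    have k: "?k > 0" using fin Nil_twist_free by (auto simp: card_gt_0_iff twist_free_classes_def)
    have "(\<lambda>n. equal_twist n / ret_at n base) \<longlonglongrightarrow> ?k"
      using F[OF subset_refl] sum_class_corr_le(2)[OF subset_refl fin] by simp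
    then have "(\<lambda>n. inverse (equal_twist n / ret_at n base)) \<longlonglongrightarrow> inverse ?k"
      using k by (intro tendsto_inverse) auto
    then show ?thesis using fin by (simp add: inverse_eq_divide)
  next
    case inf: False
    have "\<forall>\<^sub>F n in sequentially. ret_at n base / equal_twist n < \<epsilon>" if "\<epsilon> > 0" for \<epsilon> :: real
    proof -
      obtain k :: nat where k: "real k > 2 / \<epsilon>" using reals_Archimedean2 by blast
      \<comment> \<open>Any \<open>k\<close> of the infinitely many classes already account for
        about \<open>k * ret_at n base\<close> pairs of equal twist.\<close>
      obtain F where F': "F \<subseteq> twist_free_classes" "finite F" "card F = k"
        using infinite_arbitrarily_large[OF inf] by blast
      have k0: "real k > 0" using k that by (meson divide_pos_pos less_trans zero_less_numeral)
      have "\<forall>\<^sub>F n in sequentially. (\<Sum>h\<in>F. class_corr n h) / ret_at n base > real k / 2"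
        by (rule order_tendstoD(1)[OF F[OF F'(1)]]) (use k0 F' in simp)
      then show ?thesis using eventually_ge_at_top[of N]
      proof eventually_elim
        case (elim n)
        have "real k / 2 * ret_at n base < equal_twist n"
          using elim pos[OF elim(2)] sum_class_corr_le(1)[OF F'(1,2), of n] by (simp add: field_simps)
        then have "ret_at n base / equal_twist n < 2 / real k"
          using pos[OF elim(2)] k0 by (smt (verit, best) divide_less_eq less_divide_eq mult.commute mult_pos_pos times_divide_eq_left times_divide_eq_right half_gt_zero)
        also have "2 / real k < \<epsilon>" using k k0 that by (simp add: field_simps)
        finally show ?case .
      qed
    qed
    then have "(\<lambda>n. ret_at n base / equal_twist n) \<longlonglongrightarrow> 0"
      by (intro order_tendstoI) (auto simp: ret_at_nonneg equal_twist_def intro!: always_eventually elim: less_le_trans)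
    then show ?thesis using inf by simp
  qed
qed

end

section \<open>Walks up to flips and vertical space\<close>
text \<open>\<open>eqv\<close> stands for flips and preserves length; \<open>spacer p\<close> is
  free vertical space at \<open>p\<close>, two floors high. Cancelling a floor against its
  reflection leaves such a stretch, not the empty walk, so a groupoid arises only after spacers are
  ignored.\<close>

locale flip_graph = multigraph E src tgt opp base
  for E :: "'e set" and src tgt :: "'e \<Rightarrow> 'v" and opp :: "'e \<Rightarrow> 'e" and base :: 'v +
  fixes spacer :: "'v \<Rightarrow> 'e list" and eqv :: "'v \<Rightarrow> 'v \<Rightarrow> 'e list \<Rightarrow> 'e list \<Rightarrow> bool"
  assumes odd_closed_walk: "\<exists>w. walk base w base \<and> odd (length w)"
    and walk_spacer: "p \<in> src ` E \<Longrightarrow> walk p (spacer p) p"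
    and length_spacer: "length (spacer p) = 2"
    and eqv_walk: "eqv p q w w' \<Longrightarrow> walk p w q \<and> walk p w' q \<and> length w = length w'"
    and eqv_refl: "walk p w q \<Longrightarrow> eqv p q w w"
    and eqv_sym: "eqv p q w w' \<Longrightarrow> eqv p q w' w"
    and eqv_trans: "eqv p q w w' \<Longrightarrow> eqv p q w' w'' \<Longrightarrow> eqv p q w w''"
    and eqv_append: "eqv p q w w' \<Longrightarrow> eqv q r v v' \<Longrightarrow> eqv p r (w @ v) (w' @ v')"
    and eqv_cancel: "e \<in> E \<Longrightarrow> eqv (src e) (src e) [e, opp e] (spacer (src e))"
begin

definition sp :: "'v \<Rightarrow> nat \<Rightarrow> 'e list" where
  "sp p n = concat (replicate n (spacer p))"

lemma sp_0 [simp]: "sp p 0 = []" by (simp add: sp_def)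

lemma sp_add: "sp p (m + n) = sp p m @ sp p n"
  by (simp add: sp_def replicate_add)

lemma length_sp [simp]: "length (sp p n) = 2 * n"
  by (induction n) (auto simp: sp_def length_spacer)

lemma walk_sp: "p \<in> src ` E \<Longrightarrow> walk p (sp p n) p"
  by (induction n) (auto simp: sp_def intro: walk_appendI walk_spacer)

lemma src_tgt: "e \<in> E \<Longrightarrow> tgt e \<in> src ` E"
  using src_opp[of e] opp_edge[of e] by (metis image_eqI)

lemma walk_src: "walk p w q \<Longrightarrow> p \<in> src ` E \<longleftrightarrow> q \<in> src ` E"
proof (induction w arbitrary: p)
  case (Cons e w)
  then have "e \<in> E" "src e = p" "walk (tgt e) w q" by auto
  then show ?case using Cons.IH src_tgt by blast
qed simp

lemma walk_not_src: "walk p w q \<Longrightarrow> q \<notin> src ` E \<Longrightarrow> w = [] \<and> p = q"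
proof (cases w)
  case (Cons e v)
  assume w: "walk p w q" and "q \<notin> src ` E"
  moreover have "p \<in> src ` E" using w Cons by auto
  ultimately show ?thesis using walk_src by blast
qed simp

lemma verts_src: "p \<in> verts \<Longrightarrow> p \<in> src ` E"
proof -
  obtain w where "walk base w base" "odd (length w)" using odd_closed_walk by blast
  then have "base \<in> src ` E" by (cases w) auto
  then show "p \<in> verts \<Longrightarrow> p \<in> src ` E" using walk_src unfolding verts_def by blast
qed

text \<open>The walk \<open>e\<close>, \<open>opp e\<close>, \<open>e\<close> can be read as a
  spacer before \<open>e\<close> or as one after it.\<close>

lemma eqv_commute:
  assumes e: "e \<in> E"
  shows "eqv (src e) (tgt e) (spacer (src e) @ [e]) (e # spacer (tgt e))"
proof -
  have w: "walk (src e) [e] (tgt e)" using e by simp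
  have 1: "eqv (src e) (tgt e) ([e, opp e] @ [e]) (spacer (src e) @ [e])"
    by (rule eqv_append[OF eqv_cancel[OF e] eqv_refl[OF w]])
  have 2: "eqv (src e) (tgt e) ([e, opp e] @ [e]) (e # spacer (tgt e))"
    using eqv_append[OF eqv_refl[OF w], of "tgt e" "[opp e, e]"] eqv_cancel[OF opp_edge[OF e]]
    by (simp add: opp_opp[OF e] src_opp[OF e])
  show ?thesis by (rule eqv_trans[OF eqv_sym[OF 1] 2])
qed

lemma spacer_rotate:
  assumes "walk p w q" "p \<in> src ` E"
  shows "eqv p q (spacer p @ w) (w @ spacer q)"
  using assms
proof (induction w arbitrary: p)
  case Nil
  then show ?case using eqv_refl[OF walk_spacer] by simp
next
  case (Cons e w)
  then have e: "e \<in> E" "src e = p" "walk (tgt e) w q" by auto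
  have "eqv p q ((spacer p @ [e]) @ w) ((e # spacer (tgt e)) @ w)"
    using eqv_append[OF eqv_commute[OF e(1)] eqv_refl[OF e(3)]] e(2) by simp
  moreover have "eqv p q ([e] @ (spacer (tgt e) @ w)) ([e] @ (w @ spacer q))"
    using e by (intro eqv_append[OF eqv_refl Cons.IH]) (auto intro: src_tgt)
  ultimately show ?case using eqv_trans[of p q "spacer p @ e # w"] by simp
qed

text \<open>Vertical space slides along any walk, so only its amount matters.\<close>

lemma sp_rotate:
  assumes "walk p w q" "p \<in> src ` E"
  shows "eqv p q (sp p n @ w) (w @ sp q n)"
proof (induction n)
  case 0
  then show ?case using assms by (simp add: eqv_refl)
next
  case (Suc n)
  have q: "q \<in> src ` E" using walk_src assms by blast
  have s1: "sp r (Suc n) = spacer r @ sp r n" for r by (simp add: sp_def)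
  have "eqv p q (spacer p @ (sp p n @ w)) (spacer p @ (w @ sp q n))"
    by (rule eqv_append[OF eqv_refl[OF walk_spacer[OF assms(2)]] Suc])
  moreover have "eqv p q ((spacer p @ w) @ sp q n) ((w @ spacer q) @ sp q n)"
    by (rule eqv_append[OF spacer_rotate[OF assms] eqv_refl[OF walk_sp[OF q]]])
  ultimately show ?case
    using eqv_trans[of p q "spacer p @ sp p n @ w" "spacer p @ w @ sp q n"] by (simp add: s1)
qed

text \<open>\<open>red w w'\<close>: the walk \<open>w\<close> can be turned into \<open>w'\<close> followed by free vertical space.\<close>

definition red :: "'v \<Rightarrow> 'v \<Rightarrow> 'e list \<Rightarrow> 'e list \<Rightarrow> bool" where
  "red p q w w' \<longleftrightarrow> p \<in> src ` E \<and> (\<exists>c. eqv p q w (w' @ sp q c))"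

lemma red_eqv: "p \<in> src ` E \<Longrightarrow> eqv p q w w' \<Longrightarrow> red p q w w'"
  unfolding red_def by (auto intro: exI[of _ 0])

lemma red_walk:
  assumes "red p q w w'"
  shows "walk p w q" "walk p w' q" "p \<in> src ` E" "q \<in> src ` E"
proof -
  obtain c where c: "eqv p q w (w' @ sp q c)" and p: "p \<in> src ` E" using assms unfolding red_def by blast
  show "walk p w q" "p \<in> src ` E" using eqv_walk[OF c] p by auto
  then show q: "q \<in> src ` E" using walk_src by blast
  obtain r where r: "walk p w' r" "walk r (sp q c) q" using eqv_walk[OF c] walk_append by blast
  have "r = q"
  proof (cases c)
    case 0 then show ?thesis using r by simp
  next
    case (Suc c')
    then obtain e v where ev: "sp q c = e # v" using length_sp[of q c] by (cases "sp q c") fastforce+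
    then show ?thesis using r walk_sp[OF q, of c] by auto
  qed
  then show "walk p w' q" using r by simp
qed

lemma red_refl: "p \<in> src ` E \<Longrightarrow> walk p w q \<Longrightarrow> red p q w w"
  by (intro red_eqv eqv_refl)

lemma red_trans:
  assumes "red p q w w'" "red p q w' w''"
  shows "red p q w w''"
proof -
  obtain c d where c: "eqv p q w (w' @ sp q c)" and d: "eqv p q w' (w'' @ sp q d)"
    using assms unfolding red_def by blast
  have "eqv p q (w' @ sp q c) ((w'' @ sp q d) @ sp q c)"
    by (rule eqv_append[OF d eqv_refl[OF walk_sp[OF red_walk(4)[OF assms(1)]]]])
  then have "eqv p q w (w'' @ sp q (d + c))" using eqv_trans[OF c] by (simp add: sp_add)
  then show ?thesis using red_walk(3)[OF assms(1)] unfolding red_def by blast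
qed

lemma red_append:
  assumes "red p q w w'" "red q r v v'"
  shows "red p r (w @ v) (w' @ v')"
proof -
  obtain c d where c: "eqv p q w (w' @ sp q c)" and d: "eqv q r v (v' @ sp r d)"
    using assms unfolding red_def by blast
  have w: "walk p w' q" "walk q v' r" "q \<in> src ` E" "r \<in> src ` E"
    using red_walk[OF assms(1)] red_walk[OF assms(2)] by auto
  have "eqv p r (w @ v) ((w' @ sp q c) @ (v' @ sp r d))" by (rule eqv_append[OF c d])
  moreover have "eqv p r ((w' @ (sp q c @ v')) @ sp r d) ((w' @ (v' @ sp r c)) @ sp r d)"
    by (rule eqv_append[OF eqv_append[OF eqv_refl[OF w(1)] sp_rotate[OF w(2,3)]] eqv_refl[OF walk_sp[OF w(4)]]])
  ultimately have "eqv p r (w @ v) ((w' @ v') @ sp r (c + d))"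
    using eqv_trans[of p r "w @ v" "w' @ sp q c @ v' @ sp r d"] by (simp add: sp_add)
  then show ?thesis using red_walk(3)[OF assms(1)] unfolding red_def by blast
qed

lemma red_append_left:
  assumes "walk p u q" "red q r v v'"
  shows "red p r (u @ v) (u @ v')"
proof -
  have "p \<in> src ` E" using walk_src[OF assms(1)] red_walk(3)[OF assms(2)] by simp
  then show ?thesis by (rule red_append[OF red_refl[OF _ assms(1)] assms(2)])
qed

lemma red_append_right:
  assumes "red p q w w'" "walk q v r"
  shows "red p r (w @ v) (w' @ v)"
  by (rule red_append[OF assms(1) red_refl[OF red_walk(4)[OF assms(1)] assms(2)]])

lemma red_sp: "p \<in> src ` E \<Longrightarrow> walk p w q \<Longrightarrow> red p q (w @ sp q n) w"
  unfolding red_def using walk_src[of p w q] by (auto intro!: exI[of _ n] eqv_refl walk_appendI walk_sp)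

text \<open>A walk followed by its reverse collapses from the middle outwards, each cancelled pair
  of edges being released as a spacer.\<close>

lemma red_inv: "walk p w q \<Longrightarrow> p \<in> src ` E \<Longrightarrow> red p p (w @ inv_walk w) []"
proof (induction w arbitrary: p)
  case Nil
  then show ?case by (simp add: red_refl)
next
  case (Cons e w)
  then have e: "e \<in> E" "src e = p" "walk (tgt e) w q" by auto
  have o: "walk (tgt e) [opp e] p" using e by (simp add: opp_edge src_opp tgt_opp)
  have "red (tgt e) (tgt e) (w @ inv_walk w) []" by (rule Cons.IH[OF e(3) src_tgt[OF e(1)]])
  from red_append_right[OF this o] have "red p p ([e] @ ((w @ inv_walk w) @ [opp e])) ([e] @ ([] @ [opp e]))"
    using e by (intro red_append_left) auto
  moreover have "red p p ([e] @ ([] @ [opp e])) (spacer p)"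
    using eqv_cancel[OF e(1)] e(2) Cons.prems by (intro red_eqv) auto
  moreover have "red p p (spacer p) []"
    using red_sp[OF Cons.prems(2), of "[]" p 1] by (simp add: sp_def)
  ultimately have "red p p ([e] @ ((w @ inv_walk w) @ [opp e])) []"
    by (blast intro: red_trans)
  then show ?case by (simp add: inv_walk_Cons)
qed

text \<open>Vertices that meet no edge only carry the empty walk; they have no spacer.\<close>

definition sim :: "'v \<Rightarrow> 'v \<Rightarrow> 'e list \<Rightarrow> 'e list \<Rightarrow> bool" where
  "sim p q w w' \<longleftrightarrow> (if q \<in> src ` E then walk p w q \<and> walk p w' q \<and>
     (\<exists>a b. eqv p q (w @ sp q a) (w' @ sp q b)) else p = q \<and> w = [] \<and> w' = [])"

text \<open>Of the two amounts of space in \<open>sim\<close>, the one beside \<open>w'\<close> is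
  what \<open>red\<close> allows to be left over; only the supply for \<open>w\<close> remains to be
  chosen.\<close>

lemma sim_red: "q \<in> src ` E \<Longrightarrow> sim p q w w' \<longleftrightarrow> walk p w q \<and> (\<exists>a. red p q (w @ sp q a) w')"
proof
  assume q: "q \<in> src ` E" and s: "sim p q w w'"
  then obtain a b where "walk p w q" "eqv p q (w @ sp q a) (w' @ sp q b)" by (auto simp: sim_def)
  moreover from this have "p \<in> src ` E" using walk_src q by blast
  ultimately show "walk p w q \<and> (\<exists>a. red p q (w @ sp q a) w')" unfolding red_def by blast
next
  assume q: "q \<in> src ` E" and s: "walk p w q \<and> (\<exists>a. red p q (w @ sp q a) w')"
  then obtain a where a: "red p q (w @ sp q a) w'" by blast
  then obtain b where "eqv p q (w @ sp q a) (w' @ sp q b)" unfolding red_def by blast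
  then show "sim p q w w'" using q s red_walk(2)[OF a] unfolding sim_def by auto
qed

lemma sim_is_walk: "sim p q w w' \<Longrightarrow> walk p w q \<and> walk p w' q"
  by (auto simp: sim_def split: if_splits)

lemma sim_groupoid: "walk_groupoid E src tgt opp base sim"
proof unfold_locales
  show "\<exists>w. walk base w base \<and> odd (length w)" by (rule odd_closed_walk)
  fix p q r :: 'v and w w' w'' v v' :: "'e list" and e
  show "sim p q w w' \<Longrightarrow> walk p w q \<and> walk p w' q" by (rule sim_is_walk)
  show "walk p w q \<Longrightarrow> sim p q w w"
    using walk_not_src by (auto simp: sim_def intro!: exI[of _ 0] eqv_refl)
  show s: "sim p q w w' \<Longrightarrow> sim p q w' w"
    unfolding sim_def by (metis eqv_sym)
  show "sim p q w w''" if 1: "sim p q w w'" and 2: "sim p q w' w''"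
  proof (cases "q \<in> src ` E")
    case True
    obtain a b where a: "red p q (w @ sp q a) w'" and b: "red p q (w' @ sp q b) w''"
      using 1 2 sim_red[OF True] by blast
    have "red p q ((w @ sp q a) @ sp q b) (w' @ sp q b)" by (rule red_append_right[OF a walk_sp[OF True]])
    then have "red p q (w @ sp q (a + b)) w''" using red_trans[OF _ b] by (simp add: sp_add)
    then show ?thesis using sim_red[OF True] 1 by blast
  next
    case False
    then show ?thesis using 1 2 by (auto simp: sim_def)
  qed
  show "sim p r (w @ v) (w' @ v')" if 1: "sim p q w w'" and 2: "sim q r v v'"
  proof (cases "r \<in> src ` E")
    case True
    have qr: "walk q v r" using sim_is_walk[OF 2] by simp
    then have q: "q \<in> src ` E" using True walk_src by blast
    obtain a b where a: "red p q (w @ sp q a) w'" and b: "red q r (v @ sp r b) v'"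
      using 1 2 sim_red[OF True] sim_red[OF q] by blast
    have pq: "walk p w q" using sim_is_walk[OF 1] by simp
    have p: "p \<in> src ` E" using pq q walk_src by blast
    have "red p r (w @ ((v @ sp r a) @ sp r b)) (w @ ((sp q a @ v) @ sp r b))"
      by (rule red_append_left[OF pq red_append_right[OF red_eqv[OF q eqv_sym[OF sp_rotate[OF qr q]]] walk_sp[OF True]]])
    moreover have "red p r ((w @ sp q a) @ (v @ sp r b)) (w' @ v')" by (rule red_append[OF a b])
    ultimately have "red p r ((w @ v) @ sp r (a + b)) (w' @ v')"
      using red_trans[of p r "w @ v @ sp r a @ sp r b" "w @ sp q a @ v @ sp r b" "w' @ v'"] by (simp add: sp_add)
    then show ?thesis using sim_red[OF True] walk_appendI[OF pq qr] by blast
  next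
    case False
    then show ?thesis using 1 2 by (auto simp: sim_def)
  qed
  show "sim (src e) (src e) [e, opp e] []" if e: "e \<in> E"
  proof -
    have "red (src e) (src e) ([e] @ inv_walk [e]) []" by (rule red_inv) (use e in auto)
    then show ?thesis using e sim_red[of "src e" "src e" "[e, opp e]" "[]"]
      by (auto simp: inv_walk_def opp_edge src_opp tgt_opp intro!: exI[of _ 0])
  qed
qed

end

locale twisted_flip_graph = flip_graph E src tgt opp base spacer eqv
  for E :: "'e set" and src tgt :: "'e \<Rightarrow> 'v" and opp :: "'e \<Rightarrow> 'e" and base :: 'v
    and spacer :: "'v \<Rightarrow> 'e list" and eqv :: "'v \<Rightarrow> 'v \<Rightarrow> 'e list \<Rightarrow> 'e list \<Rightarrow> bool" +
  fixes tw :: "'e list \<Rightarrow> int"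
  assumes tw_eqv: "eqv base base w w' \<Longrightarrow> tw w = tw w'"
    and tw_closed_append: "walk base w base \<Longrightarrow> walk base w' base \<Longrightarrow> tw (w @ w') = tw w + tw w'"
    and tw_spacer: "tw (spacer base) = 0"
begin

lemma base_src: "base \<in> src ` E"
  by (rule verts_src[OF base_verts])

lemma tw_sp: "walk base w base \<Longrightarrow> tw (w @ sp base n) = tw w"
proof (induction n)
  case (Suc n)
  have "sp base (Suc n) = sp base n @ spacer base" using sp_add[of base n 1] by (simp add: sp_def)
  then have "tw (w @ sp base (Suc n)) = tw (w @ sp base n) + tw (spacer base)"
    using tw_closed_append[of "w @ sp base n" "spacer base"] Suc.prems
    by (simp add: walk_appendI walk_sp base_src walk_spacer)
  then show ?case using Suc by (simp add: tw_spacer)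
qed simp

lemma tw_of_sim: "sim base base w w' \<Longrightarrow> tw w = tw w'"
proof -
  assume "sim base base w w'"
  then obtain a b where "eqv base base (w @ sp base a) (w' @ sp base b)" "walk base w base" "walk base w' base"
    by (auto simp: sim_def base_src)
  then show ?thesis using tw_eqv tw_sp by metis
qed

sublocale twisted_groupoid E src tgt opp base sim tw
  using sim_groupoid tw_of_sim tw_closed_append
  by (simp add: twisted_groupoid_def twisted_groupoid_axioms_def)

lemma red_sim: "red p q w w' \<Longrightarrow> sim p q w w'"
  using sim_red[of q p w w'] red_walk[of p q w w'] by (auto intro!: exI[of _ 0])

end

section \<open>Cycles of maximal twist per height\<close>

context twisted_flip_graph
begin

lemma twl_closed_sp: "twl (spacer base) = 0"
  using tw_closed_eq[of "spacer base"] walk_spacer[OF base_src] tw_spacer by simp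

lemma twl_inv:
  assumes "p \<in> verts" "walk p w q"
  shows "twl (inv_walk w) = - twl w"
proof -
  have edge: "tw_edge (opp e) = - tw_edge e" if e: "e \<in> E" "src e \<in> verts" for e
  proof -
    let ?c = "rho (src e) @ [e] @ inv_walk (rho (tgt e))"
    have w: "walk base (rho (src e)) (src e)" "walk base (rho (tgt e)) (tgt e)"
      using walk_rho e verts_tgt by auto
    have "walk base ?c base" using w e walk_inv[OF w(2)] by (auto intro!: walk_appendI)
    then have "tw (inv_walk ?c) = - tw ?c" by (rule tw_inv)
    moreover have "inv_walk ?c = rho (tgt e) @ [opp e] @ inv_walk (rho (src e))"
      using inv_inv_walk[OF w(2)] by (simp add: inv_walk_append inv_walk_def)
    ultimately show ?thesis using e by (simp add: tw_edge_def src_opp tgt_opp)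
  qed
  show ?thesis using assms
  proof (induction w arbitrary: p)
    case (Cons e w)
    then have "e \<in> E" "src e \<in> verts" "walk (tgt e) w q" by auto
    then show ?case using Cons.IH[of "tgt e"] verts_tgt[of e] edge[of e]
      by (simp add: inv_walk_Cons twl_def)
  qed (simp add: twl_def)
qed

text \<open>Pigeonhole on the first \<open>card verts + 1\<close> vertices of the walk: two of them
  coincide, and the piece between them is the short cycle.\<close>

lemma split_cycle:
  assumes p: "p \<in> verts" and w: "walk p w q" and len: "length w > card verts"
  shows "\<exists>u z v r. w = u @ z @ v \<and> walk p u r \<and> walk r z r \<and> walk r v q \<and> z \<noteq> [] \<and> length z \<le> card verts"
proof -
  define m where "m = card verts"
  have "\<exists>r. walk p (take i w) r \<and> walk r (drop i w) q" for i
    using w walk_append[of p "take i w" "drop i w" q] by simp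
  then obtain r where r: "\<And>i. walk p (take i w) (r i)" "\<And>i. walk (r i) (drop i w) q" by metis
  have "r ` {..m} \<subseteq> verts" using r(1) verts_walk[OF p] by blast
  then have "card (r ` {..m}) \<le> m" unfolding m_def by (rule card_mono[OF finite_verts])
  then have "\<not> inj_on r {..m}" using card_image[of r "{..m}"] by fastforce
  then obtain i j where ij: "i < j" "j \<le> m" "r i = r j"
    unfolding inj_on_def by (metis atMost_iff linorder_neqE_nat)
  define z where "z = take (j - i) (drop i w)"
  have d: "drop i w = z @ drop j w"
    unfolding z_def using ij by (metis append_take_drop_id drop_drop le_add_diff_inverse2 less_imp_le)
  have lz: "length z = j - i" unfolding z_def using ij len m_def by simp
  obtain s where s: "walk (r i) z s" "walk s (drop j w) q"
    using r(2)[of i] walk_append[of "r i" z "drop j w" q] d by auto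
  have "take j w = take i w @ z" unfolding z_def using ij by (metis le_add_diff_inverse less_imp_le take_add)
  then have "walk p (take j w) s" using walk_appendI[OF r(1)[of i] s(1)] by simp
  then have "s = r j" using r(1)[of j] walk_unique by blast
  then have z: "walk (r i) z (r i)" "walk (r i) (drop j w) q" using s ij by auto
  have "w = take i w @ z @ drop j w" using d append_take_drop_id[of i w] by simp
  moreover have "z \<noteq> []" "length z \<le> card verts" using lz ij by (auto simp: m_def)
  ultimately show ?thesis using r(1)[of i] z by blast
qed

text \<open>A cycle \<open>z\<close> of maximal twist per unit of height; powers of \<open>z\<close> serve as normal forms that
  are as short as possible up to a constant.\<close>

lemma ex_max_cycle:
  "\<exists>q z C. q \<in> verts \<and> walk q z q \<and> z \<noteq> [] \<and> twl z \<ge> 0 \<and> C \<ge> 0 \<and>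
     (\<forall>p w r. p \<in> verts \<longrightarrow> walk p w r \<longrightarrow> \<bar>twl w\<bar> * int (length z) \<le> twl z * int (length w) + C)"
proof -
  define m where "m = card verts"
  \<comment> \<open>The slack \<open>+ 2\<close> admits the spacer at the base, a cycle of zero
    twist, so that the maximal ratio is not negative.\<close>
  define Cyc where "Cyc = {(p, z). p \<in> verts \<and> walk p z p \<and> z \<noteq> [] \<and> length z \<le> m + 2}"
  define f where "f pz = real_of_int (twl (snd pz)) / real (length (snd pz))" for pz :: "'v \<times> 'e list"
  have "Cyc \<subseteq> verts \<times> {z. set z \<subseteq> E \<and> length z \<le> m + 2}"
    using walk_edges by (auto simp: Cyc_def)
  then have fin: "finite Cyc"
    by (rule finite_subset) (simp add: finite_verts finite_lists_length_le[OF finite_edges])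
  have b: "(base, spacer base) \<in> Cyc"
    using base_verts walk_spacer[OF base_src] length_spacer[of base] by (auto simp: Cyc_def)
  then have "Max (f ` Cyc) \<in> f ` Cyc" using fin by (intro Max_in) auto
  then obtain q z where qz: "(q, z) \<in> Cyc" "f (q, z) = Max (f ` Cyc)" by force
  have max: "f pz \<le> f (q, z)" if "pz \<in> Cyc" for pz
    unfolding qz(2) using that fin by simp
  have z: "q \<in> verts" "walk q z q" "z \<noteq> []" using qz by (auto simp: Cyc_def)
  define L where "L = int (length z)"
  define T where "T = twl z"
  have L: "L \<ge> 1" using z(3) by (cases z) (auto simp: L_def)
  have "f (base, spacer base) = 0" by (simp add: f_def twl_closed_sp)
  then have "0 \<le> f (q, z)" using max[OF b] by simp
  then have T: "T \<ge> 0" using L z(3) by (auto simp add: f_def T_def L_def zero_le_divide_iff length_spacer twl_closed_sp)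
  have cyc: "twl z' * L \<le> T * int (length z')" if "(p, z') \<in> Cyc" for p z'
  proof -
    have "real (length z') > 0" using that by (auto simp: Cyc_def)
    moreover have "real_of_int L > 0" using L by simp
    ultimately have "real_of_int (twl z') * real_of_int L \<le> real_of_int T * real (length z')"
      using max[OF that] unfolding f_def T_def L_def by (simp add: field_simps)
    then show ?thesis by (metis of_int_le_iff of_int_mult of_int_of_nat_eq)
  qed
  obtain C0 where C0: "C0 \<ge> 0" "\<And>p w q. walk p w q \<Longrightarrow> \<bar>twl w\<bar> \<le> C0 * int (length w)"
    using twl_bound by blast
  define C where "C = C0 * int m * L"
  \<comment> \<open>Short cycles are cut out one after another. Each obeys the bound without an
    error term, and the constant \<open>C\<close> covers the remaining walk of length at most
    \<open>m\<close>.\<close>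
  have up: "twl w * L \<le> T * int (length w) + C" if "p \<in> verts" "walk p w r" for p w r
    using that
  proof (induction "length w" arbitrary: w rule: less_induct)
    case less
    show ?case
    proof (cases "length w > m")
      case True
      obtain u z' v s where s: "w = u @ z' @ v" "walk p u s" "walk s z' s" "walk s v r" "z' \<noteq> []" "length z' \<le> m"
        using split_cycle[OF less(2,3)] True unfolding m_def by blast
      have "(s, z') \<in> Cyc" using s verts_walk[OF less(2) s(2)] by (auto simp: Cyc_def)
      then have "twl z' * L \<le> T * int (length z')" by (rule cyc)
      moreover have "twl (u @ v) * L \<le> T * int (length (u @ v)) + C"
        using s less(2) by (intro less(1)) (auto intro: walk_appendI)
      ultimately show ?thesis by (simp add: s(1) algebra_simps)
    next
      case False
      have "twl w \<le> C0 * int m"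
        using C0(2)[OF less(3)] mult_left_mono[of "int (length w)" "int m" C0] False C0(1) by linarith
      then have "twl w * L \<le> C0 * int m * L" using L by (intro mult_right_mono) auto
      moreover have "T * int (length w) \<ge> 0" using T by simp
      ultimately show ?thesis by (simp add: C_def)
    qed
  qed
  have "\<bar>twl w\<bar> * L \<le> T * int (length w) + C" if "p \<in> verts" "walk p w r" for p w r
    using up[OF that] up[OF verts_walk[OF that] walk_inv[OF that(2)]] twl_inv[OF that]
    by (cases "twl w \<ge> 0") auto
  moreover have "C \<ge> 0" using C0 L by (simp add: C_def)
  ultimately show ?thesis using z T unfolding L_def T_def by blast
qed

text \<open>For a given twist and parity the classes form a coset of the kernel, and only finitely
  many twists and parities occur.\<close>

lemma finite_classes_bounded_twist:
  assumes "finite twist_free_classes"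
  shows "finite (key ` {x. walk base x base \<and> \<bar>tw x\<bar> \<le> C})"
proof -
  let ?X = "\<lambda>t b. {x. walk base x base \<and> tw x = t \<and> even (length x) = b}"
  have fin: "finite (key ` ?X t b)" for t b
  proof (cases "?X t b = {}")
    case False
    then obtain x0 where x0: "walk base x0 base" "tw x0 = t" "even (length x0) = b" by blast
    have "key ` ?X t b \<subseteq> (\<lambda>h. key (x0 @ (SOME y. y \<in> h))) ` twist_free_classes"
    proof (rule image_subsetI)
      fix x assume "x \<in> ?X t b"
      then have x: "walk base x base" "tw x = t" "even (length x) = b" by auto
      let ?d = "inv_walk x0 @ x"
      have d: "walk base ?d base" using x0 x by (auto intro: walk_appendI walk_inv)
      have "?d \<in> twist_free" using d x x0 tw_append[of "inv_walk x0" x] tw_inv[OF x0(1)] walk_inv[OF x0(1)]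
        by (auto simp: twist_free_def)
      then have kd: "key ?d \<in> twist_free_classes" by (simp add: twist_free_classes_def)
      \<comment> \<open>Any member of the class will do: its product with \<open>x0\<close> always
        lies in the class of \<open>x\<close>.\<close>
      define y where "y = (SOME y. y \<in> key ?d)"
      have "?d \<in> key ?d" using sim_refl[OF d] by (auto simp: key_def)
      then have "y \<in> key ?d" unfolding y_def by (rule someI)
      then obtain p where "sim base p ?d y" by (auto simp: key_def)
      then have y: "sim base base ?d y" using sim_walk d walk_unique by blast
      have "sim base base (x0 @ ?d) (x0 @ y)" by (rule sim_append[OF sim_refl[OF x0(1)] y])
      moreover have "sim base base ((x0 @ inv_walk x0) @ x) ([] @ x)"
        by (rule sim_append[OF sim_walk_inv[OF x0(1)] sim_refl[OF x(1)]])
      ultimately have "sim base base x (x0 @ y)"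
        using sim_trans[OF sim_sym, of base base "x0 @ ?d" x "x0 @ y"] by simp
      then have "key x = key (x0 @ y)" using key_eq_iff[OF x(1)] by simp
      then show "key x \<in> (\<lambda>h. key (x0 @ (SOME y. y \<in> h))) ` twist_free_classes"
        using kd y_def by blast
    qed
    then show ?thesis by (rule finite_subset) (use assms in simp)
  next
    case True
    then show ?thesis by (simp only: image_empty finite.emptyI)
  qed
  have "key ` {x. walk base x base \<and> \<bar>tw x\<bar> \<le> C} \<subseteq> (\<Union>t\<in>{-C..C}. \<Union>b\<in>UNIV. key ` ?X t b)"
  proof (rule image_subsetI)
    fix x assume "x \<in> {x. walk base x base \<and> \<bar>tw x\<bar> \<le> C}"
    then have "tw x \<in> {-C..C}" "x \<in> ?X (tw x) (even (length x))" by auto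
    then show "key x \<in> (\<Union>t\<in>{-C..C}. \<Union>b\<in>UNIV. key ` ?X t b)" by blast
  qed
  then show ?thesis
    by (rule finite_subset) (intro finite_UN_I finite_atLeastAtMost_int finite fin)
qed

lemma red_sp_mono:
  assumes "red p q (x @ sp q a) y" "walk p x q" "a \<le> b"
  shows "red p q (x @ sp q b) y"
proof -
  have q: "q \<in> src ` E" using red_walk(4)[OF assms(1)] .
  have "red p q ((x @ sp q a) @ sp q (b - a)) (x @ sp q a)"
    using red_walk(1,3)[OF assms(1)] by (intro red_sp) auto
  moreover have "(x @ sp q a) @ sp q (b - a) = x @ sp q b"
    using sp_add[of q a "b - a"] assms(3) by simp
  ultimately show ?thesis using red_trans[OF _ assms(1)] by simp
qed

end

section \<open>Normal forms built from powers of one cycle\<close>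

locale cycle_flip_graph = twisted_flip_graph E src tgt opp base spacer eqv tw
  for E :: "'e set" and src tgt :: "'e \<Rightarrow> 'v" and opp :: "'e \<Rightarrow> 'e" and base :: 'v
    and spacer :: "'v \<Rightarrow> 'e list" and eqv :: "'v \<Rightarrow> 'v \<Rightarrow> 'e list \<Rightarrow> 'e list \<Rightarrow> bool"
    and tw :: "'e list \<Rightarrow> int" +
  fixes q0 :: 'v and z0 :: "'e list" and C0 :: int
  assumes q0: "q0 \<in> verts" and z0: "walk q0 z0 q0" "z0 \<noteq> []" and twl_z0: "twl z0 \<ge> 0" and C0: "C0 \<ge> 0"
    and max_cycle: "p \<in> verts \<Longrightarrow> walk p w r \<Longrightarrow>
      \<bar>twl w\<bar> * int (length z0) \<le> twl z0 * int (length w) + C0"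
begin

definition zpow :: "int \<Rightarrow> 'e list" where
  "zpow j = (if j \<ge> 0 then concat (replicate (nat j) z0) else concat (replicate (nat (- j)) (inv_walk z0)))"

definition zcl :: "int \<Rightarrow> 'e list" where
  "zcl j = rho q0 @ zpow j @ inv_walk (rho q0)"

lemma concat_replicate_snoc: "concat (replicate (Suc n) x) = concat (replicate n x) @ x"
  by (induction n) auto

lemma zpow_add_1: "j \<ge> 0 \<Longrightarrow> zpow (j + 1) = zpow j @ z0"
  by (simp add: zpow_def nat_add_distrib concat_replicate_snoc del: replicate_Suc)

lemma zpow_diff_1: "j \<le> 0 \<Longrightarrow> zpow (j - 1) = zpow j @ inv_walk z0"
proof -
  assume j: "j \<le> 0"
  have neg: "zpow i = concat (replicate (nat (- i)) (inv_walk z0))" if "i \<le> 0" for i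
    using that by (cases "i = 0") (auto simp: zpow_def)
  have "nat (- (j - 1)) = Suc (nat (- j))" using j by simp
  then show ?thesis using j neg[of j] neg[of "j - 1"] by (simp only: concat_replicate_snoc)
qed

lemma q0_src: "q0 \<in> src ` E"
  by (rule verts_src[OF q0])

lemma power_walk:
  assumes "walk q x q"
  shows "walk q (concat (replicate n x)) q" and "twl (concat (replicate n x)) = int n * twl x"
    and "length (concat (replicate n x)) = n * length x"
  by (induction n) (use assms in \<open>auto intro: walk_appendI simp: twl_def algebra_simps\<close>)

lemma walk_zpow: "walk q0 (zpow j) q0"
  using power_walk(1)[OF z0(1)] power_walk(1)[OF walk_inv[OF z0(1)]] by (simp add: zpow_def)

lemma twl_zpow: "twl (zpow j) = j * twl z0"
  using power_walk(2)[OF z0(1)] power_walk(2)[OF walk_inv[OF z0(1)]] twl_inv[OF q0 z0(1)]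
  by (simp add: zpow_def)

lemma length_zpow: "int (length (zpow j)) = \<bar>j\<bar> * int (length z0)"
  using power_walk(3)[OF z0(1)] power_walk(3)[OF walk_inv[OF z0(1)]] by (simp add: zpow_def)

lemma walk_rho_q0: "walk base (rho q0) q0"
  by (rule walk_rho[OF q0])

lemma walk_zcl: "walk base (zcl j) base"
  unfolding zcl_def by (intro walk_appendI[OF walk_rho_q0] walk_appendI[OF walk_zpow] walk_inv walk_rho_q0)

lemma tw_zcl: "tw (zcl j) = j * twl z0"
  unfolding tw_closed_eq[OF walk_zcl]
  by (simp add: zcl_def twl_zpow twl_inv[OF base_verts walk_rho_q0])

lemma length_zcl: "int (length (zcl j)) = 2 * int (length (rho q0)) + \<bar>j\<bar> * int (length z0)"
  by (simp add: zcl_def length_zpow)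

lemma red_zpow_z0: "red q0 q0 (zpow i @ z0) (zpow (i + 1))"
proof (cases "i \<ge> 0")
  case True
  then show ?thesis using red_refl[OF q0_src walk_zpow[of "i + 1"]] by (simp add: zpow_add_1)
next
  case False
  have "red q0 q0 (inv_walk z0 @ inv_walk (inv_walk z0)) []"
    by (rule red_inv[OF walk_inv[OF z0(1)] q0_src])
  then have "red q0 q0 (zpow (i + 1) @ (inv_walk z0 @ z0)) (zpow (i + 1) @ [])"
    using inv_inv_walk[OF z0(1)] by (intro red_append_left[OF walk_zpow]) simp
  then show ?thesis using zpow_diff_1[of "i + 1"] False by simp
qed

lemma red_zpow_inv_z0: "red q0 q0 (zpow i @ inv_walk z0) (zpow (i - 1))"
proof (cases "i \<le> 0")
  case True
  then show ?thesis using red_refl[OF q0_src walk_zpow[of "i - 1"]] by (simp add: zpow_diff_1)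
next
  case False
  have "red q0 q0 (zpow (i - 1) @ (z0 @ inv_walk z0)) (zpow (i - 1) @ [])"
    by (rule red_append_left[OF walk_zpow red_inv[OF z0(1) q0_src]])
  then show ?thesis using zpow_add_1[of "i - 1"] False by simp
qed

text \<open>Opposite powers cancel and release their height as vertical space, so multiplying powers
  never requires additional space.\<close>

lemma red_zpow_add: "red q0 q0 (zpow i @ zpow j) (zpow (i + j))"
proof (induction j rule: int_induct[of _ 0])
  case base
  then show ?case using red_refl[OF q0_src walk_zpow[of i]] by (simp add: zpow_def)
next
  case (step1 j)
  have "red q0 q0 ((zpow i @ zpow j) @ z0) (zpow (i + j) @ z0)"
    by (rule red_append_right[OF step1(2) z0(1)])
  then show ?case using red_trans[OF _ red_zpow_z0[of "i + j"]] zpow_add_1[OF step1(1)]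
    by (simp add: algebra_simps)
next
  case (step2 j)
  have "red q0 q0 ((zpow i @ zpow j) @ inv_walk z0) (zpow (i + j) @ inv_walk z0)"
    by (rule red_append_right[OF step2(2) walk_inv[OF z0(1)]])
  then show ?case using red_trans[OF _ red_zpow_inv_z0[of "i + j"]] zpow_diff_1[OF step2(1)]
    by (simp add: algebra_simps)
qed

lemma red_zcl_add: "red base base (zcl i @ zcl j) (zcl (i + j))"
proof -
  let ?r = "rho q0" and ?r' = "inv_walk (rho q0)"
  have r': "walk q0 ?r' base" by (rule walk_inv[OF walk_rho_q0])
  have "red q0 q0 (?r' @ inv_walk ?r') []" by (rule red_inv[OF r' q0_src])
  then have "red q0 q0 (?r' @ ?r) []" using inv_inv_walk[OF walk_rho_q0] by simp
  from red_append_left[OF walk_zpow[of i] red_append_right[OF this walk_zpow[of j]]]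
  have "red q0 q0 (zpow i @ (?r' @ ?r) @ zpow j) (zpow i @ zpow j)" by simp
  then have "red q0 q0 (zpow i @ (?r' @ ?r) @ zpow j) (zpow (i + j))"
    using red_zpow_add red_trans by blast
  from red_append_left[OF walk_rho_q0 red_append_right[OF this r']]
  show ?thesis by (simp add: zcl_def)
qed

text \<open>The number of powers of \<open>z0\<close> to split off from \<open>g\<close>. If
  \<open>twl z0 = 0\<close>, division by zero yields 0 and no power is split off.\<close>

definition jof :: "'e list \<Rightarrow> int" where
  "jof g = tw g div twl z0"

text \<open>What remains after the power is removed, chosen from the class so that equivalent walks
  share it.\<close>

definition rep :: "'e list \<Rightarrow> 'e list" where
  "rep g = (SOME s. s \<in> key (zcl (- jof g) @ g))"

lemma rep_sim:
  assumes "walk base g base"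
  shows "sim base base (zcl (- jof g) @ g) (rep g)"
proof -
  have w: "walk base (zcl (- jof g) @ g) base" by (rule walk_appendI[OF walk_zcl assms])
  then have "zcl (- jof g) @ g \<in> key (zcl (- jof g) @ g)" using sim_refl by (auto simp: key_def)
  then have "rep g \<in> key (zcl (- jof g) @ g)" unfolding rep_def by (rule someI)
  then obtain p where "sim base p (zcl (- jof g) @ g) (rep g)" by (auto simp: key_def)
  then show ?thesis using sim_walk w walk_unique by blast
qed

lemma walk_rep: "walk base g base \<Longrightarrow> walk base (rep g) base"
  using rep_sim sim_walk by blast

lemma rep_cong:
  assumes "sim base base g g'"
  shows "jof g = jof g'" and "rep g = rep g'"
proof -
  have w: "walk base g base" using sim_walk[OF assms] by simp
  show j: "jof g = jof g'" using tw_sim[OF assms] by (simp add: jof_def)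
  have "sim base base (zcl (- jof g) @ g) (zcl (- jof g) @ g')"
    by (rule sim_append[OF sim_refl[OF walk_zcl] assms])
  then have "key (zcl (- jof g) @ g) = key (zcl (- jof g) @ g')"
    using key_eq_iff[OF walk_appendI[OF walk_zcl w]] by simp
  then show "rep g = rep g'" by (simp add: rep_def j)
qed

lemma sim_zcl_rep:
  assumes "walk base g base"
  shows "sim base base (zcl (jof g) @ rep g) g"
proof -
  have 1: "sim base base (zcl (jof g) @ rep g) (zcl (jof g) @ (zcl (- jof g) @ g))"
    by (rule sim_append[OF sim_refl[OF walk_zcl] sim_sym[OF rep_sim[OF assms]]])
  have "sim base base (zcl (jof g) @ zcl (- jof g)) (zcl (jof g + - jof g))"
    by (rule red_sim[OF red_zcl_add])
  moreover have "sim base base (zcl 0) []"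
    using sim_walk_inv[OF walk_rho_q0] by (simp add: zcl_def zpow_def)
  ultimately have "sim base base (zcl (jof g) @ zcl (- jof g)) []"
    using sim_trans by simp
  then have "sim base base ((zcl (jof g) @ zcl (- jof g)) @ g) ([] @ g)"
    by (rule sim_append[OF _ sim_refl[OF assms]])
  then show ?thesis using sim_trans[OF 1] by simp
qed

text \<open>The remainder has twist \<open>tw g mod twl z0\<close>, which is bounded; if
  \<open>twl z0 = 0\<close>, the maximality of the cycle bounds all twists of closed walks by
  \<open>C0\<close>. A finite kernel leaves finitely many classes of bounded twist.\<close>

lemma finite_reps:
  assumes "finite twist_free_classes"
  shows "finite (rep ` {g. walk base g base})"
proof (rule finite_subset)
  let ?X = "{x. walk base x base \<and> \<bar>tw x\<bar> \<le> twl z0 + C0}"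
  show "rep ` {g. walk base g base} \<subseteq> (\<lambda>h. SOME s. s \<in> h) ` key ` ?X"
  proof (rule image_subsetI)
    fix g assume "g \<in> {g. walk base g base}"
    then have g: "walk base g base" by simp
    let ?x = "zcl (- jof g) @ g"
    have x: "walk base ?x base" by (rule walk_appendI[OF walk_zcl g])
    have m: "tw ?x = tw g mod twl z0"
      using tw_append[OF walk_zcl g, of "- jof g"]
      by (simp add: tw_zcl jof_def minus_div_mult_eq_mod[symmetric])
    have "\<bar>tw ?x\<bar> \<le> twl z0 + C0"
    proof (cases "twl z0 = 0")
      case True
      have "\<bar>tw g\<bar> * 1 \<le> \<bar>tw g\<bar> * int (length z0)"
        using z0(2) by (intro mult_left_mono) (cases z0, auto)
      then show ?thesis using max_cycle[OF base_verts g] True tw_closed_eq[OF g] m by simp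
    next
      case False
      then have "twl z0 > 0" using twl_z0 by simp
      then have "0 \<le> tw g mod twl z0" "tw g mod twl z0 < twl z0" by auto
      then show ?thesis using m C0 by linarith
    qed
    then show "rep g \<in> (\<lambda>h. SOME s. s \<in> h) ` key ` ?X"
      unfolding rep_def using x by blast
  qed
  show "finite ((\<lambda>h. SOME s. s \<in> h) ` key ` ?X)"
    using finite_classes_bounded_twist[OF assms] by simp
qed

text \<open>Here the maximality of the cycle is decisive: up to a constant no walk gains more twist
  per height than \<open>z0\<close>, so the power carrying the twist of \<open>g\<close> is longer
  than \<open>g\<close> by a bounded amount at most.\<close>

lemma jof_bound:
  assumes "walk base g base"
  shows "\<bar>jof g\<bar> * int (length z0) \<le> int (length g) + C0 + int (length z0)"
proof (cases "twl z0 = 0")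
  case True
  then show ?thesis using C0 by (simp add: jof_def)
next
  case False
  define T L where "T = twl z0" and "L = int (length z0)"
  have T: "T \<ge> 1" using False twl_z0 by (simp add: T_def)
  have L: "L \<ge> 0" by (simp add: L_def)
  have "\<bar>jof g\<bar> * T \<le> \<bar>tw g\<bar> + T"
  proof -
    have "jof g * T = tw g - tw g mod T" by (simp add: jof_def T_def minus_mod_eq_div_mult)
    moreover have "0 \<le> tw g mod T" "tw g mod T < T" using T by auto
    ultimately have "\<bar>jof g * T\<bar> \<le> \<bar>tw g\<bar> + T" by linarith
    then show ?thesis using T by (simp add: abs_mult)
  qed
  then have "\<bar>jof g\<bar> * T * L \<le> (\<bar>tw g\<bar> + T) * L" using L by (rule mult_right_mono)
  also have "\<dots> \<le> T * int (length g) + C0 + T * L"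
    using max_cycle[OF base_verts assms] tw_closed_eq[OF assms] by (simp add: T_def L_def algebra_simps)
  also have "\<dots> \<le> T * int (length g) + T * C0 + T * L"
    using C0 T mult_right_mono[of 1 T C0] by simp
  finally have "T * (\<bar>jof g\<bar> * L) \<le> T * (int (length g) + C0 + L)" by (simp add: algebra_simps)
  then show ?thesis using T by (simp add: T_def L_def)
qed

lemma div_step_bound:
  fixes a b T :: int
  assumes "T \<ge> 0"
  shows "\<bar>(a + b) div T - a div T\<bar> \<le> \<bar>b\<bar> + 1"
proof (cases "T = 0")
  case False
  then have T: "T \<ge> 1" using assms by simp
  have "((a + b) div T - a div T) * T = b - ((a + b) mod T - a mod T)"
    by (simp add: left_diff_distrib minus_mod_eq_div_mult[symmetric])
  moreover have "0 \<le> a mod T" "a mod T < T" "0 \<le> (a + b) mod T" "(a + b) mod T < T" using T by auto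
  ultimately have "\<bar>((a + b) div T - a div T) * T\<bar> \<le> \<bar>b\<bar> + T" by linarith
  also have "\<bar>b\<bar> + T \<le> (\<bar>b\<bar> + 1) * T" using T mult_left_mono[of 1 T "\<bar>b\<bar>"] by (simp add: algebra_simps)
  finally have "\<bar>(a + b) div T - a div T\<bar> * T \<le> (\<bar>b\<bar> + 1) * T" using T by (simp add: abs_mult)
  then show ?thesis using T by simp
qed simp

text \<open>The walk is closed up along \<open>rho p\<close>, factored into a power of the cycle and
  a remainder, and then led back to \<open>p\<close>.\<close>

definition nf :: "'v \<Rightarrow> 'e list \<Rightarrow> 'e list" where
  "nf p w = (let g = w @ inv_walk (rho p) in zcl (jof g) @ rep g @ rho p)"

lemma nf_sim:
  assumes "walk base w p"
  shows "sim base p (nf p w) w"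
proof -
  have p: "p \<in> verts" using assms by (auto simp: verts_def)
  let ?g = "w @ inv_walk (rho p)"
  have r: "walk base (rho p) p" by (rule walk_rho[OF p])
  have g: "walk base ?g base" by (rule walk_appendI[OF assms walk_inv[OF r]])
  have "sim base p ((zcl (jof ?g) @ rep ?g) @ rho p) (?g @ rho p)"
    by (rule sim_append[OF sim_zcl_rep[OF g] sim_refl[OF r]])
  moreover have "sim base p (w @ (inv_walk (rho p) @ rho p)) (w @ [])"
    by (rule sim_append[OF sim_refl[OF assms] sim_inv_walk[OF r]])
  ultimately have "sim base p ((zcl (jof ?g) @ rep ?g) @ rho p) w"
    using sim_trans[of base p "(zcl (jof ?g) @ rep ?g) @ rho p" "?g @ rho p" w] by simp
  then show ?thesis by (simp add: nf_def Let_def)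
qed

text \<open>Induction along the walk, with the same \<open>K\<close> at every stage. Once a prefix
  is in normal form, appending an edge amounts to one of finitely many rewritings near the end, of
  cost at most \<open>B\<close>. As normal forms exceed their walks by at most \<open>K0\<close>,
  comparing lengths shows that this much space is available again.\<close>

lemma uniform_red:
  assumes fin: "finite twist_free_classes"
  shows "\<exists>K. \<forall>w p. walk base w p \<longrightarrow> red base p (w @ sp p K) (nf p w)"
proof -
  define R where "R = rep ` {g. walk base g base}"
  have finR: "finite R" unfolding R_def by (rule finite_reps[OF fin])
  have walkR: "walk base r base" if "r \<in> R" for r using that walk_rep by (auto simp: R_def)
  \<comment> \<open>An edge changes the exponent of the cycle by at most this amount.\<close>
  define I where "I = (\<Sum>e\<in>E. \<bar>tw_edge e\<bar>) + 1"
  have I: "\<bar>tw_edge e\<bar> + 1 \<le> I" if "e \<in> E" for e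
    unfolding I_def using member_le_sum[of e E "\<lambda>e. \<bar>tw_edge e\<bar>"] that finite_edges by auto
  define x where "x r e = r @ rho (src e) @ [e]" for r e
  define y where "y i r e = zcl i @ r @ rho (tgt e)" for i r e
  define Idx where "Idx = R \<times> R \<times> E \<times> {-I..I}"
  have finI: "finite Idx" using finR finite_edges by (simp add: Idx_def)
  define a where "a = (\<lambda>(r, r', e, i). SOME a. red base (tgt e) (x r e @ sp (tgt e) a) (y i r' e))"
  define B where "B = (\<Sum>z\<in>Idx. a z)"
  have B: "red base (tgt e) (x r e @ sp (tgt e) B) (y i r' e)"
    if "r \<in> R" "r' \<in> R" "e \<in> E" "\<bar>i\<bar> \<le> I" and s: "sim base (tgt e) (x r e) (y i r' e)" for r r' e i
  proof -
    have "\<exists>a. red base (tgt e) (x r e @ sp (tgt e) a) (y i r' e)"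
      using sim_red[OF src_tgt[OF that(3)]] s by blast
    then have "red base (tgt e) (x r e @ sp (tgt e) (a (r, r', e, i))) (y i r' e)"
      unfolding a_def prod.case by (rule someI_ex)
    moreover have "a (r, r', e, i) \<le> B"
      unfolding B_def using that finI by (intro member_le_sum) (auto simp: Idx_def)
    ultimately show ?thesis using red_sp_mono sim_walk[OF s] by blast
  qed
  define Lr where "Lr = (\<Sum>r\<in>R. length r)"
  define Lp where "Lp = (\<Sum>p\<in>verts. length (rho p))"
  have Lr: "length r \<le> Lr" if "r \<in> R" for r
    unfolding Lr_def using that finR by (intro member_le_sum) auto
  have Lp: "length (rho p) \<le> Lp" if "p \<in> verts" for p
    unfolding Lp_def using that finite_verts by (intro member_le_sum) auto
  define K0 where "K0 = 2 * length (rho q0) + Lp + nat C0 + length z0 + Lr + Lp"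
  have len: "length (nf p w) \<le> length w + K0" if w: "walk base w p" for w p
  proof -
    have p: "p \<in> verts" using w by (auto simp: verts_def)
    let ?g = "w @ inv_walk (rho p)"
    have g: "walk base ?g base" by (rule walk_appendI[OF w walk_inv[OF walk_rho[OF p]]])
    have "int (length (nf p w)) = 2 * int (length (rho q0)) + \<bar>jof ?g\<bar> * int (length z0)
        + int (length (rep ?g)) + int (length (rho p))"
      by (simp add: nf_def Let_def length_zcl)
    also have "\<dots> \<le> 2 * int (length (rho q0)) + (int (length w) + int Lp + C0 + int (length z0)) + int Lr + int Lp"
      using jof_bound[OF g] Lr[of "rep ?g"] Lp[OF p] g by (simp add: R_def)
    finally show ?thesis using C0 by (simp add: K0_def)
  qed
  have "sim base base [] (nf base [])" using sim_sym[OF nf_sim[of "[]" base]] by simp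
  then obtain K1 where K1: "red base base ([] @ sp base K1) (nf base [])"
    using sim_red[OF base_src] by blast
  \<comment> \<open>\<open>K0\<close> pays for the excess length of a normal form, \<open>B\<close>
    for one local rewriting, and \<open>K1\<close> for the empty walk.\<close>
  define K where "K = K0 + B + K1"
  have "red base p (w @ sp p K) (nf p w)" if "walk base w p" for w p
    using that
  proof (induction w arbitrary: p rule: rev_induct)
    case Nil
    then have "p = base" by simp
    then show ?case using red_sp_mono[OF K1, of K] by (simp add: K_def)
  next
    case (snoc e w)
    then have e: "e \<in> E" "tgt e = p" and w: "walk base w (src e)" by (auto simp: walk_append)
    let ?s = "src e"
    have v: "?s \<in> verts" "p \<in> verts" using w snoc.prems by (auto simp: verts_def)
    have we: "walk ?s [e] p" using e by simp
    let ?g = "w @ inv_walk (rho ?s)" and ?g' = "(w @ [e]) @ inv_walk (rho p)"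
    have g: "walk base ?g base" by (rule walk_appendI[OF w walk_inv[OF walk_rho[OF v(1)]]])
    have g': "walk base ?g' base" by (rule walk_appendI[OF snoc.prems walk_inv[OF walk_rho[OF v(2)]]])
    have tg: "tw ?g = twl w" using tw_eq_twl[OF base_verts w] by simp
    have tg': "tw ?g' = twl w + tw_edge e"
      using tw_eq_twl[OF base_verts snoc.prems] by (simp add: twl_def)
    define i where "i = jof ?g' - jof ?g"
    have "\<bar>i\<bar> \<le> I"
      using div_step_bound[OF twl_z0, of "twl w" "tw_edge e"] I[OF e(1)]
      unfolding i_def jof_def tg tg' by linarith
    have R: "rep ?g \<in> R" "rep ?g' \<in> R" using g g' by (auto simp: R_def)
    let ?x = "x (rep ?g) e" and ?y = "y i (rep ?g') e"
    have nfx: "nf ?s w @ [e] = zcl (jof ?g) @ ?x" by (simp add: nf_def x_def Let_def)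
    have wx: "walk base ?x p"
      unfolding x_def by (intro walk_appendI[OF walk_rep[OF g]] walk_appendI[OF walk_rho[OF v(1)] we])
    have wy0: "walk base (rep ?g' @ rho p) p" by (rule walk_appendI[OF walk_rep[OF g'] walk_rho[OF v(2)]])
    have wy: "walk base ?y p"
      unfolding y_def e(2) by (rule walk_appendI[OF walk_zcl wy0])
    have redy: "red base p (zcl (jof ?g) @ ?y) (nf p (w @ [e]))"
    proof -
      have "red base p ((zcl (jof ?g) @ zcl i) @ (rep ?g' @ rho p)) (zcl (jof ?g + i) @ (rep ?g' @ rho p))"
        by (rule red_append_right[OF red_zcl_add wy0])
      then show ?thesis by (simp add: y_def nf_def Let_def e(2) i_def)
    qed
    have "sim base p (zcl (jof ?g) @ ?x) (w @ [e])"
      unfolding nfx[symmetric] by (rule sim_append[OF nf_sim[OF w] sim_refl[OF we]])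
    moreover have "sim base p (zcl (jof ?g) @ ?y) (w @ [e])"
      using red_sim[OF redy] nf_sim[OF snoc.prems] sim_trans by blast
    ultimately have "sim base p (zcl (jof ?g) @ ?x) (zcl (jof ?g) @ ?y)"
      using sim_sym sim_trans by blast
    then have "sim base p ?x ?y" using sim_left_iff[OF walk_zcl wx wy] by simp
    then have redx: "red base p (?x @ sp p B) ?y"
      using B[OF R e(1) \<open>\<bar>i\<bar> \<le> I\<close>] e(2) by simp
    obtain c where c: "eqv base ?s (w @ sp ?s K) (nf ?s w @ sp ?s c)"
      using snoc.IH[OF w] unfolding red_def by blast
    \<comment> \<open>Flips preserve length, which determines the space \<open>c\<close> left beside
      the normal form.\<close>
    have "length w + 2 * K = length (nf ?s w) + 2 * c" using eqv_walk[OF c] by simp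
    then have cB: "c \<ge> B" using len[OF w] by (simp add: K_def)
    have p: "p \<in> src ` E" and s: "?s \<in> src ` E" using verts_src v by auto
    have r1: "red base p ((w @ [e]) @ sp p K) ((w @ sp ?s K) @ [e])"
      using red_append_left[OF w red_eqv[OF s eqv_sym[OF sp_rotate[OF we s, of K]]]] by simp
    have r2: "red base p ((w @ sp ?s K) @ [e]) ((nf ?s w @ sp ?s c) @ [e])"
      by (rule red_append_right[OF red_eqv[OF base_src c] we])
    have wn: "walk base (nf ?s w) ?s" using sim_walk[OF nf_sim[OF w]] by simp
    have r3: "red base p ((nf ?s w @ sp ?s c) @ [e]) (nf ?s w @ ([e] @ sp p c))"
      using red_append_left[OF wn red_eqv[OF s sp_rotate[OF we s, of c]]] by simp
    have eq: "nf ?s w @ ([e] @ sp p c) = (zcl (jof ?g) @ (?x @ sp p B)) @ sp p (c - B)"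
      using nfx sp_add[of p B "c - B"] cB by simp
    have r4: "red base p ((zcl (jof ?g) @ (?x @ sp p B)) @ sp p (c - B)) (zcl (jof ?g) @ (?x @ sp p B))"
      by (rule red_sp[OF base_src walk_appendI[OF walk_zcl red_walk(1)[OF redx]]])
    have r5: "red base p (zcl (jof ?g) @ (?x @ sp p B)) (zcl (jof ?g) @ ?y)"
      by (rule red_append_left[OF walk_zcl redx])
    show ?case
      by (rule red_trans[OF r1 red_trans[OF r2 red_trans[OF r3[unfolded eq] red_trans[OF r4 red_trans[OF r5 redy]]]]])
  qed
  then show ?thesis by blast
qed

text \<open>Equivalent walks have the same normal form, and equal lengths force equal amounts of
  space left beside it.\<close>

lemma uniform_eqv_cycle:
  assumes fin: "finite twist_free_classes"
  shows "\<exists>K. \<forall>w w'. sim base base w w' \<longrightarrow> length w = length w' \<longrightarrow> eqv base base (w @ sp base K) (w' @ sp base K)"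
proof -
  obtain K where K: "\<And>w p. walk base w p \<Longrightarrow> red base p (w @ sp p K) (nf p w)"
    using uniform_red[OF fin] by blast
  have "eqv base base (w @ sp base K) (w' @ sp base K)"
    if s: "sim base base w w'" and l: "length w = length w'" for w w'
  proof -
    have "nf base w = nf base w'" using rep_cong[OF s] by (simp add: nf_def Let_def)
    then obtain c c' where c: "eqv base base (w @ sp base K) (nf base w @ sp base c)"
      "eqv base base (w' @ sp base K) (nf base w @ sp base c')"
      using K[of w base] K[of w' base] sim_walk[OF s] unfolding red_def by metis
    have "c = c'" using eqv_walk[OF c(1)] eqv_walk[OF c(2)] l by simp
    then show ?thesis using c eqv_sym eqv_trans by blast
  qed
  then show ?thesis by blast
qed

end

context twisted_flip_graph
begin

lemma uniform_eqv:
  assumes "finite twist_free_classes"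
  shows "\<exists>K. \<forall>w w'. sim base base w w' \<longrightarrow> length w = length w' \<longrightarrow> eqv base base (w @ sp base K) (w' @ sp base K)"
proof -
  obtain q z C where "q \<in> verts" "walk q z q" "z \<noteq> []" "twl z \<ge> 0" "C \<ge> 0"
    "\<forall>p w r. p \<in> verts \<longrightarrow> walk p w r \<longrightarrow> \<bar>twl w\<bar> * int (length z) \<le> twl z * int (length w) + C"
    using ex_max_cycle by blast
  then interpret cycle_flip_graph E src tgt opp base spacer eqv tw q z C
    by unfold_locales auto
  show ?thesis by (rule uniform_eqv_cycle[OF assms])
qed

end

section \<open>From equivalence with added space to flips alone\<close>

context twisted_flip_graph
begin

definition eqv_pairs :: "nat \<Rightarrow> real" where
  "eqv_pairs n = real (card {(w, w'). w \<in> walks n base base \<and> w' \<in> walks n base base \<and> eqv base base w w'})"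

text \<open>The walks that do not visibly contain the space which joining equivalent walks by flips
  may require.\<close>

definition cramped :: "nat \<Rightarrow> nat \<Rightarrow> 'v \<Rightarrow> 'e list set" where
  "cramped K n p = {w \<in> walks n base p. \<nexists>u v. w = u @ sp base K @ v \<and> walk base u base \<and> walk base v p}"

lemma finite_cramped: "finite (cramped K n p)"
  by (rule finite_subset[OF _ finite_walks[of n base p]]) (auto simp: cramped_def)

text \<open>Spacers at the base pad walks of even length to a common length.\<close>

lemma ex_long_walks:
  "\<exists>l g. \<forall>p\<in>verts. walk base (g p) p \<and> length (g p) = l"
proof -
  obtain s k where sk: "\<And>p. p \<in> verts \<Longrightarrow> walk base (s p) p \<and> length (s p) = 2 * k p"
    using even_walk_to_base by metis
  define m where "m = (\<Sum>p\<in>verts. k p)"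
  have m: "k p \<le> m" if "p \<in> verts" for p
    unfolding m_def using that finite_verts by (intro member_le_sum) auto
  have "walk base (sp base (m - k p) @ s p) p \<and> length (sp base (m - k p) @ s p) = 2 * m"
    if "p \<in> verts" for p
    using sk[OF that] m[OF that] walk_appendI[OF walk_sp[OF base_src]] by simp
  then show ?thesis by (intro exI[of _ "2 * m"] exI[of _ "\<lambda>p. sp base (m - k p) @ s p"]) blast
qed

lemma card_walks_add:
  "card (walks (n + l) base p') = (\<Sum>p\<in>verts. card (walks n base p) * card (walks l p p'))"
proof -
  let ?U = "\<lambda>p. (\<lambda>(u, v). u @ v) ` (walks n base p \<times> walks l p p')"
  have eq: "walks (n + l) base p' = (\<Union>p\<in>verts. ?U p)"
  proof (intro equalityI subsetI)
    fix w assume w: "w \<in> walks (n + l) base p'"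
    then have l: "length w = n + l" and "walk base (take n w @ drop n w) p'" by (auto simp: walks_def)
    then obtain p where p: "walk base (take n w) p" "walk p (drop n w) p'"
      unfolding walk_append by blast
    have "w = (\<lambda>(u, v). u @ v) (take n w, drop n w)" by simp
    moreover have "(take n w, drop n w) \<in> walks n base p \<times> walks l p p'"
      using p l by (auto simp: walks_def)
    ultimately have "w \<in> ?U p" by (rule image_eqI)
    moreover have "p \<in> verts" using p by (auto simp: verts_def)
    ultimately show "w \<in> (\<Union>p\<in>verts. ?U p)" by (rule UN_I[rotated])
  qed (auto simp: walks_def intro: walk_appendI)
  have disj: "?U p \<inter> ?U q = {}" if "p \<noteq> q" for p q
  proof (rule ccontr)
    assume "?U p \<inter> ?U q \<noteq> {}"
    then obtain u v u' v' where "u @ v = u' @ v'" "u \<in> walks n base p" "u' \<in> walks n base q" by auto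
    then have "u = u'" "walk base u p" "walk base u' q" by (auto simp: walks_def)
    then show False using that walk_unique by blast
  qed
  have "card (\<Union>p\<in>verts. ?U p) = (\<Sum>p\<in>verts. card (?U p))"
    by (rule card_UN_disjoint) (use disj finite_verts in \<open>auto simp: finite_walks\<close>)
  also have "\<dots> = (\<Sum>p\<in>verts. card (walks n base p \<times> walks l p p'))"
    by (intro sum.cong refl card_image) (auto simp: inj_on_def walks_def)
  finally show ?thesis by (simp add: eq card_cartesian_product)
qed

text \<open>A stretch of fixed length \<open>L\<close> between any two reachable vertices contains the spacer
  block with probability bounded below.\<close>

lemma cramped_decay:
  "\<exists>L>0. \<exists>\<beta>. 0 < \<beta> \<and> \<beta> < 1 \<and> (\<forall>n. real (card (cramped K n base)) \<le> \<beta> ^ (n div L) * walk_count n base)"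
proof -
  obtain l g where g: "\<And>p. p \<in> verts \<Longrightarrow> walk base (g p) p \<and> length (g p) = l"
    using ex_long_walks by blast
  define L where "L = l + 2 * K + l"
  define blk where "blk p p' = inv_walk (g p) @ sp base K @ g p'" for p p'
  have blk: "blk p p' \<in> walks L p p'" if "p \<in> verts" "p' \<in> verts" for p p'
    using g[OF that(1)] g[OF that(2)] walk_sp[OF base_src, of K]
    by (auto simp: blk_def walks_def L_def intro!: walk_appendI walk_inv)
  define M where "M = card {w. set w \<subseteq> E \<and> length w = L} + 1"
  have M: "card (walks L p p') \<le> M" for p p'
  proof -
    have "card (walks L p p') \<le> card {w. set w \<subseteq> E \<and> length w = L}"
      using walk_edges by (intro card_mono finite_lists_length_eq finite_edges) (auto simp: walks_def)
    then show ?thesis by (simp add: M_def)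
  qed
  \<comment> \<open>Of at most \<open>M\<close> continuations one is excluded, which lowers their
    number at least by the factor \<beta>.\<close>
  define \<beta> where "\<beta> = 1 - 1 / (real M + 1)"
  have \<beta>: "0 < \<beta>" "\<beta> < 1" by (auto simp: \<beta>_def M_def)
  have step: "real (card (cramped K (n + L) p')) \<le> \<theta> * \<beta> * real (card (walks (n + L) base p'))"
    if p': "p' \<in> verts" and \<theta>: "\<theta> \<ge> 0" and
      IH: "\<And>p. p \<in> verts \<Longrightarrow> real (card (cramped K n p)) \<le> \<theta> * real (card (walks n base p))" for n p' \<theta>
  proof -
    let ?U = "\<lambda>p. (\<lambda>(u, v). u @ v) ` (cramped K n p \<times> (walks L p p' - {blk p p'}))"
    have "cramped K (n + L) p' \<subseteq> (\<Union>p\<in>verts. ?U p)"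
    proof
      fix w assume w: "w \<in> cramped K (n + L) p'"
      then have lw: "length w = n + L" and "walk base (take n w @ drop n w) p'"
        by (auto simp: walks_def cramped_def)
      then obtain p where p: "walk base (take n w) p" "walk p (drop n w) p'"
        unfolding walk_append by blast
      have pv: "p \<in> verts" using p by (auto simp: verts_def)
      have no: "w \<noteq> u @ sp base K @ v" if "walk base u base" "walk base v p'" for u v
        using w that by (auto simp: cramped_def)
      have "take n w \<in> cramped K n p"
      proof -
        have False if u: "take n w = u @ sp base K @ v" "walk base u base" "walk base v p" for u v
          using no[OF u(2) walk_appendI[OF u(3) p(2)]] u(1) append_take_drop_id[of n w] by simp
        then show ?thesis using p lw by (auto simp: cramped_def walks_def)
      qed
      moreover have "drop n w \<noteq> blk p p'"
      proof
        assume "drop n w = blk p p'"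
        then have "w = (take n w @ inv_walk (g p)) @ sp base K @ g p'"
          using append_take_drop_id[of n w] by (simp add: blk_def)
        moreover have "walk base (take n w @ inv_walk (g p)) base"
          using g[OF pv] by (intro walk_appendI[OF p(1)] walk_inv) simp
        ultimately show False using no g[OF p'] by blast
      qed
      moreover have "drop n w \<in> walks L p p'" using p lw by (auto simp: walks_def)
      ultimately have "(take n w, drop n w) \<in> cramped K n p \<times> (walks L p p' - {blk p p'})" by simp
      then have "w \<in> ?U p" by (rule image_eqI[rotated]) simp
      then show "w \<in> (\<Union>p\<in>verts. ?U p)" using pv by blast
    qed
    then have "card (cramped K (n + L) p') \<le> card (\<Union>p\<in>verts. ?U p)"
      by (intro card_mono) (auto simp: finite_verts finite_walks finite_cramped)
    also have "\<dots> \<le> (\<Sum>p\<in>verts. card (?U p))" by (rule card_UN_le[OF finite_verts])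
    also have "\<dots> \<le> (\<Sum>p\<in>verts. card (cramped K n p) * (card (walks L p p') - 1))"
    proof (rule sum_mono)
      fix p assume p: "p \<in> verts"
      have "card (?U p) \<le> card (cramped K n p \<times> (walks L p p' - {blk p p'}))"
        by (rule card_image_le) (simp add: finite_walks finite_cramped)
      also have "\<dots> = card (cramped K n p) * (card (walks L p p') - 1)"
        using blk[OF p p'] by (simp add: card_cartesian_product)
      finally show "card (?U p) \<le> card (cramped K n p) * (card (walks L p p') - 1)" .
    qed
    finally have "real (card (cramped K (n + L) p'))
        \<le> (\<Sum>p\<in>verts. real (card (cramped K n p)) * real (card (walks L p p') - 1))"
      using of_nat_mono by fastforce
    also have "\<dots> \<le> (\<Sum>p\<in>verts. (\<theta> * real (card (walks n base p))) * (\<beta> * real (card (walks L p p'))))"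
    proof (intro sum_mono mult_mono IH)
      fix p assume p: "p \<in> verts"
      have c: "card (walks L p p') \<ge> 1"
        using blk[OF p p'] finite_walks by (metis One_nat_def Suc_leI card_gt_0_iff empty_iff)
      have "real (card (walks L p p')) / (real M + 1) \<le> 1" using M[of p p'] by simp
      then show "real (card (walks L p p') - 1) \<le> \<beta> * real (card (walks L p p'))"
        using c by (simp add: \<beta>_def algebra_simps of_nat_diff)
    qed (use \<theta> \<beta> in auto)
    also have "\<dots> = \<theta> * \<beta> * real (card (walks (n + L) base p'))"
      unfolding card_walks_add of_nat_sum sum_distrib_left by (simp add: mult_ac)
    finally show ?thesis .
  qed
  have iter: "real (card (cramped K (r + m * L) p)) \<le> \<beta> ^ m * real (card (walks (r + m * L) base p))"
    if "p \<in> verts" for r m p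
    using that
  proof (induction m arbitrary: p)
    case 0
    then show ?case using card_mono[OF finite_walks, of "cramped K r p" r base p] by (auto simp: cramped_def)
  next
    case (Suc m)
    have "real (card (cramped K (r + m * L + L) p)) \<le> \<beta> ^ m * \<beta> * real (card (walks (r + m * L + L) base p))"
      by (rule step[OF Suc.prems _ Suc.IH]) (use \<beta> in auto)
    moreover have "r + m * L + L = r + Suc m * L" by simp
    ultimately show ?case by (simp only: power_Suc2)
  qed
  \<comment> \<open>\<open>L\<close> may be 0 while a positive period is claimed, so the blocks are
    counted with \<open>Suc L\<close>.\<close>
  have "real (card (cramped K n base)) \<le> \<beta> ^ (n div (Suc L)) * walk_count n base" for n
  proof -
    have d: "n div Suc L * L \<le> n" using div_times_less_eq_dividend[of n "Suc L"] by (metis le_trans mult_le_mono2 le_SucI order_refl)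
    show ?thesis using iter[OF base_verts, of "n - n div Suc L * L" "n div Suc L"] d by (simp add: walk_count_def)
  qed
  then show ?thesis using \<beta> by (intro exI[of _ "Suc L"]) auto
qed

lemma eqv_sim: "eqv base base w w' \<Longrightarrow> sim base base w w'"
  by (rule red_sim[OF red_eqv[OF base_src]])

lemma eqv_pairs_le: "eqv_pairs n \<le> ret_at n base"
proof -
  have "{(w, w'). w \<in> walks n base base \<and> w' \<in> walks n base base \<and> eqv base base w w'}
    \<subseteq> {(w, w'). w \<in> walks n base base \<and> w' \<in> walks n base base \<and> key w = key w'}"
  proof clarify
    fix w w' assume "w \<in> walks n base base" "eqv base base w w'"
    then show "key w = key w'" using eqv_sim key_eq_iff[of w base w'] by (simp add: walks_def)
  qed
  moreover have "finite {(w, w'). w \<in> walks n base base \<and> w' \<in> walks n base base \<and> key w = key w'}"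
    by (rule finite_subset[of _ "walks n base base \<times> walks n base base"]) (auto simp: finite_walks)
  ultimately show ?thesis unfolding eqv_pairs_def ret_at_def of_nat_le_iff by (intro card_mono)
qed

lemma roomy_walk:
  assumes "w = u @ sp base K @ v" "walk base u base" "walk base v base"
  shows "eqv base base w ((u @ v) @ sp base K)"
proof -
  have "eqv base base (u @ (sp base K @ v)) (u @ (v @ sp base K))"
    by (rule eqv_append[OF eqv_refl[OF assms(2)] sp_rotate[OF assms(3) base_src]])
  then show ?thesis using assms(1) by simp
qed

text \<open>In both walks the block of \<open>K\<close> spacers slides to the end. What precedes it
  is equivalent and of equal length, so the block is sufficient space for the flips.\<close>

lemma eqv_of_sim_roomy:
  assumes K: "\<And>w w'. sim base base w w' \<Longrightarrow> length w = length w' \<Longrightarrow> eqv base base (w @ sp base K) (w' @ sp base K)"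
    and w: "w \<in> walks n base base - cramped K n base" and w': "w' \<in> walks n base base - cramped K n base"
    and s: "sim base base w w'"
  shows "eqv base base w w'"
proof -
  obtain u v where uv: "w = u @ sp base K @ v" "walk base u base" "walk base v base"
    using w by (auto simp: cramped_def)
  obtain u' v' where uv': "w' = u' @ sp base K @ v'" "walk base u' base" "walk base v' base"
    using w' by (auto simp: cramped_def)
  have e: "eqv base base w ((u @ v) @ sp base K)" by (rule roomy_walk[OF uv])
  have e': "eqv base base w' ((u' @ v') @ sp base K)" by (rule roomy_walk[OF uv'])
  have "sim base base w (u @ v)"
    by (rule red_sim) (use e base_src in \<open>auto simp: red_def\<close>)
  moreover have "sim base base w' (u' @ v')"
    by (rule red_sim) (use e' base_src in \<open>auto simp: red_def\<close>)
  ultimately have "sim base base (u @ v) (u' @ v')" using s sim_sym sim_trans by blast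
  moreover have "length (u @ v) = length (u' @ v')" using w w' uv(1) uv'(1) by (auto simp: walks_def)
  ultimately have "eqv base base ((u @ v) @ sp base K) ((u' @ v') @ sp base K)" by (rule K)
  then show ?thesis using eqv_trans[OF e] eqv_trans[OF _ eqv_sym[OF e']] by blast
qed

text \<open>An equivalent pair of closed walks that flips do not join has a cramped member.\<close>

lemma ret_at_minus_eqv_pairs:
  assumes K: "\<And>w w'. sim base base w w' \<Longrightarrow> length w = length w' \<Longrightarrow> eqv base base (w @ sp base K) (w' @ sp base K)"
  shows "ret_at n base - eqv_pairs n \<le> 2 * real (card (cramped K n base)) * walk_count n base"
proof -
  let ?W = "walks n base base" and ?B = "cramped K n base"
  let ?S = "{(w, w'). w \<in> ?W \<and> w' \<in> ?W \<and> key w = key w'}"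
  let ?T = "{(w, w'). w \<in> ?W \<and> w' \<in> ?W \<and> eqv base base w w'}"
  have "?S \<subseteq> ?T \<union> (?B \<times> ?W \<union> ?W \<times> ?B)"
  proof (rule subsetI)
    fix z assume "z \<in> ?S"
    then obtain w w' where z: "z = (w, w')" and w: "w \<in> ?W" "w' \<in> ?W" and k: "key w = key w'" by blast
    have s: "sim base base w w'" using w k key_eq_iff[of w base w'] by (simp add: walks_def)
    show "z \<in> ?T \<union> (?B \<times> ?W \<union> ?W \<times> ?B)"
    proof (cases "w \<in> ?B \<or> w' \<in> ?B")
      case False
      then have "eqv base base w w'" using eqv_of_sim_roomy[OF K _ _ s] w by blast
      then show ?thesis using w z by blast
    qed (use w z in blast)
  qed
  moreover have finT: "finite ?T" by (rule finite_subset[of _ "?W \<times> ?W"]) (auto simp: finite_walks)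
  ultimately have "card ?S \<le> card (?T \<union> (?B \<times> ?W \<union> ?W \<times> ?B))"
    by (intro card_mono) (simp_all add: finite_walks finite_cramped)
  also have "\<dots> \<le> card ?T + (card (?B \<times> ?W) + card (?W \<times> ?B))"
    by (rule card_Un_le[THEN order_trans]) (intro add_left_mono card_Un_le)
  finally have "card ?S \<le> card ?T + 2 * card ?B * card ?W" by (simp add: card_cartesian_product algebra_simps)
  then have "real (card ?S) \<le> real (card ?T + 2 * card ?B * card ?W)" by (simp only: of_nat_le_iff)
  then have "real (card ?S) \<le> real (card ?T) + 2 * real (card ?B) * real (card ?W)" by simp
  then show ?thesis unfolding ret_at_def eqv_pairs_def walk_count_def by linarith
qed

text \<open>The pairs lost for lack of space are an exponentially small part of all pairs, while
  \<open>equal_twist\<close> falls short of all pairs by a linear factor at most. For an infinite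
  kernel \<open>eqv_pairs_le\<close> is enough.\<close>

theorem eqv_pairs_over_equal_twist:
  "(\<lambda>n. eqv_pairs n / equal_twist n) \<longlonglongrightarrow>
     (if finite twist_free_classes then 1 / real (card twist_free_classes) else 0)"
proof (cases "finite twist_free_classes")
  case False
  then have lim: "(\<lambda>n. ret_at n base / equal_twist n) \<longlonglongrightarrow> 0" using ret_at_over_equal_twist by simp
  have "(\<lambda>n. eqv_pairs n / equal_twist n) \<longlonglongrightarrow> 0"
  proof (rule tendsto_sandwich[of "\<lambda>_. 0" _ _ "\<lambda>n. ret_at n base / equal_twist n"])
    show "\<forall>\<^sub>F n in sequentially. 0 \<le> eqv_pairs n / equal_twist n"
      by (simp add: eqv_pairs_def equal_twist_def)
    show "\<forall>\<^sub>F n in sequentially. eqv_pairs n / equal_twist n \<le> ret_at n base / equal_twist n"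
      using eqv_pairs_le by (intro always_eventually allI divide_right_mono) (auto simp: equal_twist_def)
  qed (use lim in simp_all)
  then show ?thesis using False by simp
next
  case True
  obtain K where K: "\<And>w w'. sim base base w w' \<Longrightarrow> length w = length w' \<Longrightarrow>
      eqv base base (w @ sp base K) (w' @ sp base K)"
    using uniform_eqv[OF True] by blast
  obtain L \<beta> where L: "L > 0" and \<beta>: "0 < \<beta>" "\<beta> < 1"
    and dec: "\<And>n. real (card (cramped K n base)) \<le> \<beta> ^ (n div L) * walk_count n base"
    using cramped_decay by blast
  obtain C where C: "C \<ge> 0" "\<And>n. (walk_count n base)\<^sup>2 \<le> (C * real n + 1) * equal_twist n"
    using equal_twist_lower by blast
  obtain N where N: "\<And>n. n \<ge> N \<Longrightarrow> walk_count n base > 0" using walk_count_eventually_pos by blast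
  let ?h = "\<lambda>m. 2 * (C * real L * (real m * \<beta> ^ m) + (C * real L + 1) * \<beta> ^ m)"
  have bound: "(ret_at n base - eqv_pairs n) / equal_twist n \<le> ?h (n div L)" if n: "n \<ge> N" for n
  proof -
    let ?m = "n div L"
    have e: "equal_twist n > 0" by (rule equal_twist_pos[OF N[OF n]])
    have "ret_at n base - eqv_pairs n \<le> 2 * real (card (cramped K n base)) * walk_count n base"
      by (rule ret_at_minus_eqv_pairs[OF K])
    also have "\<dots> \<le> 2 * (\<beta> ^ ?m * walk_count n base) * walk_count n base"
      using dec[of n] walk_count_nonneg[of n base] by (intro mult_right_mono) auto
    also have "\<dots> = 2 * \<beta> ^ ?m * (walk_count n base)\<^sup>2" by (simp add: power2_eq_square)
    also have "\<dots> \<le> 2 * \<beta> ^ ?m * ((C * real n + 1) * equal_twist n)"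
      using C(2)[of n] \<beta> by (intro mult_left_mono) auto
    finally have "(ret_at n base - eqv_pairs n) / equal_twist n \<le> 2 * \<beta> ^ ?m * (C * real n + 1)"
      using e by (simp add: field_simps)
    also have "\<dots> \<le> 2 * \<beta> ^ ?m * (C * (real L * real ?m + real L) + 1)"
    proof -
      have "n = L * ?m + n mod L" by simp
      then have "n \<le> L * ?m + L" using mod_less_divisor[OF L, of n] by linarith
      then have "real n \<le> real (L * ?m + L)" by (simp only: of_nat_le_iff)
      then show ?thesis using C(1) \<beta> by (intro mult_left_mono add_mono) auto
    qed
    also have "\<dots> = ?h ?m" by (simp add: algebra_simps)
    finally show ?thesis .
  qed
  have "norm \<beta> < 1" using \<beta> by simp
  then have "?h \<longlonglongrightarrow> 2 * (C * real L * 0 + (C * real L + 1) * 0)"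
    by (intro tendsto_intros powser_times_n_limit_0 LIMSEQ_power_zero)
  then have h: "?h \<longlonglongrightarrow> 0" by simp
  have "filterlim (\<lambda>n. n div L) at_top sequentially"
    unfolding filterlim_at_top eventually_sequentially
  proof
    fix Z
    have "Z \<le> n div L" if "n \<ge> Z * L" for n
      using div_le_mono[OF that, of L] L by simp
    then show "\<exists>N. \<forall>n\<ge>N. Z \<le> n div L" by blast
  qed
  from filterlim_compose[OF h this] have hlim: "(\<lambda>n. ?h (n div L)) \<longlonglongrightarrow> 0" .
  have "(\<lambda>n. (ret_at n base - eqv_pairs n) / equal_twist n) \<longlonglongrightarrow> 0"
  proof (rule tendsto_sandwich[of "\<lambda>_. 0" _ _ "\<lambda>n. ?h (n div L)"])
    show "\<forall>\<^sub>F n in sequentially. 0 \<le> (ret_at n base - eqv_pairs n) / equal_twist n"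
      using eqv_pairs_le by (simp add: equal_twist_def)
    show "\<forall>\<^sub>F n in sequentially. (ret_at n base - eqv_pairs n) / equal_twist n \<le> ?h (n div L)"
      unfolding eventually_sequentially using bound by blast
  qed (use hlim in simp_all)
  from tendsto_diff[OF ret_at_over_equal_twist this] show ?thesis
    by (simp add: diff_divide_distrib)
qed

end

section \<open>Unit cubes and dominoes\<close>
lemma mem_cell: "x \<in> cell p \<longleftrightarrow> (\<forall>i. of_int (p $ i) \<le> x $ i \<and> x $ i \<le> of_int (p $ i) + 1)"
  by (simp add: cell_def mem_box_cart)

lemma interior_cell: "interior (cell p) = {x. \<forall>i. of_int (p $ i) < x $ i \<and> x $ i < of_int (p $ i) + 1}"
  by (auto simp: cell_def interior_cbox mem_box_cart)

lemma center_cell_iff: "center c \<in> cell p \<longleftrightarrow> c = p"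
proof
  assume "center c \<in> cell p"
  then have "c $ i = p $ i" for i
  proof -
    have "real_of_int (p $ i) < of_int (c $ i + 1)" "real_of_int (c $ i) < of_int (p $ i + 1)"
      using \<open>center c \<in> cell p\<close> by (auto simp: mem_cell center_def dest: spec[of _ i])
    then show ?thesis unfolding of_int_less_iff by simp
  qed
  then show "c = p" by (simp add: vec_eq_iff)
qed (simp add: mem_cell center_def)

lemma center_interior: "center c \<in> interior (cell c)"
  by (simp add: interior_cell center_def)

lemma closed_cell: "closed (cell p)"
  by (simp add: cell_def closed_cbox)

text \<open>A cell is the closure of its interior. This moves points off the faces shared by several
  cells.\<close>

lemma interior_cell_meets:
  assumes "open U" "x \<in> U" "x \<in> cell c"
  shows "\<exists>y\<in>U. y \<in> interior (cell c)"
proof -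
  have "closure (interior (cell c)) = cell c"
    using convex_closure_interior[of "cell c"] center_interior[of c] closure_closed[OF closed_cell[of c]]
      convex_box(1) unfolding cell_def by fastforce
  then show ?thesis using assms open_Int_closure_eq_empty[OF assms(1), of "interior (cell c)"] by blast
qed

lemma interior_cell_unique:
  assumes "y \<in> interior (cell c)" "y \<in> cell p"
  shows "p = c"
proof -
  have "p $ i = c $ i" for i
  proof -
    have "of_int (c $ i) < y $ i" "y $ i < of_int (c $ i) + 1" "of_int (p $ i) \<le> y $ i" "y $ i \<le> of_int (p $ i) + 1"
      using assms by (auto simp: interior_cell mem_cell)
    then have "real_of_int (c $ i) < of_int (p $ i + 1)" "real_of_int (p $ i) < of_int (c $ i + 1)" by auto
    then show ?thesis unfolding of_int_less_iff by simp
  qed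
  then show ?thesis by (simp add: vec_eq_iff)
qed

definition brick :: "(int ^ 'n) set \<Rightarrow> (real ^ 'n) set" where
  "brick d = \<Union> (cell ` d)"

text \<open>Centers test membership, so a union of cells determines the set of cells; through this
  \<open>brick\<close> transfers tilings to sets of integer points.\<close>

lemma center_brick_iff: "center c \<in> brick d \<longleftrightarrow> c \<in> d"
  by (auto simp: brick_def center_cell_iff)

lemma inj_brick: "inj brick"
proof (rule injI)
  fix x y :: "(int ^ 'n) set" assume "brick x = brick y"
  then have "c \<in> x \<longleftrightarrow> c \<in> y" for c using center_brick_iff[of c x] center_brick_iff[of c y] by simp
  then show "x = y" by blast
qed

lemma brick_mono: "d \<subseteq> d' \<Longrightarrow> brick d \<subseteq> brick d'"
  by (auto simp: brick_def)

lemma brick_subset_iff: "brick d \<subseteq> brick d' \<longleftrightarrow> d \<subseteq> d'"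
  using brick_mono center_brick_iff by (metis subsetD subsetI)

lemma Union_brick: "\<Union> (brick ` m) = brick (\<Union> m)"
  by (auto simp: brick_def)

lemma brick_pair: "brick {p, q} = cell p \<union> cell q"
  by (simp add: brick_def)

lemma interior_brick_disjoint_iff:
  "interior (brick d) \<inter> interior (brick d') = {} \<longleftrightarrow> d \<inter> d' = {}"
proof
  assume dis: "interior (brick d) \<inter> interior (brick d') = {}"
  show "d \<inter> d' = {}"
  proof (rule ccontr)
    assume "d \<inter> d' \<noteq> {}"
    then obtain c where c: "c \<in> d" "c \<in> d'" by blast
    then have "interior (cell c) \<subseteq> interior (brick d)" "interior (cell c) \<subseteq> interior (brick d')"
      by (auto simp: brick_def intro!: interior_mono)
    then show False using center_interior dis by blast
  qed
next
  assume dis: "d \<inter> d' = {}"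
  show "interior (brick d) \<inter> interior (brick d') = {}"
  proof (rule ccontr)
    assume "interior (brick d) \<inter> interior (brick d') \<noteq> {}"
    then obtain x where x: "x \<in> interior (brick d) \<inter> interior (brick d')" by blast
    then have "x \<in> brick d" using interior_subset by blast
    then obtain c where c: "c \<in> d" "x \<in> cell c" by (auto simp: brick_def)
    obtain y where y: "y \<in> interior (brick d) \<inter> interior (brick d')" "y \<in> interior (cell c)"
      using interior_cell_meets[OF _ x c(2)] by (auto simp: open_Int)
    have "y \<in> brick d'" using y interior_subset by blast
    then obtain c' where "c' \<in> d'" "y \<in> cell c'" by (auto simp: brick_def)
    then show False using interior_cell_unique[OF y(2)] c dis by blast
  qed
qed

lemma adjacent_neq: "adjacent p q \<Longrightarrow> p \<noteq> q"
  by (auto simp: adjacent_def axis_eq_0_iff)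

lemma adjacent_sym: "adjacent p q \<longleftrightarrow> adjacent q p"
  by (auto simp: adjacent_def)

definition cell_domino :: "(int ^ 'n) set \<Rightarrow> bool" where
  "cell_domino d \<longleftrightarrow> (\<exists>p q. adjacent p q \<and> d = {p, q})"

lemma is_domino_iff: "is_domino d \<longleftrightarrow> (\<exists>e. cell_domino e \<and> d = brick e)"
  unfolding is_domino_def cell_domino_def brick_pair[symmetric] by blast

definition lift :: "int ^ 2 \<Rightarrow> int \<Rightarrow> int ^ 3" where
  "lift a k = vector [a $ 1, a $ 2, k]"

lemma lift_nth [simp]: "lift a k $ 1 = a $ 1" "lift a k $ 2 = a $ 2" "lift a k $ 3 = k"
  by (simp_all add: lift_def vector_3)

lemma lift_eq_iff [simp]: "lift a k = lift b l \<longleftrightarrow> a = b \<and> k = l"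
  by (auto simp: vec_eq_iff forall_3 forall_2)

lemma ex_lift: "\<exists>a k. c = lift a k"
  by (intro exI[of _ "vector [c $ 1, c $ 2]"] exI[of _ "c $ 3"]) (simp add: vec_eq_iff forall_3 vector_2)

definition cyl :: "(int ^ 2) set \<Rightarrow> nat \<Rightarrow> (int ^ 3) set" where
  "cyl S N = {lift a k |a k. a \<in> S \<and> 0 \<le> k \<and> k < int N}"

lemma lift_cyl_iff [simp]: "lift a k \<in> cyl S N \<longleftrightarrow> a \<in> S \<and> 0 \<le> k \<and> k < int N"
  by (auto simp: cyl_def)

definition matchings :: "(int ^ 2) set \<Rightarrow> nat \<Rightarrow> (int ^ 3) set set set" where
  "matchings S N = {m. (\<forall>d\<in>m. cell_domino d) \<and> disjoint m \<and> \<Union> m = cyl S N}"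

locale cell_region =
  fixes D :: "(real ^ 2) set" and S :: "(int ^ 2) set"
  assumes finite_S: "finite S" and D_eq: "D = \<Union> (cell ` S)" and S_nonempty: "S \<noteq> {}"
begin

lemma squares_eq: "squares D = S"
proof
  show "squares D \<subseteq> S"
  proof
    fix p assume "p \<in> squares D"
    then have "center p \<in> \<Union> (cell ` S)" using D_eq center_interior interior_subset by (fastforce simp: squares_def)
    then show "p \<in> S" by (auto simp: center_cell_iff)
  qed
qed (auto simp: squares_def D_eq)

text \<open>The assumption excludes \<open>N = 0\<close>, where the region is a flat copy of
  \<open>D\<close> and not a union of cubes.\<close>

lemma region_eq: assumes N: "N \<ge> 1" shows "region D N = brick (cyl S N)"
proof (intro equalityI subsetI)
  fix x assume x: "x \<in> region D N"
  then have xD: "vector [x $ 1, x $ 2] \<in> D" and x3: "0 \<le> x $ 3" "x $ 3 \<le> real N" by (auto simp: region_def)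
  then obtain a where a: "a \<in> S" "vector [x $ 1, x $ 2] \<in> cell a" using D_eq by blast
  \<comment> \<open>On the top face the integer part is \<open>N\<close>; the last floor is chosen
    instead.\<close>
  define k where "k = min \<lfloor>x $ 3\<rfloor> (int N - 1)"
  have k: "0 \<le> k" "k < int N" using x3 N by (auto simp: k_def)
  have "of_int k \<le> x $ 3" "x $ 3 \<le> of_int k + 1"
    unfolding k_def using x3 by (auto simp: min_def) linarith+
  then have "x \<in> cell (lift a k)" using a(2) by (simp add: mem_cell forall_3 forall_2 vector_2)
  then show "x \<in> brick (cyl S N)" using a k by (auto simp: brick_def)
next
  fix x assume "x \<in> brick (cyl S N)"
  then obtain a k where a: "a \<in> S" "0 \<le> k" "k < int N" "x \<in> cell (lift a k)"
    by (auto simp: brick_def cyl_def)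
  have "vector [x $ 1, x $ 2] \<in> cell a" using a(4) by (simp add: mem_cell forall_3 forall_2 vector_2)
  moreover have "real_of_int k + 1 \<le> real N" "0 \<le> real_of_int k" using a by linarith+
  ultimately show "x \<in> region D N" using a D_eq by (auto simp: region_def mem_cell forall_3)
qed

lemma tilings_eq: assumes N: "N \<ge> 1" shows "tilings D N = image brick ` matchings S N"
proof (intro equalityI subsetI)
  fix t assume t: "t \<in> tilings D N"
  define m where "m = {e. cell_domino e \<and> brick e \<in> t}"
  have tm: "t = brick ` m" using t by (auto simp: m_def tilings_def is_domino_iff)
  have "disjoint m"
  proof (rule disjointI)
    fix d e assume "d \<in> m" "e \<in> m" "d \<noteq> e"
    then have "brick d \<in> t" "brick e \<in> t" "brick d \<noteq> brick e" by (auto simp: m_def inj_eq[OF inj_brick])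
    then have "interior (brick d) \<inter> interior (brick e) = {}" using t by (simp add: tilings_def pairwise_def)
    then show "d \<inter> e = {}" by (simp only: interior_brick_disjoint_iff)
  qed
  moreover have "brick (\<Union> m) = brick (cyl S N)"
    using t region_eq[OF N] by (simp add: Union_brick[symmetric] tm[symmetric] tilings_def)
  then have "\<Union> m = cyl S N" by (rule injD[OF inj_brick])
  ultimately have "m \<in> matchings S N" by (auto simp: matchings_def m_def)
  then show "t \<in> image brick ` matchings S N" using tm by blast
next
  fix t assume "t \<in> image brick ` matchings S N"
  then obtain m where m: "m \<in> matchings S N" and t: "t = brick ` m" by blast
  show "t \<in> tilings D N"
    unfolding tilings_def mem_Collect_eq
  proof (intro conjI)
    show "\<forall>d\<in>t. is_domino d" using m t by (auto simp: is_domino_iff matchings_def)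
    show "pairwise (\<lambda>d d'. interior d \<inter> interior d' = {}) t"
      unfolding t
    proof (rule pairwise_imageI)
      fix d e assume "d \<in> m" "e \<in> m" "d \<noteq> e"
      then have "d \<inter> e = {}" using m by (simp add: matchings_def pairwise_def disjnt_def)
      then show "interior (brick d) \<inter> interior (brick e) = {}" by (simp only: interior_brick_disjoint_iff)
    qed
    show "\<Union> t = region D N" using m by (simp add: t Union_brick region_eq[OF N] matchings_def)
  qed
qed

text \<open>Centers of cubes have half-integral height, so no domino fits into the flat region; the
  empty tiling does not cover it, as \<open>D\<close> is nonempty.\<close>

lemma tilings_0: "tilings D 0 = {}"
proof (rule ccontr)
  assume "tilings D 0 \<noteq> {}"
  then obtain t where t: "t \<in> tilings D 0" by blast
  obtain a where a: "a \<in> S" using S_nonempty by blast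
  have "center a \<in> D" using a center_interior interior_subset by (fastforce simp: D_eq)
  then have "vector [center a $ 1, center a $ 2, 0] \<in> region D 0"
  proof -
    assume "center a \<in> D"
    moreover have "vector [center a $ 1, center a $ 2] = center a" by (simp add: vec_eq_iff forall_2 vector_2)
    ultimately show ?thesis by (simp add: region_def vector_3)
  qed
  then obtain d where d: "d \<in> t" using t by (auto simp: tilings_def)
  then obtain p q where "d = cell p \<union> cell q" using t by (auto simp: tilings_def is_domino_def)
  then have "center p \<in> region D 0" using t d center_interior interior_subset by (fastforce simp: tilings_def)
  then have "real_of_int (p $ 3) + 1 / 2 = 0" by (simp add: region_def center_def)
  then have "real_of_int (2 * (p $ 3) + 1) = real_of_int 0" by simp
  then have "2 * (p $ 3) + 1 = 0" by (simp only: of_int_eq_iff)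
  then show False by presburger
qed

end

section \<open>Flips and stacking on sets of cells\<close>

definition cell_pair :: "int ^ 3 \<Rightarrow> 3 \<Rightarrow> 3 \<Rightarrow> (int ^ 3) set set" where
  "cell_pair p i j = {{p, p + axis i 1}, {p + axis j 1, p + axis j 1 + axis i 1}}"

lemma domino_pair_eq: "domino_pair p i j = brick ` cell_pair p i j"
  by (simp add: domino_pair_def cell_pair_def brick_pair)

definition cell_flip :: "(int ^ 3) set set \<Rightarrow> (int ^ 3) set set \<Rightarrow> bool" where
  "cell_flip m m' \<longleftrightarrow> (\<exists>p i j. i \<noteq> j \<and> cell_pair p i j \<subseteq> m \<and> m' = (m - cell_pair p i j) \<union> cell_pair p j i)"

lemma flip_brick_iff: "flip (brick ` m) t' \<longleftrightarrow> (\<exists>m'. t' = brick ` m' \<and> cell_flip m m')"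
proof -
  have sub: "brick ` A \<subseteq> brick ` B \<longleftrightarrow> A \<subseteq> B" for A B :: "(int ^ 3) set set"
    by (rule inj_image_subset_iff[OF inj_brick])
  have "(brick ` m - brick ` A) \<union> brick ` B = brick ` ((m - A) \<union> B)" for A B
    by (simp add: image_Un image_set_diff[OF inj_brick])
  then show ?thesis
    unfolding flip_def cell_flip_def domino_pair_eq sub by (metis (no_types, lifting))
qed

lemma flip_equiv_brick_iff: "flip_equiv (brick ` m) (brick ` m') \<longleftrightarrow> cell_flip\<^sup>*\<^sup>* m m'"
proof
  have "\<exists>m'. t' = brick ` m' \<and> cell_flip\<^sup>*\<^sup>* m m'" if "flip\<^sup>*\<^sup>* (brick ` m) t'" for t'
    using that
  proof (induction rule: rtranclp_induct)
    case (step y z)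
    then obtain m1 where m1: "y = brick ` m1" "cell_flip\<^sup>*\<^sup>* m m1" by blast
    then obtain m2 where "z = brick ` m2" "cell_flip m1 m2" using step(2) flip_brick_iff by blast
    then show ?case using rtranclp.rtrancl_into_rtrancl[OF m1(2)] by blast
  qed blast
  then show "flip_equiv (brick ` m) (brick ` m') \<Longrightarrow> cell_flip\<^sup>*\<^sup>* m m'"
    unfolding flip_equiv_def using inj_image_eq_iff[OF inj_brick] by metis
  show "cell_flip\<^sup>*\<^sup>* m m' \<Longrightarrow> flip_equiv (brick ` m) (brick ` m')"
    unfolding flip_equiv_def
  proof (induction rule: rtranclp_induct)
    case (step y z)
    then have "flip (brick ` y) (brick ` z)" using flip_brick_iff by blast
    then show ?case using step(3) by (meson rtranclp.rtrancl_into_rtrancl)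
  qed blast
qed

definition raise :: "int \<Rightarrow> int ^ 3 \<Rightarrow> int ^ 3" where
  "raise k c = c + axis 3 k"

lemma raise_lift [simp]: "raise k (lift a l) = lift a (k + l)"
  by (simp add: raise_def vec_eq_iff forall_3 axis_def)

lemma translate_brick: "(+) (axis 3 (real k)) ` brick d = brick (raise (int k) ` d)"
proof -
  have "(+) (axis 3 (real k)) ` cell p = cell (raise (int k) p)" for p
  proof (intro equalityI subsetI)
    fix x assume "x \<in> cell (raise (int k) p)"
    then have "x - axis 3 (real k) \<in> cell p"
      by (auto simp: mem_cell raise_def axis_def split: if_splits)
    then show "x \<in> (+) (axis 3 (real k)) ` cell p" by (rule image_eqI[rotated]) simp
  qed (auto simp: mem_cell raise_def axis_def)
  then show ?thesis by (simp add: brick_def image_UN)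
qed

lemma stack_brick: "stack k (brick ` m) (brick ` m') = brick ` (m \<union> image (raise (int k)) ` m')"
  by (simp add: stack_def image_Un image_image translate_brick)

section \<open>Tilings of cylinders as walks on plugs\<close>
type_synonym floor_tiling = "(int ^ 2) set \<times> (int ^ 2) set set \<times> (int ^ 2) set"

text \<open>A floor \<open>(p, f, q)\<close>: the squares of \<open>p\<close> and \<open>q\<close> are covered by vertical dominoes coming
  from below and reaching above, the rest of \<open>S\<close> by the horizontal dominoes \<open>f\<close>.\<close>

definition floors :: "(int ^ 2) set \<Rightarrow> floor_tiling set" where
  "floors S = {(p, f, q). p \<subseteq> S \<and> q \<subseteq> S \<and> p \<inter> q = {} \<and> (\<forall>d\<in>f. cell_domino d) \<and> disjoint f \<and>
     \<Union> f = S - (p \<union> q)}"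

definition top_plug :: "floor_tiling \<Rightarrow> (int ^ 2) set" where
  "top_plug e = snd (snd e)"

definition flipped_floor :: "floor_tiling \<Rightarrow> floor_tiling" where
  "flipped_floor e = (snd (snd e), fst (snd e), fst e)"

definition hor :: "int \<Rightarrow> (int ^ 2) set set \<Rightarrow> (int ^ 3) set set" where
  "hor k f = (\<lambda>d. (\<lambda>a. lift a k) ` d) ` f"

definition ver :: "int \<Rightarrow> (int ^ 2) set \<Rightarrow> (int ^ 3) set set" where
  "ver k q = (\<lambda>a. {lift a k, lift a (k + 1)}) ` q"

text \<open>Each floor contributes the vertical dominoes through its upper plug only; those through
  its lower plug come from the floor before.\<close>

primrec layers :: "int \<Rightarrow> floor_tiling list \<Rightarrow> (int ^ 3) set set" where
  "layers k [] = {}"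
| "layers k (e # w) = hor k (fst (snd e)) \<union> ver k (snd (snd e)) \<union> layers (k + 1) w"

lemma top_plug_simp [simp]: "top_plug (p, f, q) = q"
  by (simp add: top_plug_def)

lemma flipped_floor_simp [simp]: "flipped_floor (p, f, q) = (q, f, p)"
  by (simp add: flipped_floor_def)

lemma floors_iff: "(p, f, q) \<in> floors S \<longleftrightarrow> p \<subseteq> S \<and> q \<subseteq> S \<and> p \<inter> q = {} \<and>
    (\<forall>d\<in>f. cell_domino d) \<and> disjoint f \<and> \<Union> f = S - (p \<union> q)"
  by (simp add: floors_def)

lemma hor_empty [simp]: "hor k {} = {}" and ver_empty [simp]: "ver k {} = {}"
  by (simp_all add: hor_def ver_def)

lemma ver_Un: "ver k (p \<union> q) = ver k p \<union> ver k q"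
  by (auto simp: ver_def)

lemma layers_append: "layers k (u @ w) = layers k u \<union> layers (k + int (length u)) w"
  by (induction u arbitrary: k) (auto simp: algebra_simps)

lemma raise_layers: "image (raise j) ` layers k w = layers (j + k) w"
proof (induction w arbitrary: k)
  case (Cons e w)
  have "image (raise j) ` hor k f = hor (j + k) f" for f by (simp add: hor_def image_image)
  moreover have "image (raise j) ` ver k q = ver (j + k) q" for q by (simp add: ver_def image_image algebra_simps)
  ultimately show ?case using Cons[of "k + 1"] by (simp add: image_Un add.assoc)
qed simp

lemma lift_image_inj: "(\<lambda>a. lift a k) ` d = (\<lambda>a. lift a k) ` d' \<longleftrightarrow> d = d'"
  by (rule inj_image_eq_iff) (simp add: inj_def)

lemma hor_mem_iff [simp]: "(\<lambda>a. lift a k) ` d \<in> hor k f \<longleftrightarrow> d \<in> f"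
  by (auto simp: hor_def lift_image_inj)

lemma hor_height: "d \<in> hor k f \<Longrightarrow> c \<in> d \<Longrightarrow> c $ 3 = k"
  by (auto simp: hor_def)

lemma Union_hor: "lift a l \<in> \<Union> (hor k f) \<longleftrightarrow> l = k \<and> a \<in> \<Union> f"
  by (auto simp: hor_def)

lemma Union_ver: "lift a l \<in> \<Union> (ver k q) \<longleftrightarrow> a \<in> q \<and> (l = k \<or> l = k + 1)"
  by (auto simp: ver_def)

lemma disjoint_hor: "disjoint f \<Longrightarrow> disjoint (hor k f)"
  unfolding hor_def
proof (rule pairwise_imageI)
  fix d e assume "disjoint f" "d \<in> f" "e \<in> f" "d \<noteq> e"
  then have "d \<inter> e = {}" by (simp add: pairwise_def disjnt_def)
  then show "disjnt ((\<lambda>a. lift a k) ` d) ((\<lambda>a. lift a k) ` e)" by (auto simp: disjnt_def)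
qed

lemma disjoint_ver: "disjoint (ver k q)"
  by (auto simp: ver_def pairwise_def disjnt_def)

lemma hor_ver_disjoint: "hor k f \<inter> ver l q = {}"
proof (rule ccontr)
  assume "hor k f \<inter> ver l q \<noteq> {}"
  then obtain a where "{lift a l, lift a (l + 1)} \<in> hor k f" by (auto simp: ver_def)
  then have "lift a l $ 3 = k" "lift a (l + 1) $ 3 = k" by (auto dest: hor_height)
  then show False by simp
qed

definition up_axis :: "2 \<Rightarrow> 3" where
  "up_axis i = (if i = 1 then 1 else 2)"

lemma lift_axis: "lift (a + axis i 1) k = lift a k + axis (up_axis i) 1"
  using exhaust_2[of i] by (auto simp: vec_eq_iff forall_3 axis_def up_axis_def)

lemma lift_up: "lift a (k + 1) = lift a k + axis 3 1"
  by (simp add: vec_eq_iff forall_3 axis_def)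

lemma up_axis_neq_3 [simp]: "up_axis i \<noteq> 3"
  by (simp add: up_axis_def)

lemma ex_2: "(\<exists>i. P i) \<longleftrightarrow> P (1 :: 2) \<or> P 2"
  by (metis exhaust_2)

lemma ex_3: "(\<exists>i. P i) \<longleftrightarrow> P (1 :: 3) \<or> P 2 \<or> P 3"
  by (metis exhaust_3)

lemma adjacent_lift: "adjacent (lift a k) (lift b l) \<longleftrightarrow>
   (adjacent a b \<and> k = l) \<or> (a = b \<and> (l = k + 1 \<or> k = l + 1))"
  unfolding adjacent_def
  by (auto simp: vec_eq_iff forall_3 forall_2 axis_def ex_3 ex_2)

lemma cell_domino_hor: "cell_domino ((\<lambda>a. lift a k) ` d) \<longleftrightarrow> cell_domino d"
proof
  assume "cell_domino ((\<lambda>a. lift a k) ` d)"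
  then obtain x y where xy: "adjacent x y" "(\<lambda>a. lift a k) ` d = {x, y}" by (auto simp: cell_domino_def)
  then obtain a b where ab: "x = lift a k" "y = lift b k" by blast
  then have "(\<lambda>a. lift a k) ` d = (\<lambda>a. lift a k) ` {a, b}" using xy by simp
  then have "d = {a, b}" by (simp only: lift_image_inj)
  then show "cell_domino d" using xy(1) unfolding cell_domino_def ab adjacent_lift by auto
next
  assume "cell_domino d"
  then obtain a b where "adjacent a b" "d = {a, b}" by (auto simp: cell_domino_def)
  then have "adjacent (lift a k) (lift b k)" "(\<lambda>a. lift a k) ` d = {lift a k, lift b k}"
    by (simp_all add: adjacent_lift)
  then show "cell_domino ((\<lambda>a. lift a k) ` d)" unfolding cell_domino_def by blast
qed

lemma cell_domino_ver: "d \<in> ver k q \<Longrightarrow> cell_domino d"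
proof -
  assume "d \<in> ver k q"
  then obtain a where "d = {lift a k, lift a (k + 1)}" by (auto simp: ver_def)
  moreover have "adjacent (lift a k) (lift a (k + 1))" by (simp add: adjacent_lift)
  ultimately show ?thesis unfolding cell_domino_def by blast
qed

lemma cell_domino_nonempty: "cell_domino d \<Longrightarrow> d \<noteq> {}"
  by (auto simp: cell_domino_def)

lemma cell_domino_cases:
  assumes "cell_domino d" "lift a k \<in> d"
  obtains "d = {lift a k, lift a (k + 1)}" | "d = {lift a (k - 1), lift a k}"
    | b where "adjacent a b" "d = (\<lambda>a. lift a k) ` {a, b}"
proof -
  from assms obtain y where y: "adjacent (lift a k) y" "d = {lift a k, y}"
    unfolding cell_domino_def using adjacent_sym by (auto simp: insert_commute)
  obtain b l where yb: "y = lift b l" using ex_lift by blast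
  then consider "adjacent a b" "k = l" | "b = a" "l = k + 1" | "b = a" "l = k - 1"
    using y(1) by (auto simp: adjacent_lift)
  then show ?thesis using that y(2) yb by cases (auto simp: insert_commute)
qed

text \<open>A subfamily of a partition may be exchanged for another one covering the same points.
  The exchange can be undone because a nonempty member of \<open>B\<close> meets some member of
  \<open>A\<close>, so it is not in \<open>m - A\<close>.\<close>

lemma exchange_cover:
  assumes m: "disjoint m" "A \<subseteq> m" and B: "disjoint B" "\<Union> A = \<Union> B" "{} \<notin> B"
  shows "disjoint ((m - A) \<union> B)" "\<Union> ((m - A) \<union> B) = \<Union> m" "m = (((m - A) \<union> B) - B) \<union> A"
proof -
  have dis: "\<Union> (m - A) \<inter> \<Union> A = {}" using m by (fastforce simp: pairwise_def disjnt_def)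
  show "disjoint ((m - A) \<union> B)"
    by (rule disjoint_union) (use m B dis in \<open>auto intro: pairwise_subset\<close>)
  show "\<Union> ((m - A) \<union> B) = \<Union> m" using B m by auto
  have "d \<notin> B" if d: "d \<in> m - A" for d
  proof
    assume "d \<in> B"
    then obtain c where "c \<in> d" using B(3) by (metis all_not_in_conv)
    then have "c \<in> \<Union> (m - A)" "c \<in> \<Union> A" using d \<open>d \<in> B\<close> B(2) by auto
    then show False using dis by blast
  qed
  then show "m = (((m - A) \<union> B) - B) \<union> A" using m by blast
qed

lemma cell_pair_props:
  assumes "i \<noteq> j"
  shows "disjoint (cell_pair p i j)" "\<Union> (cell_pair p i j) = \<Union> (cell_pair p j i)"
    "\<And>d. d \<in> cell_pair p i j \<Longrightarrow> cell_domino d"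
proof -
  have "axis i 1 + axis j 1 \<noteq> (0 :: int ^ 3)"
    using assms by (auto simp: vec_eq_iff axis_def intro!: exI[of _ i])
  then show "disjoint (cell_pair p i j)"
    using assms by (auto simp: cell_pair_def pairwise_def disjnt_def axis_eq_axis add.assoc add.commute)
  show "\<Union> (cell_pair p i j) = \<Union> (cell_pair p j i)"
    by (auto simp: cell_pair_def add.assoc add.commute)
  show "\<And>d. d \<in> cell_pair p i j \<Longrightarrow> cell_domino d"
    by (auto simp: cell_pair_def cell_domino_def adjacent_def)
qed

lemma cell_flip_matching:
  assumes m: "m \<in> matchings S N" and "cell_flip m m'"
  shows "m' \<in> matchings S N" "cell_flip m' m"
proof -
  obtain p i j where ij: "i \<noteq> j" "cell_pair p i j \<subseteq> m" and m': "m' = (m - cell_pair p i j) \<union> cell_pair p j i"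
    using assms(2) by (auto simp: cell_flip_def)
  have d: "disjoint m" using m by (simp add: matchings_def)
  have ne: "{} \<notin> cell_pair p j i" by (auto simp: cell_pair_def)
  note ex = exchange_cover[OF d ij(2) cell_pair_props(1)[of j i p] cell_pair_props(2)[OF ij(1)] ne]
  show "m' \<in> matchings S N"
    using ex(1,2) ij m cell_pair_props(3)[of j i _ p] by (auto simp: matchings_def m')
  show "cell_flip m' m"
    unfolding cell_flip_def using ex(3) ij(1) by (intro exI[of _ p] exI[of _ j] exI[of _ i]) (auto simp: m')
qed

lemma cell_flips_matching:
  assumes "cell_flip\<^sup>*\<^sup>* m m'" "m \<in> matchings S N"
  shows "m' \<in> matchings S N \<and> cell_flip\<^sup>*\<^sup>* m' m"
  using assms
proof (induction rule: rtranclp_induct)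
  case (step y z)
  then have "y \<in> matchings S N" "cell_flip\<^sup>*\<^sup>* y m" by auto
  then show ?case using cell_flip_matching[OF _ step(2)] by (meson converse_rtranclp_into_rtranclp)
qed simp

text \<open>Two equal horizontal dominoes on consecutive floors fill a flippable block. The
  hypothesis on \<open>F\<close> ensures that removing them leaves \<open>F\<close> intact.\<close>

lemma cell_flip_stacked:
  assumes "adjacent a b"
    and "F \<inter> (hor k {{a, b}} \<union> hor (k + 1) {{a, b}}) = {}"
  shows "cell_flip (F \<union> hor k {{a, b}} \<union> hor (k + 1) {{a, b}}) (F \<union> ver k {a, b})"
proof -
  have main: "cell_flip (F \<union> hor k {{a, b}} \<union> hor (k + 1) {{a, b}}) (F \<union> ver k {a, b})"
    if b: "b = a + axis i 1" and F: "F \<inter> (hor k {{a, b}} \<union> hor (k + 1) {{a, b}}) = {}" for a b i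
  proof -
    have e: "lift b k = lift a k + axis (up_axis i) 1" "lift a (k + 1) = lift a k + axis 3 1"
      "lift b (k + 1) = lift a k + axis 3 1 + axis (up_axis i) 1"
      by (simp_all only: b lift_axis) (simp_all only: lift_up)
    have e4: "lift b (k + 1) = lift a k + axis (up_axis i) 1 + axis 3 1"
      unfolding e(3) by (simp only: add.assoc add.commute[of "axis 3 1" "axis (up_axis i) 1"])
    have 1: "hor k {{a, b}} \<union> hor (k + 1) {{a, b}} = cell_pair (lift a k) (up_axis i) 3"
      unfolding cell_pair_def hor_def by (auto simp: e)
    have 2: "ver k {a, b} = cell_pair (lift a k) 3 (up_axis i)"
      unfolding cell_pair_def ver_def by (auto simp: e(1,2) e4)
    show ?thesis unfolding cell_flip_def
    proof (rule exI[of _ "lift a k"], rule exI[of _ "up_axis i"], rule exI[of _ 3], intro conjI)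
      show "cell_pair (lift a k) (up_axis i) 3 \<subseteq> F \<union> hor k {{a, b}} \<union> hor (k + 1) {{a, b}}"
        unfolding 1[symmetric] by blast
      show "F \<union> ver k {a, b} = F \<union> hor k {{a, b}} \<union> hor (k + 1) {{a, b}} -
          cell_pair (lift a k) (up_axis i) 3 \<union> cell_pair (lift a k) 3 (up_axis i)"
        unfolding 1[symmetric] 2[symmetric] using F by blast
    qed simp
  qed
  from assms(1) obtain i where "b = a + axis i 1 \<or> a = b + axis i 1" by (auto simp: adjacent_def)
  then show ?thesis using main[of b a i] main[of a b i] assms(2) by (auto simp: insert_commute)
qed

text \<open>One flip for each horizontal domino of the floor, together with its copy on the next
  floor.\<close>

lemma cell_flips_stacked:
  assumes "finite f" "\<forall>d\<in>f. cell_domino d" "F \<inter> (hor k f \<union> hor (k + 1) f) = {}"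
  shows "cell_flip\<^sup>*\<^sup>* (F \<union> hor k f \<union> hor (k + 1) f) (F \<union> ver k (\<Union> f))"
  using assms
proof (induction f arbitrary: F rule: finite_induct)
  case (insert d f)
  obtain a b where ab: "adjacent a b" "d = {a, b}" using insert.prems by (auto simp: cell_domino_def)
  have ins: "hor l (insert d f) = hor l f \<union> hor l {d}" for l by (auto simp: hor_def)
  let ?F = "F \<union> hor k f \<union> hor (k + 1) f"
  have "(\<lambda>a. lift a l) ` d \<notin> hor l' f" if "l \<noteq> l'" for l l'
    using that ab(2) by (auto dest!: hor_height)
  then have F: "?F \<inter> (hor k {d} \<union> hor (k + 1) {d}) = {}"
    using insert.prems insert.hyps by (auto simp: ins) (auto simp: hor_def lift_image_inj)
  have "cell_flip (?F \<union> hor k {d} \<union> hor (k + 1) {d}) (?F \<union> ver k d)"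
    using cell_flip_stacked[OF ab(1), of ?F k] F ab(2) by simp
  moreover have "cell_flip\<^sup>*\<^sup>* ((F \<union> ver k d) \<union> hor k f \<union> hor (k + 1) f) ((F \<union> ver k d) \<union> ver k (\<Union> f))"
  proof (rule insert.IH)
    show "\<forall>d\<in>f. cell_domino d" using insert.prems by simp
    show "(F \<union> ver k d) \<inter> (hor k f \<union> hor (k + 1) f) = {}"
      using insert.prems hor_ver_disjoint by (fastforce simp: ins)
  qed
  moreover have "F \<union> hor k (insert d f) \<union> hor (k + 1) (insert d f) = ?F \<union> hor k {d} \<union> hor (k + 1) {d}"
    by (auto simp: ins)
  moreover have "?F \<union> ver k d = (F \<union> ver k d) \<union> hor k f \<union> hor (k + 1) f" by blast
  moreover have "(F \<union> ver k d) \<union> ver k (\<Union> f) = F \<union> ver k (\<Union> (insert d f))" by (simp add: ver_Un Un_assoc)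
  ultimately show ?case by (metis converse_rtranclp_into_rtranclp)
qed simp

section \<open>Walks on plugs and perfect matchings of cells\<close>

locale board =
  fixes S :: "(int ^ 2) set"
  assumes finite_S: "finite S"
begin

lemma finite_floors: "finite (floors S)"
  by (rule finite_subset[of _ "Pow S \<times> Pow (Pow S) \<times> Pow S"]) (auto simp: floors_def finite_S)

sublocale multigraph "floors S" fst top_plug flipped_floor "{}"
  by unfold_locales
     (auto simp: finite_floors floors_iff)

text \<open>The cells covered by a walk from \<open>p\<close> to \<open>q\<close>: the squares of
  \<open>p\<close> on the bottom floor belong to dominoes from below, and those of \<open>q\<close>
  protrude above the top floor.\<close>

definition occupied :: "int \<Rightarrow> nat \<Rightarrow> (int ^ 2) set \<Rightarrow> (int ^ 2) set \<Rightarrow> (int ^ 3) set" where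
  "occupied k n p q = {lift a l |a l. (a \<in> S \<and> k \<le> l \<and> l < k + int n \<or> a \<in> q \<and> l = k + int n)
     \<and> \<not> (a \<in> p \<and> l = k)}"

lemma lift_occupied_iff: "lift a l \<in> occupied k n p q \<longleftrightarrow>
   (a \<in> S \<and> k \<le> l \<and> l < k + int n \<or> a \<in> q \<and> l = k + int n) \<and> \<not> (a \<in> p \<and> l = k)"
  by (auto simp: occupied_def)

lemma layers_cover:
  assumes "walk p w q"
  shows "\<Union> (layers k w) = occupied k (length w) p q" "disjoint (layers k w)" "\<forall>d\<in>layers k w. cell_domino d"
proof -
  have "\<Union> (layers k w) = occupied k (length w) p q \<and> disjoint (layers k w) \<and> (\<forall>d\<in>layers k w. cell_domino d)"
    using assms
  proof (induction w arbitrary: k p)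
    case Nil
    then show ?case by (auto simp: occupied_def)
  next
    case (Cons e w)
    obtain f r where e: "e = (p, f, r)" using Cons.prems by (cases e) auto
    have E: "p \<subseteq> S" "r \<subseteq> S" "p \<inter> r = {}" "\<forall>d\<in>f. cell_domino d" "disjoint f" "\<Union> f = S - (p \<union> r)"
      using Cons.prems by (auto simp: floors_iff e)
    have w: "walk r w q" using Cons.prems by (simp add: e)
    have rq: "r = q" if "length w = 0" using w that by simp
    note IH = Cons.IH[OF w, of "k + 1"]
    have L: "layers k (e # w) = (hor k f \<union> ver k r) \<union> layers (k + 1) w" by (simp add: e)
    have c1: "lift a l \<in> \<Union> (hor k f \<union> ver k r) \<longleftrightarrow> (l = k \<and> a \<in> S - p) \<or> (a \<in> r \<and> l = k + 1)" for a l
      using E Union_hor[of a l k f] Union_ver[of a l k r] by auto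
    have c2: "lift a l \<in> \<Union> (layers (k + 1) w) \<longleftrightarrow>
      (a \<in> S \<and> k + 1 \<le> l \<and> l < k + 1 + int (length w) \<or> a \<in> q \<and> l = k + 1 + int (length w)) \<and> \<not> (a \<in> r \<and> l = k + 1)" for a l
      using IH lift_occupied_iff[of a l "k + 1" "length w" r q] by simp
    have cov: "lift a l \<in> \<Union> (layers k (e # w)) \<longleftrightarrow> lift a l \<in> occupied k (length (e # w)) p q" for a l
    proof -
      have "lift a l \<in> \<Union> (layers k (e # w)) \<longleftrightarrow> lift a l \<in> \<Union> (hor k f \<union> ver k r) \<or> lift a l \<in> \<Union> (layers (k + 1) w)"
        unfolding L by blast
      also have "\<dots> \<longleftrightarrow> lift a l \<in> occupied k (length (e # w)) p q"
        unfolding c1 c2 lift_occupied_iff using E(1-3) rq by (cases "length w = 0") auto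
      finally show ?thesis .
    qed
    have "disjoint (layers k (e # w))"
      unfolding L
    proof (intro disjoint_union disjoint_hor disjoint_ver E(5))
      show "disjoint (layers (k + 1) w)" using IH by simp
      have "lift a l \<notin> \<Union> (hor k f) \<inter> \<Union> (ver k r)" for a l
        using Union_hor[of a l k f] Union_ver[of a l k r] E(6) by blast
      then show "\<Union> (hor k f) \<inter> \<Union> (ver k r) = {}" using ex_lift by (metis all_not_in_conv)
      have "lift a l \<notin> \<Union> (hor k f \<union> ver k r) \<inter> \<Union> (layers (k + 1) w)" for a l
        using c1[of a l] c2[of a l] by auto
      then show "\<Union> (hor k f \<union> ver k r) \<inter> \<Union> (layers (k + 1) w) = {}" using ex_lift by (metis all_not_in_conv)
    qed
    moreover have "\<forall>d\<in>layers k (e # w). cell_domino d"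
      unfolding L using IH E(4) cell_domino_ver by (auto simp: hor_def cell_domino_hor)
    moreover have "\<Union> (layers k (e # w)) = occupied k (length (e # w)) p q"
    proof (rule Set.set_eqI)
      fix c
      obtain a l where c: "c = lift a l" using ex_lift by blast
      show "c \<in> \<Union> (layers k (e # w)) \<longleftrightarrow> c \<in> occupied k (length (e # w)) p q"
        unfolding c by (rule cov)
    qed
    ultimately show ?case by blast
  qed
  then show "\<Union> (layers k w) = occupied k (length w) p q" "disjoint (layers k w)" "\<forall>d\<in>layers k w. cell_domino d"
    by auto
qed

lemma layers_matching: "walk {} w {} \<Longrightarrow> layers 0 w \<in> matchings S (length w)"
  using layers_cover[of "{}" w "{}" 0] by (auto simp: matchings_def occupied_def cyl_def)

lemma layers_height:
  assumes "walk p w q" "d \<in> layers k w"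
  shows "c \<in> d \<Longrightarrow> k \<le> c $ 3" "\<exists>c\<in>d. c $ 3 < k + int (length w)"
proof -
  have "(\<forall>c\<in>d. k \<le> c $ 3) \<and> (\<exists>c\<in>d. c $ 3 < k + int (length w))"
    using assms
  proof (induction w arbitrary: p k)
    case (Cons e w)
    then have w: "walk (top_plug e) w q" by simp
    have dom: "cell_domino d" using layers_cover(3)[OF Cons.prems(1)] Cons.prems(2) by blast
    consider "d \<in> hor k (fst (snd e))" | "d \<in> ver k (snd (snd e))" | "d \<in> layers (k + 1) w"
      using Cons.prems(2) by auto
    then show ?case
    proof cases
      case 1
      then obtain c where "c \<in> d" using cell_domino_nonempty[OF dom] by blast
      then show ?thesis using hor_height[OF 1] by (auto intro!: bexI[of _ c])
    next
      case 2
      then show ?thesis by (auto simp: ver_def)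
    next
      case 3
      note IH = Cons.IH[OF w 3]
      then obtain c where "c \<in> d" "c $ 3 < k + 1 + int (length w)" by blast
      then have "\<exists>c\<in>d. c $ 3 < k + int (length (e # w))" by (intro bexI[of _ c]) auto
      then show ?thesis using IH by force
    qed
  qed simp
  then show "c \<in> d \<Longrightarrow> k \<le> c $ 3" "\<exists>c\<in>d. c $ 3 < k + int (length w)" by auto
qed

text \<open>The first floor can be read off from the dominoes touching its height, and the dominoes
  entirely above it are the layers of the remaining walk.\<close>

lemma layers_inj:
  assumes "walk p w q" "walk p w' q'" "length w = length w'" "layers k w = layers k w'"
  shows "w = w'"
  using assms
proof (induction w arbitrary: p k w')
  case (Cons e w)
  then obtain e' v where w': "w' = e' # v" by (cases w') auto
  obtain f r where e: "e = (p, f, r)" using Cons.prems by (cases e) auto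
  obtain f' r' where e': "e' = (p, f', r')" using Cons.prems w' by (cases e') auto
  have rec: "f = {d. (\<lambda>a. lift a k) ` d \<in> layers k ((p, f, r) # x)}"
      "r = {a. {lift a k, lift a (k + 1)} \<in> layers k ((p, f, r) # x)}"
      "layers (k + 1) x = {d \<in> layers k ((p, f, r) # x). \<forall>c\<in>d. k + 1 \<le> c $ 3}"
    if wx: "walk p ((p, f, r) # x) q" for f r x q
  proof -
    have x: "walk r x q" using wx by simp
    have ne: "{} \<notin> layers k ((p, f, r) # x)" using layers_cover(3)[OF wx] cell_domino_nonempty by blast
    have no: "(\<lambda>a. lift a k) ` d \<notin> ver k r" for d
    proof
      assume "(\<lambda>a. lift a k) ` d \<in> ver k r"
      then obtain a where "(\<lambda>a. lift a k) ` d = {lift a k, lift a (k + 1)}" by (auto simp: ver_def)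
      then have "lift a (k + 1) \<in> (\<lambda>a. lift a k) ` d" by simp
      then show False by auto
    qed
    have no2: "(\<lambda>a. lift a k) ` d \<notin> layers (k + 1) x" for d
    proof
      assume d: "(\<lambda>a. lift a k) ` d \<in> layers (k + 1) x"
      then have "(\<lambda>a. lift a k) ` d \<noteq> {}" using ne by auto
      then obtain a where "a \<in> d" by blast
      then show False using layers_height(1)[OF x d, of "lift a k"] by simp
    qed
    show "f = {d. (\<lambda>a. lift a k) ` d \<in> layers k ((p, f, r) # x)}" using no no2 by auto
    have "{lift a k, lift a (k + 1)} \<notin> hor k f" for a
      by (auto dest!: hor_height[of _ k f "lift a (k + 1)"])
    moreover have "{lift a k, lift a (k + 1)} \<notin> layers (k + 1) x" for a
      by (auto dest!: layers_height(1)[OF x, of _ "k + 1" "lift a k"])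
    moreover have "{lift a k, lift a (k + 1)} \<in> ver k r \<longleftrightarrow> a \<in> r" for a
      by (auto simp: ver_def doubleton_eq_iff)
    ultimately show "r = {a. {lift a k, lift a (k + 1)} \<in> layers k ((p, f, r) # x)}" by auto
    have "\<exists>c\<in>d. c $ 3 = k" if "d \<in> hor k f" for d
    proof -
      have "d \<noteq> {}" using that ne by auto
      then show ?thesis using that hor_height by blast
    qed
    moreover have "\<exists>c\<in>d. c $ 3 = k" if "d \<in> ver k r" for d using that by (auto simp: ver_def)
    ultimately show "layers (k + 1) x = {d \<in> layers k ((p, f, r) # x). \<forall>c\<in>d. k + 1 \<le> c $ 3}"
      using layers_height(1)[OF x] by fastforce
  qed
  have w1: "walk p ((p, f, r) # w) q" and w2: "walk p ((p, f', r') # v) q'" using Cons.prems w' e e' by auto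
  have eq: "layers k ((p, f, r) # w) = layers k ((p, f', r') # v)" using Cons.prems(4) e e' w' by simp
  have "f = f'" by (rule trans[OF rec(1)[OF w1]]) (simp only: eq rec(1)[OF w2, symmetric])
  moreover have "r = r'" by (rule trans[OF rec(2)[OF w1]]) (simp only: eq rec(2)[OF w2, symmetric])
  moreover have "layers (k + 1) w = layers (k + 1) v"
    by (rule trans[OF rec(3)[OF w1]]) (simp only: eq rec(3)[OF w2, symmetric])
  then have "w = v"
    using Cons.IH[of r v "k + 1"] w1 w2 \<open>r = r'\<close> Cons.prems(3) w' by simp
  ultimately show ?case using e e' w' by simp
qed simp

definition plug :: "(int ^ 3) set set \<Rightarrow> int \<Rightarrow> (int ^ 2) set" where
  "plug m k = {a. {lift a (k - 1), lift a k} \<in> m}"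

definition flat :: "(int ^ 3) set set \<Rightarrow> int \<Rightarrow> (int ^ 2) set set" where
  "flat m k = {d. (\<lambda>a. lift a k) ` d \<in> m}"

primrec word :: "(int ^ 3) set set \<Rightarrow> int \<Rightarrow> nat \<Rightarrow> floor_tiling list" where
  "word m k 0 = []"
| "word m k (Suc n) = (plug m k, flat m k, plug m (k + 1)) # word m (k + 1) n"

lemma length_word [simp]: "length (word m k n) = n"
  by (induction n arbitrary: k) auto

lemma matching_unique:
  "m \<in> matchings S N \<Longrightarrow> d \<in> m \<Longrightarrow> d' \<in> m \<Longrightarrow> c \<in> d \<Longrightarrow> c \<in> d' \<Longrightarrow> d = d'"
  by (auto simp: matchings_def pairwise_def disjnt_def)

lemma word_floor:
  assumes m: "m \<in> matchings S N" and k: "0 \<le> k" "k < int N"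
  shows "(plug m k, flat m k, plug m (k + 1)) \<in> floors S"
proof -
  have cell: "c \<in> cyl S N" if "d \<in> m" "c \<in> d" for c d using m that by (auto simp: matchings_def)
  have sub: "plug m l \<subseteq> S" for l
  proof
    fix a assume "a \<in> plug m l"
    then have "{lift a (l - 1), lift a l} \<in> m" by (simp add: plug_def)
    from cell[OF this, of "lift a l"] show "a \<in> S" by simp
  qed
  have no_flat: "a \<notin> d" if d: "d \<in> flat m k" and a: "{lift a l, lift a (l + 1)} \<in> m" and l: "l = k \<or> l + 1 = k" for a d l
  proof
    assume "a \<in> d"
    then have "(\<lambda>a. lift a k) ` d = {lift a l, lift a (l + 1)}"
      using matching_unique[OF m _ a, of "(\<lambda>a. lift a k) ` d" "lift a k"] d l by (auto simp: flat_def)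
    then have "lift a l \<in> (\<lambda>a. lift a k) ` d" "lift a (l + 1) \<in> (\<lambda>a. lift a k) ` d" by auto
    then show False by auto
  qed
  have "plug m k \<inter> plug m (k + 1) = {}"
  proof (rule ccontr)
    assume "plug m k \<inter> plug m (k + 1) \<noteq> {}"
    then obtain a where a: "{lift a (k - 1), lift a k} \<in> m" "{lift a k, lift a (k + 1)} \<in> m"
      by (auto simp: plug_def)
    from matching_unique[OF m a, of "lift a k"] show False by (auto simp: doubleton_eq_iff)
  qed
  moreover have "\<forall>d\<in>flat m k. cell_domino d"
    using m by (auto simp: flat_def matchings_def simp flip: cell_domino_hor[of k])
  moreover have "disjoint (flat m k)"
  proof (rule disjointI)
    fix d e assume de: "d \<in> flat m k" "e \<in> flat m k" "d \<noteq> e"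
    show "d \<inter> e = {}"
    proof (rule ccontr)
      assume "d \<inter> e \<noteq> {}"
      then obtain a where "a \<in> d" "a \<in> e" by blast
      then have "(\<lambda>a. lift a k) ` d = (\<lambda>a. lift a k) ` e"
        using matching_unique[OF m, of _ _ "lift a k"] de by (auto simp: flat_def)
      then show False using de by (simp add: lift_image_inj)
    qed
  qed
  moreover have "\<Union> (flat m k) = S - (plug m k \<union> plug m (k + 1))"
  proof (intro equalityI subsetI)
    fix a assume "a \<in> \<Union> (flat m k)"
    then obtain d where d: "d \<in> flat m k" "a \<in> d" by blast
    then have "a \<in> S" using cell[of "(\<lambda>a. lift a k) ` d" "lift a k"] by (auto simp: flat_def)
    moreover have "a \<notin> plug m k" "a \<notin> plug m (k + 1)"
      using no_flat[OF d(1), of a "k - 1"] no_flat[OF d(1), of a k] d(2) by (auto simp: plug_def)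
    ultimately show "a \<in> S - (plug m k \<union> plug m (k + 1))" by blast
  next
    fix a assume a: "a \<in> S - (plug m k \<union> plug m (k + 1))"
    then have "lift a k \<in> \<Union> m" using m k by (simp add: matchings_def)
    then obtain d where d: "d \<in> m" "lift a k \<in> d" by blast
    then have "cell_domino d" using m by (simp add: matchings_def)
    then show "a \<in> \<Union> (flat m k)" using d(2)
      by (cases rule: cell_domino_cases) (use a d in \<open>auto simp: plug_def flat_def intro!: exI[of _ "{a, _}"]\<close>)
  qed
  ultimately show ?thesis using sub by (simp add: floors_iff)
qed

lemma walk_word:
  assumes m: "m \<in> matchings S N" and "0 \<le> k" "k + int n \<le> int N"
  shows "walk (plug m k) (word m k n) (plug m (k + int n))"
  using assms(2,3)
proof (induction n arbitrary: k)
  case (Suc n)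
  have "walk (plug m (k + 1)) (word m (k + 1) n) (plug m (k + 1 + int n))"
    by (rule Suc.IH) (use Suc.prems in auto)
  then show ?case using word_floor[OF m, of k] Suc.prems by (simp add: algebra_simps)
qed simp

lemma layers_word_subset: "layers k (word m k n) \<subseteq> m"
  by (induction n arbitrary: k) (auto simp: hor_def ver_def plug_def flat_def)

text \<open>A cover without overlaps has no proper subcover, so the inclusion
  \<open>layers_word_subset\<close> already gives equality.\<close>

lemma matching_subset_eq:
  assumes "m \<in> matchings S N" "m' \<in> matchings S N" "m' \<subseteq> m"
  shows "m' = m"
proof
  show "m \<subseteq> m'"
  proof
    fix d assume d: "d \<in> m"
    then obtain c where c: "c \<in> d" using assms(1) cell_domino_nonempty by (fastforce simp: matchings_def)
    then have "c \<in> \<Union> m'" using d assms(1,2) by (auto simp: matchings_def)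
    then obtain d' where "d' \<in> m'" "c \<in> d'" by blast
    then show "d \<in> m'" using matching_unique[OF assms(1) d, of d' c] c assms(3) by auto
  qed
qed (rule assms(3))

lemma layers_word:
  assumes m: "m \<in> matchings S N"
  shows "walk {} (word m 0 N) {}" "layers 0 (word m 0 N) = m"
proof -
  have U: "\<Union> m = cyl S N" using m by (simp add: matchings_def)
  have "plug m 0 = {}" "plug m (int N) = {}"
  proof -
    have "a \<notin> plug m 0" for a
    proof
      assume "a \<in> plug m 0"
      then have "lift a (- 1) \<in> \<Union> m" by (auto simp: plug_def)
      then show False unfolding U by simp
    qed
    then show "plug m 0 = {}" by blast
    have "a \<notin> plug m (int N)" for a
    proof
      assume "a \<in> plug m (int N)"
      then have "lift a (int N) \<in> \<Union> m" by (auto simp: plug_def)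
      then show False unfolding U by simp
    qed
    then show "plug m (int N) = {}" by blast
  qed
  then show w: "walk {} (word m 0 N) {}" using walk_word[OF m, of 0 N] by simp
  show "layers 0 (word m 0 N) = m"
    using matching_subset_eq[OF m _ layers_word_subset] layers_matching[OF w] by simp
qed

lemma bij_layers: "bij_betw (layers 0) (walks N {} {}) (matchings S N)"
proof (rule bij_betw_imageI)
  show "inj_on (layers 0) (walks N {} {})"
    by (rule inj_onI) (auto simp: walks_def intro: layers_inj)
  show "layers 0 ` walks N {} {} = matchings S N"
  proof (intro equalityI subsetI)
    fix m assume m: "m \<in> matchings S N"
    show "m \<in> layers 0 ` walks N {} {}"
      using layers_word[OF m] by (intro image_eqI[of _ _ "word m 0 N"]) (auto simp: walks_def)
  qed (auto simp: walks_def layers_matching)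
qed

text \<open>Two floors without horizontal dominoes: over \<open>p\<close> one domino ends from below
  and the next reaches above, and the other squares carry dominoes standing on both floors.\<close>

definition room :: "(int ^ 2) set \<Rightarrow> floor_tiling list" where
  "room p = [(p, {}, S - p), (S - p, {}, p)]"

text \<open>A piece of a walk need not fill a cylinder, so flips are tested in all its completions
  to closed walks. This makes the relation a congruence; for closed pieces the empty completion
  suffices by \<open>flips_closed_iff\<close>.\<close>

definition flips :: "(int ^ 2) set \<Rightarrow> (int ^ 2) set \<Rightarrow> floor_tiling list \<Rightarrow> floor_tiling list \<Rightarrow> bool" where
  "flips p q w w' \<longleftrightarrow> walk p w q \<and> walk p w' q \<and> length w = length w' \<and>
     (\<forall>u v. walk {} u p \<longrightarrow> walk q v {} \<longrightarrow> cell_flip\<^sup>*\<^sup>* (layers 0 (u @ w @ v)) (layers 0 (u @ w' @ v)))"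

lemma walk_room: "p \<subseteq> S \<Longrightarrow> walk p (room p) p"
  by (auto simp: room_def floors_iff)

text \<open>A floor and its reflection have the same horizontal dominoes one above the other;
  flipping all of them upright leaves two purely vertical floors.\<close>

lemma flips_cancel:
  assumes e: "e \<in> floors S"
  shows "flips (fst e) (fst e) [e, flipped_floor e] (room (fst e))"
proof -
  obtain p f q where epfq: "e = (p, f, q)" by (cases e)
  have E: "p \<subseteq> S" "q \<subseteq> S" "p \<inter> q = {}" "\<forall>d\<in>f. cell_domino d" "\<Union> f = S - (p \<union> q)"
    using e by (auto simp: floors_iff epfq)
  have finf: "finite f" by (rule finite_subset[of _ "Pow S"]) (use E(5) finite_S in auto)
  have we: "walk p [e, flipped_floor e] p" using e opp_edge[OF e] by (simp add: epfq)
  have "cell_flip\<^sup>*\<^sup>* (layers 0 (u @ [e, flipped_floor e] @ v)) (layers 0 (u @ room p @ v))"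
    if u: "walk {} u p" and v: "walk p v {}" for u v
  proof -
    let ?k = "int (length u)"
    let ?F = "layers 0 u \<union> ver ?k q \<union> ver (?k + 1) p \<union> layers (?k + 2) v"
    have 1: "layers 0 (u @ [e, flipped_floor e] @ v) = ?F \<union> hor ?k f \<union> hor (?k + 1) f"
      by (auto simp: layers_append epfq algebra_simps)
    have "S - p = q \<union> \<Union> f" using E by auto
    then have 2: "layers 0 (u @ room p @ v) = ?F \<union> ver ?k (\<Union> f)"
      by (auto simp: layers_append room_def ver_Un algebra_simps)
    have "d \<notin> hor l f" if "d \<in> layers 0 u" "l \<ge> ?k" for d l
      using layers_height(2)[OF u that(1)] that(2) by (fastforce dest: hor_height)
    moreover have "d \<notin> hor l f" if d: "d \<in> layers (?k + 2) v" "l \<le> ?k + 1" for d l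
    proof
      assume h: "d \<in> hor l f"
      have "d \<noteq> {}" using layers_cover(3)[OF v] d cell_domino_nonempty by blast
      then obtain c where "c \<in> d" by blast
      then show False using hor_height[OF h] layers_height(1)[OF v d(1)] d(2) by fastforce
    qed
    ultimately have "?F \<inter> (hor ?k f \<union> hor (?k + 1) f) = {}"
      using hor_ver_disjoint by fastforce
    from cell_flips_stacked[OF finf E(4) this] show ?thesis unfolding 1 2 .
  qed
  then show ?thesis using we walk_room[OF E(1)] by (simp add: flips_def epfq room_def)
qed

lemma flips_sym: "flips p q w w' \<Longrightarrow> flips p q w' w"
  unfolding flips_def
proof (intro conjI allI impI)
  assume w: "walk p w q \<and> walk p w' q \<and> length w = length w' \<and>
    (\<forall>u v. walk {} u p \<longrightarrow> walk q v {} \<longrightarrow> cell_flip\<^sup>*\<^sup>* (layers 0 (u @ w @ v)) (layers 0 (u @ w' @ v)))"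
  fix u v assume u: "walk {} u p" and v: "walk q v {}"
  have "walk {} (u @ w @ v) {}" using w u v by (blast intro: walk_appendI)
  from cell_flips_matching[OF _ layers_matching[OF this], of "layers 0 (u @ w' @ v)"]
  show "cell_flip\<^sup>*\<^sup>* (layers 0 (u @ w' @ v)) (layers 0 (u @ w @ v))" using w u v by blast
qed simp_all

lemma flips_append:
  assumes "flips p q w w'" "flips q r v v'"
  shows "flips p r (w @ v) (w' @ v')"
proof -
  have W: "walk p w q" "walk p w' q" "length w = length w'" "walk q v r" "walk q v' r" "length v = length v'"
    using assms by (auto simp: flips_def)
  have "cell_flip\<^sup>*\<^sup>* (layers 0 (u @ (w @ v) @ x)) (layers 0 (u @ (w' @ v') @ x))"
    if u: "walk {} u p" and x: "walk r x {}" for u x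
  proof -
    have 1: "cell_flip\<^sup>*\<^sup>* (layers 0 (u @ w @ (v @ x))) (layers 0 (u @ w' @ (v @ x)))"
      using assms(1) u walk_appendI[OF W(4) x] unfolding flips_def by blast
    have "cell_flip\<^sup>*\<^sup>* (layers 0 ((u @ w') @ v @ x)) (layers 0 ((u @ w') @ v' @ x))"
      using assms(2) walk_appendI[OF u W(2)] x unfolding flips_def by blast
    then have 2: "cell_flip\<^sup>*\<^sup>* (layers 0 (u @ w' @ (v @ x))) (layers 0 (u @ w' @ (v' @ x)))"
      by (simp only: append_assoc)
    show ?thesis using rtranclp_trans[OF 1 2] by (simp only: append_assoc)
  qed
  then show ?thesis
    unfolding flips_def using walk_appendI[OF W(1,4)] walk_appendI[OF W(2,5)] W(3,6)
    by (simp only: length_append simp_thms) blast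
qed

end

section \<open>The twist, floor by floor\<close>
definition chi :: "int ^ 'n \<Rightarrow> int" where
  "chi a = (if black a then 1 else - 1)"

lemma chi_axis: "chi (a + axis i 1) = - chi (a :: int ^ 'n)"
proof -
  have "(\<Sum>k\<in>UNIV. (a + axis i 1) $ k) = (\<Sum>k\<in>UNIV. a $ k) + 1"
    by (simp add: sum.distrib axis_def)
  then show ?thesis by (simp add: chi_def black_def)
qed

lemma chi_diff_axis: "chi (a - axis i 1) = - chi (a :: int ^ 'n)"
  using chi_axis[of "a - axis i 1" i] by simp

lemma chi_square [simp]: "chi a * chi a = 1"
  by (simp add: chi_def)

lemma odd_chi [simp]: "odd (chi a)"
  by (simp add: chi_def)

text \<open>\<open>i\<close> is the direction in which rows run and shades are cast;
  \<open>j\<close> is the other horizontal direction.\<close>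

locale floor_twist = board S for S +
  fixes i j :: 2
  assumes ij: "i \<noteq> j"
begin

definition K :: "int ^ 2 \<Rightarrow> int ^ 2 \<Rightarrow> int" where
  "K x y = (if x $ j = y $ j then sgn (y $ i - x $ i) else 0)"

definition R :: "(int ^ 2) set \<Rightarrow> int ^ 2 \<Rightarrow> int" where
  "R X b = (\<Sum>x\<in>X. chi x * K x b)"

definition uppers :: "(int ^ 2) set set \<Rightarrow> (int ^ 2) set" where
  "uppers f = {y. {y - axis j 1, y} \<in> f}"

definition lefts :: "(int ^ 2) set set \<Rightarrow> (int ^ 2) set" where
  "lefts f = {x. {x, x + axis i 1} \<in> f}"

text \<open>Four times the share of one floor in the twist, up to the sign
  \<open>orientation\<close>. Dominoes in direction \<open>i\<close> are parallel to the shade and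
  have determinant 0, so vertical dominoes are paired with those in direction \<open>j\<close>. Both
  cells of the latter carry the same vector, hence the common sign \<open>chi y\<close>.\<close>

definition tau :: "floor_tiling \<Rightarrow> int" where
  "tau = (\<lambda>(p, f, q). \<Sum>y\<in>uppers f. chi y *
     ((R p y - R q y) + (R p (y - axis j 1) - R q (y - axis j 1))))"

lemma vec_eq_ij: "x = (y :: int ^ 2) \<longleftrightarrow> x $ i = y $ i \<and> x $ j = y $ j"
  using ij exhaust_2[of i] exhaust_2[of j] by (auto simp: vec_eq_iff forall_2)

lemma axis_ij [simp]: "axis i 1 $ i = (1 :: int)" "axis j 1 $ j = (1 :: int)"
  "axis i 1 $ j = (0 :: int)" "axis j 1 $ i = (0 :: int)"
  using ij by (auto simp: axis_def)

lemma K_swap: "K y x = - K x y"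
  by (auto simp: K_def sgn_if)

lemma K_same [simp]: "K x x = 0"
  by (simp add: K_def)

lemma K_shift: "K (x + axis j 1) (y + axis j 1) = K x y"
  by (simp add: K_def)

lemma K_shift': "K x (y - axis j 1) = K (x + axis j 1) y"
  using K_shift[of x "y - axis j 1"] by simp

lemma K_column: "K x (x + axis j 1) = 0" "K (x + axis j 1) x = 0"
  by (simp_all add: K_def)

text \<open>A step along the row changes the order relative to \<open>c\<close> only at
  \<open>c\<close> itself. Hence the two cells of a domino in direction \<open>i\<close>, having
  opposite colours, cancel in signed counts.\<close>

lemma K_step:
  assumes "c \<noteq> x" "c \<noteq> x + axis i 1"
  shows "K c (x + axis i 1) = K c x"
  using assms by (auto simp: K_def vec_eq_ij sgn_if)

lemma K_step':
  assumes "c \<noteq> x" "c \<noteq> x + axis i 1"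
  shows "K (x + axis i 1) c = K x c"
  using K_step[OF assms] K_swap by metis

lemma adjacent_ij: "adjacent a b \<longleftrightarrow>
   b = a + axis i 1 \<or> a = b + axis i 1 \<or> b = a + axis j 1 \<or> a = b + axis j 1"
  using ij exhaust_2[of i] exhaust_2[of j] by (auto simp: adjacent_def ex_2)

lemma upper_pair_iff: "{y - axis j 1, y :: int ^ 2} = {z - axis j 1, z} \<longleftrightarrow> y = z"
proof
  assume "{y - axis j 1, y} = {z - axis j 1, z}"
  then have "(y - axis j 1 = z - axis j 1 \<and> y = z) \<or> (y - axis j 1 = z \<and> y = z - axis j 1)"
    by (simp only: doubleton_eq_iff)
  then show "y = z"
  proof (elim disjE conjE)
    assume 1: "y - axis j 1 = z" and 2: "y = z - axis j 1"
    show ?thesis using arg_cong[OF 1, of "\<lambda>v. v $ j"] arg_cong[OF 2, of "\<lambda>v. v $ j"]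
      unfolding vector_minus_component axis_ij by linarith
  qed
qed simp

lemma left_pair_iff: "{x :: int ^ 2, x + axis i 1} = {z, z + axis i 1} \<longleftrightarrow> x = z"
proof
  assume "{x, x + axis i 1} = {z, z + axis i 1}"
  then have "(x = z \<and> x + axis i 1 = z + axis i 1) \<or> (x = z + axis i 1 \<and> x + axis i 1 = z)"
    by (simp only: doubleton_eq_iff)
  then show "x = z"
  proof (elim disjE conjE)
    assume 1: "x = z + axis i 1" and 2: "x + axis i 1 = z"
    show ?thesis using arg_cong[OF 1, of "\<lambda>v. v $ i"] arg_cong[OF 2, of "\<lambda>v. v $ i"]
      unfolding vector_add_component axis_ij by linarith
  qed
qed simp

lemma upper_left_pair: "{y - axis j 1, y :: int ^ 2} \<noteq> {x, x + axis i 1}"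
proof
  assume "{y - axis j 1, y} = {x, x + axis i 1}"
  then have 1: "y - axis j 1 \<in> {x, x + axis i 1}" and 2: "y \<in> {x, x + axis i 1}" by blast+
  have row: "v $ j = x $ j" if "v \<in> {x, x + axis i 1}" for v using that by auto
  show False using row[OF 1] row[OF 2] unfolding vector_minus_component axis_ij by linarith
qed

lemma cell_domino_ij:
  assumes "cell_domino d"
  obtains y where "d = {y - axis j 1, y}" | x where "d = {x, x + axis i 1}"
proof -
  obtain a b where ab: "adjacent a b" "d = {a, b}" using assms by (auto simp: cell_domino_def)
  then consider "b = a + axis i 1" | "a = b + axis i 1" | "b = a + axis j 1" | "a = b + axis j 1"
    using adjacent_ij by blast
  then show ?thesis
    by cases (use ab(2) that(1)[of a] that(1)[of b] that(2)[of a] that(2)[of b] in \<open>auto simp: insert_commute\<close>)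
qed

lemma sum_dominoes:
  fixes g :: "int ^ 2 \<Rightarrow> int"
  assumes f: "\<forall>d\<in>f. cell_domino d" "disjoint f" "finite f"
  shows "(\<Sum>x\<in>\<Union> f. g x) = (\<Sum>y\<in>uppers f. g y + g (y - axis j 1)) + (\<Sum>x\<in>lefts f. g x + g (x + axis i 1))"
proof -
  let ?u = "\<lambda>y. {y - axis j 1, y}" and ?l = "\<lambda>x. {x, x + axis i 1}"
  have feq: "f = ?u ` uppers f \<union> ?l ` lefts f"
  proof (intro equalityI subsetI)
    fix d assume d: "d \<in> f"
    then have "cell_domino d" using f by blast
    then show "d \<in> ?u ` uppers f \<union> ?l ` lefts f"
      by (cases rule: cell_domino_ij) (use d in \<open>auto simp: uppers_def lefts_def\<close>)
  qed (auto simp: uppers_def lefts_def)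
  have inj: "inj_on ?u (uppers f)" "inj_on ?l (lefts f)"
    by (rule inj_onI, simp only: upper_pair_iff) (rule inj_onI, simp only: left_pair_iff)
  have fin: "finite (?u ` uppers f)" "finite (?l ` lefts f)"
    using f(3) by (auto simp: uppers_def lefts_def intro!: finite_subset[of _ f])
  have "finite d \<and> (\<Sum>x\<in>d. g x) = (\<Sum>x\<in>d. g x)" if "d \<in> f" for d
    using f(1) that by (auto simp: cell_domino_def)
  then have "(\<Sum>x\<in>\<Union> f. g x) = (\<Sum>d\<in>f. \<Sum>x\<in>d. g x)"
    using f(2) by (subst sum.Union_disjoint) (auto simp: pairwise_def disjnt_def)
  also have "\<dots> = (\<Sum>d\<in>?u ` uppers f. \<Sum>x\<in>d. g x) + (\<Sum>d\<in>?l ` lefts f. \<Sum>x\<in>d. g x)"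
  proof -
    have "?u ` uppers f \<inter> ?l ` lefts f = {}" using upper_left_pair by auto
    then show ?thesis
      by (rule trans[OF arg_cong[OF feq, of "sum (sum g)"] sum.union_disjoint[OF fin]])
  qed
  also have "(\<Sum>d\<in>?u ` uppers f. \<Sum>x\<in>d. g x) = (\<Sum>y\<in>uppers f. g y + g (y - axis j 1))"
    by (subst sum.reindex[OF inj(1)]) (auto simp: vec_eq_ij intro!: sum.cong)
  also have "(\<Sum>d\<in>?l ` lefts f. \<Sum>x\<in>d. g x) = (\<Sum>x\<in>lefts f. g x + g (x + axis i 1))"
    by (subst sum.reindex[OF inj(2)]) (auto simp: vec_eq_ij intro!: sum.cong)
  finally show ?thesis .
qed

lemma finite_uppers: "finite f \<Longrightarrow> finite (uppers f)"
  by (rule finite_imageD[of "\<lambda>y. {y - axis j 1, y}"])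
     (auto simp: uppers_def inj_on_def upper_pair_iff intro: finite_subset[of _ f])

lemma R_Un: "finite X \<Longrightarrow> finite Y \<Longrightarrow> X \<inter> Y = {} \<Longrightarrow> R (X \<union> Y) b = R X b + R Y b"
  by (simp add: R_def sum.union_disjoint)

lemma R_pair: "a \<noteq> b \<Longrightarrow> R {a, b} c = chi a * K a c + chi b * K b c"
  by (simp add: R_def)

lemma tau_swap: "tau (q, f, p) = - tau (p, f, q)"
  by (simp add: tau_def sum_negf[symmetric] algebra_simps)

lemma floor_finite:
  assumes "(p, f, q) \<in> floors S"
  shows "finite p" "finite q" "finite f"
proof -
  show "finite p" "finite q" using assms finite_S by (auto simp: floors_iff intro: finite_subset)
  show "finite f" by (rule finite_subset[of _ "Pow S"]) (use assms finite_S in \<open>auto simp: floors_iff\<close>)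
qed

definition stack_shift :: "(int ^ 2) set \<Rightarrow> int ^ 2 \<Rightarrow> int ^ 2 \<Rightarrow> int" where
  "stack_shift q a b = (if b = a + axis j 1
     then - chi a * (R S a + R S b - 2 * (R q a + R q b)) else 0)"

text \<open>Standing the horizontal domino \<open>{a, b}\<close> up changes \<open>tau\<close> by an amount that depends only on
  the plug \<open>q\<close> shared by the two floors of the flip, so the two changes cancel.\<close>

lemma tau_stack:
  assumes fl: "(p, insert {a, b} f, q) \<in> floors S" and ab: "b = a + axis i 1 \<or> b = a + axis j 1"
    and nf: "{a, b} \<notin> f"
  shows "tau (p, insert {a, b} f, q) - tau (p, f, q \<union> {a, b}) = stack_shift q a b"
proof -
  have fl': "p \<subseteq> S" "q \<subseteq> S" "p \<inter> q = {}" "\<forall>d\<in>f. cell_domino d" "disjoint f" "\<Union> f \<union> {a, b} = S - (p \<union> q)"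
    "disjoint (insert {a, b} f)"
    using fl by (auto simp: floors_iff pairwise_insert)
  have fin: "finite p" "finite q" "finite f" using floor_finite[OF fl] by auto
  have dis: "{a, b} \<inter> \<Union> f = {}"
    using fl'(7) nf by (auto simp: pairwise_insert disjnt_def)
  have ne: "a \<noteq> b" using ab by (auto simp: vec_eq_ij)
  have qab: "q \<inter> {a, b} = {}" using fl'(6) by auto
  let ?A = "\<lambda>y. R p y - R q y"
  let ?A' = "\<lambda>y. R p y - R (q \<union> {a, b}) y"
  have A': "?A' y = ?A y - (chi a * K a y + chi b * K b y)" for y
    using R_Un[of q "{a, b}" y] fin qab ne by (simp add: R_pair)
  have notin: "y \<notin> {a, b}" "y - axis j 1 \<notin> {a, b}" if "y \<in> uppers f" for y
  proof -
    have "{y - axis j 1, y} \<in> f" using that by (simp add: uppers_def)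
    then show "y \<notin> {a, b}" "y - axis j 1 \<notin> {a, b}" using dis by blast+
  qed
  have notin': "x \<notin> {a, b}" "x + axis i 1 \<notin> {a, b}" if "x \<in> lefts f" for x
  proof -
    have "{x, x + axis i 1} \<in> f" using that by (simp add: lefts_def)
    then show "x \<notin> {a, b}" "x + axis i 1 \<notin> {a, b}" using dis by blast+
  qed
  let ?D = "\<Sum>y\<in>uppers f. chi y * ((chi a * K a y + chi b * K b y)
      + (chi a * K a (y - axis j 1) + chi b * K b (y - axis j 1)))"
  have tau': "tau (p, f, q \<union> {a, b}) = tau (p, f, q) - ?D"
    unfolding tau_def prod.case A' sum_subtractf[symmetric]
    by (intro sum.cong refl) (simp add: algebra_simps)
  show ?thesis
  proof (cases "b = a + axis j 1")
    case False
    then have b: "b = a + axis i 1" using ab by blast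
    have "uppers (insert {a, b} f) = uppers f"
      using upper_left_pair by (auto simp: uppers_def b)
    then have "tau (p, insert {a, b} f, q) = tau (p, f, q)" by (simp add: tau_def)
    moreover have "K a y = K b y" if "y \<notin> {a, b}" for y
      using K_step'[of y a] that by (auto simp: b)
    then have "?D = 0"
      using notin by (intro sum.neutral ballI) (simp add: b chi_axis)
    ultimately show ?thesis using tau' False by (simp add: stack_shift_def)
  next
    case b: True
    have chib: "chi b = - chi a" and ba: "b - axis j 1 = a" by (simp_all add: b chi_axis)
    have up: "uppers (insert {a, b} f) = insert b (uppers f)" "b \<notin> uppers f"
    proof -
      have "{y - axis j 1, y} = {a, b} \<longleftrightarrow> y = b" for y
        using upper_pair_iff[of y b] by (simp add: b)
      then show "uppers (insert {a, b} f) = insert b (uppers f)" by (auto simp: uppers_def)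
      show "b \<notin> uppers f" using notin by blast
    qed
    have tau1: "tau (p, insert {a, b} f, q) = - chi a * (?A b + ?A a) + tau (p, f, q)"
      unfolding tau_def prod.case up(1)
      by (subst sum.insert) (use finite_uppers[OF fin(3)] up(2) ba in \<open>auto simp: chib\<close>)
    \<comment> \<open>The signed row count seen from \<open>{a, b}\<close>. It cancels on dominoes
      in direction \<open>i\<close>, so its sum over those in direction \<open>j\<close> extends to
      all cells outside the plugs and \<open>{a, b}\<close>.\<close>
    define g where "g x = chi x * (K x a + K x b)" for x
    have "chi y * ((chi a * K a y + chi b * K b y) + (chi a * K a (y - axis j 1) + chi b * K b (y - axis j 1)))
        = - chi a * (g y + g (y - axis j 1))" for y
    proof -
      have 1: "K b y = K a (y - axis j 1)" using K_shift'[of a y] by (simp add: b)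
      have 2: "K y b = K (y - axis j 1) a" using K_shift[of "y - axis j 1" a] by (simp add: b)
      show ?thesis
        unfolding g_def chib 1 2 chi_diff_axis K_swap[of y a] K_swap[of "y - axis j 1" b]
        by (simp add: algebra_simps)
    qed
    then have D: "?D = - chi a * (\<Sum>y\<in>uppers f. g y + g (y - axis j 1))"
      by (simp add: sum_distrib_left)
    have "g x + g (x + axis i 1) = 0" if "x \<in> lefts f" for x
      using notin'[OF that] K_step'[of a x] K_step'[of b x] by (auto simp: g_def chi_axis)
    then have "(\<Sum>x\<in>\<Union> f. g x) = (\<Sum>y\<in>uppers f. g y + g (y - axis j 1))"
      using sum_dominoes[OF fl'(4,5) fin(3), of g] by simp
    then have D': "?D = - chi a * (\<Sum>x\<in>\<Union> f. g x)" using D by simp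
    have g0: "g a = 0" "g b = 0" by (auto simp: g_def b K_column)
    have finU: "finite (\<Union> f)" using fl'(6) finite_S by (metis finite_Diff finite_Un)
    have S: "S = (p \<union> q) \<union> ({a, b} \<union> \<Union> f)" using fl' by blast
    have "(\<Sum>x\<in>S. g x) = (\<Sum>x\<in>p \<union> q. g x) + (\<Sum>x\<in>{a, b} \<union> \<Union> f. g x)"
      by (rule trans[OF arg_cong[OF S, of "sum g"] sum.union_disjoint]) (use fin finU fl' finite_S in auto)
    also have "(\<Sum>x\<in>p \<union> q. g x) = (\<Sum>x\<in>p. g x) + (\<Sum>x\<in>q. g x)"
      by (rule sum.union_disjoint) (use fin fl' in auto)
    also have "(\<Sum>x\<in>{a, b} \<union> \<Union> f. g x) = (\<Sum>x\<in>{a, b}. g x) + (\<Sum>x\<in>\<Union> f. g x)"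
      by (rule sum.union_disjoint) (use finU dis in auto)
    also have "(\<Sum>x\<in>{a, b}. g x) = 0" using ne by (simp add: g0)
    finally have sums: "(\<Sum>x\<in>\<Union> f. g x) = (\<Sum>x\<in>S. g x) - (\<Sum>x\<in>p. g x) - (\<Sum>x\<in>q. g x)" by simp
    have Rg: "R X a + R X b = (\<Sum>x\<in>X. g x)" for X
      by (simp add: R_def g_def sum.distrib[symmetric] algebra_simps)
    have "tau (p, insert {a, b} f, q) - tau (p, f, q \<union> {a, b}) = - chi a * (?A b + ?A a) + ?D"
      using tau1 tau' by simp
    also have "\<dots> = - chi a * ((R p a + R p b) - (R q a + R q b) + (\<Sum>x\<in>\<Union> f. g x))"
      unfolding D' by (simp add: algebra_simps)
    also have "\<dots> = - chi a * (R S a + R S b - 2 * (R q a + R q b))"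
      unfolding sums Rg by (simp add: algebra_simps)
    finally show ?thesis using b by (simp add: stack_shift_def)
  qed
qed

lemma tau_stack_upper:
  assumes fl: "(q, insert {a, b} f, r) \<in> floors S" and ab: "b = a + axis i 1 \<or> b = a + axis j 1"
    and nf: "{a, b} \<notin> f"
  shows "tau (q, insert {a, b} f, r) - tau (q \<union> {a, b}, f, r) = - stack_shift q a b"
proof -
  have "(r, insert {a, b} f, q) \<in> floors S" using opp_edge[OF fl] by simp
  from tau_stack[OF this ab nf] show ?thesis
    using tau_swap[of r "insert {a, b} f" q] tau_swap[of r f "q \<union> {a, b}"] by simp
qed

text \<open>The two dominoes in direction \<open>j\<close> have opposite signs and see the same plug
  counts, since no vertical domino stands at their cells; so they cancel. Dominoes in direction
  \<open>i\<close> do not contribute.\<close>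

lemma tau_flat:
  assumes fin: "finite f" "finite p" "finite q"
    and d: "x \<notin> p \<union> q" "x + axis i 1 \<notin> p \<union> q" "x + axis j 1 \<notin> p \<union> q" "x + axis j 1 + axis i 1 \<notin> p \<union> q"
    and nf: "x + axis j 1 \<notin> uppers f" "x + axis j 1 + axis i 1 \<notin> uppers f"
  shows "tau (p, f \<union> {{x, x + axis j 1}, {x + axis i 1, x + axis i 1 + axis j 1}}, q) = tau (p, f, q)"
    and "tau (p, f \<union> {{x, x + axis i 1}, {x + axis j 1, x + axis j 1 + axis i 1}}, q) = tau (p, f, q)"
proof -
  let ?y = "x + axis j 1" and ?z = "x + axis j 1 + axis i 1"
  have comm: "x + axis i 1 + axis j 1 = ?z" by (simp add: add_ac)
  have "{y - axis j 1, y} = {x, ?y} \<longleftrightarrow> y = ?y" for y using upper_pair_iff[of y ?y] by simp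
  moreover have "{y - axis j 1, y} = {x + axis i 1, ?z} \<longleftrightarrow> y = ?z" for y
    using upper_pair_iff[of y ?z] by (simp add: add_ac)
  ultimately have up: "uppers (f \<union> {{x, ?y}, {x + axis i 1, x + axis i 1 + axis j 1}}) = insert ?y (insert ?z (uppers f))"
    unfolding comm by (auto simp: uppers_def)
  have ne: "?y \<noteq> ?z" by (simp add: vec_eq_ij)
  have Rx: "R X (c + axis i 1) = R X c" if "c \<notin> X" "c + axis i 1 \<notin> X" for X c
    unfolding R_def
  proof (intro sum.cong refl)
    fix x assume "x \<in> X"
    then have "x \<noteq> c" "x \<noteq> c + axis i 1" using that by auto
    then show "chi x * K x (c + axis i 1) = chi x * K x c" using K_step by simp
  qed
  have Ry: "R p ?z = R p ?y" "R q ?z = R q ?y" "R p (x + axis i 1) = R p x" "R q (x + axis i 1) = R q x"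
    using d by (auto intro!: Rx)
  have z: "?z - axis j 1 = x + axis i 1" by (simp add: add_ac)
  show "tau (p, f \<union> {{x, ?y}, {x + axis i 1, x + axis i 1 + axis j 1}}, q) = tau (p, f, q)"
    unfolding tau_def prod.case up using finite_uppers[OF fin(1)] nf ne
    by (simp add: z Ry chi_axis)
  have "uppers (f \<union> {{x, x + axis i 1}, {?y, ?y + axis i 1}}) = uppers f"
    using upper_left_pair by (auto simp: uppers_def)
  then show "tau (p, f \<union> {{x, x + axis i 1}, {x + axis j 1, x + axis j 1 + axis i 1}}, q) = tau (p, f, q)"
    by (simp add: tau_def)
qed

section \<open>Integrality of the twist: \<open>tau\<close> modulo 4\<close>

definition bform :: "(int ^ 2) set \<Rightarrow> (int ^ 2) set \<Rightarrow> int" where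
  "bform X Y = (\<Sum>b\<in>Y. chi b * R X b)"

definition same_row :: "(int ^ 2) set \<Rightarrow> (int ^ 2) set \<Rightarrow> int" where
  "same_row X Y = (\<Sum>a\<in>X. \<Sum>b\<in>Y. of_bool (a $ j = b $ j))"

definition below :: "(int ^ 2) set \<Rightarrow> (int ^ 2) set \<Rightarrow> int" where
  "below X Y = (\<Sum>a\<in>X. \<Sum>b\<in>Y. of_bool (b $ j < a $ j))"

text \<open>Chosen so that modulo 4 \<open>tau\<close> is the drop of \<open>potential\<close>
  across the floor; along closed walks the drops cancel.\<close>

definition potential :: "(int ^ 2) set \<Rightarrow> int" where
  "potential p = 2 * (below p S + below p p) - bform p S"

lemma bform_swap: "bform Y X = - bform X Y"
proof -
  have "bform Y X = (\<Sum>b\<in>X. \<Sum>a\<in>Y. chi b * (chi a * K a b))" by (simp add: bform_def R_def sum_distrib_left)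
  also have "\<dots> = (\<Sum>a\<in>Y. \<Sum>b\<in>X. chi b * (chi a * K a b))" by (rule sum.swap)
  also have "\<dots> = - bform X Y"
    unfolding bform_def R_def sum_distrib_left sum_negf[symmetric]
  proof (intro sum.cong refl)
    fix a b
    have "K a b = - K b a" by (rule K_swap)
    then show "chi b * (chi a * K a b) = - (chi a * (chi b * K b a))" by simp
  qed
  finally show ?thesis .
qed

lemma bform_parity:
  assumes "X \<inter> Y = {}" "finite X" "finite Y"
  shows "even (bform X Y - same_row X Y)"
proof -
  have "bform X Y - same_row X Y = (\<Sum>a\<in>X. \<Sum>b\<in>Y. chi b * (chi a * K a b) - of_bool (a $ j = b $ j))"
    unfolding bform_def R_def same_row_def sum_distrib_left
    by (subst sum.swap) (simp add: sum_subtractf)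
  moreover have "even (chi b * (chi a * K a b) - of_bool (a $ j = b $ j))" if "a \<in> X" "b \<in> Y" for a b
  proof (cases "a $ j = b $ j")
    case True
    then have "a $ i \<noteq> b $ i" using that assms vec_eq_ij[of a b] by auto
    then have "odd (K a b)" using True by (auto simp: K_def sgn_if)
    then show ?thesis using True by simp
  qed (simp add: K_def)
  ultimately show ?thesis by (auto intro!: dvd_sum)
qed

lemma row_trichotomy: "same_row X Y + below X Y + below Y X = int (card X) * int (card Y)"
proof -
  have "below Y X = (\<Sum>a\<in>X. \<Sum>b\<in>Y. of_bool (a $ j < b $ j))"
    unfolding below_def by (rule sum.swap)
  then have "same_row X Y + below X Y + below Y X
     = (\<Sum>a\<in>X. \<Sum>b\<in>Y. of_bool (a $ j = b $ j) + of_bool (b $ j < a $ j) + of_bool (a $ j < b $ j))"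
    by (simp add: same_row_def below_def sum.distrib)
  also have "\<dots> = (\<Sum>a\<in>X. \<Sum>b\<in>Y. 1)" by (intro sum.cong refl) auto
  finally show ?thesis by simp
qed

text \<open>Cells below the line at height \<open>y\<close> are counted: a domino in direction
  \<open>j\<close> contributes an odd number exactly when it straddles the line, one in direction
  \<open>i\<close> always an even number.\<close>

lemma row_crossings:
  assumes fl: "(p, f, q) \<in> floors S"
  shows "even ((\<Sum>b\<in>uppers f. of_bool (y = b $ j)) -
     ((\<Sum>b\<in>S. of_bool (b $ j < y)) + (\<Sum>b\<in>p. of_bool (b $ j < y)) + (\<Sum>b\<in>q. of_bool (b $ j < y))) :: int)"
proof -
  let ?g = "\<lambda>b. of_bool (b $ j < y) :: int"
  have f: "\<forall>d\<in>f. cell_domino d" "disjoint f" "\<Union> f = S - (p \<union> q)" "p \<inter> q = {}" "p \<subseteq> S" "q \<subseteq> S"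
    using fl by (auto simp: floors_iff)
  have fin: "finite p" "finite q" "finite f" using floor_finite[OF fl] by auto
  have "(\<Sum>b\<in>S. ?g b) = (\<Sum>b\<in>\<Union> f. ?g b) + (\<Sum>b\<in>p \<union> q. ?g b)"
    using sum.subset_diff[of "p \<union> q" S ?g] f finite_S by simp
  also have "(\<Sum>b\<in>p \<union> q. ?g b) = (\<Sum>b\<in>p. ?g b) + (\<Sum>b\<in>q. ?g b)"
    by (rule sum.union_disjoint) (use fin f in auto)
  also have "(\<Sum>b\<in>\<Union> f. ?g b) = (\<Sum>b\<in>uppers f. ?g b + ?g (b - axis j 1)) + (\<Sum>b\<in>lefts f. ?g b + ?g (b + axis i 1))"
    by (rule sum_dominoes[OF f(1,2) fin(3)])
  also have "(\<Sum>b\<in>lefts f. ?g b + ?g (b + axis i 1)) = 2 * (\<Sum>b\<in>lefts f. ?g b)"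
    by (simp add: sum_distrib_left)
  also have "(\<Sum>b\<in>uppers f. ?g b + ?g (b - axis j 1)) = (\<Sum>b\<in>uppers f. of_bool (y = b $ j)) + 2 * (\<Sum>b\<in>uppers f. ?g b)"
    unfolding sum_distrib_left sum.distrib[symmetric] by (intro sum.cong refl) auto
  finally show ?thesis by simp
qed

text \<open>Antisymmetry of \<open>bform\<close> expresses \<open>tau\<close> as twice a sum
  \<open>?B\<close> plus plug terms, so only the parity of \<open>?B\<close> matters. Modulo 2 the
  signs disappear, and \<open>row_crossings\<close> evaluates the count of pairs in a common row
  through the plugs.\<close>

lemma tau_mod_4:
  assumes fl: "(p, f, q) \<in> floors S" and ev: "even (card p)"
  shows "4 dvd tau (p, f, q) - (potential p - potential q)"
proof -
  have f: "\<forall>d\<in>f. cell_domino d" "disjoint f" "\<Union> f = S - (p \<union> q)" "p \<inter> q = {}" "p \<subseteq> S" "q \<subseteq> S"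
    using fl by (auto simp: floors_iff)
  have fin: "finite p" "finite q" "finite f" using floor_finite[OF fl] by auto
  let ?U = "uppers f"
  have finU: "finite ?U" by (rule finite_uppers[OF fin(3)])
  have Usub: "?U \<subseteq> S - (p \<union> q)" unfolding f(3)[symmetric] by (auto simp: uppers_def)
  define low where "low X = (\<Sum>y\<in>?U. chi (y - axis j 1) * R X (y - axis j 1))" for X
  have tau: "tau (p, f, q) = bform p ?U - bform q ?U - low p + low q"
    by (simp add: tau_def bform_def low_def chi_diff_axis sum_subtractf[symmetric] sum.distrib[symmetric] sum_negf algebra_simps)
  have dec: "bform X S = bform X p + bform X q + bform X ?U + low X" if X: "X \<subseteq> p \<union> q" for X
  proof -
    let ?g = "\<lambda>b. chi b * R X b"
    have "bform X S = (\<Sum>b\<in>\<Union> f. ?g b) + (\<Sum>b\<in>p \<union> q. ?g b)"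
      unfolding bform_def using sum.subset_diff[of "p \<union> q" S ?g] f finite_S by simp
    also have "(\<Sum>b\<in>p \<union> q. ?g b) = bform X p + bform X q"
      unfolding bform_def by (rule sum.union_disjoint) (use fin f in auto)
    also have "(\<Sum>b\<in>\<Union> f. ?g b) = (\<Sum>y\<in>?U. ?g y + ?g (y - axis j 1)) + (\<Sum>x\<in>lefts f. ?g x + ?g (x + axis i 1))"
      by (rule sum_dominoes[OF f(1,2) fin(3)])
    also have "(\<Sum>x\<in>lefts f. ?g x + ?g (x + axis i 1)) = 0"
    proof (intro sum.neutral ballI)
      fix x assume "x \<in> lefts f"
      then have "x \<in> \<Union> f" "x + axis i 1 \<in> \<Union> f" by (auto simp: lefts_def)
      then have "x \<notin> X" "x + axis i 1 \<notin> X" using X f(3) by auto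
      then have "R X (x + axis i 1) = R X x"
        unfolding R_def
      proof (intro sum.cong refl)
        fix z assume "z \<in> X"
        then have "z \<noteq> x" "z \<noteq> x + axis i 1" using \<open>x \<notin> X\<close> \<open>x + axis i 1 \<notin> X\<close> by auto
        then show "chi z * K z (x + axis i 1) = chi z * K z x" using K_step by simp
      qed
      then show "?g x + ?g (x + axis i 1) = 0" by (simp add: chi_axis)
    qed
    finally show ?thesis by (simp add: bform_def low_def sum.distrib)
  qed
  have self: "bform X X = 0" for X using bform_swap[of X X] by simp
  let ?B = "bform p ?U - bform q ?U + bform p q"
  have tauB: "tau (p, f, q) = 2 * ?B - bform p S + bform q S"
    using dec[of p] dec[of q] self[of p] self[of q] bform_swap[of p q] tau by simp
  have cross: "even (same_row X ?U - (below X S + below X p + below X q))" for X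
  proof -
    have "same_row X ?U - (below X S + below X p + below X q) = (\<Sum>a\<in>X. (\<Sum>b\<in>?U. of_bool (a $ j = b $ j)) -
     ((\<Sum>b\<in>S. of_bool (b $ j < a $ j)) + (\<Sum>b\<in>p. of_bool (b $ j < a $ j)) + (\<Sum>b\<in>q. of_bool (b $ j < a $ j))))"
      by (simp add: same_row_def below_def sum_subtractf sum.distrib)
    then show ?thesis using row_crossings[OF fl] by (auto intro!: dvd_sum)
  qed
  have e1: "even (bform p ?U - same_row p ?U)" "even (bform q ?U - same_row q ?U)" "even (bform p q - same_row p q)"
    by (rule bform_parity; use Usub f(4) fin finU in blast)+
  \<comment> \<open>Here the parity of \<open>card p\<close> enters.\<close>
  have tri: "even (same_row p q + below p q + below q p)"
    unfolding row_trichotomy using ev by simp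
  let ?h = "\<lambda>p. below p S + below p p"
  have "even (?B - (?h p + ?h q))"
    using e1 tri cross[of p] cross[of q] by presburger
  then obtain c where c: "?B = ?h p + ?h q + 2 * c" by (metis add.commute diff_add_cancel dvdE)
  have "tau (p, f, q) - (potential p - potential q) = 4 * (c + ?h q)"
    unfolding tauB c potential_def by simp
  then show ?thesis by simp
qed

end

section \<open>The geometric twist as a sum over pairs of cells\<close>

lemma chi_lift: "chi (lift x k) = (if even k then chi x else - chi x)"
proof -
  have "(\<Sum>t\<in>UNIV. lift x k $ t) = (\<Sum>t\<in>UNIV. x $ t) + k" by (simp add: sum_3 sum_2)
  then show ?thesis by (auto simp: chi_def black_def)
qed

lemma chi_adjacent: "adjacent p q \<Longrightarrow> chi q = - chi p"
  by (auto simp: adjacent_def chi_axis)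

lemma domino_vec_brick:
  assumes "adjacent c c'"
  shows "domino_vec (brick {c, c'}) = of_int (chi c) *\<^sub>R (center c - center c')"
  unfolding domino_vec_def
proof (rule the_equality)
  have "chi c' = - chi c" by (rule chi_adjacent[OF assms])
  then have bl: "black c' \<longleftrightarrow> \<not> black c" by (auto simp: chi_def split: if_splits)
  show "\<exists>p q. adjacent p q \<and> brick {c, c'} = cell p \<union> cell q \<and> black p \<and> \<not> black q \<and>
      of_int (chi c) *\<^sub>R (center c - center c') = center p - center q"
  proof (cases "black c")
    case True
    then show ?thesis using assms bl by (intro exI[of _ c] exI[of _ c']) (auto simp: brick_pair chi_def)
  next
    case False
    then have "black c'" "adjacent c' c" using assms bl adjacent_sym[of c c'] by auto
    then show ?thesis
      by - (rule exI[of _ c'], rule exI[of _ c], use False in \<open>auto simp: brick_pair chi_def\<close>)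
  qed
  fix w assume "\<exists>p q. adjacent p q \<and> brick {c, c'} = cell p \<union> cell q \<and> black p \<and> \<not> black q \<and>
      w = center p - center q"
  then obtain p q where pq: "brick {c, c'} = brick {p, q}" "black p" "\<not> black q" "w = center p - center q"
    by (auto simp: brick_pair)
  then have "{c, c'} = {p, q}" by (simp add: inj_eq[OF inj_brick])
  then have "(c = p \<and> c' = q) \<or> (c = q \<and> c' = p)" by (simp only: doubleton_eq_iff)
  then show "w = of_int (chi c) *\<^sub>R (center c - center c')"
    using pq by (elim disjE conjE) (simp_all add: chi_def)
qed

text \<open>The shade is open, so a meeting point can be moved into the interior of a cell of
  \<open>d1\<close>; this discards contact along faces and leaves cells on a common line.\<close>

lemma brick_meets_shade_iff:
  fixes \<sigma> :: int and I :: 3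
  assumes \<sigma>: "\<sigma> = 1 \<or> \<sigma> = - 1"
  shows "brick d1 \<inter> shade (of_int \<sigma> *\<^sub>R axis I 1) (brick d0) \<noteq> {} \<longleftrightarrow>
    (\<exists>a\<in>d0. \<exists>b\<in>d1 - d0. \<exists>n>0. b = a + axis I (\<sigma> * n))" (is "?L \<longleftrightarrow> ?R")
proof -
  let ?u = "of_int \<sigma> *\<^sub>R axis I 1 :: real ^ 3"
  let ?X = "(\<Union>s\<in>{0..}. (\<lambda>x. x + s *\<^sub>R ?u) ` brick d0) - brick d0"
  show ?thesis
  proof
    assume ?L
    then obtain x where x: "x \<in> brick d1" "x \<in> interior ?X" by (auto simp: shade_def)
    obtain b where b: "b \<in> d1" "x \<in> cell b" using x(1) by (auto simp: brick_def)
    obtain y where y: "y \<in> interior ?X" "y \<in> interior (cell b)"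
      using interior_cell_meets[OF open_interior x(2) b(2)] by blast
    then have yX: "y \<in> ?X" using interior_subset by blast
    then obtain s z where s: "s \<ge> 0" "z \<in> brick d0" "y = z + s *\<^sub>R ?u" and yd: "y \<notin> brick d0" by auto
    obtain a where a: "a \<in> d0" "z \<in> cell a" using s(2) by (auto simp: brick_def)
    have bd: "b \<notin> d0" using yd y(2) interior_subset by (auto simp: brick_def)
    have yb: "of_int (b $ t) < y $ t" "y $ t < of_int (b $ t) + 1" for t
      using y(2) by (auto simp: interior_cell)
    have za: "of_int (a $ t) \<le> z $ t" "z $ t \<le> of_int (a $ t) + 1" for t
      using a(2) by (auto simp: mem_cell)
    have other: "a $ t = b $ t" if "t \<noteq> I" for t
    proof -
      have "y $ t = z $ t" using that by (simp add: s(3) axis_def)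
      then have "real_of_int (a $ t) < of_int (b $ t + 1)" "real_of_int (b $ t) < of_int (a $ t + 1)"
        using yb[of t] za[of t] by auto
      then show ?thesis unfolding of_int_less_iff by simp
    qed
    have yI: "y $ I = z $ I + s * of_int \<sigma>" by (simp add: s(3))
    have ge: "\<sigma> * (b $ I - a $ I) \<ge> 0"
    proof (cases "\<sigma> = 1")
      case True
      then have "real_of_int (a $ I) < of_int (b $ I + 1)" using yI s(1) yb[of I] za[of I] by auto
      then show ?thesis using True unfolding of_int_less_iff by simp
    next
      case False
      then have "\<sigma> = - 1" using \<sigma> by blast
      then have "real_of_int (b $ I) < of_int (a $ I + 1)" using yI s(1) yb[of I] za[of I] by auto
      then show ?thesis using \<open>\<sigma> = - 1\<close> unfolding of_int_less_iff by simp
    qed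
    have beq: "b = a + axis I (\<sigma> * (\<sigma> * (b $ I - a $ I)))"
      using other \<sigma> by (auto simp: vec_eq_iff axis_def)
    have "\<sigma> * (b $ I - a $ I) \<noteq> 0"
    proof
      assume "\<sigma> * (b $ I - a $ I) = 0"
      then have "b $ I = a $ I" using \<sigma> by auto
      then have "b = a" using other by (metis vec_eq_iff)
      then show False using bd a(1) by simp
    qed
    then have "\<sigma> * (b $ I - a $ I) > 0" using ge by linarith
    then show ?R using a(1) b(1) bd beq by blast
  next
    assume ?R
    then obtain a b n where ab: "a \<in> d0" "b \<in> d1" "b \<notin> d0" "n > 0" "b = a + axis I (\<sigma> * n)" by auto
    have "interior (cell b) \<subseteq> ?X"
    proof
      fix y assume y: "y \<in> interior (cell b)"
      define z where "z = y - of_int n *\<^sub>R ?u"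
      have "z \<in> cell a"
        using y by (auto simp: z_def interior_cell mem_cell ab(5) axis_def less_imp_le split: if_splits)
           (smt (verit) mult.commute of_int_mult)+
      then have "y \<in> (\<lambda>x. x + of_int n *\<^sub>R ?u) ` brick d0"
        using ab(1) by (intro image_eqI[of _ _ z]) (auto simp: z_def brick_def)
      then have "y \<in> (\<Union>s\<in>{0..}. (\<lambda>x. x + s *\<^sub>R ?u) ` brick d0)"
        using ab(4) by (intro UN_I[of "of_int n"]) auto
      moreover have "y \<notin> brick d0"
        using interior_cell_unique[OF y] ab(3) by (auto simp: brick_def)
      ultimately show "y \<in> ?X" by blast
    qed
    then have "interior (cell b) \<subseteq> interior ?X" by (rule interior_maximal) simp
    moreover have "center b \<in> brick d1" using ab(2) by (simp add: center_brick_iff)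
    ultimately show ?L using center_interior[of b] by (auto simp: shade_def)
  qed
qed

definition ray :: "3 \<Rightarrow> int \<Rightarrow> int ^ 3 \<Rightarrow> int ^ 3 \<Rightarrow> real" where
  "ray I \<sigma> a b = of_bool (\<exists>n>0. b = a + axis I (\<sigma> * n))"

lemma domino_direction:
  assumes "cell_domino d"
  shows "\<exists>J. (\<forall>a\<in>d. \<forall>a'\<in>d. \<forall>t. t \<noteq> J \<longrightarrow> a $ t = a' $ t) \<and> (\<forall>t. t \<noteq> J \<longrightarrow> domino_vec (brick d) $ t = 0)"
proof -
  obtain c c' where c: "adjacent c c'" "d = {c, c'}" using assms by (auto simp: cell_domino_def)
  then obtain J where "c' = c + axis J 1 \<or> c = c' + axis J 1" by (auto simp: adjacent_def)
  then have "\<forall>t. t \<noteq> J \<longrightarrow> c $ t = c' $ t" by (auto simp: axis_def)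
  then show ?thesis
    using domino_vec_brick[OF c(1)] c(2) by (intro exI[of _ J]) (auto simp: center_def)
qed

text \<open>A nonzero determinant forces the two dominoes and \<open>u\<close> to be pairwise orthogonal; then at most
  one pair of cells of the two dominoes lies on a common line in direction \<open>u\<close>.\<close>

lemma effect_eq_sum:
  fixes \<sigma> :: int and I :: 3
  assumes \<sigma>: "\<sigma> = 1 \<or> \<sigma> = - 1" and d0: "cell_domino d0" and d1: "cell_domino d1"
  defines "u \<equiv> of_int \<sigma> *\<^sub>R axis I 1"
  shows "effect u (brick d0) (brick d1) =
    (\<Sum>a\<in>d0. \<Sum>b\<in>d1. 1 / 4 * (ray I \<sigma> a b * det (vector [domino_vec (brick d1), domino_vec (brick d0), u])))"
proof (cases "det (vector [domino_vec (brick d1), domino_vec (brick d0), u]) = 0")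
  case True
  then show ?thesis by (simp add: effect_def)
next
  case False
  let ?det = "det (vector [domino_vec (brick d1), domino_vec (brick d0), u])"
  obtain J0 where J0: "\<And>a a' t. a \<in> d0 \<Longrightarrow> a' \<in> d0 \<Longrightarrow> t \<noteq> J0 \<Longrightarrow> a $ t = a' $ t"
      "\<And>t. t \<noteq> J0 \<Longrightarrow> domino_vec (brick d0) $ t = 0"
    using domino_direction[OF d0] by blast
  obtain J1 where J1: "\<And>a a' t. a \<in> d1 \<Longrightarrow> a' \<in> d1 \<Longrightarrow> t \<noteq> J1 \<Longrightarrow> a $ t = a' $ t"
      "\<And>t. t \<noteq> J1 \<Longrightarrow> domino_vec (brick d1) $ t = 0"
    using domino_direction[OF d1] by blast
  have u: "\<And>t. t \<noteq> I \<Longrightarrow> u $ t = 0" by (simp add: u_def axis_def)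
  have ne: "J0 \<noteq> J1" "J0 \<noteq> I" "J1 \<noteq> I"
    using False J0(2) J1(2) u exhaust_3[of J0] exhaust_3[of J1] exhaust_3[of I]
    unfolding det_3 vector_3 by auto
  have rayE: "b $ t = a $ t" if "ray I \<sigma> a b \<noteq> 0" "t \<noteq> I" for a b t
    using that by (auto simp: ray_def axis_def)
  have unique: "a = a' \<and> b = b'"
    if r: "ray I \<sigma> a b \<noteq> 0" "ray I \<sigma> a' b' \<noteq> 0" and m: "a \<in> d0" "a' \<in> d0" "b \<in> d1" "b' \<in> d1" for a b a' b'
  proof
    have "a $ J0 = a' $ J0"
      using rayE[OF r(1), of J0] rayE[OF r(2), of J0] J1(1)[OF m(3,4), of J0] ne by simp
    then show "a = a'" using J0(1)[OF m(1,2)] by (metis vec_eq_iff)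
    have "b $ J1 = b' $ J1"
      using rayE[OF r(1), of J1] rayE[OF r(2), of J1] J0(1)[OF m(1,2), of J1] ne by simp
    then show "b = b'" using J1(1)[OF m(3,4)] by (metis vec_eq_iff)
  qed
  have notin: "b \<notin> d0" if "ray I \<sigma> a b \<noteq> 0" "a \<in> d0" for a b
  proof
    assume "b \<in> d0"
    then have bI: "b $ I = a $ I" using J0(1)[of b a I] that ne by auto
    have "\<exists>n>0. b = a + axis I (\<sigma> * n)" using that(1) by (simp add: ray_def)
    then obtain n where "n > 0" "b = a + axis I (\<sigma> * n)" by blast
    then show False using \<sigma> bI by auto
  qed
  have meets: "brick d1 \<inter> shade u (brick d0) \<noteq> {} \<longleftrightarrow> (\<exists>a\<in>d0. \<exists>b\<in>d1. ray I \<sigma> a b \<noteq> 0)"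
  proof -
    have "ray I \<sigma> a b \<noteq> 0 \<longleftrightarrow> (\<exists>n>0. b = a + axis I (\<sigma> * n))" for a b by (simp add: ray_def)
    then show ?thesis unfolding u_def brick_meets_shade_iff[OF \<sigma>] using notin by blast
  qed
  have fin: "finite d0" "finite d1" using d0 d1 by (auto simp: cell_domino_def)
  have sum: "(\<Sum>a\<in>d0. \<Sum>b\<in>d1. ray I \<sigma> a b) = of_bool (\<exists>a\<in>d0. \<exists>b\<in>d1. ray I \<sigma> a b \<noteq> 0)"
  proof (cases "\<exists>a\<in>d0. \<exists>b\<in>d1. ray I \<sigma> a b \<noteq> 0")
    case True
    then obtain a b where ab: "a \<in> d0" "b \<in> d1" "ray I \<sigma> a b \<noteq> 0" by blast
    have one: "ray I \<sigma> a' b' = (if a' = a \<and> b' = b then 1 else 0)" if "a' \<in> d0" "b' \<in> d1" for a' b'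
    proof (cases "a' = a \<and> b' = b")
      case True
      then show ?thesis using ab(3) by (simp add: ray_def)
    next
      case False
      then have "ray I \<sigma> a' b' = 0" using unique[OF ab(3) _ ab(1) that(1) ab(2) that(2)] by blast
      then show ?thesis using False by simp
    qed
    have "(\<Sum>a'\<in>d0. \<Sum>b'\<in>d1. ray I \<sigma> a' b') = (\<Sum>a'\<in>d0. \<Sum>b'\<in>d1. (if a' = a \<and> b' = b then 1 else 0))"
      using one by (intro sum.cong refl) auto
    also have "\<dots> = (\<Sum>a'\<in>d0. if a' = a then 1 else 0)"
      by (intro sum.cong refl) (use fin ab in auto)
    also have "\<dots> = 1" using fin ab by simp
    finally show ?thesis using True by simp
  qed (auto intro!: sum.neutral)
  have "(\<Sum>a\<in>d0. \<Sum>b\<in>d1. 1 / 4 * (ray I \<sigma> a b * ?det)) = 1 / 4 * ?det * (\<Sum>a\<in>d0. \<Sum>b\<in>d1. ray I \<sigma> a b)"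
    unfolding sum_distrib_left by (intro sum.cong refl) simp
  then show ?thesis unfolding sum effect_def meets by simp
qed

context floor_twist
begin

definition twist_sum :: "nat \<Rightarrow> (int ^ 3) set set \<Rightarrow> int" where
  "twist_sum N m = (\<Sum>k\<in>{0..<int N}. tau (plug m k, flat m k, plug m (k + 1)))"

definition cell_vec :: "(int ^ 3) set set \<Rightarrow> int ^ 3 \<Rightarrow> real ^ 3" where
  "cell_vec m c = domino_vec (brick (THE d. d \<in> m \<and> c \<in> d))"

lemma cell_vec_eq:
  assumes "m \<in> matchings S N" "d \<in> m" "c \<in> d"
  shows "cell_vec m c = domino_vec (brick d)"
proof -
  have "(THE d. d \<in> m \<and> c \<in> d) = d"
    by (rule the_equality) (use assms matching_unique in blast)+
  then show ?thesis by (simp add: cell_vec_def)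
qed

lemma cell_vec_components:
  assumes m: "m \<in> matchings S N" and k: "0 \<le> k" "k < int N" and x: "x \<in> S"
  shows "cell_vec m (lift x k) $ 3 =
      of_int (chi (lift x k) * (of_bool (x \<in> plug m k) - of_bool (x \<in> plug m (k + 1))))"
    and "cell_vec m (lift x k) $ up_axis j =
      of_int (chi (lift x k) * (of_bool (x \<in> uppers (flat m k)) - of_bool (x + axis j 1 \<in> uppers (flat m k))))"
proof -
  let ?c = "lift x k" and ?F = "flat m k"
  let ?P1 = "cell_vec m ?c $ 3 = of_int (chi ?c * (of_bool (x \<in> plug m k) - of_bool (x \<in> plug m (k + 1))))"
  let ?P2 = "cell_vec m ?c $ up_axis j = of_int (chi ?c * (of_bool (x \<in> uppers ?F) - of_bool (x + axis j 1 \<in> uppers ?F)))"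
  have "?c \<in> \<Union> m" using m k x by (simp add: matchings_def)
  then obtain d where d: "d \<in> m" "?c \<in> d" by blast
  have dom: "cell_domino d" using m d by (simp add: matchings_def)
  have fl: "(plug m k, ?F, plug m (k + 1)) \<in> floors S" by (rule word_floor[OF m k])
  then have E: "plug m k \<inter> plug m (k + 1) = {}" "\<Union> ?F = S - (plug m k \<union> plug m (k + 1))" "disjoint ?F"
    by (auto simp: floors_iff)
  have upF: "x \<in> \<Union> ?F" if "x \<in> uppers ?F \<or> x + axis j 1 \<in> uppers ?F"
    using that by (auto simp: uppers_def)
  have uj: "lift a l $ up_axis t = a $ t" for a l t
    using exhaust_2[of t] by (auto simp: up_axis_def)
  have vec: "cell_vec m ?c = of_int (chi ?c) *\<^sub>R (center ?c - center c')"
    if "{?c, c'} \<in> m" "adjacent ?c c'" for c'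
    using cell_vec_eq[OF m that(1), of ?c] domino_vec_brick[OF that(2)] by simp
  from dom d(2) have "?P1 \<and> ?P2"
  proof (cases rule: cell_domino_cases)
    case 1
    then have "x \<in> plug m (k + 1)" using d(1) by (simp add: plug_def)
    moreover have "cell_vec m ?c = of_int (chi ?c) *\<^sub>R (center ?c - center (lift x (k + 1)))"
      by (rule vec) (use 1 d(1) in \<open>auto simp: adjacent_lift\<close>)
    moreover have "x \<notin> plug m k" "x \<notin> \<Union> ?F" using E \<open>x \<in> plug m (k + 1)\<close> by blast+
    moreover from this have "x \<notin> uppers ?F" "x + axis j 1 \<notin> uppers ?F" using upF by blast+
    ultimately show ?thesis by (simp add: center_def uj)
  next
    case 2
    then have "x \<in> plug m k" using d(1) by (simp add: plug_def)
    moreover have "cell_vec m ?c = of_int (chi ?c) *\<^sub>R (center ?c - center (lift x (k - 1)))"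
      by (rule vec) (use 2 d(1) in \<open>auto simp: adjacent_lift insert_commute\<close>)
    moreover have "x \<notin> plug m (k + 1)" "x \<notin> \<Union> ?F" using E \<open>x \<in> plug m k\<close> by blast+
    moreover from this have "x \<notin> uppers ?F" "x + axis j 1 \<notin> uppers ?F" using upF by blast+
    ultimately show ?thesis by (simp add: center_def uj)
  next
    case (3 b)
    have xbF: "{x, b} \<in> ?F" using 3 d(1) by (simp add: flat_def)
    have v: "cell_vec m ?c = of_int (chi ?c) *\<^sub>R (center ?c - center (lift b k))"
      by (rule vec) (use 3 d(1) in \<open>auto simp: adjacent_lift\<close>)
    have xn: "x \<notin> plug m k" "x \<notin> plug m (k + 1)" using E(2) xbF by blast+
    have up1: "x \<in> uppers ?F \<longleftrightarrow> b = x - axis j 1"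
    proof
      assume "x \<in> uppers ?F"
      then have "{x - axis j 1, x} \<in> ?F" by (simp add: uppers_def)
      moreover have "{x - axis j 1, x} \<inter> {x, b} \<noteq> {}" by blast
      ultimately have "{x - axis j 1, x} = {x, b}" using E(3) xbF by (meson disjointD)
      then show "b = x - axis j 1" using adjacent_neq[OF 3(1)] by (auto simp: doubleton_eq_iff)
    qed (use xbF in \<open>auto simp: uppers_def insert_commute\<close>)
    have up2: "x + axis j 1 \<in> uppers ?F \<longleftrightarrow> b = x + axis j 1"
    proof
      assume "x + axis j 1 \<in> uppers ?F"
      then have "{x, x + axis j 1} \<in> ?F" by (simp add: uppers_def)
      moreover have "{x, x + axis j 1} \<inter> {x, b} \<noteq> {}" by blast
      ultimately have "{x, x + axis j 1} = {x, b}" using E(3) xbF by (meson disjointD)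
      then show "b = x + axis j 1" using adjacent_neq[OF 3(1)] by (auto simp: doubleton_eq_iff)
    qed (use xbF in \<open>auto simp: uppers_def\<close>)
    have "of_bool (x \<in> uppers ?F) - of_bool (x + axis j 1 \<in> uppers ?F) = x $ j - b $ j"
      using 3(1) unfolding adjacent_ij up1 up2 by (auto simp: vec_eq_ij)
    then show ?thesis using v xn by (simp add: center_def uj)
  qed
  then show ?P1 ?P2 by auto
qed

lemma sum_indicator:
  fixes g :: "int ^ 2 \<Rightarrow> int"
  assumes "X \<subseteq> S"
  shows "(\<Sum>x\<in>S. of_bool (x \<in> X) * g x) = (\<Sum>x\<in>X. g x)"
proof -
  have "of_bool (x \<in> X) * g x = (if x \<in> X then g x else 0)" for x by simp
  then have "(\<Sum>x\<in>S. of_bool (x \<in> X) * g x) = (\<Sum>x\<in>S \<inter> X. g x)"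
    using finite_S by (simp only: sum.inter_restrict)
  moreover have "S \<inter> X = X" using assms by blast
  ultimately show ?thesis by simp
qed

text \<open>The form that the effects take once dominoes are split into cells: a double sum over the
  squares of a floor whose factors are the vertical and the \<open>j\<close>-component of the domino
  vectors, up to signs that cancel.\<close>

lemma tau_eq_cell_sum:
  assumes "(p, f, q) \<in> floors S"
  shows "tau (p, f, q) = (\<Sum>x\<in>S. \<Sum>y\<in>S. K x y * (chi x * (of_bool (x \<in> p) - of_bool (x \<in> q)))
     * (chi y * (of_bool (y \<in> uppers f) - of_bool (y + axis j 1 \<in> uppers f))))"
proof -
  let ?U = "uppers f" and ?A = "\<lambda>y. R p y - R q y"
  have pq: "p \<subseteq> S" "q \<subseteq> S" "\<Union> f \<subseteq> S" using assms by (auto simp: floors_iff)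
  have U: "y \<in> S" "y - axis j 1 \<in> S" if "y \<in> ?U" for y
    using that pq(3) by (auto simp: uppers_def)
  have A: "?A y = (\<Sum>x\<in>S. K x y * (chi x * (of_bool (x \<in> p) - of_bool (x \<in> q))))" for y
  proof -
    have "R X y = (\<Sum>x\<in>S. of_bool (x \<in> X) * (chi x * K x y))" if "X \<subseteq> S" for X
      using sum_indicator[OF that] by (simp add: R_def)
    then show ?thesis using pq by (simp add: sum_subtractf[symmetric] algebra_simps)
  qed
  have low: "(\<Sum>y\<in>?U. chi y * ?A (y - axis j 1)) = - (\<Sum>y\<in>S. of_bool (y + axis j 1 \<in> ?U) * (chi y * ?A y))"
  proof -
    have "(\<Sum>y\<in>S. of_bool (y + axis j 1 \<in> ?U) * (chi y * ?A y)) = (\<Sum>y\<in>(\<lambda>y. y - axis j 1) ` ?U. chi y * ?A y)"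
    proof -
      have sub: "(\<lambda>y. y - axis j 1) ` ?U \<subseteq> S" using U by auto
      have "y + axis j 1 \<in> ?U \<longleftrightarrow> y \<in> (\<lambda>y. y - axis j 1) ` ?U" for y
        by (auto intro: image_eqI[of _ _ "y + axis j 1"])
      then show ?thesis using sum_indicator[OF sub] by simp
    qed
    also have "\<dots> = (\<Sum>y\<in>?U. chi (y - axis j 1) * ?A (y - axis j 1))"
      by (subst sum.reindex) (auto simp: inj_on_def)
    finally show ?thesis by (simp add: chi_diff_axis sum_negf)
  qed
  have "tau (p, f, q) = (\<Sum>y\<in>?U. chi y * ?A y) + (\<Sum>y\<in>?U. chi y * ?A (y - axis j 1))"
    unfolding tau_def prod.case distrib_left sum.distrib ..
  also have "(\<Sum>y\<in>?U. chi y * ?A y) = (\<Sum>y\<in>S. of_bool (y \<in> ?U) * (chi y * ?A y))"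
    by (rule sum_indicator[symmetric]) (use U in auto)
  finally have "tau (p, f, q) = (\<Sum>y\<in>S. (chi y * (of_bool (y \<in> ?U) - of_bool (y + axis j 1 \<in> ?U))) * ?A y)"
    unfolding low by (simp add: sum_subtractf[symmetric] algebra_simps)
  also have "\<dots> = (\<Sum>y\<in>S. \<Sum>x\<in>S. K x y * (chi x * (of_bool (x \<in> p) - of_bool (x \<in> q)))
     * (chi y * (of_bool (y \<in> ?U) - of_bool (y + axis j 1 \<in> ?U))))"
    unfolding A sum_distrib_left by (intro sum.cong refl) (simp add: mult.commute)
  finally show ?thesis by (rule trans[OF _ sum.swap])
qed

end

section \<open>Invariance of the floor sum under flips\<close>

lemma ver_pair_iff: "{lift x (l - 1), lift x l} \<in> ver k X \<longleftrightarrow> x \<in> X \<and> l = k + 1"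
  by (auto simp: ver_def doubleton_eq_iff)

lemma ver_pair_not_hor: "{lift x (l - 1), lift x l} \<notin> hor k f"
proof
  assume h: "{lift x (l - 1), lift x l} \<in> hor k f"
  show False using hor_height[OF h, of "lift x (l - 1)"] hor_height[OF h, of "lift x l"] by simp
qed

lemma flat_not_ver: "(\<lambda>a. lift a l) ` d \<notin> ver k X"
proof
  assume v: "(\<lambda>a. lift a l) ` d \<in> ver k X"
  moreover have "(\<lambda>a. lift a l) ` d \<in> hor l {d}" by simp
  ultimately show False using hor_ver_disjoint by blast
qed

lemma flat_hor_iff:
  assumes "{} \<notin> f"
  shows "(\<lambda>a. lift a l) ` d \<in> hor k f \<longleftrightarrow> l = k \<and> d \<in> f"
proof
  assume h: "(\<lambda>a. lift a l) ` d \<in> hor k f"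
  then obtain e where e: "e \<in> f" "(\<lambda>a. lift a l) ` d = (\<lambda>a. lift a k) ` e" by (auto simp: hor_def)
  then have "d \<noteq> {}" using assms by auto
  then obtain x where "x \<in> d" by blast
  then have "l = k" using hor_height[OF h, of "lift x l"] by simp
  then show "l = k \<and> d \<in> f" using h by simp
qed auto

lemma cell_pair_hor_hor:
  "cell_pair (lift a k) (up_axis h) (up_axis h') = hor k {{a, a + axis h 1}, {a + axis h' 1, a + axis h' 1 + axis h 1}}"
  by (simp add: cell_pair_def hor_def lift_axis)

lemma cell_pair_hor_ver:
  "cell_pair (lift a k) (up_axis h) 3 = hor k {{a, a + axis h 1}} \<union> hor (k + 1) {{a, a + axis h 1}}"
proof -
  have "lift (a + axis h 1) (k + 1) = lift a k + axis 3 1 + axis (up_axis h) 1"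
    by (simp only: lift_axis) (simp only: lift_up)
  then show ?thesis by (auto simp: cell_pair_def hor_def lift_axis[of a h k] lift_up[of a k])
qed

lemma cell_pair_ver_hor:
  "cell_pair (lift a k) 3 (up_axis h) = ver k {a, a + axis h 1}"
proof -
  have "lift (a + axis h 1) (k + 1) = lift a k + axis (up_axis h) 1 + axis 3 1"
    by (simp only: lift_up) (simp only: lift_axis)
  then show ?thesis by (auto simp: cell_pair_def ver_def lift_axis[of a h k] lift_up[of a k])
qed

context floor_twist
begin

lemma axis_cases: "I = up_axis i \<or> I = up_axis j \<or> I = 3"
  using ij exhaust_2[of i] exhaust_2[of j] exhaust_3[of I] by (auto simp: up_axis_def)

text \<open>Only the floors \<open>k\<close> and \<open>k + 1\<close> change. They share the plug on
  which \<open>stack_shift\<close> depends, and their changes are opposite.\<close>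

lemma twist_sum_stack:
  assumes m: "m \<in> matchings S N" and m'm: "m' \<in> matchings S N"
    and A: "hor k {{a, b}} \<union> hor (k + 1) {{a, b}} \<subseteq> m"
    and m': "m' = (m - (hor k {{a, b}} \<union> hor (k + 1) {{a, b}})) \<union> ver k {a, b}"
    and b: "b = a + axis i 1 \<or> b = a + axis j 1"
  shows "twist_sum N m = twist_sum N m'"
proof -
  have cyl: "\<Union> m = cyl S N" using m by (simp add: matchings_def)
  have ab: "{a, b} \<in> flat m k" "{a, b} \<in> flat m (k + 1)"
    using A by (auto simp: flat_def hor_def)
  then have "lift a k \<in> \<Union> m" "lift a (k + 1) \<in> \<Union> m" by (auto simp: flat_def)
  then have k: "0 \<le> k" "k + 1 < int N" unfolding cyl by auto
  have plug: "plug m' l = (if l = k + 1 then plug m l \<union> {a, b} else plug m l)" for l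
    using ver_pair_not_hor by (auto simp: plug_def m' ver_pair_iff)
  have flat: "flat m' l = (if l = k \<or> l = k + 1 then flat m l - {{a, b}} else flat m l)" for l
    using flat_not_ver by (auto simp: flat_def m' flat_hor_iff)
  define t where "t l = tau (plug m l, flat m l, plug m (l + 1))" for l
  define t' where "t' l = tau (plug m' l, flat m' l, plug m' (l + 1))" for l
  define s where "s = stack_shift (plug m (k + 1)) a b"
  have diff: "t l - t' l = (if l = k then s else 0) + (if l = k + 1 then - s else 0)" if l: "l \<in> {0..<int N}" for l
  proof -
    have fl: "(plug m l, flat m l, plug m (l + 1)) \<in> floors S" using word_floor[OF m] l by simp
    consider "l = k" | "l = k + 1" | "l \<noteq> k" "l \<noteq> k + 1" by blast
    then show ?thesis
    proof cases
      case 1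
      have ins: "insert {a, b} (flat m k - {{a, b}}) = flat m k" using ab by blast
      show ?thesis
        using tau_stack[of "plug m k" a b "flat m k - {{a, b}}" "plug m (k + 1)"] fl b
        unfolding ins 1 t_def t'_def plug flat s_def by simp
    next
      case 2
      have ins: "insert {a, b} (flat m (k + 1) - {{a, b}}) = flat m (k + 1)" using ab by blast
      show ?thesis
        using tau_stack_upper[of "plug m (k + 1)" a b "flat m (k + 1) - {{a, b}}" "plug m (k + 1 + 1)"] fl b
        unfolding ins 2 t_def t'_def plug flat s_def by simp
    next
      case 3
      then show ?thesis by (simp add: t_def t'_def plug flat)
    qed
  qed
  have "twist_sum N m - twist_sum N m' = (\<Sum>l\<in>{0..<int N}. t l - t' l)"
    by (simp add: twist_sum_def t_def t'_def sum_subtractf)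
  also have "\<dots> = (\<Sum>l\<in>{0..<int N}. (if l = k then s else 0) + (if l = k + 1 then - s else 0))"
    by (rule sum.cong[OF refl diff])
  also have "\<dots> = 0" using k by (simp add: sum.distrib)
  finally show ?thesis by simp
qed

lemma twist_sum_flat:
  assumes m: "m \<in> matchings S N"
    and XY: "(X = {{x, x + axis i 1}, {x + axis j 1, x + axis j 1 + axis i 1}} \<and>
       Y = {{x, x + axis j 1}, {x + axis i 1, x + axis i 1 + axis j 1}}) \<or>
      (X = {{x, x + axis j 1}, {x + axis i 1, x + axis i 1 + axis j 1}} \<and>
       Y = {{x, x + axis i 1}, {x + axis j 1, x + axis j 1 + axis i 1}})"
    and A: "hor k X \<subseteq> m" and m': "m' = (m - hor k X) \<union> hor k Y"
  shows "twist_sum N m = twist_sum N m'"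
proof -
  have cyl: "\<Union> m = cyl S N" using m by (simp add: matchings_def)
  have XF: "X \<subseteq> flat m k" using A by (auto simp: flat_def hor_def)
  have UX: "\<Union> X = {x, x + axis i 1, x + axis j 1, x + axis j 1 + axis i 1}"
    using XY by (auto simp: add_ac)
  have ne: "{} \<notin> X" "{} \<notin> Y" using XY by auto
  have "x \<in> \<Union> (flat m k)" using XF UX by blast
  then have "lift x k \<in> \<Union> m" by (auto simp: flat_def)
  then have k: "0 \<le> k" "k < int N" unfolding cyl by auto
  have plug: "plug m' l = plug m l" for l
    using ver_pair_not_hor by (auto simp: plug_def m')
  have flat: "flat m' l = (if l = k then (flat m k - X) \<union> Y else flat m l)" for l
    using ne by (auto simp: flat_def m' flat_hor_iff)
  let ?f = "flat m k - X" and ?p = "plug m k" and ?q = "plug m (k + 1)"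
  have fl: "(?p, flat m k, ?q) \<in> floors S" using word_floor[OF m k] .
  then have E: "\<Union> (flat m k) = S - (?p \<union> ?q)" "disjoint (flat m k)" by (auto simp: floors_iff)
  have fin: "finite ?f" "finite ?p" "finite ?q" using floor_finite[OF fl] by auto
  have cells: "c \<notin> ?p \<union> ?q" if "c \<in> \<Union> X" for c using that XF E(1) by blast
  have nof: "d \<notin> ?f" if "d \<inter> \<Union> X \<noteq> {}" for d
  proof
    assume d: "d \<in> ?f"
    obtain e where e: "e \<in> X" "d \<inter> e \<noteq> {}" using \<open>d \<inter> \<Union> X \<noteq> {}\<close> by blast
    then have "d = e" using E(2) XF d by (meson DiffD1 disjointD subsetD)
    then show False using d e by blast
  qed
  have up: "x + axis j 1 \<notin> uppers ?f" "x + axis j 1 + axis i 1 \<notin> uppers ?f"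
    unfolding uppers_def mem_Collect_eq by (rule nof, unfold UX, blast)+
  have mem: "x \<in> \<Union> X" "x + axis i 1 \<in> \<Union> X" "x + axis j 1 \<in> \<Union> X" "x + axis j 1 + axis i 1 \<in> \<Union> X"
    unfolding UX by auto
  note tf = tau_flat[OF fin cells[OF mem(1)] cells[OF mem(2)] cells[OF mem(3)] cells[OF mem(4)] up]
  have "tau (?p, ?f \<union> X, ?q) = tau (?p, ?f \<union> Y, ?q)"
    using XY
  proof
    assume "X = {{x, x + axis i 1}, {x + axis j 1, x + axis j 1 + axis i 1}} \<and>
       Y = {{x, x + axis j 1}, {x + axis i 1, x + axis i 1 + axis j 1}}"
    then show ?thesis using tf by (simp only:)
  next
    assume "X = {{x, x + axis j 1}, {x + axis i 1, x + axis i 1 + axis j 1}} \<and>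
       Y = {{x, x + axis i 1}, {x + axis j 1, x + axis j 1 + axis i 1}}"
    then show ?thesis using tf by (simp only:)
  qed
  moreover have "?f \<union> X = flat m k" using XF by blast
  ultimately have "tau (plug m l, flat m l, plug m (l + 1)) = tau (plug m' l, flat m' l, plug m' (l + 1))" for l
    unfolding plug flat by simp
  then show ?thesis by (simp add: twist_sum_def)
qed

text \<open>A flip either involves the vertical direction, in one of two ways inverse to each other,
  or takes place inside a floor.\<close>

lemma twist_sum_flip:
  assumes m: "m \<in> matchings S N" and fl: "cell_flip m m'"
  shows "twist_sum N m = twist_sum N m'"
proof -
  have m'm: "m' \<in> matchings S N" by (rule cell_flip_matching(1)[OF assms])
  obtain c I J where IJ: "I \<noteq> J" "cell_pair c I J \<subseteq> m" "m' = (m - cell_pair c I J) \<union> cell_pair c J I"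
    using fl by (auto simp: cell_flip_def)
  obtain a k where c: "c = lift a k" using ex_lift by blast
  have ne: "{} \<notin> cell_pair c J I" by (auto simp: cell_pair_def)
  have "disjoint m" using m by (simp add: matchings_def)
  from exchange_cover(3)[OF this IJ(2) cell_pair_props(1)[of J I c] cell_pair_props(2)[OF IJ(1)] ne]
  have undo: "m = (m' - cell_pair c J I) \<union> cell_pair c I J" using IJ(1) by (simp add: IJ(3))
  have sub': "cell_pair c J I \<subseteq> m'" using IJ(3) by blast
  have horver: "twist_sum N m1 = twist_sum N m2"
    if "m1 \<in> matchings S N" "m2 \<in> matchings S N" "cell_pair c (up_axis h) 3 \<subseteq> m1"
      "m2 = (m1 - cell_pair c (up_axis h) 3) \<union> cell_pair c 3 (up_axis h)" "h = i \<or> h = j" for m1 m2 h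
    using twist_sum_stack[OF that(1,2) that(3,4)[unfolded c cell_pair_hor_ver cell_pair_ver_hor]] that(5) by blast
  consider h where "I = up_axis h" "J = 3" "h = i \<or> h = j" | h where "J = up_axis h" "I = 3" "h = i \<or> h = j"
    | "I = up_axis i" "J = up_axis j" | "I = up_axis j" "J = up_axis i"
    using axis_cases[of I] axis_cases[of J] IJ(1) by blast
  then show ?thesis
  proof cases
    case (1 h)
    then show ?thesis using horver[OF m m'm, of h] IJ by simp
  next
    case (2 h)
    then show ?thesis using horver[OF m'm m, of h] sub' undo by simp
  next
    case 3
    show ?thesis
      by (rule twist_sum_flat[where x = a, OF m _ IJ(2,3)[unfolded c 3 cell_pair_hor_hor]]) simp
  next
    case 4
    show ?thesis
      by (rule twist_sum_flat[where x = a, OF m _ IJ(2,3)[unfolded c 4 cell_pair_hor_hor]]) simp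
  qed
qed

lemma twist_sum_flips:
  assumes "cell_flip\<^sup>*\<^sup>* m m'" "m \<in> matchings S N"
  shows "twist_sum N m = twist_sum N m'"
  using assms
proof (induction rule: rtranclp_induct)
  case (step y z)
  then show ?case using twist_sum_flip[OF _ step(2)] cell_flips_matching[OF step(1)] by simp
qed simp

section \<open>Identification of the floor sum with the twist\<close>

definition orientation :: int where
  "orientation = (if i = 1 then 1 else - 1)"

lemma det_u:
  "det (vector [v, w, of_int \<sigma> *\<^sub>R axis (up_axis i) 1 :: real ^ 3]) =
     of_int orientation * of_int \<sigma> * (v $ up_axis j * w $ 3 - v $ 3 * w $ up_axis j)"
  using ij exhaust_2[of i] exhaust_2[of j]
  by (auto simp: det_3 vector_3 axis_def up_axis_def orientation_def algebra_simps)

lemma sum_cyl: "(\<Sum>a\<in>cyl S N. h a) = (\<Sum>k\<in>{0..<int N}. \<Sum>x\<in>S. (h (lift x k) :: real))"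
proof -
  have "cyl S N = (\<lambda>(k, x). lift x k) ` ({0..<int N} \<times> S)" by (auto simp: cyl_def)
  moreover have "inj_on (\<lambda>(k, x). lift x k) ({0..<int N} \<times> S)" by (auto simp: inj_on_def)
  ultimately show ?thesis by (simp add: sum.reindex sum.cartesian_product split_def)
qed

lemma ray_lift:
  assumes "\<sigma> = 1 \<or> \<sigma> = - 1"
  shows "ray (up_axis i) \<sigma> (lift x k) (lift y l) =
    (if l = k then of_bool (x $ j = y $ j \<and> \<sigma> * (y $ i - x $ i) > 0) else 0)"
proof -
  have "(\<exists>n>0. lift y l = lift x k + axis (up_axis i) (\<sigma> * n)) \<longleftrightarrow> l = k \<and> x $ j = y $ j \<and> \<sigma> * (y $ i - x $ i) > 0"
  proof
    assume "\<exists>n>0. lift y l = lift x k + axis (up_axis i) (\<sigma> * n)"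
    then obtain n where n: "n > 0" "lift y l = lift x k + axis (up_axis i) (\<sigma> * n)" by blast
    then show "l = k \<and> x $ j = y $ j \<and> \<sigma> * (y $ i - x $ i) > 0"
      using assms ij exhaust_2[of i] exhaust_2[of j]
      by (auto simp: vec_eq_iff forall_3 axis_def up_axis_def)
  next
    assume r: "l = k \<and> x $ j = y $ j \<and> \<sigma> * (y $ i - x $ i) > 0"
    then have "lift y l = lift x k + axis (up_axis i) (\<sigma> * (\<sigma> * (y $ i - x $ i)))"
      using assms ij exhaust_2[of i] exhaust_2[of j]
      by (auto simp: vec_eq_iff forall_3 axis_def up_axis_def)
    then show "\<exists>n>0. lift y l = lift x k + axis (up_axis i) (\<sigma> * n)" using r by blast
  qed
  then show ?thesis by (simp add: ray_def)
qed

text \<open>Exchanging \<open>x\<close> and \<open>y\<close> in the second half turns the one-sided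
  condition of the ray into the antisymmetric kernel \<open>K\<close>. The sign \<sigma> occurs
  twice and drops out, so opposite shades give the same total.\<close>

lemma floor_effects:
  fixes \<alpha> \<beta> :: "int ^ 2 \<Rightarrow> real"
  assumes "\<sigma> = 1 \<or> \<sigma> = - 1"
  shows "(\<Sum>x\<in>S. \<Sum>y\<in>S. of_bool (x $ j = y $ j \<and> \<sigma> * (y $ i - x $ i) > 0) * (of_int \<sigma> * (\<beta> y * \<alpha> x - \<alpha> y * \<beta> x)))
    = (\<Sum>x\<in>S. \<Sum>y\<in>S. of_int (K x y) * \<alpha> x * \<beta> y)"
proof -
  let ?r = "\<lambda>x y. of_bool (x $ j = y $ j \<and> \<sigma> * (y $ i - x $ i) > 0) :: real"
  have "(\<Sum>x\<in>S. \<Sum>y\<in>S. ?r x y * (of_int \<sigma> * (\<beta> y * \<alpha> x - \<alpha> y * \<beta> x)))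
      = (\<Sum>x\<in>S. \<Sum>y\<in>S. ?r x y * of_int \<sigma> * (\<alpha> x * \<beta> y)) - (\<Sum>x\<in>S. \<Sum>y\<in>S. ?r x y * of_int \<sigma> * (\<alpha> y * \<beta> x))"
    unfolding sum_subtractf[symmetric] by (intro sum.cong refl) (simp add: algebra_simps)
  also have "(\<Sum>x\<in>S. \<Sum>y\<in>S. ?r x y * of_int \<sigma> * (\<alpha> y * \<beta> x)) = (\<Sum>x\<in>S. \<Sum>y\<in>S. ?r y x * of_int \<sigma> * (\<alpha> x * \<beta> y))"
    by (rule sum.swap)
  also have "(\<Sum>x\<in>S. \<Sum>y\<in>S. ?r x y * of_int \<sigma> * (\<alpha> x * \<beta> y)) - (\<Sum>x\<in>S. \<Sum>y\<in>S. ?r y x * of_int \<sigma> * (\<alpha> x * \<beta> y))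
      = (\<Sum>x\<in>S. \<Sum>y\<in>S. of_int (K x y) * \<alpha> x * \<beta> y)"
    unfolding sum_subtractf[symmetric]
  proof (intro sum.cong refl)
    fix x y
    have "of_int (K x y) = ?r x y * of_int \<sigma> - ?r y x * of_int \<sigma>"
      using assms by (auto simp: K_def sgn_if)
    then show "?r x y * of_int \<sigma> * (\<alpha> x * \<beta> y) - ?r y x * of_int \<sigma> * (\<alpha> x * \<beta> y) = of_int (K x y) * \<alpha> x * \<beta> y"
      by (simp only: left_diff_distrib mult.assoc)
  qed
  finally show ?thesis .
qed

text \<open>Effects split into pairs of cells, the double sum over dominoes becomes one over the
  cells of the cylinder, and horizontal rays join only cells of the same floor.\<close>

lemma effect_sum:
  assumes m: "m \<in> matchings S N" and \<sigma>: "\<sigma> = 1 \<or> \<sigma> = - 1"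
  shows "(\<Sum>d0\<in>brick ` m. \<Sum>d1\<in>brick ` m. effect (of_int \<sigma> *\<^sub>R axis (up_axis i) 1) d0 d1)
    = of_int (orientation * twist_sum N m) / 4"
proof -
  let ?u = "of_int \<sigma> *\<^sub>R axis (up_axis i) 1 :: real ^ 3"
  have dom: "cell_domino d" if "d \<in> m" for d using m that by (simp add: matchings_def)
  have inj: "inj_on brick m" using inj_brick by (auto intro: inj_on_subset)
  have part: "(\<Sum>d\<in>m. \<Sum>a\<in>d. h a) = (\<Sum>a\<in>cyl S N. h a)" for h :: "int ^ 3 \<Rightarrow> real"
  proof -
    have fin: "\<forall>d\<in>m. finite d" using dom by (auto simp: cell_domino_def)
    have dis: "\<forall>d\<in>m. \<forall>e\<in>m. d \<noteq> e \<longrightarrow> d \<inter> e = {}" using m by (auto simp: matchings_def dest: disjointD)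
    have U: "\<Union> m = cyl S N" using m by (simp add: matchings_def)
    show ?thesis unfolding U[symmetric] using sum.Union_disjoint[OF fin dis, of h] by simp
  qed
  define G where "G a b = 1 / 4 * (ray (up_axis i) \<sigma> a b * det (vector [cell_vec m b, cell_vec m a, ?u]))" for a b
  have "(\<Sum>d0\<in>brick ` m. \<Sum>d1\<in>brick ` m. effect ?u d0 d1) = (\<Sum>d0\<in>m. \<Sum>d1\<in>m. effect ?u (brick d0) (brick d1))"
    by (simp add: sum.reindex[OF inj])
  also have "\<dots> = (\<Sum>d0\<in>m. \<Sum>d1\<in>m. \<Sum>a\<in>d0. \<Sum>b\<in>d1. G a b)"
    unfolding G_def
    by (intro sum.cong refl) (simp add: effect_eq_sum[OF \<sigma> dom dom] cell_vec_eq[OF m] cong: sum.cong)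
  also have "\<dots> = (\<Sum>d0\<in>m. \<Sum>a\<in>d0. \<Sum>d1\<in>m. \<Sum>b\<in>d1. G a b)"
    by (intro sum.cong refl sum.swap)
  also have "\<dots> = (\<Sum>a\<in>cyl S N. \<Sum>b\<in>cyl S N. G a b)" by (simp only: part)
  also have "\<dots> = (\<Sum>k\<in>{0..<int N}. \<Sum>x\<in>S. \<Sum>l\<in>{0..<int N}. \<Sum>y\<in>S. G (lift x k) (lift y l))"
    by (simp only: sum_cyl)
  also have "\<dots> = (\<Sum>k\<in>{0..<int N}. \<Sum>x\<in>S. \<Sum>y\<in>S. G (lift x k) (lift y k))"
  proof (intro sum.cong refl)
    fix k x assume k: "k \<in> {0..<int N}"
    have "(\<Sum>l\<in>{0..<int N}. \<Sum>y\<in>S. G (lift x k) (lift y l)) = (\<Sum>l\<in>{0..<int N}. if l = k then \<Sum>y\<in>S. G (lift x k) (lift y k) else 0)"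
      by (intro sum.cong refl) (auto simp: G_def ray_lift[OF \<sigma>])
    also have "\<dots> = (\<Sum>y\<in>S. G (lift x k) (lift y k))" using k by simp
    finally show "(\<Sum>l\<in>{0..<int N}. \<Sum>y\<in>S. G (lift x k) (lift y l)) = (\<Sum>y\<in>S. G (lift x k) (lift y k))" .
  qed
  also have "\<dots> = (\<Sum>k\<in>{0..<int N}. of_int orientation / 4 * of_int (tau (plug m k, flat m k, plug m (k + 1))))"
  proof (intro sum.cong refl)
    fix k assume "k \<in> {0..<int N}"
    then have k: "0 \<le> k" "k < int N" by auto
    define \<alpha> where "\<alpha> x = cell_vec m (lift x k) $ 3" for x
    define \<beta> where "\<beta> x = cell_vec m (lift x k) $ up_axis j" for x
    have "(\<Sum>x\<in>S. \<Sum>y\<in>S. G (lift x k) (lift y k)) = of_int orientation / 4 *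
       (\<Sum>x\<in>S. \<Sum>y\<in>S. of_bool (x $ j = y $ j \<and> \<sigma> * (y $ i - x $ i) > 0) * (of_int \<sigma> * (\<beta> y * \<alpha> x - \<alpha> y * \<beta> x)))"
      unfolding sum_distrib_left
      by (intro sum.cong refl) (simp add: G_def det_u ray_lift[OF \<sigma>] \<alpha>_def \<beta>_def)
    also have "\<dots> = of_int orientation / 4 * (\<Sum>x\<in>S. \<Sum>y\<in>S. of_int (K x y) * \<alpha> x * \<beta> y)"
      unfolding floor_effects[OF \<sigma>] ..
    also have "(\<Sum>x\<in>S. \<Sum>y\<in>S. of_int (K x y) * \<alpha> x * \<beta> y) = of_int (tau (plug m k, flat m k, plug m (k + 1)))"
      unfolding tau_eq_cell_sum[OF word_floor[OF m k]] of_int_sum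
    proof (intro sum.cong refl)
      fix x y assume x: "x \<in> S" and y: "y \<in> S"
      have c: "chi (lift x k) * (A * (chi (lift y k) * B)) = chi x * (A * (chi y * B))" for A B
        by (simp add: chi_lift)
      show "of_int (K x y) * \<alpha> x * \<beta> y = of_int (K x y * (chi x * (of_bool (x \<in> plug m k) - of_bool (x \<in> plug m (k + 1))))
        * (chi y * (of_bool (y \<in> uppers (flat m k)) - of_bool (y + axis j 1 \<in> uppers (flat m k)))))"
        unfolding \<alpha>_def \<beta>_def cell_vec_components(1)[OF m k x] cell_vec_components(2)[OF m k y]
          of_int_mult[symmetric] by (simp only: mult.assoc c)
    qed
    finally show "(\<Sum>x\<in>S. \<Sum>y\<in>S. G (lift x k) (lift y k)) =
      of_int orientation / 4 * of_int (tau (plug m k, flat m k, plug m (k + 1)))" .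
  qed
  also have "\<dots> = of_int (orientation * twist_sum N m) / 4"
    by (simp add: twist_sum_def sum_distrib_left sum_divide_distrib)
  finally show ?thesis .
qed

end

section \<open>Balanced disks have closed walks of odd length\<close>
text \<open>Two such squares are disjoint or share only a corner.\<close>

lemma finite_cell_Int:
  fixes a b :: "int ^ 2"
  assumes ab: "a \<noteq> b" "\<not> adjacent a b"
  shows "finite (cell a \<inter> cell b)"
proof -
  have "x = y" if x: "x \<in> cell a \<inter> cell b" and y: "y \<in> cell a \<inter> cell b" for x y
  proof -
    have bnd: "b $ t \<le> a $ t + 1" "a $ t \<le> b $ t + 1" for t
    proof -
      have "of_int (a $ t) \<le> x $ t" "x $ t \<le> of_int (a $ t) + 1" "of_int (b $ t) \<le> x $ t" "x $ t \<le> of_int (b $ t) + 1"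
        using x by (auto simp: mem_cell)
      then have "real_of_int (b $ t) \<le> of_int (a $ t + 1)" "real_of_int (a $ t) \<le> of_int (b $ t + 1)" by auto
      then show "b $ t \<le> a $ t + 1" "a $ t \<le> b $ t + 1" unfolding of_int_le_iff by auto
    qed
    have ne: "a $ t \<noteq> b $ t" for t
    proof
      assume t: "a $ t = b $ t"
      obtain s where s: "s \<noteq> t" "\<And>r. r = s \<or> r = t"
        using exhaust_2[of t] exhaust_2 by (metis (full_types) zero_neq_one)
      have "a $ s \<noteq> b $ s"
      proof
        assume "a $ s = b $ s"
        then have "a $ r = b $ r" for r using s(2)[of r] t by auto
        then show False using ab(1) by (simp add: vec_eq_iff)
      qed
      then have "b $ s = a $ s + 1 \<or> a $ s = b $ s + 1" using bnd[of s] by linarith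
      then have "b = a + axis s 1 \<or> a = b + axis s 1"
      proof -
        have eq: "v = w" if "v $ s = w $ s" "v $ t = w $ t" for v w :: "int ^ 2"
          unfolding vec_eq_iff
        proof
          fix r
          show "v $ r = w $ r" using s(2)[of r] that by auto
        qed
        have ax: "axis s 1 $ s = (1 :: int)" "axis s 1 $ t = (0 :: int)" using s(1) by (auto simp: axis_def)
        from \<open>b $ s = a $ s + 1 \<or> a $ s = b $ s + 1\<close> show ?thesis
        proof
          assume "b $ s = a $ s + 1"
          then have "b = a + axis s 1" by (intro eq) (simp_all add: ax t)
          then show ?thesis ..
        next
          assume "a $ s = b $ s + 1"
          then have "a = b + axis s 1" by (intro eq) (simp_all add: ax t)
          then show ?thesis ..
        qed
      qed
      then show False using ab(2) by (auto simp: adjacent_def)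
    qed
    have "x $ t = y $ t" for t
    proof -
      have "b $ t = a $ t + 1 \<or> a $ t = b $ t + 1" using bnd[of t] ne[of t] by linarith
      moreover have "of_int (a $ t) \<le> x $ t" "x $ t \<le> of_int (a $ t) + 1" "of_int (b $ t) \<le> x $ t" "x $ t \<le> of_int (b $ t) + 1"
        "of_int (a $ t) \<le> y $ t" "y $ t \<le> of_int (a $ t) + 1" "of_int (b $ t) \<le> y $ t" "y $ t \<le> of_int (b $ t) + 1"
        using x y by (auto simp: mem_cell)
      ultimately show ?thesis by auto
    qed
    then show ?thesis by (simp add: vec_eq_iff)
  qed
  then have "cell a \<inter> cell b \<subseteq> {SOME x. x \<in> cell a \<inter> cell b}" by (metis singletonI someI subsetI)
  then show ?thesis by (rule finite_subset) simp
qed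

text \<open>Two unions of squares that share no edge meet in finitely many points, but removing finitely
  many points does not disconnect a disk.\<close>

lemma disk_squares_connected:
  fixes D :: "(real ^ 2) set"
  assumes hom: "D homeomorphic cball (0 :: real ^ 2) 1" and S: "finite S" "D = \<Union> (cell ` S)"
    and A: "A \<subseteq> S" "A \<noteq> {}" "\<And>a b. a \<in> A \<Longrightarrow> b \<in> S \<Longrightarrow> adjacent a b \<Longrightarrow> b \<in> A"
  shows "A = S"
proof (rule ccontr)
  assume "A \<noteq> S"
  then obtain b0 where b0: "b0 \<in> S" "b0 \<notin> A" using A(1) by blast
  obtain a0 where a0: "a0 \<in> A" using A(2) by blast
  let ?X = "\<Union> (cell ` A)" and ?Y = "\<Union> (cell ` (S - A))"
  let ?F = "?X \<inter> ?Y"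
  have finA: "finite A" using S(1) A(1) finite_subset by blast
  have "finite (\<Union>a\<in>A. \<Union>b\<in>S - A. cell a \<inter> cell b)"
  proof (intro finite_UN_I)
    fix a b assume "a \<in> A" "b \<in> S - A"
    then show "finite (cell a \<inter> cell b)"
      by - (rule finite_cell_Int, use A(3)[of a b] in auto)
  qed (use finA S(1) in auto)
  moreover have "?F = (\<Union>a\<in>A. \<Union>b\<in>S - A. cell a \<inter> cell b)" by blast
  ultimately have finF: "finite ?F" by (simp only:)
  obtain f g where fg: "homeomorphism D (cball (0 :: real ^ 2) 1) f g" using hom by (auto simp: homeomorphic_def)
  have gf: "g (f x) = x" "f x \<in> cball 0 1" if "x \<in> D" for x
    using that homeomorphism_apply1[OF fg] homeomorphism_image1[OF fg] by auto
  have gF: "f (g y) = y" "g y \<in> D" if "y \<in> cball 0 1" for y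
    using that homeomorphism_apply2[OF fg] homeomorphism_image2[OF fg] by auto
  define F where "F = ?F"
  have FD: "F \<subseteq> D" unfolding F_def S(2) using A(1) by blast
  have "D - F = g ` (cball 0 1 - f ` F)"
  proof (intro equalityI subsetI)
    fix x assume x: "x \<in> D - F"
    have "f x \<notin> f ` F"
    proof
      assume "f x \<in> f ` F"
      then obtain y where y: "y \<in> F" "f x = f y" by blast
      then have "g (f x) = g (f y)" "y \<in> D" using FD by auto
      then have "x = y" using x gf(1) by simp
      then show False using x y(1) by blast
    qed
    then show "x \<in> g ` (cball 0 1 - f ` F)"
      using x gf[of x] by (intro image_eqI[of _ _ "f x"]) auto
  next
    fix x assume "x \<in> g ` (cball 0 1 - f ` F)"
    then obtain y where y: "x = g y" "y \<in> cball 0 1" "y \<notin> f ` F" by blast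
    have "g y \<notin> F"
    proof
      assume "g y \<in> F"
      then have "f (g y) \<in> f ` F" by (rule imageI)
      then show False using gF(1)[OF y(2)] y(3) by simp
    qed
    then show "x \<in> D - F" using y gF(2)[OF y(2)] by simp
  qed
  moreover have "countable (f ` F)" using finF by (simp add: F_def countable_finite)
  then have "connected (cball (0 :: real ^ 2) 1 - f ` F)"
    by (intro connected_convex_diff_countable) (simp_all add: collinear_aff_dim aff_dim_cball)
  moreover have "continuous_on (cball 0 1 - f ` F) g"
    by (rule continuous_on_subset[OF homeomorphism_cont2[OF fg]]) blast
  ultimately have conn: "connected (D - ?F)"
    using connected_continuous_image[of "cball 0 1 - f ` F" g] by (simp only: F_def)
  moreover have "closed ?X" "closed ?Y" using finA S(1) by (auto intro!: closed_UN closed_cell)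
  moreover have "?X \<inter> ?Y \<inter> (D - ?F) = {}" by blast
  moreover have "D - ?F \<subseteq> ?X \<union> ?Y" unfolding S(2) by blast
  ultimately have "?X \<inter> (D - ?F) = {} \<or> ?Y \<inter> (D - ?F) = {}"
    using connected_closedD[OF conn, of ?X ?Y] by (simp only: simp_thms)
  moreover have "center a0 \<in> ?X \<inter> (D - ?F)"
    unfolding S(2) using a0 A(1) by (auto simp: center_cell_iff)
  moreover have "center b0 \<in> ?Y \<inter> (D - ?F)"
    unfolding S(2) using b0 by (auto simp: center_cell_iff)
  ultimately show False by blast
qed

section \<open>Plugs linked by walks of even length\<close>

locale balanced_board = board S for S +
  assumes connected_S: "\<And>A. A \<subseteq> S \<Longrightarrow> A \<noteq> {} \<Longrightarrow> (\<And>a b. a \<in> A \<Longrightarrow> b \<in> S \<Longrightarrow> adjacent a b \<Longrightarrow> b \<in> A) \<Longrightarrow> A = S"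
    and balanced_S: "(\<Sum>a\<in>S. chi a) = 0"
begin

definition even_linked :: "(int ^ 2) set \<Rightarrow> (int ^ 2) set \<Rightarrow> bool" where
  "even_linked p q \<longleftrightarrow> (\<exists>w. walk p w q \<and> even (length w))"

lemma even_linked_sym: "even_linked p q \<Longrightarrow> even_linked q p"
  unfolding even_linked_def using walk_inv by (metis length_inv_walk)

lemma even_linked_trans: "even_linked p q \<Longrightarrow> even_linked q r \<Longrightarrow> even_linked p r"
  unfolding even_linked_def by (metis walk_appendI length_append even_add)

text \<open>The domino \<open>{a, c}\<close> lies on the first of two floors and every other square
  is covered vertically, so the plug grows by \<open>{a, c}\<close>.\<close>

lemma even_linked_adjacent:
  assumes "adjacent a c" "a \<in> S" "c \<in> S" "p \<subseteq> S" "a \<notin> p" "c \<notin> p"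
  shows "even_linked p (p \<union> {a, c})"
proof -
  let ?r = "S - p - {a, c}"
  have "cell_domino {a, c}" using assms(1) by (auto simp: cell_domino_def)
  then have "(p, {{a, c}}, ?r) \<in> floors S" "(?r, {}, p \<union> {a, c}) \<in> floors S"
    using assms by (auto simp: floors_iff)
  then have "walk p [(p, {{a, c}}, ?r), (?r, {}, p \<union> {a, c})] (p \<union> {a, c})" by simp
  then show ?thesis unfolding even_linked_def by (metis even_Suc even_zero list.size(3,4) add_Suc_right add_0_right)
qed

text \<open>The plug is changed at the two ends of a path of adjacent squares only.\<close>

definition movable :: "int ^ 2 \<Rightarrow> int ^ 2 \<Rightarrow> bool" where
  "movable a b \<longleftrightarrow> (if chi a = chi b
     then \<forall>r\<subseteq>S. a \<notin> r \<longrightarrow> b \<notin> r \<longrightarrow> even_linked (insert a r) (insert b r)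
     else \<forall>r\<subseteq>S. a \<notin> r \<longrightarrow> b \<notin> r \<longrightarrow> even_linked r (r \<union> {a, b}))"

lemma even_linked_refl: "even_linked p p"
  unfolding even_linked_def by (intro exI[of _ "[]"]) simp

text \<open>To lengthen the path from \<open>b\<close> to \<open>c\<close>, the pair
  \<open>{b, c}\<close> is added and the known move between \<open>a\<close> and \<open>b\<close> is
  applied. If \<open>b\<close> already belongs to the plug, the two are done in the opposite
  order.\<close>

lemma movable_step:
  assumes mv: "movable a b" and S: "a \<in> S" "b \<in> S" "c \<in> S" and bc: "adjacent b c"
  shows "movable a c"
proof -
  have chi: "chi c = - chi b" by (rule chi_adjacent[OF bc])
  have val: "chi x = 1 \<or> chi x = - 1" for x :: "int ^ 2" by (simp add: chi_def)
  have bc': "b \<noteq> c" by (rule adjacent_neq[OF bc])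
  show ?thesis
  proof (cases "chi a = chi b")
    case True
    then have ac: "chi a \<noteq> chi c" using chi val[of b] by auto
    have mv': "even_linked (insert a r) (insert b r)" if "r \<subseteq> S" "a \<notin> r" "b \<notin> r" for r
      using mv that by (simp only: movable_def True simp_thms if_True)
    have "even_linked r (r \<union> {a, c})" if r: "r \<subseteq> S" "a \<notin> r" "c \<notin> r" for r
    proof (cases "b \<in> r")
      case b: False
      then have 1: "even_linked r (r \<union> {b, c})" using even_linked_adjacent[OF bc S(2,3)] r by blast
      have 2: "even_linked (insert a (insert c r)) (insert b (insert c r))"
      proof (cases "a = b")
        case False
        have "a \<noteq> c" using ac by auto
        then show ?thesis by (intro mv') (use r b bc' S \<open>a \<noteq> c\<close> in auto)
      qed (simp add: even_linked_refl)
      have "r \<union> {b, c} = insert b (insert c r)" "r \<union> {a, c} = insert a (insert c r)" by blast+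
      then show ?thesis using even_linked_trans[OF 1] even_linked_sym[OF 2] by simp
    next
      case b: True
      let ?r = "r - {b}"
      have "even_linked (insert a ?r) (insert b ?r)" by (rule mv') (use r in auto)
      moreover have "insert b ?r = r" using b by blast
      ultimately have 1: "even_linked r (insert a ?r)" using even_linked_sym[of "insert a ?r" r] by simp
      have "a \<noteq> b" using b r by blast
      then have "even_linked (insert a ?r) (insert a ?r \<union> {b, c})"
        by (intro even_linked_adjacent[OF bc S(2,3)]) (use r S ac in auto)
      moreover have "insert a ?r \<union> {b, c} = r \<union> {a, c}" using b by blast
      ultimately show ?thesis using even_linked_trans[OF 1] by simp
    qed
    then show ?thesis using ac by (simp add: movable_def)
  next
    case False
    then have ac: "chi a = chi c" using chi val[of a] val[of b] by auto
    have ab: "a \<noteq> b" using False by auto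
    have mv': "even_linked r (r \<union> {a, b})" if "r \<subseteq> S" "a \<notin> r" "b \<notin> r" for r
      using mv that by (simp only: movable_def False simp_thms if_False)
    have "even_linked (insert a r) (insert c r)" if r: "r \<subseteq> S" "a \<notin> r" "c \<notin> r" for r
    proof (cases "a = c")
      case True
      then show ?thesis by (simp add: even_linked_refl)
    next
      case ne: False
      show ?thesis
      proof (cases "b \<in> r")
        case b: False
        have 1: "even_linked (insert a r) (insert a r \<union> {b, c})"
          by (intro even_linked_adjacent[OF bc S(2,3)]) (use r S ab ne b in auto)
        have 2: "even_linked (insert c r) (insert c r \<union> {a, b})"
          by (rule mv') (use r b bc' ne S in auto)
        have "insert a r \<union> {b, c} = insert c r \<union> {a, b}" by blast
        then show ?thesis using even_linked_trans[OF 1] even_linked_sym[OF 2] by simp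
      next
        case b: True
        let ?r = "r - {b}"
        have 1: "even_linked ?r (?r \<union> {a, b})" by (rule mv') (use r in auto)
        have 2: "even_linked ?r (?r \<union> {b, c})"
          by (intro even_linked_adjacent[OF bc S(2,3)]) (use r in auto)
        have "?r \<union> {a, b} = insert a r" "?r \<union> {b, c} = insert c r" using b by blast+
        then show ?thesis using even_linked_trans[OF even_linked_sym[OF 1] 2] by simp
      qed
    qed
    then show ?thesis using ac by (simp add: movable_def)
  qed
qed

lemma movable: assumes "a \<in> S" "b \<in> S" shows "movable a b"
proof -
  have "{b \<in> S. movable a b} = S"
  proof (rule connected_S)
    have "movable a a" by (simp add: movable_def even_linked_refl)
    then show "{b \<in> S. movable a b} \<noteq> {}" using assms by blast
  qed (use movable_step assms in auto)
  then show ?thesis using assms by blast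
qed

text \<open>As long as the plug is not full, balancedness provides squares of both colours outside
  it, and \<open>movable\<close> adds such a pair.\<close>

lemma even_linked_full:
  assumes "p \<subseteq> S" "(\<Sum>a\<in>S - p. chi a) = 0"
  shows "even_linked p S"
  using assms
proof (induction "card (S - p)" arbitrary: p rule: less_induct)
  case less
  show ?case
  proof (cases "S - p = {}")
    case True
    then have "p = S" using less.prems by blast
    then show ?thesis by (simp add: even_linked_refl)
  next
    case False
    have fin: "finite (S - p)" using finite_S by simp
    have "\<exists>a\<in>S - p. chi a = 1"
    proof (rule ccontr)
      assume "\<not> (\<exists>a\<in>S - p. chi a = 1)"
      then have "(\<Sum>a\<in>S - p. chi a) = (\<Sum>a\<in>S - p. - 1)" by (intro sum.cong refl) (metis chi_def)
      then show False using less.prems fin False by (auto simp: card_eq_0_iff)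
    qed
    then obtain a where a: "a \<in> S - p" "chi a = 1" by blast
    have "\<exists>a\<in>S - p. chi a = - 1"
    proof (rule ccontr)
      assume "\<not> (\<exists>a\<in>S - p. chi a = - 1)"
      then have "(\<Sum>a\<in>S - p. chi a) = (\<Sum>a\<in>S - p. 1)" by (intro sum.cong refl) (metis chi_def)
      then show False using less.prems fin False by (auto simp: card_eq_0_iff)
    qed
    then obtain b where b: "b \<in> S - p" "chi b = - 1" by blast
    have ab: "a \<noteq> b" using a b by auto
    have "movable a b" using movable a b by blast
    then have "\<forall>r\<subseteq>S. a \<notin> r \<longrightarrow> b \<notin> r \<longrightarrow> even_linked r (r \<union> {a, b})" using a b by (simp add: movable_def)
    then have 1: "even_linked p (p \<union> {a, b})" using a b less.prems by blast
    have "even_linked (p \<union> {a, b}) S"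
    proof (rule less.hyps)
      have sub: "{a, b} \<subseteq> S - p" using a b by blast
      have eq: "S - (p \<union> {a, b}) = S - p - {a, b}" by blast
      show "card (S - (p \<union> {a, b})) < card (S - p)"
        unfolding eq by (rule psubset_card_mono[OF fin]) (use a in blast)
      show "p \<union> {a, b} \<subseteq> S" using a b less.prems by blast
      have "(\<Sum>x\<in>{a, b}. chi x) = 0" using ab a b by simp
      then show "(\<Sum>x\<in>S - (p \<union> {a, b}). chi x) = 0"
        unfolding eq using sum_diff[OF fin sub, of chi] less.prems by simp
    qed
    then show ?thesis by (rule even_linked_trans[OF 1])
  qed
qed

text \<open>The full plug is reached in an even number of floors, and one further floor, covered
  entirely from below, returns to the empty plug.\<close>

lemma odd_closed_walk_S: "\<exists>w. walk {} w {} \<and> odd (length w)"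
proof -
  have "even_linked {} S" by (rule even_linked_full) (simp_all add: balanced_S)
  then obtain w where w: "walk {} w S" "even (length w)" by (auto simp: even_linked_def)
  have "(S, {}, {}) \<in> floors S" by (simp add: floors_iff)
  then have "walk {} (w @ [(S, {}, {})]) {}" by (intro walk_appendI[OF w(1)]) simp
  then show ?thesis using w(2) by (intro exI[of _ "w @ [(S, {}, {})]"]) simp
qed

lemma even_card_S: "even (card S)"
proof -
  have "even (\<Sum>a\<in>S. chi a - 1)" by (intro dvd_sum) simp
  then show ?thesis by (simp add: sum_subtractf balanced_S)
qed

end

lemma sum_chi_balanced:
  assumes "finite S" "card {p \<in> S. black p} = card {p \<in> S. \<not> black p}"
  shows "(\<Sum>a\<in>S. chi a) = 0"
proof -
  have "(\<Sum>a\<in>S. chi a) = (\<Sum>a\<in>S. of_bool (black a)) - (\<Sum>a\<in>S. of_bool (\<not> black a))"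
    unfolding sum_subtractf[symmetric] by (intro sum.cong refl) (simp add: chi_def)
  then show ?thesis using assms by (simp add: sum_of_bool_eq Int_def)
qed

section \<open>Random tilings of cylinders\<close>
lemma cell_flips_frame:
  assumes "cell_flip\<^sup>*\<^sup>* m m'" "m \<in> matchings S N" and X: "\<Union> X \<inter> raise k ` cyl S N = {}"
  shows "cell_flip\<^sup>*\<^sup>* (X \<union> image (raise k) ` m) (X \<union> image (raise k) ` m')"
  using assms(1,2)
proof (induction rule: rtranclp_induct)
  case (step y z)
  have y: "y \<in> matchings S N" using cell_flips_matching[OF step(1) step.prems] by simp
  obtain p i j where pij: "i \<noteq> j" "cell_pair p i j \<subseteq> y" "z = (y - cell_pair p i j) \<union> cell_pair p j i"
    using step(2) by (auto simp: cell_flip_def)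
  have pair: "image (raise k) ` cell_pair p i j = cell_pair (raise k p) i j" for p i j
    by (simp add: cell_pair_def raise_def add_ac)
  have inj: "inj (image (raise k))" by (rule injI, rule inj_image_eq_iff[THEN iffD1]) (simp_all add: raise_def inj_def)
  have "image (raise k) ` cell_pair p i j \<inter> X = {}"
  proof (rule ccontr)
    assume "image (raise k) ` cell_pair p i j \<inter> X \<noteq> {}"
    then obtain d where d: "d \<in> y" "raise k ` d \<in> X" using pij(2) by blast
    have "cell_domino d" "d \<subseteq> cyl S N" using y d(1) by (auto simp: matchings_def)
    moreover from this obtain c where "c \<in> d" using cell_domino_nonempty by blast
    ultimately have "raise k c \<in> \<Union> X \<inter> raise k ` cyl S N" using d(2) by blast
    then show False unfolding X by simp
  qed
  then have "X \<union> image (raise k) ` z =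
      ((X \<union> image (raise k) ` y) - cell_pair (raise k p) i j) \<union> cell_pair (raise k p) j i"
    unfolding pij(3) image_Un image_set_diff[OF inj] pair by blast
  moreover have "cell_pair (raise k p) i j \<subseteq> X \<union> image (raise k) ` y"
    unfolding pair[symmetric] using pij(2) by blast
  ultimately have "cell_flip (X \<union> image (raise k) ` y) (X \<union> image (raise k) ` z)"
    unfolding cell_flip_def using pij(1) by blast
  then show ?case using step.IH[OF step.prems] by (rule rtranclp.rtrancl_into_rtrancl[rotated])
qed simp

lemma card_pairs_bij_betw:
  assumes "bij_betw h A B"
  shows "card {(b, b'). b \<in> B \<and> b' \<in> B \<and> P b b'} = card {(a, a'). a \<in> A \<and> a' \<in> A \<and> P (h a) (h a')}"
proof -
  have inj: "inj_on h A" and img: "h ` A = B" using assms by (auto simp: bij_betw_def)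
  have "bij_betw (map_prod h h) {(a, a'). a \<in> A \<and> a' \<in> A \<and> P (h a) (h a')} {(b, b'). b \<in> B \<and> b' \<in> B \<and> P b b'}"
    unfolding bij_betw_def
  proof
    show "inj_on (map_prod h h) {(a, a'). a \<in> A \<and> a' \<in> A \<and> P (h a) (h a')}"
      using inj by (auto simp: inj_on_def)
    show "map_prod h h ` {(a, a'). a \<in> A \<and> a' \<in> A \<and> P (h a) (h a')} = {(b, b'). b \<in> B \<and> b' \<in> B \<and> P b b'}"
      unfolding img[symmetric] by (auto intro!: image_eqI[of "(h x, h y)" "map_prod h h" "(x, y)" for x y])
  qed
  then show ?thesis by (simp add: bij_betw_same_card)
qed

lemma cond_prob_pair_pmf_of_set:
  fixes P Q :: "'a \<Rightarrow> 'a \<Rightarrow> bool"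
  assumes A: "finite A" "A \<noteq> {}"
  shows "cond_prob (measure_pmf (pair_pmf (pmf_of_set A) (pmf_of_set A))) (\<lambda>(x, y). P x y) (\<lambda>(x, y). Q x y) =
    real (card {(x, y). x \<in> A \<and> y \<in> A \<and> P x y \<and> Q x y}) / real (card {(x, y). x \<in> A \<and> y \<in> A \<and> Q x y})"
proof -
  have AA: "finite (A \<times> A)" "A \<times> A \<noteq> {}" using A by auto
  have eq: "pair_pmf (pmf_of_set A) (pmf_of_set A) = pmf_of_set (A \<times> A)"
  proof (rule pmf_eqI)
    fix z
    show "pmf (pair_pmf (pmf_of_set A) (pmf_of_set A)) z = pmf (pmf_of_set (A \<times> A)) z"
      using A AA by (cases z) (simp add: pmf_pair indicator_def card_cartesian_product)
  qed
  have prob: "measure (measure_pmf (pmf_of_set (A \<times> A))) {z. R z} = real (card {z \<in> A \<times> A. R z}) / real (card (A \<times> A))" for R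
    using measure_pmf_of_set[OF AA(2,1)] by (simp add: Collect_conj_eq)
  have c: "card (A \<times> A) \<noteq> 0" using AA by simp
  have "{z \<in> A \<times> A. (case z of (x, y) \<Rightarrow> P x y) \<and> (case z of (x, y) \<Rightarrow> Q x y)} = {(x, y). x \<in> A \<and> y \<in> A \<and> P x y \<and> Q x y}"
    "{z \<in> A \<times> A. case z of (x, y) \<Rightarrow> Q x y} = {(x, y). x \<in> A \<and> y \<in> A \<and> Q x y}"
    by auto
  then show ?thesis
    unfolding cond_prob_def eq using c by (simp add: prob)
qed

context board
begin

text \<open>A closed walk fills whole floors, so its flips can be carried out inside any completion
  without touching the rest.\<close>

lemma flips_closed_iff:
  assumes w: "walk {} w {}" "walk {} w' {}" "length w = length w'"
  shows "flips {} {} w w' \<longleftrightarrow> cell_flip\<^sup>*\<^sup>* (layers 0 w) (layers 0 w')"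
proof
  assume "flips {} {} w w'"
  then have "\<forall>u v. walk {} u {} \<longrightarrow> walk {} v {} \<longrightarrow> cell_flip\<^sup>*\<^sup>* (layers 0 (u @ w @ v)) (layers 0 (u @ w' @ v))"
    unfolding flips_def by blast
  from this[rule_format, of "[]" "[]"] show "cell_flip\<^sup>*\<^sup>* (layers 0 w) (layers 0 w')" by simp
next
  assume fl: "cell_flip\<^sup>*\<^sup>* (layers 0 w) (layers 0 w')"
  have "cell_flip\<^sup>*\<^sup>* (layers 0 (u @ w @ v)) (layers 0 (u @ w' @ v))"
    if u: "walk {} u {}" and v: "walk {} v {}" for u v
  proof -
    let ?k = "int (length u)"
    let ?X = "layers 0 u \<union> layers (?k + int (length w)) v"
    have dec: "layers 0 (u @ x @ v) = ?X \<union> image (raise ?k) ` layers 0 x" if "length x = length w" for x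
      using that by (auto simp: layers_append raise_layers)
    have "\<Union> ?X \<inter> raise ?k ` cyl S (length w) = {}"
    proof (rule ccontr)
      assume "\<Union> ?X \<inter> raise ?k ` cyl S (length w) \<noteq> {}"
      then obtain c where c: "c \<in> cyl S (length w)" "raise ?k c \<in> \<Union> ?X" by blast
      obtain a l where "c = lift a l" using ex_lift by blast
      then have al: "lift a l \<in> cyl S (length w)" "lift a (?k + l) \<in> \<Union> ?X" using c by simp_all
      have "\<Union> ?X = occupied 0 (length u) {} {} \<union> occupied (?k + int (length w)) (length v) {} {}"
        using layers_cover(1)[OF u, of 0] layers_cover(1)[OF v, of "?k + int (length w)"] by simp
      then have "lift a (?k + l) \<in> occupied 0 (length u) {} {} \<or>
          lift a (?k + l) \<in> occupied (?k + int (length w)) (length v) {} {}"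
        using al(2) by simp
      then show False using al(1) by (auto simp: lift_occupied_iff)
    qed
    from cell_flips_frame[OF fl layers_matching[OF w(1)] this] show ?thesis
      using dec[of w] dec[of w'] w(3) by simp
  qed
  then show "flips {} {} w w'" unfolding flips_def using w by blast
qed

lemma flips_refl: "walk p w q \<Longrightarrow> flips p q w w"
  by (simp add: flips_def)

lemma flips_trans: "flips p q w w' \<Longrightarrow> flips p q w' w'' \<Longrightarrow> flips p q w w''"
  unfolding flips_def
proof (elim conjE, intro conjI allI impI)
  fix u v
  assume 1: "\<forall>u v. walk {} u p \<longrightarrow> walk q v {} \<longrightarrow> cell_flip\<^sup>*\<^sup>* (layers 0 (u @ w @ v)) (layers 0 (u @ w' @ v))"
    and 2: "\<forall>u v. walk {} u p \<longrightarrow> walk q v {} \<longrightarrow> cell_flip\<^sup>*\<^sup>* (layers 0 (u @ w' @ v)) (layers 0 (u @ w'' @ v))"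
    and uv: "walk {} u p" "walk q v {}"
  show "cell_flip\<^sup>*\<^sup>* (layers 0 (u @ w @ v)) (layers 0 (u @ w'' @ v))"
    using rtranclp_trans[OF 1[rule_format, OF uv] 2[rule_format, OF uv]] .
qed simp_all

end

section \<open>The cylinder as an instance of the abstract graph\<close>

locale cylinder = cell_region D S + balanced_board S + floor_twist S i j
  for D S i j +
  fixes \<sigma> :: int
  assumes sign: "\<sigma> = 1 \<or> \<sigma> = - 1"
begin

abbreviation u :: "real ^ 3" where
  "u \<equiv> of_int \<sigma> *\<^sub>R axis (up_axis i) 1"

text \<open>The division is exact on closed walks by \<open>closed_tau_mod_4\<close>, which is what
  makes \<open>tw\<close> additive there.\<close>

definition tw :: "floor_tiling list \<Rightarrow> int" where
  "tw w = orientation * (sum_list (map tau w) div 4)"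

definition tiling_of :: "floor_tiling list \<Rightarrow> tiling" where
  "tiling_of w = image brick (layers 0 w)"

lemma even_card_step:
  assumes fl: "(p, f, q) \<in> floors S" and "even (card p)"
  shows "even (card q)"
proof -
  have f: "\<forall>d\<in>f. cell_domino d" "disjoint f" "\<Union> f = S - (p \<union> q)" "p \<inter> q = {}" "p \<subseteq> S" "q \<subseteq> S"
    using fl by (auto simp: floors_iff)
  have fin: "finite p" "finite q" "finite f" using floor_finite[OF fl] by auto
  have "int (card (\<Union> f)) = 2 * int (card (uppers f)) + 2 * int (card (lefts f))"
    using sum_dominoes[OF f(1,2) fin(3), of "\<lambda>_. 1"] by simp
  then have "even (card (\<Union> f))" by presburger
  moreover have "card S = card (\<Union> f) + card (p \<union> q)"
    using card_Diff_subset[of "p \<union> q" S] card_mono[OF finite_S, of "p \<union> q"] f fin by simp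
  moreover have "card (p \<union> q) = card p + card q" using card_Un_disjoint[OF fin(1,2) f(4)] .
  ultimately show ?thesis using even_card_S assms(2) by presburger
qed

lemma walk_tau_mod_4:
  assumes "walk p w q" "even (card p)"
  shows "4 dvd sum_list (map tau w) - (potential p - potential q)"
  using assms
proof (induction w arbitrary: p)
  case (Cons e w)
  obtain f r where e: "e = (p, f, r)" using Cons.prems by (cases e) auto
  have fl: "(p, f, r) \<in> floors S" and w: "walk r w q" using Cons.prems by (simp_all add: e)
  have "4 dvd tau (p, f, r) - (potential p - potential r)" by (rule tau_mod_4[OF fl Cons.prems(2)])
  moreover have "4 dvd sum_list (map tau w) - (potential r - potential q)"
    by (rule Cons.IH[OF w even_card_step[OF fl Cons.prems(2)]])
  ultimately have "4 dvd (tau (p, f, r) - (potential p - potential r)) + (sum_list (map tau w) - (potential r - potential q))"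
    by (rule dvd_add)
  then show ?case by (simp add: e algebra_simps)
qed simp

lemma closed_tau_mod_4: "walk {} w {} \<Longrightarrow> 4 dvd sum_list (map tau w)"
  using walk_tau_mod_4[of "{}" w "{}"] by simp

lemma sum_word: "sum_list (map tau (word m k n)) = (\<Sum>l\<in>{k..<k + int n}. tau (plug m l, flat m l, plug m (l + 1)))"
proof (induction n arbitrary: k)
  case (Suc n)
  have "{k..<k + int (Suc n)} = insert k {k + 1..<k + 1 + int n}" by auto
  then show ?case using Suc[of "k + 1"] by simp
qed simp

lemma word_layers: "walk {} w {} \<Longrightarrow> word (layers 0 w) 0 (length w) = w"
proof -
  assume w: "walk {} w {}"
  note lw = layers_word[OF layers_matching[OF w]]
  show ?thesis by (rule layers_inj[OF lw(1) w _ lw(2)]) simp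
qed

lemma twist_sum_layers: "walk {} w {} \<Longrightarrow> twist_sum (length w) (layers 0 w) = sum_list (map tau w)"
  using sum_word[of "layers 0 w" 0 "length w"] by (simp add: twist_sum_def word_layers)

lemma twist_tiling_of:
  assumes w: "walk {} w {}"
  shows "twist u (tiling_of w) = tw w"
proof -
  obtain c where c: "sum_list (map tau w) = 4 * c" using closed_tau_mod_4[OF w] by (auto elim: dvdE)
  have "(\<Sum>d0\<in>tiling_of w. \<Sum>d1\<in>tiling_of w. effect u d0 d1) = of_int (tw w)"
    unfolding tiling_of_def effect_sum[OF layers_matching[OF w] sign] twist_sum_layers[OF w]
    by (simp add: tw_def c)
  then show ?thesis unfolding twist_def by (intro the_equality) auto
qed

sublocale G: twisted_flip_graph "floors S" fst top_plug flipped_floor "{}" room flips tw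
proof unfold_locales
  fix p q r w w' w'' v v' e
  show "\<exists>w. walk {} w {} \<and> odd (length w)" by (rule odd_closed_walk_S)
  show "p \<in> fst ` floors S \<Longrightarrow> walk p (room p) p" by (rule walk_room) (auto simp: floors_iff)
  show "length (room p) = 2" by (simp add: room_def)
  show "flips p q w w' \<Longrightarrow> walk p w q \<and> walk p w' q \<and> length w = length w'" by (simp add: flips_def)
  show "walk p w q \<Longrightarrow> flips p q w w" by (rule flips_refl)
  show "flips p q w w' \<Longrightarrow> flips p q w' w" by (rule flips_sym)
  show "flips p q w w' \<Longrightarrow> flips p q w' w'' \<Longrightarrow> flips p q w w''" by (rule flips_trans)
  show "flips p q w w' \<Longrightarrow> flips q r v v' \<Longrightarrow> flips p r (w @ v) (w' @ v')" by (rule flips_append)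
  show "e \<in> floors S \<Longrightarrow> flips (fst e) (fst e) [e, flipped_floor e] (room (fst e))" by (rule flips_cancel)
  show "tw w = tw w'" if f: "flips {} {} w w'"
  proof -
    have w: "walk {} w {}" "walk {} w' {}" "length w = length w'" using f by (auto simp: flips_def)
    have "cell_flip\<^sup>*\<^sup>* (layers 0 w) (layers 0 w')" using f flips_closed_iff[OF w] by simp
    from twist_sum_flips[OF this layers_matching[OF w(1)]]
    have "sum_list (map tau w) = sum_list (map tau w')"
      using twist_sum_layers[OF w(1)] twist_sum_layers[OF w(2)] w(3) by simp
    then show ?thesis by (simp add: tw_def)
  qed
  show "tw (w @ w') = tw w + tw w'" if w: "walk {} w {}" "walk {} w' {}"
  proof -
    obtain c where "sum_list (map tau w) = 4 * c" using closed_tau_mod_4[OF w(1)] by (auto elim: dvdE)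
    then show ?thesis by (simp add: tw_def distrib_left)
  qed
  show "tw (room {}) = 0" by (simp add: tw_def room_def tau_def uppers_def)
qed

lemma inj_tiling_of:
  assumes "walk {} w {}" "walk {} w' {}" "length w = length w'" "tiling_of w = tiling_of w'"
  shows "w = w'"
proof -
  have "layers 0 w = layers 0 w'" using assms(4) unfolding tiling_of_def inj_image_eq_iff[OF inj_brick] .
  then show ?thesis by (rule layers_inj[OF assms(1-3)])
qed

lemma bij_tiling_of: "N \<ge> 1 \<Longrightarrow> bij_betw tiling_of (walks N {} {}) (tilings D N)"
proof -
  assume N: "N \<ge> 1"
  have "layers 0 ` walks N {} {} = matchings S N" using bij_layers[of N] by (simp add: bij_betw_def)
  then have "tiling_of ` walks N {} {} = tilings D N"
    unfolding tilings_eq[OF N] by (auto simp: tiling_of_def image_image[symmetric])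
  moreover have "inj_on tiling_of (walks N {} {})"
    by (rule inj_onI) (auto simp: walks_def intro: inj_tiling_of)
  ultimately show ?thesis by (simp add: bij_betw_def)
qed

text \<open>The empty walk is excluded because height 0 admits no tiling.\<close>

lemma tilings_iff: "t \<in> tilings D N \<longleftrightarrow> (\<exists>w. walk {} w {} \<and> w \<noteq> [] \<and> length w = N \<and> t = tiling_of w)"
proof (cases "N = 0")
  case True
  then show ?thesis using tilings_0 by auto
next
  case False
  then have "tiling_of ` walks N {} {} = tilings D N" using bij_tiling_of[of N] by (simp add: bij_betw_def)
  then have "t \<in> tilings D N \<longleftrightarrow> (\<exists>w\<in>walks N {} {}. t = tiling_of w)" by (simp only: image_iff[symmetric])
  then show ?thesis using False unfolding walks_def by auto
qed

lemma flip_equiv_tiling_of: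
  assumes "walk {} w {}" "walk {} w' {}" "length w = length w'"
  shows "flip_equiv (tiling_of w) (tiling_of w') \<longleftrightarrow> flips {} {} w w'"
  unfolding tiling_of_def flip_equiv_brick_iff flips_closed_iff[OF assms] ..

lemma stack_tiling_of: "stack (length w) (tiling_of w) (tiling_of w') = tiling_of (w @ w')"
  by (simp add: tiling_of_def stack_brick raise_layers layers_append)

lemma walk_sp: "walk {} (G.sp {} n) {}"
  by (rule G.walk_sp[OF G.base_src])

lemma sp_1: "G.sp {} 1 = room {}"
  by (simp add: G.sp_def)

lemma layers_sp: "layers 0 (G.sp {} n) = {{lift a (2 * l), lift a (2 * l + 1)} |a l. a \<in> S \<and> 0 \<le> l \<and> l < int n}"
proof (induction n)
  case (Suc n)
  have room: "layers k (room {}) = ver k S" for k by (simp add: room_def)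
  have L: "layers 0 (G.sp {} (Suc n)) = layers 0 (G.sp {} n) \<union> ver (2 * int n) S"
    using G.sp_add[of "{}" n 1] unfolding sp_1 by (simp add: layers_append room)
  have V: "ver (2 * int n) S = {{lift a (2 * l), lift a (2 * l + 1)} |a l. a \<in> S \<and> l = int n}"
    unfolding ver_def by blast
  have iff: "0 \<le> l \<and> l < int (Suc n) \<longleftrightarrow> 0 \<le> l \<and> l < int n \<or> l = int n" for l by auto
  show ?case unfolding L V Suc iff by blast
qed simp

lemma vert_tiling_eq: "vert_tiling D (2 * n) = tiling_of (G.sp {} n)"
proof (cases "n = 0")
  case True
  have "\<not> cell p \<union> cell (p + axis 3 1) \<subseteq> region D 0" for p :: "int ^ 3"
  proof
    assume "cell p \<union> cell (p + axis 3 1) \<subseteq> region D 0"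
    moreover have "center p \<in> cell p" by (simp add: center_cell_iff)
    ultimately have "center p \<in> region D 0" by blast
    then have "real_of_int (p $ 3) + 1 / 2 = 0" by (simp add: region_def center_def)
    then have "real_of_int (2 * (p $ 3) + 1) = real_of_int 0" by simp
    then have "2 * (p $ 3) + 1 = 0" by (simp only: of_int_eq_iff)
    then show False by presburger
  qed
  then have "vert_tiling D 0 = {}" unfolding vert_tiling_def by blast
  then show ?thesis using True by (simp add: tiling_of_def)
next
  case False
  then have reg: "region D (2 * n) = brick (cyl S (2 * n))" by (intro region_eq) simp
  show ?thesis
  proof (intro equalityI subsetI)
    fix d assume "d \<in> vert_tiling D (2 * n)"
    then obtain p where p: "d = cell p \<union> cell (p + axis 3 1)" "even (p $ 3)" "d \<subseteq> brick (cyl S (2 * n))"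
      unfolding vert_tiling_def reg by blast
    obtain a k where ak: "p = lift a k" using ex_lift by blast
    have d: "d = brick {lift a k, lift a (k + 1)}" unfolding p(1) ak brick_pair lift_up ..
    obtain l where l: "k = 2 * l" using p(2) by (auto simp: ak elim: evenE)
    have "{lift a k, lift a (k + 1)} \<subseteq> cyl S (2 * n)" using p(3) unfolding d brick_subset_iff .
    then have "a \<in> S" "0 \<le> l" "l < int n" by (auto simp: l)
    then show "d \<in> tiling_of (G.sp {} n)"
      unfolding tiling_of_def layers_sp d l by blast
  next
    fix d assume "d \<in> tiling_of (G.sp {} n)"
    then obtain a l where al: "a \<in> S" "0 \<le> l" "l < int n" "d = brick {lift a (2 * l), lift a (2 * l + 1)}"
      unfolding tiling_of_def layers_sp by blast
    then have "d \<subseteq> brick (cyl S (2 * n))" unfolding al(4) brick_subset_iff by simp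
    moreover have "d = cell (lift a (2 * l)) \<union> cell (lift a (2 * l) + axis 3 1)"
      unfolding al(4) brick_pair lift_up ..
    moreover have "even (lift a (2 * l) $ 3)" by simp
    ultimately show "d \<in> vert_tiling D (2 * n)" unfolding vert_tiling_def reg by blast
  qed
qed

lemma sim_iff: "G.sim {} {} w w' \<longleftrightarrow>
   walk {} w {} \<and> walk {} w' {} \<and> (\<exists>a b. flips {} {} (w @ G.sp {} a) (w' @ G.sp {} b))"
  using G.base_src by (simp add: G.sim_def)

lemma stack_vert_tiling:
  "even n \<Longrightarrow> stack (length w) (tiling_of w) (vert_tiling D n) = tiling_of (w @ G.sp {} (n div 2))"
  using vert_tiling_eq[of "n div 2"] by (simp add: stack_tiling_of)

text \<open>The common height \<open>N\<close> fixes the numbers of spacers above the two tilings,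
  equal parities making the differences even; conversely, numbers of spacers giving equal total
  lengths determine \<open>N\<close>.\<close>

lemma domino_rel_iff:
  assumes w: "walk {} w {}" "walk {} w' {}" "w \<noteq> []" "w' \<noteq> []"
  shows "((length w, tiling_of w), (length w', tiling_of w')) \<in> domino_rel D \<longleftrightarrow> G.sim {} {} w w'"
proof -
  have walks: "walk {} (w @ G.sp {} a) {}" "walk {} (w' @ G.sp {} b) {}" for a b
    using w walk_sp by (auto intro: walk_appendI)
  have mem: "tiling_of w \<in> tilings D (length w)" "tiling_of w' \<in> tilings D (length w')"
    using w unfolding tilings_iff by blast+
  show ?thesis
  proof
    assume "((length w, tiling_of w), (length w', tiling_of w')) \<in> domino_rel D"
    then obtain N where N: "length w mod 2 = length w' mod 2" "N mod 2 = length w mod 2" "N \<ge> length w" "N \<ge> length w'"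
      "flip_equiv (stack (length w) (tiling_of w) (vert_tiling D (N - length w)))
        (stack (length w') (tiling_of w') (vert_tiling D (N - length w')))"
      unfolding domino_rel_def by auto
    have ev: "even (N - length w)" "even (N - length w')" using N(1-4) by presburger+
    let ?a = "(N - length w) div 2" and ?b = "(N - length w') div 2"
    have "length (w @ G.sp {} ?a) = length (w' @ G.sp {} ?b)" using ev N(3,4) by (simp add: G.length_sp)
    from flip_equiv_tiling_of[OF walks this]
    have "flips {} {} (w @ G.sp {} ?a) (w' @ G.sp {} ?b)"
      using N(5) unfolding stack_vert_tiling[OF ev(1)] stack_vert_tiling[OF ev(2)] by simp
    then show "G.sim {} {} w w'" unfolding sim_iff using w by blast
  next
    assume "G.sim {} {} w w'"
    then obtain a b where ab: "flips {} {} (w @ G.sp {} a) (w' @ G.sp {} b)" unfolding sim_iff by blast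
    then have len: "length (w @ G.sp {} a) = length (w' @ G.sp {} b)" unfolding flips_def by blast
    let ?N = "length w + 2 * a"
    have N: "?N - length w = 2 * a" "?N - length w' = 2 * b" "?N \<ge> length w'" "?N = length w' + 2 * b"
      using len by (auto simp: G.length_sp)
    have "flip_equiv (stack (length w) (tiling_of w) (vert_tiling D (?N - length w)))
        (stack (length w') (tiling_of w') (vert_tiling D (?N - length w')))"
      unfolding N(1,2) vert_tiling_eq stack_tiling_of using flip_equiv_tiling_of[OF walks len] ab by simp
    moreover have "?N mod 2 = length w mod 2" "length w mod 2 = length w' mod 2"
      using N(4) by presburger+
    moreover have "?N \<ge> max (length w) (length w')" using N(3) by simp
    ultimately show "((length w, tiling_of w), (length w', tiling_of w')) \<in> domino_rel D"
      unfolding domino_rel_def using mem by blast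
  qed
qed

text \<open>The class of the vertical tilings contains the empty walk, which represents no tiling
  and is removed.\<close>

definition tiling_class :: "floor_tiling list set \<Rightarrow> (nat \<times> tiling) set" where
  "tiling_class c = (\<lambda>w. (length w, tiling_of w)) ` (c - {[]})"

lemma key_iff: "walk {} w {} \<Longrightarrow> w' \<in> G.key w \<longleftrightarrow> G.sim {} {} w w'"
  unfolding G.key_def using G.sim_walk walk_unique by blast

lemma tiling_class_key:
  assumes w: "walk {} w {}" "w \<noteq> []"
  shows "domino_rel D `` {(length w, tiling_of w)} = tiling_class (G.key w)"
proof (intro equalityI subsetI)
  fix z assume z: "z \<in> domino_rel D `` {(length w, tiling_of w)}"
  obtain N t where Nt: "z = (N, t)" by (cases z)
  then have "t \<in> tilings D N" using z by (auto simp: domino_rel_def)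
  then obtain w' where w': "walk {} w' {}" "w' \<noteq> []" "length w' = N" "t = tiling_of w'"
    unfolding tilings_iff by blast
  have "G.sim {} {} w w'" using z domino_rel_iff[OF w(1) w'(1) w(2) w'(2)] by (simp add: Nt w')
  then show "z \<in> tiling_class (G.key w)"
    unfolding tiling_class_def using w' Nt key_iff[OF w(1)] by blast
next
  fix z assume "z \<in> tiling_class (G.key w)"
  then obtain w' where w': "w' \<in> G.key w" "w' \<noteq> []" "z = (length w', tiling_of w')"
    unfolding tiling_class_def by blast
  then have s: "G.sim {} {} w w'" using key_iff[OF w(1)] by blast
  then have "walk {} w' {}" using G.sim_walk by blast
  from domino_rel_iff[OF w(1) this w(2) w'(2)] s
  show "z \<in> domino_rel D `` {(length w, tiling_of w)}" unfolding w'(3) by blast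
qed

lemma invariants_tiling_class:
  assumes w: "walk {} w {}" "w \<noteq> []"
  shows "height_parity (tiling_class (G.key w)) = int (length w) mod 2"
    and "twist_hom u (tiling_class (G.key w)) = tw w"
proof -
  have ne: "w \<in> G.key w - {[]}" using w G.sim_refl key_iff[OF w(1)] by blast
  have inv: "int (length w') mod 2 = int (length w) mod 2 \<and> twist u (tiling_of w') = tw w"
    if "w' \<in> G.key w - {[]}" for w'
  proof
    have s: "G.sim {} {} w w'" using that key_iff[OF w(1)] by blast
    then obtain a b where "flips {} {} (w @ G.sp {} a) (w' @ G.sp {} b)" unfolding sim_iff by blast
    then have "length (w @ G.sp {} a) = length (w' @ G.sp {} b)" unfolding flips_def by blast
    then have "length w + 2 * a = length w' + 2 * b" by (simp add: G.length_sp)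
    then show "int (length w') mod 2 = int (length w) mod 2" by presburger
    have "walk {} w' {}" using s G.sim_walk by blast
    then show "twist u (tiling_of w') = tw w" using twist_tiling_of G.tw_of_sim[OF s] by simp
  qed
  have "(\<lambda>(N, t). int N mod 2) ` tiling_class (G.key w) = {int (length w) mod 2}"
    "(\<lambda>(N, t). twist u t) ` tiling_class (G.key w) = {tw w}"
    unfolding tiling_class_def image_image prod.case using inv ne by (blast intro: sym)+
  then show "height_parity (tiling_class (G.key w)) = int (length w) mod 2"
    "twist_hom u (tiling_class (G.key w)) = tw w"
    by (simp_all add: height_parity_def twist_hom_def)
qed

lemma twist_kernel_iff:
  "A \<in> twist_kernel u D \<longleftrightarrow> A \<in> all_tilings D // domino_rel D \<and> height_parity A = 0 \<and> twist_hom u A = 0"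
  by (simp add: twist_kernel_def even_domino_group_def domino_group_def kernel_def)

text \<open>Appending two vertical floors changes neither class nor twist; this bridges the absence
  of a tiling of height 0.\<close>

lemma nonempty_representative:
  assumes "s \<in> G.twist_free"
  shows "\<exists>s'\<in>G.twist_free. s' \<noteq> [] \<and> G.key s' = G.key s"
proof (intro bexI conjI)
  let ?s = "s @ room {}"
  have s: "walk {} s {}" "even (length s)" "tw s = 0" using assms by (auto simp: G.twist_free_def)
  have r: "walk {} (room {}) {}" by (rule walk_room) simp
  have w: "walk {} ?s {}" by (rule walk_appendI[OF s(1) r])
  show "?s \<noteq> []" by (simp add: room_def)
  show "?s \<in> G.twist_free"
    using w s G.tw_closed_append[OF s(1) r] by (simp add: G.twist_free_def G.tw_spacer G.length_spacer)
  have "flips {} {} (?s @ G.sp {} 0) (s @ G.sp {} 1)" unfolding sp_1 using flips_refl[OF w] by simp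
  then have "G.sim {} {} ?s s" unfolding sim_iff using w s(1) by blast
  then show "G.key ?s = G.key s" using G.key_eq_iff[OF w] by simp
qed

lemma twist_kernel_eq: "twist_kernel u D = tiling_class ` G.twist_free_classes"
proof (intro equalityI subsetI)
  fix A assume "A \<in> twist_kernel u D"
  then have A: "A \<in> all_tilings D // domino_rel D" "height_parity A = 0" "twist_hom u A = 0"
    unfolding twist_kernel_iff by auto
  then obtain N t where Nt: "t \<in> tilings D N" "A = domino_rel D `` {(N, t)}"
    by (auto simp: quotient_def all_tilings_def)
  then obtain w where w: "walk {} w {}" "w \<noteq> []" "length w = N" "t = tiling_of w"
    unfolding tilings_iff by blast
  have Aw: "A = tiling_class (G.key w)" unfolding Nt(2) w(3)[symmetric] w(4) by (rule tiling_class_key[OF w(1,2)])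
  have "int (length w) mod 2 = 0" "tw w = 0"
    using A(2,3) unfolding Aw invariants_tiling_class[OF w(1,2)] by auto
  moreover from this have "even (length w)" by presburger
  ultimately have "w \<in> G.twist_free" using w(1) by (simp add: G.twist_free_def)
  then show "A \<in> tiling_class ` G.twist_free_classes" unfolding Aw G.twist_free_classes_def by blast
next
  fix A assume "A \<in> tiling_class ` G.twist_free_classes"
  then obtain s where s: "s \<in> G.twist_free" "A = tiling_class (G.key s)" by (auto simp: G.twist_free_classes_def)
  obtain w where w: "w \<in> G.twist_free" "w \<noteq> []" "G.key w = G.key s" using nonempty_representative[OF s(1)] by blast
  have ww: "walk {} w {}" "even (length w)" "tw w = 0" using w(1) by (auto simp: G.twist_free_def)
  have A: "A = tiling_class (G.key w)" using s(2) w(3) by simp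
  have "(length w, tiling_of w) \<in> all_tilings D"
    using ww w(2) by (auto simp: all_tilings_def tilings_iff)
  then have "A \<in> all_tilings D // domino_rel D"
    unfolding A tiling_class_key[OF ww(1) w(2), symmetric] by (rule quotientI)
  moreover have "height_parity A = 0" "twist_hom u A = 0"
    unfolding A invariants_tiling_class[OF ww(1) w(2)] using ww by presburger+
  ultimately show "A \<in> twist_kernel u D" unfolding twist_kernel_iff by blast
qed

text \<open>Every class contains a nonempty walk, and the walk is recovered from its tiling and
  height.\<close>

lemma inj_tiling_class: "inj_on tiling_class G.twist_free_classes"
proof (rule inj_onI)
  fix c c' assume c: "c \<in> G.twist_free_classes" "c' \<in> G.twist_free_classes" "tiling_class c = tiling_class c'"
  obtain s where "s \<in> G.twist_free" "c = G.key s" using c(1) by (auto simp: G.twist_free_classes_def)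
  then obtain w where w: "w \<in> G.twist_free" "w \<noteq> []" "c = G.key w" using nonempty_representative by metis
  obtain s' where s': "s' \<in> G.twist_free" "c' = G.key s'" using c(2) by (auto simp: G.twist_free_classes_def)
  have ww: "walk {} w {}" and ws': "walk {} s' {}" using w(1) s'(1) by (auto simp: G.twist_free_def)
  have "w \<in> c" using w(3) key_iff[OF ww] G.sim_refl[OF ww] by simp
  then have "(length w, tiling_of w) \<in> tiling_class c" using w(2) by (auto simp: tiling_class_def)
  then have "(length w, tiling_of w) \<in> tiling_class c'" using c(3) by simp
  then obtain w' where w': "w' \<in> c'" "length w = length w'" "tiling_of w = tiling_of w'"
    by (auto simp: tiling_class_def)
  have s: "G.sim {} {} s' w'" using w'(1) key_iff[OF ws'] s'(2) by simp
  then have "walk {} w' {}" using G.sim_walk by blast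
  then have "w = w'" by (rule inj_tiling_of[OF ww _ w'(2,3)])
  then have "G.key s' = G.key w" using G.key_eq_iff[OF ws'] s by simp
  then show "c = c'" using w(3) s'(2) by simp
qed

text \<open>Flips preserve the twist, so the numerator counts all flip-equivalent pairs. Positivity
  makes the set of tilings nonempty, as \<open>pmf_of_set\<close> requires.\<close>

lemma cond_prob_eq:
  assumes N: "N \<ge> 1" and pos: "G.walk_count N {} > 0"
  shows "cond_prob (measure_pmf (pair_pmf (random_tiling D N) (random_tiling D N)))
      (\<lambda>(T0, T1). flip_equiv T0 T1) (\<lambda>(T0, T1). twist u T0 = twist u T1)
    = G.eqv_pairs N / G.equal_twist N"
proof -
  note bij = bij_tiling_of[OF N]
  have fin: "finite (tilings D N)" using bij_betw_finite[OF bij] finite_walks by blast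
  have "walks N {} {} \<noteq> {}" using pos by (auto simp: G.walk_count_def)
  then have ne: "tilings D N \<noteq> {}" using bij by (auto simp: bij_betw_def)
  have W: "walk {} w {}" "length w = N" if "w \<in> walks N {} {}" for w using that by (auto simp: walks_def)
  have fe: "flip_equiv (tiling_of w) (tiling_of w') \<longleftrightarrow> flips {} {} w w'"
    if "w \<in> walks N {} {}" "w' \<in> walks N {} {}" for w w'
    using flip_equiv_tiling_of W that by simp
  have te: "twist u (tiling_of w) = tw w" if "w \<in> walks N {} {}" for w
    using twist_tiling_of W that by blast
  have "(w \<in> walks N {} {} \<and> w' \<in> walks N {} {} \<and> flip_equiv (tiling_of w) (tiling_of w') \<and>
        twist u (tiling_of w) = twist u (tiling_of w')) \<longleftrightarrow>
      (w \<in> walks N {} {} \<and> w' \<in> walks N {} {} \<and> flips {} {} w w')" for w w'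
    using fe[of w w'] te[of w] te[of w'] G.tw_eqv[of w w'] by auto
  then have 1: "card {(T, T'). T \<in> tilings D N \<and> T' \<in> tilings D N \<and> flip_equiv T T' \<and> twist u T = twist u T'} =
      card {(w, w'). w \<in> walks N {} {} \<and> w' \<in> walks N {} {} \<and> flips {} {} w w'}"
    using card_pairs_bij_betw[OF bij, of "\<lambda>T T'. flip_equiv T T' \<and> twist u T = twist u T'"] by simp
  have "(w \<in> walks N {} {} \<and> w' \<in> walks N {} {} \<and> twist u (tiling_of w) = twist u (tiling_of w')) \<longleftrightarrow>
      (w \<in> walks N {} {} \<and> w' \<in> walks N {} {} \<and> tw w = tw w')" for w w'
    using te[of w] te[of w'] by auto
  then have 2: "card {(T, T'). T \<in> tilings D N \<and> T' \<in> tilings D N \<and> twist u T = twist u T'} =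
      card {(w, w'). w \<in> walks N {} {} \<and> w' \<in> walks N {} {} \<and> tw w = tw w'}"
    using card_pairs_bij_betw[OF bij, of "\<lambda>T T'. twist u T = twist u T'"] by simp
  show ?thesis
    unfolding random_tiling_def cond_prob_pair_pmf_of_set[OF fin ne] 1 2 G.eqv_pairs_def G.equal_twist_def ..
qed

theorem cond_prob_tendsto:
  "(\<lambda>N. cond_prob (measure_pmf (pair_pmf (random_tiling D N) (random_tiling D N)))
      (\<lambda>(T0, T1). flip_equiv T0 T1) (\<lambda>(T0, T1). twist u T0 = twist u T1))
   \<longlonglongrightarrow> (if finite (twist_kernel u D) then 1 / real (card (twist_kernel u D)) else 0)"
proof -
  have "finite (twist_kernel u D) \<longleftrightarrow> finite G.twist_free_classes"
    "card (twist_kernel u D) = card G.twist_free_classes"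
    unfolding twist_kernel_eq by (rule finite_image_iff[OF inj_tiling_class], rule card_image[OF inj_tiling_class])
  then have lim: "(\<lambda>N. G.eqv_pairs N / G.equal_twist N) \<longlonglongrightarrow>
      (if finite (twist_kernel u D) then 1 / real (card (twist_kernel u D)) else 0)"
    using G.eqv_pairs_over_equal_twist by (simp only:)
  obtain N0 where N0: "\<forall>n\<ge>N0. G.walk_count n {} > 0" using G.walk_count_eventually_pos by blast
  have "eventually (\<lambda>N. G.eqv_pairs N / G.equal_twist N =
      cond_prob (measure_pmf (pair_pmf (random_tiling D N) (random_tiling D N)))
        (\<lambda>(T0, T1). flip_equiv T0 T1) (\<lambda>(T0, T1). twist u T0 = twist u T1)) sequentially"
    \<comment> \<open>Small heights may admit no tiling; they do not affect the limit.\<close>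
    using eventually_ge_at_top[of "max 1 N0"]
  proof eventually_elim
    case (elim N)
    then show ?case using cond_prob_eq[of N] N0 by simp
  qed
  then show ?thesis by (rule Lim_transform_eventually[OF lim])
qed

end

theorem theorem5:
  fixes D :: "(real ^ 2) set" and u :: "real ^ 3"
  assumes "quadriculated_disk D" and "balanced D" and "nontrivial D"
    and "u \<in> {axis 1 1, - axis 1 1, axis 2 1, - axis 2 1}"
  shows "(\<lambda>N. cond_prob (measure_pmf (pair_pmf (random_tiling D N) (random_tiling D N)))
                (\<lambda>(T0, T1). flip_equiv T0 T1)
                (\<lambda>(T0, T1). twist u T0 = twist u T1))
         \<longlonglongrightarrow> (if finite (twist_kernel u D) then 1 / real (card (twist_kernel u D)) else 0)"
proof -
  obtain S where S: "finite S" "D = \<Union> (cell ` S)" and hom: "D homeomorphic cball (0 :: real ^ 2) 1"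
    using assms(1) by (auto simp: quadriculated_disk_def)
  have "D \<noteq> {}" using hom by (auto simp: homeomorphic_def homeomorphism_def)
  then have ne: "S \<noteq> {}" using S(2) by auto
  interpret cell_region D S by unfold_locales (rule S(1), rule S(2), rule ne)
  have bal: "(\<Sum>a\<in>S. chi a) = 0"
    by (rule sum_chi_balanced[OF S(1)]) (use assms(2) in \<open>simp add: balanced_def squares_eq\<close>)
  \<comment> \<open>The topology of the disk enters here, through the connectedness of its
    squares.\<close>
  have cyl: "cylinder D S i j \<sigma>" if "i \<noteq> j" "\<sigma> = 1 \<or> \<sigma> = - 1" for i j :: 2 and \<sigma> :: int
    by unfold_locales (use S ne bal disk_squares_connected[OF hom S] that in blast)+
  have up: "up_axis 1 = 1" "up_axis 2 = 2" by (simp_all add: up_axis_def)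
  have "\<exists>i :: 2. \<exists>\<sigma>. (\<sigma> = 1 \<or> \<sigma> = - 1) \<and> u = of_int \<sigma> *\<^sub>R axis (up_axis i) 1"
    using assms(4)
  proof (elim insertE emptyE)
    assume "u = axis 1 1"
    then show ?thesis by - (rule exI[of _ 1], rule exI[of _ 1], simp add: up)
  next
    assume "u = - axis 1 1"
    then show ?thesis by - (rule exI[of _ 1], rule exI[of _ "- 1"], simp add: up)
  next
    assume "u = axis 2 1"
    then show ?thesis by - (rule exI[of _ 2], rule exI[of _ 1], simp add: up)
  next
    assume "u = - axis 2 1"
    then show ?thesis by - (rule exI[of _ 2], rule exI[of _ "- 1"], simp add: up)
  qed
  then obtain i :: 2 and \<sigma> :: int where u: "\<sigma> = 1 \<or> \<sigma> = - 1" "u = of_int \<sigma> *\<^sub>R axis (up_axis i) 1"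
    by blast
  have "(1 :: 2) \<noteq> 2" by simp
  then obtain j :: 2 where j: "i \<noteq> j" by metis
  show ?thesis unfolding u(2) by (rule cylinder.cond_prob_tendsto[OF cyl[OF j u(1)]])
qed

end
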